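(* Let $n\ge 4$, let $S^{\lambda,\mu}$ be an irreducible representation of $B_{n-2}$, where $\lambda,\mu$ are partitions with $|\lambda|+|\mu|=n-2$, and let $W$ be an irreducible representation of $H_2$. Then: 1. if $\mathrm{ind}^{B_2}_{H_2}W=S^{(2),\emptyset}\oplus S^{\emptyset,(1^2)}$, then $\mathrm{ind}^{B_n}_{B_{n-2}\times H_2}S^{\lambda,\mu}\boxtimes W=\bigoplus_{\tau\in\bar{\bar{\lambda}}}S^{\tau,\mu}\oplus\bigoplus_{\rho\in\tilde{\bar{\mu}}}S^{\lambda,\rho}$; 2. if $\mathrm{ind}^{B_2}_{H_2}W=S^{\emptyset,(2)}\oplus S^{(1^2),\emptyset}$, then $\mathrm{ind}^{B_n}_{B_{n-2}\times H_2}S^{\lambda,\mu}\boxtimes W=\bigoplus_{\rho\in\bar{\bar{\mu}}}S^{\lambda,\rho}\oplus\bigoplus_{\tau\in\tilde{\bar{\lambda}}}S^{\tau,\mu}$; 3. if $\mathrm{ind}^{B_2}_{H_2}W=S^{(1),(1)}$, then $\mathrm{ind}^{B_n}_{B_{n-2}\times H_2}S^{\lambda,\mu}\boxtimes W=\bigoplus_{\tau\in\bar{\lambda},\,\rho\in\bar{\mu}}S^{\tau,\rho}$.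
   Context: All representations are finite-dimensional over $\mathbb{C}$. Let $F=\mathbb{Z}/2=\{0,1\}$ and $B_m=F\wr S_m=F^m\rtimes S_m$, where $S_m$ permutes the coordinates of $F^m$. $B_{m-k}\times B_k$ is identified with $F\wr(S_{m-k}\times S_k)\leqslant B_m$. $H_2=\{(f,\sigma)\in B_2:\mathrm{sgn}(\sigma)=(-1)^{\#f}\}$, where $\#f$ is the number of $1$'s in $f$. $\mathbf 1$ denotes the trivial and $\epsilon$ the sign (nontrivial one-dimensional) representation of $F$. For $D\in\{\mathbf 1,\epsilon\}$ and a representation $E$ of $S_m$, $(D;E)$ is the representation of $B_m$ on the space of $E$ in which $(f,\sigma)$ acts as $D(f_1)\cdots D(f_m)$ times the action of $\sigma$. For partitions $\lambda\vdash m-k$, $\mu\vdash k$, with Specht modules $S^\lambda,S^\mu$, set $S^{\lambda,\mu}:=\mathrm{ind}^{B_m}_{B_{m-k}\times B_k}(\mathbf 1;S^\lambda)\boxtimes(\epsilon;S^\mu)$; these are the irreducible representations of $B_m$. For a partition $\lambda$ of $m$: $\bar\lambda$ is the set of $\tau\vdash m+1$ such that $S^\tau$ is a summand of $\mathrm{ind}^{S_{m+1}}_{S_m\times S_1}S^\lambda\boxtimes\mathbf 1$; $\bar{\bar\lambda}$ is the set of $\tau\vdash m+2$ such that $S^\tau$ is a summand of $\mathrm{ind}^{S_{m+2}}_{S_m\times S_2}S^\lambda\boxtimes\mathbf 1_{S_2}$; $\tilde{\bar\lambda}$ is the set of $\tau\vdash m+2$ such that $S^\tau$ is a summand of $\mathrm{ind}^{S_{m+2}}_{S_m\times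 S_2}S^\lambda\boxtimes\epsilon_{S_2}$, where $\epsilon_{S_2}$ is the sign representation of $S_2$. *)

theory Defs
  imports
    "HOL.Complex"
    "HOL-Algebra.Sym_Groups"
    "HOL-Library.Function_Algebras"
    "HOL-Library.Product_Plus"
    "HOL-Library.Z2"
begin

section \<open>Complex vector spaces\<close>

class complex_vector = ab_group_add +
  fixes scaleC :: "complex \<Rightarrow> 'a \<Rightarrow> 'a"  (infixr \<open>*\<^sub>C\<close> 75)
  assumes scaleC_add_right: "a *\<^sub>C (x + y) = a *\<^sub>C x + a *\<^sub>C y"
    and scaleC_add_left: "(a + b) *\<^sub>C x = a *\<^sub>C x + b *\<^sub>C x"
    and scaleC_scaleC: "a *\<^sub>C b *\<^sub>C x = (a * b) *\<^sub>C x"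
    and scaleC_one: "1 *\<^sub>C x = x"

global_interpretation complex_vector: vector_space "scaleC :: complex \<Rightarrow> 'a \<Rightarrow> 'a::complex_vector"
  defines csubspace = complex_vector.subspace
    and cspan = complex_vector.span
  by unfold_locales (rule scaleC_add_right scaleC_add_left scaleC_scaleC scaleC_one)+

instantiation complex :: complex_vector
begin
definition scaleC_complex :: "complex \<Rightarrow> complex \<Rightarrow> complex"
  where "scaleC_complex c z = c * z"
instance by standard (simp_all add: scaleC_complex_def algebra_simps)
end

instantiation "fun" :: (type, complex_vector) complex_vector
begin
definition scaleC_fun :: "complex \<Rightarrow> ('a \<Rightarrow> 'b) \<Rightarrow> 'a \<Rightarrow> 'b"
  where "scaleC_fun c f = (\<lambda>x. c *\<^sub>C f x)"
instance
  by standard (simp_all add: scaleC_fun_def fun_eq_iff scaleC_add_right scaleC_add_left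
      scaleC_scaleC scaleC_one)
end

instantiation prod :: (complex_vector, complex_vector) complex_vector
begin
definition scaleC_prod :: "complex \<Rightarrow> 'a \<times> 'b \<Rightarrow> 'a \<times> 'b"
  where "scaleC_prod c p = (c *\<^sub>C fst p, c *\<^sub>C snd p)"
instance
  by standard (simp_all add: scaleC_prod_def prod_eq_iff scaleC_add_right scaleC_add_left
      scaleC_scaleC scaleC_one)
end

definition clinear_on :: "'v::complex_vector set \<Rightarrow> ('v \<Rightarrow> 'w::complex_vector) \<Rightarrow> bool"
  where "clinear_on V \<phi> \<longleftrightarrow>
    (\<forall>x\<in>V. \<forall>y\<in>V. \<phi> (x + y) = \<phi> x + \<phi> y) \<and> (\<forall>c. \<forall>x\<in>V. \<phi> (c *\<^sub>C x) = c *\<^sub>C \<phi> x)"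


section \<open>Finite-dimensional complex representations\<close>

text \<open>
  The space of a representation is a subspace of a vector space type. Only the values of
  \<open>ract\<close> at group elements and at vectors of \<open>rspace\<close> matter.
\<close>

record ('g, 'v) rep =
  rspace :: "'v set"
  ract :: "'g \<Rightarrow> 'v \<Rightarrow> 'v"

definition representation :: "('g, 'a) monoid_scheme \<Rightarrow> ('g, 'v::complex_vector) rep \<Rightarrow> bool"
  where "representation G R \<longleftrightarrow>
    group G \<and> csubspace (rspace R) \<and> (\<exists>B. finite B \<and> cspan B = rspace R) \<and>
    (\<forall>g\<in>carrier G. clinear_on (rspace R) (ract R g) \<and> ract R g ` rspace R \<subseteq> rspace R) \<and>
    (\<forall>v\<in>rspace R. ract R \<one>\<^bsub>G\<^esub> v = v) \<and>
    (\<forall>g\<in>carrier G. \<forall>h\<in>carrier G. \<forall>v\<in>rspace R.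
       ract R (g \<otimes>\<^bsub>G\<^esub> h) v = ract R g (ract R h v))"

definition invariant_subspace ::
    "('g, 'a) monoid_scheme \<Rightarrow> ('g, 'v::complex_vector) rep \<Rightarrow> 'v set \<Rightarrow> bool"
  where "invariant_subspace G R U \<longleftrightarrow>
    csubspace U \<and> U \<subseteq> rspace R \<and> (\<forall>g\<in>carrier G. ract R g ` U \<subseteq> U)"

definition irreducible_rep :: "('g, 'a) monoid_scheme \<Rightarrow> ('g, 'v::complex_vector) rep \<Rightarrow> bool"
  where "irreducible_rep G R \<longleftrightarrow>
    representation G R \<and> rspace R \<noteq> {0} \<and>
    (\<forall>U. invariant_subspace G R U \<longrightarrow> U = {0} \<or> U = rspace R)"

definition rep_iso ::
    "('g, 'a) monoid_scheme \<Rightarrow> ('g, 'v::complex_vector) rep \<Rightarrow> ('g, 'w::complex_vector) rep \<Rightarrow> bool"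
  where "rep_iso G R S \<longleftrightarrow>
    (\<exists>\<phi>. bij_betw \<phi> (rspace R) (rspace S) \<and> clinear_on (rspace R) \<phi> \<and>
      (\<forall>g\<in>carrier G. \<forall>v\<in>rspace R. \<phi> (ract R g v) = ract S g (\<phi> v)))"

definition summand ::
    "('g, 'a) monoid_scheme \<Rightarrow> ('g, 'v::complex_vector) rep \<Rightarrow> ('g, 'w::complex_vector) rep \<Rightarrow> bool"
  where "summand G S R \<longleftrightarrow>
    (\<exists>U U'. invariant_subspace G R U \<and> invariant_subspace G R U' \<and>
      U \<inter> U' = {0} \<and> {u + u' | u u'. u \<in> U \<and> u' \<in> U'} = rspace R \<and>
      rep_iso G S (R\<lparr>rspace := U\<rparr>))"

definition oplus ::
    "('g, 'v::complex_vector) rep \<Rightarrow> ('g, 'w::complex_vector) rep \<Rightarrow> ('g, 'v \<times> 'w) rep"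
  where "oplus R S =
    \<lparr>rspace = rspace R \<times> rspace S, ract = (\<lambda>g (v, w). (ract R g v, ract S g w))\<rparr>"

definition direct_sum ::
    "'i set \<Rightarrow> ('i \<Rightarrow> ('g, 'v::complex_vector) rep) \<Rightarrow> ('g, 'i \<Rightarrow> 'v) rep"
  where "direct_sum I R =
    \<lparr>rspace = {u. (\<forall>i\<in>I. u i \<in> rspace (R i)) \<and> (\<forall>i. i \<notin> I \<longrightarrow> u i = 0) \<and> finite {i. u i \<noteq> 0}},
     ract = (\<lambda>g u i. if i \<in> I then ract (R i) g (u i) else 0)\<rparr>"

text \<open>
  The tensor product of finite-dimensional spaces \<open>V\<close> and \<open>W\<close> is taken to be the dual of the space
  of bilinear forms on \<open>V \<times> W\<close>, spanned by the evaluations \<open>\<beta> \<mapsto> \<beta> v w\<close>. An element is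
  represented as a functional on all functions \<open>\<beta>\<close>, vanishing on those that are not bilinear
  on \<open>V \<times> W\<close>.
\<close>

definition bilinear_form_on ::
    "'v::complex_vector set \<Rightarrow> 'w::complex_vector set \<Rightarrow> ('v \<Rightarrow> 'w \<Rightarrow> complex) \<Rightarrow> bool"
  where "bilinear_form_on V W \<beta> \<longleftrightarrow>
    (\<forall>v\<in>V. clinear_on W (\<beta> v)) \<and> (\<forall>w\<in>W. clinear_on V (\<lambda>v. \<beta> v w))"

definition pure_tensor ::
    "'v::complex_vector set \<Rightarrow> 'w::complex_vector set \<Rightarrow> 'v \<Rightarrow> 'w \<Rightarrow> ('v \<Rightarrow> 'w \<Rightarrow> complex) \<Rightarrow> complex"
  where "pure_tensor V W v w = (\<lambda>\<beta>. if bilinear_form_on V W \<beta> then \<beta> v w else 0)"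

definition box ::
    "('g, 'v::complex_vector) rep \<Rightarrow> ('h, 'w::complex_vector) rep
      \<Rightarrow> ('g \<times> 'h, ('v \<Rightarrow> 'w \<Rightarrow> complex) \<Rightarrow> complex) rep"  (infixr \<open>\<boxtimes>\<close> 70)
  where "R \<boxtimes> S =
    \<lparr>rspace = cspan {pure_tensor (rspace R) (rspace S) v w | v w. v \<in> rspace R \<and> w \<in> rspace S},
     ract = (\<lambda>(g, h) t \<beta>. t (\<lambda>v w. \<beta> (ract R g v) (ract S h w)))\<rparr>"

text \<open>
  Induction along an injective homomorphism \<open>\<iota> : H \<rightarrow> G\<close> of finite groups, which identifies \<open>H\<close>
  with a subgroup of \<open>G\<close>: the functions \<open>u : G \<rightarrow> V\<close> with \<open>u (x h) = h\<^sup>-\<^sup>1 u(x)\<close> (extended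
  by \<open>0\<close> outside the carrier), on which \<open>G\<close> acts by left translation.
\<close>

definition induced ::
    "('g, 'a) monoid_scheme \<Rightarrow> ('h, 'b) monoid_scheme \<Rightarrow> ('h \<Rightarrow> 'g)
      \<Rightarrow> ('h, 'v::complex_vector) rep \<Rightarrow> ('g, 'g \<Rightarrow> 'v) rep"
  where "induced G H \<iota> R =
    \<lparr>rspace = {u. (\<forall>x\<in>carrier G. u x \<in> rspace R) \<and> (\<forall>x. x \<notin> carrier G \<longrightarrow> u x = 0) \<and>
       (\<forall>x\<in>carrier G. \<forall>h\<in>carrier H. u (x \<otimes>\<^bsub>G\<^esub> \<iota> h) = ract R (inv\<^bsub>H\<^esub> h) (u x))},
     ract = (\<lambda>g u x. if x \<in> carrier G then u (inv\<^bsub>G\<^esub> g \<otimes>\<^bsub>G\<^esub> x) else 0)\<rparr>"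


section \<open>Representations of symmetric groups\<close>

text \<open>\<open>S\<^sub>a \<times> S\<^sub>b\<close> sits in \<open>S\<^sub>a\<^sub>+\<^sub>b\<close> with \<open>S\<^sub>b\<close> permuting \<open>a+1, \<dots>, a+b\<close>.\<close>

definition sym_embed :: "nat \<Rightarrow> (nat \<Rightarrow> nat) \<times> (nat \<Rightarrow> nat) \<Rightarrow> nat \<Rightarrow> nat"
  where "sym_embed a = (\<lambda>(\<sigma>, \<sigma>') i. if i \<le> a then \<sigma> i else \<sigma>' (i - a) + a)"

definition trivial_rep :: "(nat \<Rightarrow> nat, complex) rep"
  where "trivial_rep = \<lparr>rspace = UNIV, ract = (\<lambda>\<sigma> z. z)\<rparr>"

definition sign_rep :: "(nat \<Rightarrow> nat, complex) rep"
  where "sign_rep = \<lparr>rspace = UNIV, ract = (\<lambda>\<sigma> z. of_int (sign \<sigma>) * z)\<rparr>"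

definition is_partition :: "nat \<Rightarrow> nat list \<Rightarrow> bool"
  where "is_partition m p \<longleftrightarrow> sorted_wrt (\<ge>) p \<and> 0 \<notin> set p \<and> sum_list p = m"

definition young_diagram :: "nat list \<Rightarrow> (nat \<times> nat) set"
  where "young_diagram p = {(i, j). i < length p \<and> j < p ! i}"

definition tableaux :: "nat list \<Rightarrow> (nat \<times> nat \<Rightarrow> nat) set"
  where "tableaux p = {t. bij_betw t (young_diagram p) {1..sum_list p}}"

text \<open>A tabloid is encoded as the sequence of the sets of entries of its rows.\<close>

definition tabloid :: "nat list \<Rightarrow> (nat \<times> nat \<Rightarrow> nat) \<Rightarrow> nat \<Rightarrow> nat set"
  where "tabloid p t = (\<lambda>i. {t (i, j) | j. (i, j) \<in> young_diagram p})"

definition column_stabilizer :: "nat list \<Rightarrow> (nat \<times> nat \<Rightarrow> nat) \<Rightarrow> (nat \<Rightarrow> nat) set"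
  where "column_stabilizer p t = {\<pi>. \<pi> permutes {1..sum_list p} \<and>
    (\<forall>(i, j)\<in>young_diagram p. \<exists>i'. (i', j) \<in> young_diagram p \<and> \<pi> (t (i, j)) = t (i', j))}"

text \<open>\<open>e\<^sub>t = \<Sum>\<^sub>\<pi> sgn(\<pi>) {\<pi> t}\<close>, as a function on tabloids.\<close>

definition polytabloid :: "nat list \<Rightarrow> (nat \<times> nat \<Rightarrow> nat) \<Rightarrow> (nat \<Rightarrow> nat set) \<Rightarrow> complex"
  where "polytabloid p t =
    (\<lambda>T. \<Sum>\<pi>\<in>column_stabilizer p t. if T = tabloid p (\<pi> \<circ> t) then of_int (sign \<pi>) else 0)"

definition specht :: "nat list \<Rightarrow> (nat \<Rightarrow> nat, (nat \<Rightarrow> nat set) \<Rightarrow> complex) rep"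
  where "specht p =
    \<lparr>rspace = cspan (polytabloid p ` tableaux p), ract = (\<lambda>\<sigma> u T. u (\<lambda>i. inv' \<sigma> ` T i))\<rparr>"

text \<open>The sets written with one bar, two bars, and a tilde over a bar, respectively.\<close>

definition bar :: "nat list \<Rightarrow> nat list set"
  where "bar p = (let m = sum_list p in
    {q. is_partition (m + 1) q \<and>
      summand (sym_group (m + 1)) (specht q)
        (induced (sym_group (m + 1)) (sym_group m \<times>\<times> sym_group 1) (sym_embed m)
          (specht p \<boxtimes> trivial_rep))})"

definition bar_bar :: "nat list \<Rightarrow> nat list set"
  where "bar_bar p = (let m = sum_list p in
    {q. is_partition (m + 2) q \<and>
      summand (sym_group (m + 2)) (specht q)
        (induced (sym_group (m + 2)) (sym_group m \<times>\<times> sym_group 2) (sym_embed m)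
          (specht p \<boxtimes> trivial_rep))})"

definition tilde_bar :: "nat list \<Rightarrow> nat list set"
  where "tilde_bar p = (let m = sum_list p in
    {q. is_partition (m + 2) q \<and>
      summand (sym_group (m + 2)) (specht q)
        (induced (sym_group (m + 2)) (sym_group m \<times>\<times> sym_group 2) (sym_embed m)
          (specht p \<boxtimes> sign_rep))})"


section \<open>Representations of \<open>B\<^sub>m\<close>\<close>

text \<open>\<open>F = \<int>/2\<close> is the type \<open>bit\<close>; \<open>S\<^sub>m\<close> acts on \<open>F\<^sup>m\<close> by \<open>(\<sigma> f)\<^sub>i = f\<^bsub>\<sigma>\<^sup>-\<^sup>1(i)\<^esub>\<close>.\<close>

type_synonym signed_perm = "(nat \<Rightarrow> bit) \<times> (nat \<Rightarrow> nat)"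

definition hyperoct :: "nat \<Rightarrow> signed_perm monoid"
  where "hyperoct m =
    \<lparr>carrier = {(f, \<sigma>). (\<forall>i. i \<notin> {1..m} \<longrightarrow> f i = 0) \<and> \<sigma> permutes {1..m}},
     mult = (\<lambda>(f, \<sigma>) (f', \<sigma>'). (\<lambda>i. f i + f' (inv' \<sigma> i), \<sigma> \<circ> \<sigma>')),
     one = (\<lambda>i. 0, id)\<rparr>"

definition hyperoct_embed ::
    "nat \<Rightarrow> signed_perm \<times> signed_perm \<Rightarrow> signed_perm"
  where "hyperoct_embed a = (\<lambda>((f, \<sigma>), (f', \<sigma>')).
    (\<lambda>i. if i \<le> a then f i else f' (i - a), sym_embed a (\<sigma>, \<sigma>')))"

definition H2 :: "signed_perm monoid"
  where "H2 = (hyperoct 2)\<lparr>carrier :=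
    {(f, \<sigma>) \<in> carrier (hyperoct 2). sign \<sigma> = (-1) ^ card {i \<in> {1..2}. f i = 1}}\<rparr>"

definition triv_char :: "bit \<Rightarrow> complex"
  where "triv_char x = 1"

definition sign_char :: "bit \<Rightarrow> complex"
  where "sign_char x = (if x = 0 then 1 else -1)"

definition char_rep ::
    "nat \<Rightarrow> (bit \<Rightarrow> complex) \<Rightarrow> (nat \<Rightarrow> nat, 'v::complex_vector) rep
      \<Rightarrow> ((nat \<Rightarrow> bit) \<times> (nat \<Rightarrow> nat), 'v) rep"
  where "char_rep m D E =
    \<lparr>rspace = rspace E, ract = (\<lambda>(f, \<sigma>) v. (\<Prod>i=1..m. D (f i)) *\<^sub>C ract E \<sigma> v)\<rparr>"

type_synonym specht_space = "(nat \<Rightarrow> nat set) \<Rightarrow> complex"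

text \<open>The representation \<open>S\<^bsup>p,q\<^esup>\<close>.\<close>

definition bispecht ::
    "nat list \<Rightarrow> nat list \<Rightarrow>
      (signed_perm, signed_perm \<Rightarrow> (specht_space \<Rightarrow> specht_space \<Rightarrow> complex) \<Rightarrow> complex) rep"
  where "bispecht p q = (let a = sum_list p; b = sum_list q in
    induced (hyperoct (a + b)) (hyperoct a \<times>\<times> hyperoct b) (hyperoct_embed a)
      (char_rep a triv_char (specht p) \<boxtimes> char_rep b sign_char (specht q)))"

end

theory Submission
  imports Defs
begin

text \<open>
  Induction in stages together with a permutation of the blocks of \<open>B\<^sub>n\<close> turns
  \<open>S\<^bsup>\<lambda>,\<mu>\<^esup> \<boxtimes> S\<^bsup>\<alpha>,\<beta>\<^esup>\<close> into the induction product of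
  \<open>(1; ind S\<^sup>\<lambda> \<boxtimes> S\<^sup>\<alpha>)\<close> and \<open>(\<epsilon>; ind S\<^sup>\<mu> \<boxtimes> S\<^sup>\<beta>)\<close>, and the hypothesis on \<open>W\<close> enters
  through \<open>ind (S \<boxtimes> W) = ind (S \<boxtimes> ind W)\<close>. It remains to decompose
  \<open>ind S\<^sup>\<lambda> \<boxtimes> \<chi>\<close> for a character \<open>\<chi>\<close> of \<open>S\<^sub>1\<close> or \<open>S\<^sub>2\<close>. By Maschke's theorem
  this amounts to two facts. The Specht modules are all the irreducible representations: they are
  irreducible and distinct by James' argument, and enough by comparison with the number of cycle
  types. The multiplicities are at most one by Gelfand's trick, because every permutation of
  \<open>m + k\<close> points, \<open>k \<le> 2\<close>, is conjugate to its inverse under \<open>S\<^sub>m \<times> S\<^sub>k\<close>.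
\<close>

section \<open>Representations and intertwiners\<close>

text \<open>The sets \<open>bar\<close>, \<open>bar_bar\<close> and \<open>tilde_bar\<close> are
  defined by what occurs in an induced representation, so no skew shape is ever computed:
  completeness of the Specht modules and multiplicity one are all that is at stake. Neither is
  obtained from traces; a single matrix coefficient of a polytabloid, summed over conjugations,
  plays the role of the character. The bound k \<le> 2 in Gelfand's trick comes from the reflection
  that inverts a cycle: it can be chosen to preserve a set of one or two marked points, whereas
  three points in general position on a long cycle admit no such reflection. Over the complex
  numbers two forms on tabloid functions are needed, a bilinear one, which is the coefficient in
  James' identity, and a Hermitian one, whose definiteness keeps norms from vanishing; they agree
  against polytabloids, which have real values. The dominance order is replaced by a numerical
  weight, so that any two partitions are comparable.\<close>

lemma scaleC_fun_apply [simp]: "(c *\<^sub>C f) x = c *\<^sub>C f x"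
  by (simp add: scaleC_fun_def)

lemma scaleC_complex_apply [simp]: "(c::complex) *\<^sub>C z = c * z"
  by (simp add: scaleC_complex_def)

lemma sum_fun_apply: "(\<Sum>i\<in>I. f i) x = (\<Sum>i\<in>I. f i x)"
  for f :: "'i \<Rightarrow> 'x \<Rightarrow> 'v::comm_monoid_add"
  by (induction I rule: infinite_finite_induct) auto

section \<open>Linear maps on a subspace\<close>

lemma clinear_onI:
  assumes "\<And>x y. x \<in> V \<Longrightarrow> y \<in> V \<Longrightarrow> f (x + y) = f x + f y"
    and "\<And>c x. x \<in> V \<Longrightarrow> f (c *\<^sub>C x) = c *\<^sub>C f x"
  shows "clinear_on V f"
  using assms by (simp add: clinear_on_def)

lemma clinear_on_add: "clinear_on V f \<Longrightarrow> x \<in> V \<Longrightarrow> y \<in> V \<Longrightarrow> f (x + y) = f x + f y"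
  by (simp add: clinear_on_def)

lemma clinear_on_scale: "clinear_on V f \<Longrightarrow> x \<in> V \<Longrightarrow> f (c *\<^sub>C x) = c *\<^sub>C f x"
  by (simp add: clinear_on_def)

lemma clinear_on_0: "clinear_on V f \<Longrightarrow> csubspace V \<Longrightarrow> f 0 = 0"
  using clinear_on_scale[of V f 0 0] complex_vector.subspace_0[of V] by simp

lemma clinear_on_diff:
  assumes "clinear_on V f" "csubspace V" "x \<in> V" "y \<in> V"
  shows "f (x - y) = f x - f y"
  using clinear_on_add[OF assms(1), of "x - y" y] assms complex_vector.subspace_diff by fastforce

lemma clinear_on_sum:
  assumes "clinear_on V f" "csubspace V" "\<And>i. i \<in> I \<Longrightarrow> x i \<in> V"
  shows "f (\<Sum>i\<in>I. x i) = (\<Sum>i\<in>I. f (x i))"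
  using assms(3)
proof (induction I rule: infinite_finite_induct)
  case (insert i I)
  then show ?case
    using assms(1,2) complex_vector.subspace_sum[OF assms(2), of I x]
    by (simp add: clinear_on_add)
qed (use assms in \<open>auto simp: clinear_on_0\<close>)

lemma clinear_on_subset: "clinear_on V f \<Longrightarrow> U \<subseteq> V \<Longrightarrow> clinear_on U f"
  by (simp add: clinear_on_def subset_iff)

lemma clinear_on_compose:
  "clinear_on V f \<Longrightarrow> clinear_on W g \<Longrightarrow> f ` V \<subseteq> W \<Longrightarrow> clinear_on V (\<lambda>x. g (f x))"
  by (simp add: clinear_on_def image_subset_iff)

lemma clinear_on_sum_fun:
  "(\<And>i. i \<in> I \<Longrightarrow> clinear_on V (f i)) \<Longrightarrow> clinear_on V (\<lambda>x. \<Sum>i\<in>I. f i x)"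
  by (simp add: clinear_on_def sum.distrib complex_vector.scale_sum_right)

lemma clinear_on_scale_fun:
  "clinear_on V f \<Longrightarrow> clinear_on V (\<lambda>x. c *\<^sub>C f x)"
  by (simp add: clinear_on_def scaleC_add_right scaleC_scaleC mult.commute)

lemma clinear_on_id: "clinear_on V (\<lambda>x. x)"
  by (simp add: clinear_on_def)

lemma clinear_on_span_eq:
  assumes f: "clinear_on (cspan B) f" and g: "clinear_on (cspan B) g"
    and eq: "\<And>b. b \<in> B \<Longrightarrow> f b = g b" and x: "x \<in> cspan B"
  shows "f x = g x"
proof -
  have "x \<in> cspan B \<and> f x = g x"
    using x
  proof (induction rule: complex_vector.span_induct_alt)
    case base
    then show ?case
      using clinear_on_0[OF f] clinear_on_0[OF g] complex_vector.subspace_span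
      by (simp add: complex_vector.span_zero)
  next
    case (step c x y)
    then show ?case
      using clinear_on_add[OF f, of "c *\<^sub>C x" y] clinear_on_add[OF g, of "c *\<^sub>C x" y]
        clinear_on_scale[OF f, of x c] clinear_on_scale[OF g, of x c] eq[of x]
      by (simp add: complex_vector.span_base complex_vector.span_scale complex_vector.span_add)
  qed
  then show ?thesis by simp
qed

lemma clinear_on_span_image:
  assumes f: "clinear_on (cspan B) f" and W: "csubspace W"
    and sub: "\<And>b. b \<in> B \<Longrightarrow> f b \<in> W" and x: "x \<in> cspan B"
  shows "f x \<in> W"
proof -
  have "x \<in> cspan B \<and> f x \<in> W"
    using x
  proof (induction rule: complex_vector.span_induct_alt)
    case base
    then show ?case
      using clinear_on_0[OF f] W
      by (simp add: complex_vector.span_zero complex_vector.subspace_0)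
  next
    case (step c x y)
    then show ?case
      using clinear_on_add[OF f, of "c *\<^sub>C x" y] clinear_on_scale[OF f, of x c] sub[of x] W
      by (simp add: complex_vector.span_base complex_vector.span_scale complex_vector.span_add
          complex_vector.subspace_add complex_vector.subspace_scale)
  qed
  then show ?thesis by simp
qed

text \<open>\<open>representation\<close> without the finite spanning set and without
  \<open>group G\<close>. Induced spaces, tensor products and direct sums stay in this class without
  any dimension argument, and Maschke's averaging works in it over a finite group.\<close>

definition linear_rep :: "('g, 'a) monoid_scheme \<Rightarrow> ('g, 'v::complex_vector) rep \<Rightarrow> bool"
  where "linear_rep G R \<longleftrightarrow> csubspace (rspace R) \<and>
    (\<forall>g\<in>carrier G. clinear_on (rspace R) (ract R g) \<and> ract R g ` rspace R \<subseteq> rspace R) \<and>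
    (\<forall>v\<in>rspace R. ract R \<one>\<^bsub>G\<^esub> v = v) \<and>
    (\<forall>g\<in>carrier G. \<forall>h\<in>carrier G. \<forall>v\<in>rspace R.
       ract R (g \<otimes>\<^bsub>G\<^esub> h) v = ract R g (ract R h v))"

lemma representation_linear_rep: "representation G R \<Longrightarrow> linear_rep G R"
  by (simp add: representation_def linear_rep_def)

lemma linear_rep_subspace: "linear_rep G R \<Longrightarrow> csubspace (rspace R)"
  by (simp add: linear_rep_def)

lemma linear_rep_linear: "linear_rep G R \<Longrightarrow> g \<in> carrier G \<Longrightarrow> clinear_on (rspace R) (ract R g)"
  by (simp add: linear_rep_def)

lemma linear_rep_closed: "linear_rep G R \<Longrightarrow> g \<in> carrier G \<Longrightarrow> v \<in> rspace R \<Longrightarrow> ract R g v \<in> rspace R"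
  by (auto simp add: linear_rep_def)

lemma linear_rep_one: "linear_rep G R \<Longrightarrow> v \<in> rspace R \<Longrightarrow> ract R \<one>\<^bsub>G\<^esub> v = v"
  by (simp add: linear_rep_def)

lemma linear_rep_mult:
  "linear_rep G R \<Longrightarrow> g \<in> carrier G \<Longrightarrow> h \<in> carrier G \<Longrightarrow> v \<in> rspace R \<Longrightarrow>
    ract R (g \<otimes>\<^bsub>G\<^esub> h) v = ract R g (ract R h v)"
  by (simp add: linear_rep_def)

lemma linear_rep_inv:
  assumes "linear_rep G R" "group G" "g \<in> carrier G" "v \<in> rspace R"
  shows "ract R (inv\<^bsub>G\<^esub> g) (ract R g v) = v" "ract R g (ract R (inv\<^bsub>G\<^esub> g) v) = v"
  using assms linear_rep_mult[OF assms(1), of "inv\<^bsub>G\<^esub> g" g v]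
    linear_rep_mult[OF assms(1), of g "inv\<^bsub>G\<^esub> g" v] linear_rep_one[OF assms(1), of v]
  by (simp_all add: group.inv_closed group.l_inv group.r_inv)

section \<open>Intertwiners and isomorphisms\<close>

definition intertwiner ::
    "('g, 'a) monoid_scheme \<Rightarrow> ('g, 'v::complex_vector) rep \<Rightarrow> ('g, 'w::complex_vector) rep
      \<Rightarrow> ('v \<Rightarrow> 'w) \<Rightarrow> bool"
  where "intertwiner G R S \<phi> \<longleftrightarrow> clinear_on (rspace R) \<phi> \<and> \<phi> ` rspace R \<subseteq> rspace S \<and>
    (\<forall>g\<in>carrier G. \<forall>v\<in>rspace R. \<phi> (ract R g v) = ract S g (\<phi> v))"

lemma intertwinerI:
  assumes "clinear_on (rspace R) \<phi>" "\<And>v. v \<in> rspace R \<Longrightarrow> \<phi> v \<in> rspace S"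
    and "\<And>g v. g \<in> carrier G \<Longrightarrow> v \<in> rspace R \<Longrightarrow> \<phi> (ract R g v) = ract S g (\<phi> v)"
  shows "intertwiner G R S \<phi>"
  using assms by (auto simp: intertwiner_def)

lemma intertwinerD:
  assumes "intertwiner G R S \<phi>"
  shows "clinear_on (rspace R) \<phi>" "\<And>v. v \<in> rspace R \<Longrightarrow> \<phi> v \<in> rspace S"
    and "\<And>g v. g \<in> carrier G \<Longrightarrow> v \<in> rspace R \<Longrightarrow> \<phi> (ract R g v) = ract S g (\<phi> v)"
  using assms by (auto simp: intertwiner_def)

lemma intertwiner_compose:
  "intertwiner G R S \<phi> \<Longrightarrow> intertwiner G S T \<psi> \<Longrightarrow> intertwiner G R T (\<lambda>v. \<psi> (\<phi> v))"
  by (rule intertwinerI) (auto simp: intertwinerD intro: clinear_on_compose[of _ _ "rspace S"]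
      dest: intertwinerD)

lemma intertwiner_id: "intertwiner G R R (\<lambda>v. v)"
  by (rule intertwinerI) (auto simp: clinear_on_id)

lemma rep_isoI:
  assumes \<phi>: "intertwiner G R S \<phi>" and \<psi>: "\<And>w. w \<in> rspace S \<Longrightarrow> \<psi> w \<in> rspace R"
    and inv: "\<And>v. v \<in> rspace R \<Longrightarrow> \<psi> (\<phi> v) = v" "\<And>w. w \<in> rspace S \<Longrightarrow> \<phi> (\<psi> w) = w"
  shows "rep_iso G R S"
proof -
  have "bij_betw \<phi> (rspace R) (rspace S)"
    by (rule bij_betwI[where g = \<psi>]) (use assms intertwinerD(2)[OF \<phi>] in auto)
  then show ?thesis
    using \<phi> by (auto simp: rep_iso_def intertwiner_def)
qed

text \<open>The inverse bijection is linear and equivariant because every operation on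
  \<open>rspace S\<close> can be carried out on preimages in \<open>rspace R\<close>, which is
  closed under it.\<close>

lemma rep_isoE:
  assumes "rep_iso G R S" "linear_rep G R"
  obtains \<phi> \<psi> where "intertwiner G R S \<phi>" "intertwiner G S R \<psi>"
    "\<And>v. v \<in> rspace R \<Longrightarrow> \<psi> (\<phi> v) = v" "\<And>w. w \<in> rspace S \<Longrightarrow> \<phi> (\<psi> w) = w"
proof -
  obtain \<phi> where bij: "bij_betw \<phi> (rspace R) (rspace S)" and lin: "clinear_on (rspace R) \<phi>"
    and eqv: "\<And>g v. g \<in> carrier G \<Longrightarrow> v \<in> rspace R \<Longrightarrow> \<phi> (ract R g v) = ract S g (\<phi> v)"
    using assms by (auto simp: rep_iso_def)
  define \<psi> where "\<psi> = the_inv_into (rspace R) \<phi>"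
  have inj: "inj_on \<phi> (rspace R)" and im: "\<phi> ` rspace R = rspace S"
    using bij by (auto simp: bij_betw_def)
  have \<phi>\<psi>: "\<phi> (\<psi> w) = w" if "w \<in> rspace S" for w
    using that inj im by (simp add: \<psi>_def f_the_inv_into_f)
  have \<psi>\<phi>: "\<psi> (\<phi> v) = v" if "v \<in> rspace R" for v
    using that inj by (simp add: \<psi>_def the_inv_into_f_f)
  have \<psi>in: "\<psi> w \<in> rspace R" if "w \<in> rspace S" for w
    using that im \<psi>\<phi> by (metis imageE)
  note R = assms(2)
  note sub = linear_rep_subspace[OF R]
  have "intertwiner G S R \<psi>"
  proof (rule intertwinerI)
    show "clinear_on (rspace S) \<psi>"
    proof (rule clinear_onI)
      fix x y assume xy: "x \<in> rspace S" "y \<in> rspace S"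
      have "x + y = \<phi> (\<psi> x + \<psi> y)"
        using xy by (simp add: clinear_on_add[OF lin] \<psi>in \<phi>\<psi>)
      then show "\<psi> (x + y) = \<psi> x + \<psi> y"
        using xy by (simp add: \<psi>\<phi> \<psi>in sub complex_vector.subspace_add)
    next
      fix c x assume x: "x \<in> rspace S"
      have "c *\<^sub>C x = \<phi> (c *\<^sub>C \<psi> x)"
        using x by (simp add: clinear_on_scale[OF lin] \<psi>in \<phi>\<psi>)
      then show "\<psi> (c *\<^sub>C x) = c *\<^sub>C \<psi> x"
        using x by (simp add: \<psi>\<phi> \<psi>in sub complex_vector.subspace_scale)
    qed
    fix g w assume g: "g \<in> carrier G" and w: "w \<in> rspace S"
    have "ract S g w = \<phi> (ract R g (\<psi> w))"
      using g w by (simp add: eqv \<psi>in \<phi>\<psi>)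
    then show "\<psi> (ract S g w) = ract R g (\<psi> w)"
      using g w by (simp add: \<psi>\<phi> \<psi>in linear_rep_closed[OF R])
  qed (rule \<psi>in)
  moreover have "intertwiner G R S \<phi>"
    using im by (intro intertwinerI lin eqv) auto
  ultimately show ?thesis
    using that \<phi>\<psi> \<psi>\<phi> by blast
qed

lemma rep_iso_refl: "rep_iso G R R"
  by (rule rep_isoI[where \<phi> = "\<lambda>v. v" and \<psi> = "\<lambda>v. v"]) (auto simp: intertwiner_id)

lemma rep_iso_sym: "rep_iso G R S \<Longrightarrow> linear_rep G R \<Longrightarrow> rep_iso G S R"
  by (erule (1) rep_isoE, rule rep_isoI) (auto dest: intertwinerD)

lemma rep_iso_trans [trans]: "rep_iso G R S \<Longrightarrow> rep_iso G S T \<Longrightarrow> rep_iso G R T"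
proof -
  assume "rep_iso G R S" "rep_iso G S T"
  then obtain \<phi> \<psi> where \<phi>: "bij_betw \<phi> (rspace R) (rspace S)" "clinear_on (rspace R) \<phi>"
      "\<And>g v. g \<in> carrier G \<Longrightarrow> v \<in> rspace R \<Longrightarrow> \<phi> (ract R g v) = ract S g (\<phi> v)"
    and \<psi>: "bij_betw \<psi> (rspace S) (rspace T)" "clinear_on (rspace S) \<psi>"
      "\<And>g v. g \<in> carrier G \<Longrightarrow> v \<in> rspace S \<Longrightarrow> \<psi> (ract S g v) = ract T g (\<psi> v)"
    by (auto simp: rep_iso_def)
  have im: "\<phi> ` rspace R = rspace S"
    using \<phi>(1) by (simp add: bij_betw_def)
  have "bij_betw (\<lambda>v. \<psi> (\<phi> v)) (rspace R) (rspace T)"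
    using bij_betw_trans[OF \<phi>(1) \<psi>(1)] by (simp add: comp_def)
  moreover have "clinear_on (rspace R) (\<lambda>v. \<psi> (\<phi> v))"
    using clinear_on_compose[OF \<phi>(2) \<psi>(2)] im by simp
  ultimately show "rep_iso G R T"
    using \<phi>(3) \<psi>(3) im by (auto simp: rep_iso_def intro!: exI[of _ "\<lambda>v. \<psi> (\<phi> v)"] dest: equalityD1[THEN subsetD])
qed

section \<open>Tensor products\<close>

definition tensor_space ::
    "'v::complex_vector set \<Rightarrow> 'w::complex_vector set \<Rightarrow> (('v \<Rightarrow> 'w \<Rightarrow> complex) \<Rightarrow> complex) set"
  where "tensor_space V W = cspan {pure_tensor V W v w | v w. v \<in> V \<and> w \<in> W}"

text \<open>The map A \<otimes> B, acting by precomposition of the form with A and B. The guard is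
  there because precomposition can turn a function that is not bilinear on X \<times> Y into a
  bilinear one, while a tensor has to vanish on everything that is not bilinear.\<close>

definition tensor_map ::
    "'x::complex_vector set \<Rightarrow> 'y::complex_vector set \<Rightarrow> ('v \<Rightarrow> 'x) \<Rightarrow> ('w \<Rightarrow> 'y)
      \<Rightarrow> (('v \<Rightarrow> 'w \<Rightarrow> complex) \<Rightarrow> complex) \<Rightarrow> ('x \<Rightarrow> 'y \<Rightarrow> complex) \<Rightarrow> complex"
  where "tensor_map X Y A B t = (\<lambda>\<beta>. if bilinear_form_on X Y \<beta> then t (\<lambda>v w. \<beta> (A v) (B w)) else 0)"

lemma rspace_box [simp]: "rspace (R \<boxtimes> S) = tensor_space (rspace R) (rspace S)"
  by (simp add: box_def tensor_space_def)

lemma subspace_tensor_space: "csubspace (tensor_space V W)"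
  by (simp add: tensor_space_def complex_vector.subspace_span)

lemma pure_tensor_in: "v \<in> V \<Longrightarrow> w \<in> W \<Longrightarrow> pure_tensor V W v w \<in> tensor_space V W"
  by (auto simp: tensor_space_def intro!: complex_vector.span_base)

lemma tensor_space_eq:
  assumes "clinear_on (tensor_space V W) f" "clinear_on (tensor_space V W) g"
    and "\<And>v w. v \<in> V \<Longrightarrow> w \<in> W \<Longrightarrow> f (pure_tensor V W v w) = g (pure_tensor V W v w)"
    and "t \<in> tensor_space V W"
  shows "f t = g t"
  by (rule clinear_on_span_eq[OF assms(1,2)[unfolded tensor_space_def] _
        assms(4)[unfolded tensor_space_def]]) (use assms(3) in auto)

lemma tensor_space_image:
  assumes "clinear_on (tensor_space V W) f" "csubspace U"
    and "\<And>v w. v \<in> V \<Longrightarrow> w \<in> W \<Longrightarrow> f (pure_tensor V W v w) \<in> U"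
    and "t \<in> tensor_space V W"
  shows "f t \<in> U"
  by (rule clinear_on_span_image[OF assms(1)[unfolded tensor_space_def] assms(2) _
        assms(4)[unfolded tensor_space_def]]) (use assms(3) in auto)

lemma bilinear_form_onD:
  assumes "bilinear_form_on V W \<beta>"
  shows "v \<in> V \<Longrightarrow> clinear_on W (\<beta> v)" "w \<in> W \<Longrightarrow> clinear_on V (\<lambda>v. \<beta> v w)"
  using assms by (auto simp: bilinear_form_on_def)

lemma bilinear_form_on_compose:
  assumes "bilinear_form_on X Y \<beta>" "clinear_on V A" "A ` V \<subseteq> X" "clinear_on W B" "B ` W \<subseteq> Y"
  shows "bilinear_form_on V W (\<lambda>v w. \<beta> (A v) (B w))"
  using assms unfolding bilinear_form_on_def
  by (auto intro!: clinear_on_compose[of W B Y] clinear_on_compose[of V A X])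

lemma pure_tensor_linear:
  "v \<in> V \<Longrightarrow> clinear_on W (pure_tensor V W v)"
  "w \<in> W \<Longrightarrow> clinear_on V (\<lambda>v. pure_tensor V W v w)"
  by (auto intro!: clinear_onI simp: pure_tensor_def fun_eq_iff clinear_on_def bilinear_form_on_def)

lemma tensor_map_linear: "clinear_on U (tensor_map X Y A B)"
  by (auto intro!: clinear_onI simp: tensor_map_def fun_eq_iff)

lemma tensor_map_pure:
  assumes "clinear_on V A" "A ` V \<subseteq> X" "clinear_on W B" "B ` W \<subseteq> Y" "v \<in> V" "w \<in> W"
  shows "tensor_map X Y A B (pure_tensor V W v w) = pure_tensor X Y (A v) (B w)"
  using bilinear_form_on_compose[OF _ assms(1-4)]
  by (auto simp: tensor_map_def pure_tensor_def fun_eq_iff)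

lemma tensor_map_in:
  assumes "clinear_on V A" "A ` V \<subseteq> X" "clinear_on W B" "B ` W \<subseteq> Y" "t \<in> tensor_space V W"
  shows "tensor_map X Y A B t \<in> tensor_space X Y"
  by (rule tensor_space_image[OF tensor_map_linear subspace_tensor_space _ assms(5)])
    (use assms in \<open>auto simp: tensor_map_pure intro!: pure_tensor_in\<close>)

lemma tensor_map_compose:
  assumes "clinear_on V A" "A ` V \<subseteq> X" "clinear_on W B" "B ` W \<subseteq> Y"
    and "clinear_on X A'" "A' ` X \<subseteq> X'" "clinear_on Y B'" "B' ` Y \<subseteq> Y'"
    and "t \<in> tensor_space V W"
  shows "tensor_map X' Y' A' B' (tensor_map X Y A B t) = tensor_map X' Y' (\<lambda>v. A' (A v)) (\<lambda>w. B' (B w)) t"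
proof -
  have A: "clinear_on V (\<lambda>v. A' (A v))" and B: "clinear_on W (\<lambda>w. B' (B w))"
    by (rule clinear_on_compose[OF assms(1) assms(5) assms(2)],
        rule clinear_on_compose[OF assms(3) assms(7) assms(4)])
  have im: "(\<lambda>v. A' (A v)) ` V \<subseteq> X'" "(\<lambda>w. B' (B w)) ` W \<subseteq> Y'"
    using assms(2,4,6,8) by (simp_all add: image_subset_iff)
  show ?thesis
  proof (rule tensor_space_eq[OF _ _ _ assms(9)])
    show "clinear_on (tensor_space V W) (\<lambda>t. tensor_map X' Y' A' B' (tensor_map X Y A B t))"
      by (rule clinear_on_compose[of _ "tensor_map X Y A B" UNIV "tensor_map X' Y' A' B'"])
        (auto intro: tensor_map_linear)
    fix v w assume vw: "v \<in> V" "w \<in> W"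
    then have "A v \<in> X" "B w \<in> Y" using assms by auto
    then show "tensor_map X' Y' A' B' (tensor_map X Y A B (pure_tensor V W v w)) =
        tensor_map X' Y' (\<lambda>v. A' (A v)) (\<lambda>w. B' (B w)) (pure_tensor V W v w)"
      using vw assms by (simp add: tensor_map_pure tensor_map_pure[OF A im(1) B im(2)])
  qed (rule tensor_map_linear)
qed

lemma tensor_map_cong:
  assumes "clinear_on V A" "A ` V \<subseteq> X" "clinear_on W B" "B ` W \<subseteq> Y"
    and "clinear_on V A'" "A' ` V \<subseteq> X" "clinear_on W B'" "B' ` W \<subseteq> Y"
    and "\<And>v. v \<in> V \<Longrightarrow> A v = A' v" "\<And>w. w \<in> W \<Longrightarrow> B w = B' w" "t \<in> tensor_space V W"
  shows "tensor_map X Y A B t = tensor_map X Y A' B' t"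
  by (rule tensor_space_eq[OF tensor_map_linear tensor_map_linear _ assms(11)])
    (use assms in \<open>simp add: tensor_map_pure\<close>)

lemma tensor_map_id:
  assumes "csubspace V" "csubspace W"
    and "\<And>v. v \<in> V \<Longrightarrow> A v = v" "\<And>w. w \<in> W \<Longrightarrow> B w = w" "t \<in> tensor_space V W"
  shows "tensor_map V W A B t = t"
proof (rule tensor_space_eq[OF tensor_map_linear clinear_on_id _ assms(5)])
  have A: "clinear_on V A" "A ` V \<subseteq> V" and B: "clinear_on W B" "B ` W \<subseteq> W"
    using assms by (auto intro!: clinear_onI
      simp: complex_vector.subspace_add complex_vector.subspace_scale)
  show "tensor_map V W A B (pure_tensor V W v w) = pure_tensor V W v w" if "v \<in> V" "w \<in> W" for v w
    using that assms(3,4) by (simp add: tensor_map_pure[OF A B])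
qed

lemma box_action_linear: "clinear_on U (ract (R \<boxtimes> S) g)"
  by (auto intro!: clinear_onI simp: box_def fun_eq_iff split: prod.splits)

text \<open>The action on \<open>box\<close> is bare precomposition, without the guard of
  \<open>tensor_map\<close>. The two agree because g and h are invertible: composing with the
  inverses shows that \<beta> is bilinear exactly when its translate is.\<close>

lemma box_action:
  assumes R: "linear_rep G R" "group G" "g \<in> carrier G" and S: "linear_rep H S" "group H" "h \<in> carrier H"
    and t: "t \<in> rspace (R \<boxtimes> S)"
  shows "ract (R \<boxtimes> S) (g, h) t = tensor_map (rspace R) (rspace S) (ract R g) (ract S h) t"
proof (rule tensor_space_eq[OF box_action_linear tensor_map_linear _ t[unfolded rspace_box]])
  fix v w assume vw: "v \<in> rspace R" "w \<in> rspace S"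
  have g: "clinear_on (rspace R) (ract R g)" "ract R g ` rspace R \<subseteq> rspace R"
    "clinear_on (rspace R) (ract R (inv\<^bsub>G\<^esub> g))" "ract R (inv\<^bsub>G\<^esub> g) ` rspace R \<subseteq> rspace R"
    using R by (auto simp: linear_rep_def group.inv_closed)
  have h: "clinear_on (rspace S) (ract S h)" "ract S h ` rspace S \<subseteq> rspace S"
    "clinear_on (rspace S) (ract S (inv\<^bsub>H\<^esub> h))" "ract S (inv\<^bsub>H\<^esub> h) ` rspace S \<subseteq> rspace S"
    using S by (auto simp: linear_rep_def group.inv_closed)
  have "bilinear_form_on (rspace R) (rspace S) \<beta>"
    if b: "bilinear_form_on (rspace R) (rspace S) (\<lambda>v w. \<beta> (ract R g v) (ract S h w))" for \<beta>
  proof -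
    have *: "bilinear_form_on (rspace R) (rspace S)
        (\<lambda>v w. \<beta> (ract R g (ract R (inv\<^bsub>G\<^esub> g) v)) (ract S h (ract S (inv\<^bsub>H\<^esub> h) w)))"
      by (rule bilinear_form_on_compose[OF b g(3,4) h(3,4)])
    have eq: "\<beta> (ract R g (ract R (inv\<^bsub>G\<^esub> g) v)) (ract S h (ract S (inv\<^bsub>H\<^esub> h) w)) = \<beta> v w"
      if "v \<in> rspace R" "w \<in> rspace S" for v w
      using that by (simp add: linear_rep_inv[OF R(1-3)] linear_rep_inv[OF S(1-3)])
    show ?thesis
      using * linear_rep_subspace[OF R(1)] linear_rep_subspace[OF S(1)]
      by (simp add: bilinear_form_on_def clinear_on_def eq complex_vector.subspace_add
          complex_vector.subspace_scale)
  qed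
  then have iff: "bilinear_form_on (rspace R) (rspace S) (\<lambda>v w. \<beta> (ract R g v) (ract S h w)) \<longleftrightarrow>
      bilinear_form_on (rspace R) (rspace S) \<beta>" for \<beta>
    using bilinear_form_on_compose[OF _ g(1,2) h(1,2)] by blast
  show "ract (R \<boxtimes> S) (g, h) (pure_tensor (rspace R) (rspace S) v w) =
      tensor_map (rspace R) (rspace S) (ract R g) (ract S h) (pure_tensor (rspace R) (rspace S) v w)"
    unfolding tensor_map_pure[OF g(1,2) h(1,2) vw] by (simp add: box_def pure_tensor_def iff)
qed

lemma box_action_pure:
  assumes R: "linear_rep G R" "group G" "g \<in> carrier G" and S: "linear_rep H S" "group H" "h \<in> carrier H"
    and vw: "v \<in> rspace R" "w \<in> rspace S"
  shows "ract (R \<boxtimes> S) (g, h) (pure_tensor (rspace R) (rspace S) v w) =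
    pure_tensor (rspace R) (rspace S) (ract R g v) (ract S h w)"
proof -
  have "ract R g ` rspace R \<subseteq> rspace R" "ract S h ` rspace S \<subseteq> rspace S"
    using R S by (auto simp: linear_rep_def)
  then show ?thesis
    using vw by (simp add: box_action[OF R S] pure_tensor_in tensor_map_pure linear_rep_linear[OF R(1,3)]
        linear_rep_linear[OF S(1,3)])
qed

lemma linear_rep_box:
  assumes R: "linear_rep G R" "group G" and S: "linear_rep H S" "group H"
  shows "linear_rep (G \<times>\<times> H) (R \<boxtimes> S)"
proof -
  have act: "clinear_on (rspace R) (ract R g)" "ract R g ` rspace R \<subseteq> rspace R" if "g \<in> carrier G" for g
    using R that by (auto simp: linear_rep_def)
  have act': "clinear_on (rspace S) (ract S h)" "ract S h ` rspace S \<subseteq> rspace S" if "h \<in> carrier H" for h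
    using S that by (auto simp: linear_rep_def)
  have closed: "ract (R \<boxtimes> S) (g, h) t \<in> tensor_space (rspace R) (rspace S)"
    if "g \<in> carrier G" "h \<in> carrier H" "t \<in> tensor_space (rspace R) (rspace S)" for g h t
    using that by (simp add: box_action[OF R _ S] tensor_map_in[of "rspace R" _ _ "rspace S"] act act')
  show ?thesis
    unfolding linear_rep_def
  proof (intro conjI ballI)
    show "csubspace (rspace (R \<boxtimes> S))"
      by (simp add: subspace_tensor_space)
    fix t assume t: "t \<in> rspace (R \<boxtimes> S)"
    show "ract (R \<boxtimes> S) \<one>\<^bsub>G \<times>\<times> H\<^esub> t = t"
      using t R S by (simp add: box_action[OF R _ S] tensor_map_id linear_rep_subspace linear_rep_one
          group.is_monoid)
    fix x y assume x: "x \<in> carrier (G \<times>\<times> H)" and y: "y \<in> carrier (G \<times>\<times> H)"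
    obtain g h g' h' where [simp]: "x = (g, h)" "y = (g', h')"
      by (cases x, cases y)
    have m: "g \<in> carrier G" "h \<in> carrier H" "g' \<in> carrier G" "h' \<in> carrier H"
      "g \<otimes>\<^bsub>G\<^esub> g' \<in> carrier G" "h \<otimes>\<^bsub>H\<^esub> h' \<in> carrier H"
      using x y R(2) S(2) by (auto simp: group.is_monoid monoid.m_closed)
    have "ract (R \<boxtimes> S) (g, h) (ract (R \<boxtimes> S) (g', h') t) =
        tensor_map (rspace R) (rspace S) (\<lambda>v. ract R g (ract R g' v)) (\<lambda>w. ract S h (ract S h' w)) t"
      using t m closed by (simp add: box_action[OF R _ S] tensor_map_compose[of "rspace R" _ "rspace R" "rspace S" _ "rspace S"] act act')
    also have "\<dots> = tensor_map (rspace R) (rspace S) (ract R (g \<otimes>\<^bsub>G\<^esub> g')) (ract S (h \<otimes>\<^bsub>H\<^esub> h')) t"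
    proof (rule tensor_map_cong)
      show "clinear_on (rspace R) (\<lambda>v. ract R g (ract R g' v))"
        by (rule clinear_on_compose[OF act(1) act(1) act(2)]) (use m in auto)
      show "clinear_on (rspace S) (\<lambda>v. ract S h (ract S h' v))"
        by (rule clinear_on_compose[OF act'(1) act'(1) act'(2)]) (use m in auto)
    qed (use t m act act' in \<open>auto simp: linear_rep_mult[OF R(1)] linear_rep_mult[OF S(1)]
        intro!: linear_rep_closed[OF R(1)] linear_rep_closed[OF S(1)]\<close>)
    finally show "ract (R \<boxtimes> S) (x \<otimes>\<^bsub>G \<times>\<times> H\<^esub> y) t = ract (R \<boxtimes> S) x (ract (R \<boxtimes> S) y t)"
      using t m by (simp add: box_action[OF R _ S])
  qed (use closed in \<open>auto simp: box_action_linear\<close>)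
qed

lemma intertwiner_box:
  assumes R: "linear_rep G R" "linear_rep G R'" "group G" and S: "linear_rep H S" "linear_rep H S'" "group H"
    and \<phi>: "intertwiner G R R' \<phi>" and \<psi>: "intertwiner H S S' \<psi>"
  shows "intertwiner (G \<times>\<times> H) (R \<boxtimes> S) (R' \<boxtimes> S') (tensor_map (rspace R') (rspace S') \<phi> \<psi>)"
proof (rule intertwinerI)
  note \<phi>' = intertwinerD[OF \<phi>] and \<psi>' = intertwinerD[OF \<psi>]
  have im: "\<phi> ` rspace R \<subseteq> rspace R'" "\<psi> ` rspace S \<subseteq> rspace S'"
    using \<phi>'(2) \<psi>'(2) by auto
  show "clinear_on (rspace (R \<boxtimes> S)) (tensor_map (rspace R') (rspace S') \<phi> \<psi>)"
    by (rule tensor_map_linear)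
  show in': "tensor_map (rspace R') (rspace S') \<phi> \<psi> t \<in> rspace (R' \<boxtimes> S')" if "t \<in> rspace (R \<boxtimes> S)" for t
    using that by (simp add: tensor_map_in[of "rspace R" _ _ "rspace S"] \<phi>'(1) \<psi>'(1) im)
  fix x t assume x: "x \<in> carrier (G \<times>\<times> H)" and t: "t \<in> rspace (R \<boxtimes> S)"
  obtain g h where [simp]: "x = (g, h)" by (cases x)
  have m: "g \<in> carrier G" "h \<in> carrier H" using x by auto
  show "tensor_map (rspace R') (rspace S') \<phi> \<psi> (ract (R \<boxtimes> S) x t) =
      ract (R' \<boxtimes> S') x (tensor_map (rspace R') (rspace S') \<phi> \<psi> t)"
  proof (rule tensor_space_eq[OF _ _ _ t[unfolded rspace_box]])
    show "clinear_on (tensor_space (rspace R) (rspace S)) (\<lambda>t. tensor_map (rspace R') (rspace S') \<phi> \<psi> (ract (R \<boxtimes> S) x t))"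
      by (rule clinear_on_compose[where f = "ract (R \<boxtimes> S) x" and W = UNIV]) (auto intro: box_action_linear tensor_map_linear)
    show "clinear_on (tensor_space (rspace R) (rspace S)) (\<lambda>t. ract (R' \<boxtimes> S') x (tensor_map (rspace R') (rspace S') \<phi> \<psi> t))"
      by (rule clinear_on_compose[where g = "ract (R' \<boxtimes> S') x" and W = UNIV]) (auto intro: box_action_linear tensor_map_linear)
  qed (simp add: box_action_pure[OF R(1,3) m(1) S(1,3) m(2)] box_action_pure[OF R(2,3) m(1) S(2,3) m(2)]
      tensor_map_pure \<phi>' \<psi>' im linear_rep_closed[OF R(1) m(1)] linear_rep_closed[OF S(1) m(2)] m)
qed

lemma rep_iso_box:
  assumes R: "linear_rep G R" "linear_rep G R'" "group G" and S: "linear_rep H S" "linear_rep H S'" "group H"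
    and iso: "rep_iso G R R'" "rep_iso H S S'"
  shows "rep_iso (G \<times>\<times> H) (R \<boxtimes> S) (R' \<boxtimes> S')"
proof -
  obtain \<phi> \<phi>' where \<phi>: "intertwiner G R R' \<phi>" "intertwiner G R' R \<phi>'"
    "\<And>v. v \<in> rspace R \<Longrightarrow> \<phi>' (\<phi> v) = v" "\<And>w. w \<in> rspace R' \<Longrightarrow> \<phi> (\<phi>' w) = w"
    using rep_isoE[OF iso(1) R(1)] by metis
  obtain \<psi> \<psi>' where \<psi>: "intertwiner H S S' \<psi>" "intertwiner H S' S \<psi>'"
    "\<And>v. v \<in> rspace S \<Longrightarrow> \<psi>' (\<psi> v) = v" "\<And>w. w \<in> rspace S' \<Longrightarrow> \<psi> (\<psi>' w) = w"
    using rep_isoE[OF iso(2) S(1)] by metis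
  note D = intertwinerD(1)[OF \<phi>(1)] intertwinerD(1)[OF \<phi>(2)] intertwinerD(1)[OF \<psi>(1)] intertwinerD(1)[OF \<psi>(2)]
  have im: "\<phi> ` rspace R \<subseteq> rspace R'" "\<phi>' ` rspace R' \<subseteq> rspace R" "\<psi> ` rspace S \<subseteq> rspace S'" "\<psi>' ` rspace S' \<subseteq> rspace S"
    using \<phi>(1,2) \<psi>(1,2) by (auto dest: intertwinerD(2))
  show ?thesis
  proof (rule rep_isoI)
    show "intertwiner (G \<times>\<times> H) (R \<boxtimes> S) (R' \<boxtimes> S') (tensor_map (rspace R') (rspace S') \<phi> \<psi>)"
      by (rule intertwiner_box[OF R S \<phi>(1) \<psi>(1)])
    show "tensor_map (rspace R) (rspace S) \<phi>' \<psi>' t \<in> rspace (R \<boxtimes> S)" if "t \<in> rspace (R' \<boxtimes> S')" for t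
      using that by (simp add: tensor_map_in[of "rspace R'" _ _ "rspace S'"] D im)
    show "tensor_map (rspace R) (rspace S) \<phi>' \<psi>' (tensor_map (rspace R') (rspace S') \<phi> \<psi> t) = t"
      if "t \<in> rspace (R \<boxtimes> S)" for t
      using that \<phi> \<psi> R S by (simp add: tensor_map_compose[of "rspace R" _ "rspace R'" "rspace S" _ "rspace S'"]
        tensor_map_id linear_rep_subspace D im)
    show "tensor_map (rspace R') (rspace S') \<phi> \<psi> (tensor_map (rspace R) (rspace S) \<phi>' \<psi>' t) = t"
      if "t \<in> rspace (R' \<boxtimes> S')" for t
      using that \<phi> \<psi> R S by (simp add: tensor_map_compose[of "rspace R'" _ "rspace R" "rspace S'" _ "rspace S"]
        tensor_map_id linear_rep_subspace D im)
  qed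
qed

text \<open>A tensor is a functional on arbitrary functions of two variables, yet it sees only their
  values on V \<times> W. This permits pointwise rewriting of a form under a functional, which the
  nested evaluations of \<open>tensor_swap\<close> call for.\<close>

lemma tensor_form_cong:
  assumes t: "t \<in> tensor_space V W" and sub: "csubspace V" "csubspace W"
    and eq: "\<And>v w. v \<in> V \<Longrightarrow> w \<in> W \<Longrightarrow> F v w = F' v w"
  shows "t F = t F'"
proof -
  have "t \<in> {t. t F = t F'}"
  proof (rule tensor_space_image[where f = "\<lambda>t. t", OF clinear_on_id _ _ t])
    show "csubspace {t. t F = t F'}"
      by (rule complex_vector.subspaceI) auto
    have "bilinear_form_on V W F \<longleftrightarrow> bilinear_form_on V W F'"
      using sub by (simp add: bilinear_form_on_def clinear_on_def eq complex_vector.subspace_add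
          complex_vector.subspace_scale)
    then show "pure_tensor V W v w \<in> {t. t F = t F'}" if "v \<in> V" "w \<in> W" for v w
      using that by (simp add: pure_tensor_def eq)
  qed
  then show ?thesis by simp
qed

lemma tensor_form_linear:
  assumes t: "t \<in> tensor_space V W" and F: "bilinear_form_on V W F" and F': "bilinear_form_on V W F'"
  shows "t (\<lambda>v w. F v w + F' v w) = t F + t F'" "t (\<lambda>v w. c * F v w) = c * t F"
proof -
  have b: "bilinear_form_on V W (\<lambda>v w. F v w + F' v w)" "bilinear_form_on V W (\<lambda>v w. c * F v w)"
    using F F' by (simp_all add: bilinear_form_on_def clinear_on_def algebra_simps)
  have "t \<in> {t. t (\<lambda>v w. F v w + F' v w) = t F + t F' \<and> t (\<lambda>v w. c * F v w) = c * t F}"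
  proof (rule tensor_space_image[where f = "\<lambda>t. t", OF clinear_on_id _ _ t])
    show "csubspace {t. t (\<lambda>v w. F v w + F' v w) = t F + t F' \<and> t (\<lambda>v w. c * F v w) = c * t F}"
      by (rule complex_vector.subspaceI) (auto simp: algebra_simps)
  qed (use b F F' in \<open>auto simp: pure_tensor_def\<close>)
  then show "t (\<lambda>v w. F v w + F' v w) = t F + t F'" "t (\<lambda>v w. c * F v w) = c * t F" by simp_all
qed

text \<open>The interchange of W and X in (V \<otimes> W) \<otimes> (X \<otimes> Y). It is dual to
  the passage from \<gamma> to \<gamma>(v \<otimes> x, w \<otimes> y): for fixed v and w the
  functional b consumes x and y, and the result, a form in v and w, is consumed by a. No expression
  of t by pure tensors is chosen, so nothing has to be checked for well-definedness.\<close>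

definition tensor_swap ::
    "'v::complex_vector set \<Rightarrow> 'w::complex_vector set \<Rightarrow> 'x::complex_vector set \<Rightarrow> 'y::complex_vector set
     \<Rightarrow> (((('v \<Rightarrow> 'w \<Rightarrow> complex) \<Rightarrow> complex) \<Rightarrow> (('x \<Rightarrow> 'y \<Rightarrow> complex) \<Rightarrow> complex) \<Rightarrow> complex) \<Rightarrow> complex)
     \<Rightarrow> ((('v \<Rightarrow> 'x \<Rightarrow> complex) \<Rightarrow> complex) \<Rightarrow> (('w \<Rightarrow> 'y \<Rightarrow> complex) \<Rightarrow> complex) \<Rightarrow> complex) \<Rightarrow> complex"
  where "tensor_swap V W X Y t = (\<lambda>\<gamma>. if bilinear_form_on (tensor_space V X) (tensor_space W Y) \<gamma>
    then t (\<lambda>a b. a (\<lambda>v w. b (\<lambda>x y. \<gamma> (pure_tensor V X v x) (pure_tensor W Y w y)))) else 0)"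

lemma tensor_swap_linear: "clinear_on U (tensor_swap V W X Y)"
  by (auto intro!: clinear_onI simp: tensor_swap_def fun_eq_iff)

lemma pure_tensor_apply: "bilinear_form_on V W \<beta> \<Longrightarrow> pure_tensor V W v w \<beta> = \<beta> v w"
  by (simp add: pure_tensor_def)

text \<open>Pure tensors vanish on anything that is not bilinear, so the nested form must be
  bilinear at three levels: in (x, y) for fixed v and w (\<open>b1\<close>), in (v, w) after
  evaluation at an arbitrary tensor b (\<open>b2\<close>), and finally in (a, b).\<close>

lemma tensor_swap_pure:
  assumes sub: "csubspace V" "csubspace W" "csubspace X" "csubspace Y"
    and "v \<in> V" "w \<in> W" "x \<in> X" "y \<in> Y"
  shows "tensor_swap V W X Y (pure_tensor (tensor_space V W) (tensor_space X Y) (pure_tensor V W v w) (pure_tensor X Y x y))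
    = pure_tensor (tensor_space V X) (tensor_space W Y) (pure_tensor V X v x) (pure_tensor W Y w y)"
proof (rule ext)
  fix \<gamma>
  show "tensor_swap V W X Y (pure_tensor (tensor_space V W) (tensor_space X Y) (pure_tensor V W v w) (pure_tensor X Y x y)) \<gamma>
    = pure_tensor (tensor_space V X) (tensor_space W Y) (pure_tensor V X v x) (pure_tensor W Y w y) \<gamma>"
  proof (cases "bilinear_form_on (tensor_space V X) (tensor_space W Y) \<gamma>")
    case True
    note \<gamma> = bilinear_form_onD[OF True]
    have lin1: "clinear_on V (\<lambda>v. \<gamma> (pure_tensor V X v x) b)" if "x \<in> X" "b \<in> tensor_space W Y" for x b
      using clinear_on_compose[OF pure_tensor_linear(2)[of x X V] \<gamma>(2)[of b]] that by (auto simp: pure_tensor_in image_subset_iff)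
    have lin2: "clinear_on X (\<lambda>x. \<gamma> (pure_tensor V X v x) b)" if "v \<in> V" "b \<in> tensor_space W Y" for v b
      using clinear_on_compose[OF pure_tensor_linear(1)[of v V X] \<gamma>(2)[of b]] that by (auto simp: pure_tensor_in image_subset_iff)
    have lin3: "clinear_on W (\<lambda>w. \<gamma> a (pure_tensor W Y w y))" if "y \<in> Y" "a \<in> tensor_space V X" for y a
      using clinear_on_compose[OF pure_tensor_linear(2)[of y Y W] \<gamma>(1)[of a]] that by (auto simp: pure_tensor_in image_subset_iff)
    have lin4: "clinear_on Y (\<lambda>y. \<gamma> a (pure_tensor W Y w y))" if "w \<in> W" "a \<in> tensor_space V X" for w a
      using clinear_on_compose[OF pure_tensor_linear(1)[of w W Y] \<gamma>(1)[of a]] that by (auto simp: pure_tensor_in image_subset_iff)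
    have b1: "bilinear_form_on X Y (\<lambda>x y. \<gamma> (pure_tensor V X v x) (pure_tensor W Y w y))"
      if "v \<in> V" "w \<in> W" for v w
      using that by (auto simp: bilinear_form_on_def pure_tensor_in intro!: lin2 lin4)
    have b2: "bilinear_form_on V W (\<lambda>v w. b (\<lambda>x y. \<gamma> (pure_tensor V X v x) (pure_tensor W Y w y)))"
      if b: "b \<in> tensor_space X Y" for b
      unfolding bilinear_form_on_def
    proof (intro conjI ballI clinear_onI)
      fix v w w' assume "v \<in> V" "w \<in> W" "w' \<in> W"
      then show "b (\<lambda>x y. \<gamma> (pure_tensor V X v x) (pure_tensor W Y (w + w') y)) =
          b (\<lambda>x y. \<gamma> (pure_tensor V X v x) (pure_tensor W Y w y)) + b (\<lambda>x y. \<gamma> (pure_tensor V X v x) (pure_tensor W Y w' y))"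
        by (subst tensor_form_linear(1)[OF b b1 b1, symmetric])
          (auto intro!: tensor_form_cong[OF b sub(3,4)] clinear_on_add[OF lin3] pure_tensor_in)
    next
      fix v w c assume "v \<in> V" "w \<in> W"
      then show "b (\<lambda>x y. \<gamma> (pure_tensor V X v x) (pure_tensor W Y (c *\<^sub>C w) y)) =
          c *\<^sub>C b (\<lambda>x y. \<gamma> (pure_tensor V X v x) (pure_tensor W Y w y))"
        by (simp, subst tensor_form_linear(2)[OF b b1 b1, symmetric])
          (auto intro!: tensor_form_cong[OF b sub(3,4)] clinear_on_scale[OF lin3, simplified] pure_tensor_in)
    next
      fix w v v' assume "w \<in> W" "v \<in> V" "v' \<in> V"
      then show "b (\<lambda>x y. \<gamma> (pure_tensor V X (v + v') x) (pure_tensor W Y w y)) =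
          b (\<lambda>x y. \<gamma> (pure_tensor V X v x) (pure_tensor W Y w y)) + b (\<lambda>x y. \<gamma> (pure_tensor V X v' x) (pure_tensor W Y w y))"
        by (subst tensor_form_linear(1)[OF b b1 b1, symmetric])
          (auto intro!: tensor_form_cong[OF b sub(3,4)] clinear_on_add[OF lin1] pure_tensor_in)
    next
      fix w v c assume "w \<in> W" "v \<in> V"
      then show "b (\<lambda>x y. \<gamma> (pure_tensor V X (c *\<^sub>C v) x) (pure_tensor W Y w y)) =
          c *\<^sub>C b (\<lambda>x y. \<gamma> (pure_tensor V X v x) (pure_tensor W Y w y))"
        by (simp, subst tensor_form_linear(2)[OF b b1 b1, symmetric])
          (auto intro!: tensor_form_cong[OF b sub(3,4)] clinear_on_scale[OF lin1, simplified] pure_tensor_in)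
    qed
    have "bilinear_form_on (tensor_space V W) (tensor_space X Y)
        (\<lambda>a b. a (\<lambda>v w. b (\<lambda>x y. \<gamma> (pure_tensor V X v x) (pure_tensor W Y w y))))"
      unfolding bilinear_form_on_def
    proof (intro conjI ballI)
      fix a assume a: "a \<in> tensor_space V W"
      show "clinear_on (tensor_space X Y) (\<lambda>b. a (\<lambda>v w. b (\<lambda>x y. \<gamma> (pure_tensor V X v x) (pure_tensor W Y w y))))"
        using tensor_form_linear[OF a b2 b2] by (auto intro!: clinear_onI)
    next
      fix b
      show "clinear_on (tensor_space V W) (\<lambda>a. a (\<lambda>v w. b (\<lambda>x y. \<gamma> (pure_tensor V X v x) (pure_tensor W Y w y))))"
        by (auto intro!: clinear_onI)
    qed
    then show ?thesis
      using True assms b1 b2[OF pure_tensor_in[of x X y Y]] by (simp add: tensor_swap_def pure_tensor_apply)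
  qed (simp add: tensor_swap_def pure_tensor_def)
qed

lemma tensor4_eq:
  assumes f: "clinear_on (tensor_space (tensor_space V W) (tensor_space X Y)) f"
    and g: "clinear_on (tensor_space (tensor_space V W) (tensor_space X Y)) g"
    and eq: "\<And>v w x y. v \<in> V \<Longrightarrow> w \<in> W \<Longrightarrow> x \<in> X \<Longrightarrow> y \<in> Y \<Longrightarrow>
      f (pure_tensor (tensor_space V W) (tensor_space X Y) (pure_tensor V W v w) (pure_tensor X Y x y)) =
      g (pure_tensor (tensor_space V W) (tensor_space X Y) (pure_tensor V W v w) (pure_tensor X Y x y))"
    and t: "t \<in> tensor_space (tensor_space V W) (tensor_space X Y)"
  shows "f t = g t"
proof (rule tensor_space_eq[OF f g _ t])
  let ?p = "pure_tensor (tensor_space V W) (tensor_space X Y)"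
  have L1: "clinear_on (tensor_space V W) (\<lambda>a. h (?p a b))"
    if "clinear_on (tensor_space (tensor_space V W) (tensor_space X Y)) h" "b \<in> tensor_space X Y"
    for h :: "_ \<Rightarrow> 'f::complex_vector" and b
    using clinear_on_compose[OF pure_tensor_linear(2)[OF that(2), of "tensor_space V W"] that(1)] that(2)
    by (auto simp: pure_tensor_in image_subset_iff)
  have L2: "clinear_on (tensor_space X Y) (\<lambda>b. h (?p a b))"
    if "clinear_on (tensor_space (tensor_space V W) (tensor_space X Y)) h" "a \<in> tensor_space V W"
    for h :: "_ \<Rightarrow> 'f::complex_vector" and a
    using clinear_on_compose[OF pure_tensor_linear(1)[OF that(2), of "tensor_space X Y"] that(1)] that(2)
    by (auto simp: pure_tensor_in image_subset_iff)
  fix a b assume a: "a \<in> tensor_space V W" and b: "b \<in> tensor_space X Y"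
  show "f (?p a b) = g (?p a b)"
  proof (rule tensor_space_eq[OF L1[OF f b] L1[OF g b] _ a])
    fix v w assume vw: "v \<in> V" "w \<in> W"
    show "f (?p (pure_tensor V W v w) b) = g (?p (pure_tensor V W v w) b)"
      by (rule tensor_space_eq[OF L2[OF f] L2[OF g] _ b]) (use vw in \<open>auto intro: pure_tensor_in eq\<close>)
  qed
qed

lemma tensor_swap_in:
  assumes sub: "csubspace V" "csubspace W" "csubspace X" "csubspace Y"
    and t: "t \<in> tensor_space (tensor_space V W) (tensor_space X Y)"
  shows "tensor_swap V W X Y t \<in> tensor_space (tensor_space V X) (tensor_space W Y)"
proof (rule tensor_space_image[OF tensor_swap_linear subspace_tensor_space _ t])
  let ?p = "pure_tensor (tensor_space V W) (tensor_space X Y)"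
  let ?T = "tensor_space (tensor_space V X) (tensor_space W Y)"
  note T = subspace_tensor_space[of "tensor_space V X" "tensor_space W Y"]
  have L1: "clinear_on (tensor_space V W) (\<lambda>a. tensor_swap V W X Y (?p a b))" if "b \<in> tensor_space X Y" for b
    using clinear_on_compose[OF pure_tensor_linear(2)[OF that] tensor_swap_linear[of UNIV]] by auto
  have L2: "clinear_on (tensor_space X Y) (\<lambda>b. tensor_swap V W X Y (?p a b))" if "a \<in> tensor_space V W" for a
    using clinear_on_compose[OF pure_tensor_linear(1)[OF that] tensor_swap_linear[of UNIV]] by auto
  fix a b assume a: "a \<in> tensor_space V W" and b: "b \<in> tensor_space X Y"
  show "tensor_swap V W X Y (?p a b) \<in> ?T"
  proof (rule tensor_space_image[OF L1[OF b] T _ a])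
    fix v w assume vw: "v \<in> V" "w \<in> W"
    show "tensor_swap V W X Y (?p (pure_tensor V W v w) b) \<in> ?T"
      by (rule tensor_space_image[OF L2 T _ b]) (use vw sub in \<open>auto simp: tensor_swap_pure intro!: pure_tensor_in\<close>)
  qed
qed

lemma tensor_swap_swap:
  assumes sub: "csubspace V" "csubspace W" "csubspace X" "csubspace Y"
    and t: "t \<in> tensor_space (tensor_space V W) (tensor_space X Y)"
  shows "tensor_swap V X W Y (tensor_swap V W X Y t) = t"
proof (rule tensor4_eq[OF _ clinear_on_id _ t])
  show "clinear_on (tensor_space (tensor_space V W) (tensor_space X Y)) (\<lambda>t. tensor_swap V X W Y (tensor_swap V W X Y t))"
    by (rule clinear_on_compose[where f = "tensor_swap V W X Y" and W = UNIV]) (auto intro: tensor_swap_linear)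
qed (simp add: tensor_swap_pure sub)

definition pullback :: "('h \<Rightarrow> 'g) \<Rightarrow> ('g, 'v) rep \<Rightarrow> ('h, 'v) rep"
  where "pullback \<theta> R = \<lparr>rspace = rspace R, ract = (\<lambda>h. ract R (\<theta> h))\<rparr>"

lemma pullback_simps [simp]: "rspace (pullback \<theta> R) = rspace R" "ract (pullback \<theta> R) h = ract R (\<theta> h)"
  by (simp_all add: pullback_def)

lemma linear_rep_pullback: "group_hom H G \<theta> \<Longrightarrow> linear_rep G R \<Longrightarrow> linear_rep H (pullback \<theta> R)"
  by (simp add: linear_rep_def group_hom.hom_one group_hom.hom_mult group_hom.hom_closed)

text \<open>The interchange of tensor factors also permutes the factors of the acting group;
  \<open>pullback\<close> brings the right-hand side back to the group on the left.\<close>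

lemma rep_iso_box_swap:
  assumes R: "linear_rep G1 R1" "group G1" "linear_rep G2 R2" "group G2"
    "linear_rep G3 R3" "group G3" "linear_rep G4 R4" "group G4"
  shows "rep_iso ((G1 \<times>\<times> G2) \<times>\<times> (G3 \<times>\<times> G4)) ((R1 \<boxtimes> R2) \<boxtimes> (R3 \<boxtimes> R4))
    (pullback (\<lambda>((a, b), (c, d)). ((a, c), (b, d))) ((R1 \<boxtimes> R3) \<boxtimes> (R2 \<boxtimes> R4)))"
    (is "rep_iso ?G ?R (pullback ?\<theta> ?S)")
proof (rule rep_isoI)
  note sub = linear_rep_subspace[OF R(1)] linear_rep_subspace[OF R(3)]
    linear_rep_subspace[OF R(5)] linear_rep_subspace[OF R(7)]
  let ?s = "tensor_swap (rspace R1) (rspace R2) (rspace R3) (rspace R4)"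
  note box = linear_rep_box[OF R(1,2) R(3,4)] linear_rep_box[OF R(5,6) R(7,8)]
    linear_rep_box[OF R(1,2) R(5,6)] linear_rep_box[OF R(3,4) R(7,8)]
  note grp = DirProd_group[OF R(2,4)] DirProd_group[OF R(6,8)] DirProd_group[OF R(2,6)] DirProd_group[OF R(4,8)]
  show "intertwiner ?G ?R (pullback ?\<theta> ?S) ?s"
  proof (rule intertwinerI)
    fix x t assume x: "x \<in> carrier ?G" and t: "t \<in> rspace ?R"
    obtain a b c d where [simp]: "x = ((a, b), (c, d))"
      by (metis surj_pair)
    have m: "a \<in> carrier G1" "b \<in> carrier G2" "c \<in> carrier G3" "d \<in> carrier G4"
      using x by auto
    have m': "(a, b) \<in> carrier (G1 \<times>\<times> G2)" "(c, d) \<in> carrier (G3 \<times>\<times> G4)"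
      "(a, c) \<in> carrier (G1 \<times>\<times> G3)" "(b, d) \<in> carrier (G2 \<times>\<times> G4)"
      using m by auto
    show "?s (ract ?R x t) = ract (pullback ?\<theta> ?S) x (?s t)"
    proof (rule tensor4_eq[OF _ _ _ t[unfolded rspace_box]])
      show "clinear_on (tensor_space (tensor_space (rspace R1) (rspace R2)) (tensor_space (rspace R3) (rspace R4)))
          (\<lambda>t. ?s (ract ?R x t))"
        by (rule clinear_on_compose[where f = "ract ?R x" and W = UNIV]) (auto intro: tensor_swap_linear box_action_linear)
      show "clinear_on (tensor_space (tensor_space (rspace R1) (rspace R2)) (tensor_space (rspace R3) (rspace R4)))
          (\<lambda>t. ract (pullback ?\<theta> ?S) x (?s t))"
        by (rule clinear_on_compose[where f = "?s" and W = UNIV]) (auto intro: tensor_swap_linear box_action_linear)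
      fix v w y z assume vs: "v \<in> rspace R1" "w \<in> rspace R2" "y \<in> rspace R3" "z \<in> rspace R4"
      have gv: "ract R1 a v \<in> rspace R1" "ract R2 b w \<in> rspace R2" "ract R3 c y \<in> rspace R3" "ract R4 d z \<in> rspace R4"
        using vs m by (auto intro: linear_rep_closed[OF R(1)] linear_rep_closed[OF R(3)]
            linear_rep_closed[OF R(5)] linear_rep_closed[OF R(7)])
      show "?s (ract ?R x (pure_tensor (tensor_space (rspace R1) (rspace R2)) (tensor_space (rspace R3) (rspace R4))
            (pure_tensor (rspace R1) (rspace R2) v w) (pure_tensor (rspace R3) (rspace R4) y z))) =
          ract (pullback ?\<theta> ?S) x (?s (pure_tensor (tensor_space (rspace R1) (rspace R2)) (tensor_space (rspace R3) (rspace R4))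
            (pure_tensor (rspace R1) (rspace R2) v w) (pure_tensor (rspace R3) (rspace R4) y z)))"
        using box_action_pure[OF box(1) grp(1) m'(1) box(2) grp(2) m'(2),
            of "pure_tensor (rspace R1) (rspace R2) v w" "pure_tensor (rspace R3) (rspace R4) y z"]
          box_action_pure[OF box(3) grp(3) m'(3) box(4) grp(4) m'(4),
            of "pure_tensor (rspace R1) (rspace R3) v y" "pure_tensor (rspace R2) (rspace R4) w z"]
        by (simp add: pure_tensor_in vs gv tensor_swap_pure sub
            box_action_pure[OF R(1,2) m(1) R(3,4) m(2)] box_action_pure[OF R(5,6) m(3) R(7,8) m(4)]
            box_action_pure[OF R(1,2) m(1) R(5,6) m(3)] box_action_pure[OF R(3,4) m(2) R(7,8) m(4)])
    qed
  qed (auto intro: tensor_swap_linear tensor_swap_in sub)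
  show "tensor_swap (rspace R1) (rspace R3) (rspace R2) (rspace R4) t \<in> rspace ?R" if "t \<in> rspace (pullback ?\<theta> ?S)" for t
    using that by (simp add: tensor_swap_in sub)
  show "tensor_swap (rspace R1) (rspace R3) (rspace R2) (rspace R4) (?s t) = t" if "t \<in> rspace ?R" for t
    using that by (simp add: tensor_swap_swap sub)
  show "?s (tensor_swap (rspace R1) (rspace R3) (rspace R2) (rspace R4) t) = t"
    if "t \<in> rspace (pullback ?\<theta> ?S)" for t
    using that by (simp add: tensor_swap_swap sub)
qed

section \<open>Induced representations\<close>

lemma induced_iff:
  "u \<in> rspace (induced G H \<iota> R) \<longleftrightarrow> (\<forall>x\<in>carrier G. u x \<in> rspace R) \<and> (\<forall>x. x \<notin> carrier G \<longrightarrow> u x = 0) \<and>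
     (\<forall>x\<in>carrier G. \<forall>h\<in>carrier H. u (x \<otimes>\<^bsub>G\<^esub> \<iota> h) = ract R (inv\<^bsub>H\<^esub> h) (u x))"
  by (simp add: induced_def)

lemma inducedI:
  assumes "\<And>x. x \<in> carrier G \<Longrightarrow> u x \<in> rspace R" "\<And>x. x \<notin> carrier G \<Longrightarrow> u x = 0"
    and "\<And>x h. x \<in> carrier G \<Longrightarrow> h \<in> carrier H \<Longrightarrow> u (x \<otimes>\<^bsub>G\<^esub> \<iota> h) = ract R (inv\<^bsub>H\<^esub> h) (u x)"
  shows "u \<in> rspace (induced G H \<iota> R)"
  using assms by (simp add: induced_iff)

lemma inducedD:
  assumes "u \<in> rspace (induced G H \<iota> R)"
  shows "x \<in> carrier G \<Longrightarrow> u x \<in> rspace R" "x \<notin> carrier G \<Longrightarrow> u x = 0"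
    and "x \<in> carrier G \<Longrightarrow> h \<in> carrier H \<Longrightarrow> u (x \<otimes>\<^bsub>G\<^esub> \<iota> h) = ract R (inv\<^bsub>H\<^esub> h) (u x)"
  using assms by (simp_all add: induced_iff)

lemma induced_action:
  "ract (induced G H \<iota> R) g u x = (if x \<in> carrier G then u (inv\<^bsub>G\<^esub> g \<otimes>\<^bsub>G\<^esub> x) else 0)"
  by (simp add: induced_def)

lemma induced_eqI:
  assumes "u \<in> rspace (induced G H \<iota> R)" "u' \<in> rspace (induced G H \<iota> R)"
    and "\<And>x. x \<in> carrier G \<Longrightarrow> u x = u' x"
  shows "u = u'"
proof
  fix x show "u x = u' x"
    using assms by (cases "x \<in> carrier G") (simp_all add: inducedD)
qed

lemma linear_rep_induced:
  assumes hom: "group_hom H G \<iota>" and R: "linear_rep H R"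
  shows "linear_rep G (induced G H \<iota> R)"
proof -
  interpret G: group G by (rule group_hom.axioms(2)[OF hom])
  interpret H: group H by (rule group_hom.axioms(1)[OF hom])
  interpret hom: group_hom H G \<iota> by (rule hom)
  have sub: "csubspace (rspace R)"
    by (rule linear_rep_subspace[OF R])
  note lin = linear_rep_linear[OF R H.inv_closed]
  have subs: "csubspace (rspace (induced G H \<iota> R))"
  proof (rule complex_vector.subspaceI)
    show "0 \<in> rspace (induced G H \<iota> R)"
      using complex_vector.subspace_0[OF sub] clinear_on_0[OF lin sub] by (auto intro!: inducedI)
  next
    fix u v assume "u \<in> rspace (induced G H \<iota> R)" "v \<in> rspace (induced G H \<iota> R)"
    then show "u + v \<in> rspace (induced G H \<iota> R)"
      by (auto intro!: inducedI simp: inducedD complex_vector.subspace_add[OF sub] clinear_on_add[OF lin])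
  next
    fix c u assume "u \<in> rspace (induced G H \<iota> R)"
    then show "c *\<^sub>C u \<in> rspace (induced G H \<iota> R)"
      by (auto intro!: inducedI simp: inducedD complex_vector.subspace_scale[OF sub] clinear_on_scale[OF lin])
  qed
  have cl: "ract (induced G H \<iota> R) g u \<in> rspace (induced G H \<iota> R)"
    if "g \<in> carrier G" "u \<in> rspace (induced G H \<iota> R)" for g u
  proof (rule inducedI)
    fix x h assume "x \<in> carrier G" "h \<in> carrier H"
    then show "ract (induced G H \<iota> R) g u (x \<otimes>\<^bsub>G\<^esub> \<iota> h) = ract R (inv\<^bsub>H\<^esub> h) (ract (induced G H \<iota> R) g u x)"
      using that inducedD(3)[OF that(2), of "inv\<^bsub>G\<^esub> g \<otimes>\<^bsub>G\<^esub> x" h]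
      by (simp add: induced_action G.m_assoc)
  qed (use that in \<open>auto simp: induced_action inducedD\<close>)
  have one: "ract (induced G H \<iota> R) \<one>\<^bsub>G\<^esub> u = u" if "u \<in> rspace (induced G H \<iota> R)" for u
    by (rule induced_eqI[OF cl that]) (use that in \<open>auto simp: induced_action\<close>)
  have mult: "ract (induced G H \<iota> R) (g \<otimes>\<^bsub>G\<^esub> g') u = ract (induced G H \<iota> R) g (ract (induced G H \<iota> R) g' u)"
    if "g \<in> carrier G" "g' \<in> carrier G" "u \<in> rspace (induced G H \<iota> R)" for g g' u
    by (rule induced_eqI[OF cl cl]) (use that in \<open>auto simp: induced_action G.inv_mult_group G.m_assoc intro!: cl\<close>)
  show ?thesis
    unfolding linear_rep_def
    using subs cl one mult by (auto intro!: clinear_onI simp: induced_action fun_eq_iff)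
qed

lemma intertwiner_induced:
  assumes hom: "group_hom H G \<iota>" and R: "linear_rep H R" and \<phi>: "intertwiner H R S \<phi>"
  shows "intertwiner G (induced G H \<iota> R) (induced G H \<iota> S) (\<lambda>u x. \<phi> (u x))"
proof -
  interpret G: group G by (rule group_hom.axioms(2)[OF hom])
  interpret H: group H by (rule group_hom.axioms(1)[OF hom])
  interpret hom: group_hom H G \<iota> by (rule hom)
  note \<phi>' = intertwinerD[OF \<phi>]
  have 0: "\<phi> 0 = 0"
    using clinear_on_0[OF \<phi>'(1) linear_rep_subspace[OF R]] .
  show ?thesis
  proof (rule intertwinerI)
    show "clinear_on (rspace (induced G H \<iota> R)) (\<lambda>u x. \<phi> (u x))"
    proof (rule clinear_onI; rule ext)
      fix u v x assume "u \<in> rspace (induced G H \<iota> R)" "v \<in> rspace (induced G H \<iota> R)"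
      then show "\<phi> ((u + v) x) = ((\<lambda>x. \<phi> (u x)) + (\<lambda>x. \<phi> (v x))) x"
        by (cases "x \<in> carrier G") (simp_all add: inducedD clinear_on_add[OF \<phi>'(1)] 0)
    next
      fix c u x assume "u \<in> rspace (induced G H \<iota> R)"
      then show "\<phi> ((c *\<^sub>C u) x) = (c *\<^sub>C (\<lambda>x. \<phi> (u x))) x"
        by (cases "x \<in> carrier G") (simp_all add: inducedD clinear_on_scale[OF \<phi>'(1)] 0)
    qed
  qed (auto intro!: inducedI simp: inducedD \<phi>' 0 induced_action fun_eq_iff)
qed

lemma rep_iso_induced:
  assumes hom: "group_hom H G \<iota>" and R: "linear_rep H R" and S: "linear_rep H S" and iso: "rep_iso H R S"
  shows "rep_iso G (induced G H \<iota> R) (induced G H \<iota> S)"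
proof -
  obtain \<phi> \<psi> where \<phi>: "intertwiner H R S \<phi>" "intertwiner H S R \<psi>"
    "\<And>v. v \<in> rspace R \<Longrightarrow> \<psi> (\<phi> v) = v" "\<And>w. w \<in> rspace S \<Longrightarrow> \<phi> (\<psi> w) = w"
    using rep_isoE[OF iso R] by metis
  note I = intertwiner_induced[OF hom R \<phi>(1)] intertwiner_induced[OF hom S \<phi>(2)]
  show ?thesis
    by (rule rep_isoI[where \<phi> = "\<lambda>u x. \<phi> (u x)" and \<psi> = "\<lambda>u x. \<psi> (u x)"])
      (auto simp: I intro!: induced_eqI[of _ G H \<iota>] dest: intertwinerD(2)[OF I(1)] intertwinerD(2)[OF I(2)]
        simp: \<phi>(3,4) inducedD)
qed

text \<open>Currying: equivariance along \<kappa> makes U x k equal to the value of U (x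
  \<kappa>(k)) at the identity of K, so U is recovered from the function x \<mapsto> U x 1.\<close>

lemma induced_transitive:
  assumes hom: "group_hom H K \<iota>" "group_hom K G \<kappa>" and R: "linear_rep H R"
  shows "rep_iso G (induced G K \<kappa> (induced K H \<iota> R)) (induced G H (\<lambda>h. \<kappa> (\<iota> h)) R)"
proof -
  interpret i: group_hom H K \<iota> by fact
  interpret k: group_hom K G \<kappa> by fact
  have ki: "group_hom H G (\<lambda>h. \<kappa> (\<iota> h))"
    by unfold_locales (auto intro!: homI)
  let ?b = "\<lambda>u x k. if x \<in> carrier G \<and> k \<in> carrier K then u (x \<otimes>\<^bsub>G\<^esub> \<kappa> k) else 0"
  have b: "?b u \<in> rspace (induced G K \<kappa> (induced K H \<iota> R))"
    if "u \<in> rspace (induced G H (\<lambda>h. \<kappa> (\<iota> h)) R)" for u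
    using that inducedD(3)[OF that, of "_ \<otimes>\<^bsub>G\<^esub> \<kappa> _"]
    by (auto intro!: inducedI simp: inducedD induced_action fun_eq_iff k.H.m_assoc[symmetric])
  have f: "(\<lambda>x. U x \<one>\<^bsub>K\<^esub>) \<in> rspace (induced G H (\<lambda>h. \<kappa> (\<iota> h)) R)"
    if U: "U \<in> rspace (induced G K \<kappa> (induced K H \<iota> R))" for U
  proof (rule inducedI)
    fix x h assume "x \<in> carrier G" "h \<in> carrier H"
    then show "U (x \<otimes>\<^bsub>G\<^esub> \<kappa> (\<iota> h)) \<one>\<^bsub>K\<^esub> = ract R (inv\<^bsub>H\<^esub> h) (U x \<one>\<^bsub>K\<^esub>)"
      using inducedD(3)[OF U, of x "\<iota> h"] inducedD(3)[OF inducedD(1)[OF U, of x], of "\<one>\<^bsub>K\<^esub>" h]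
      by (simp add: induced_action)
  qed (use inducedD[OF U] in \<open>auto dest: inducedD(1)\<close>)
  show ?thesis
  proof (rule rep_isoI[where \<phi> = "\<lambda>U x. U x \<one>\<^bsub>K\<^esub>" and \<psi> = ?b])
    show "intertwiner G (induced G K \<kappa> (induced K H \<iota> R)) (induced G H (\<lambda>h. \<kappa> (\<iota> h)) R) (\<lambda>U x. U x \<one>\<^bsub>K\<^esub>)"
      by (rule intertwinerI) (auto intro!: clinear_onI f simp: fun_eq_iff induced_action)
    fix U assume U: "U \<in> rspace (induced G K \<kappa> (induced K H \<iota> R))"
    have "U (x \<otimes>\<^bsub>G\<^esub> \<kappa> k) \<one>\<^bsub>K\<^esub> = U x k" if "x \<in> carrier G" "k \<in> carrier K" for x k
      using that inducedD(3)[OF U that] by (simp add: induced_action)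
    moreover have "U x k = 0" if "x \<notin> carrier G \<or> k \<notin> carrier K" for x k
      using that inducedD(1,2)[OF U, of x] inducedD(2)[of "U x" K H \<iota> R k] by (cases "x \<in> carrier G") auto
    ultimately show "?b (\<lambda>x. U x \<one>\<^bsub>K\<^esub>) = U"
      by (auto simp: fun_eq_iff)
  next
    fix u assume "u \<in> rspace (induced G H (\<lambda>h. \<kappa> (\<iota> h)) R)"
    then show "(\<lambda>x. ?b u x \<one>\<^bsub>K\<^esub>) = u"
      by (auto simp: fun_eq_iff inducedD)
  qed (rule b)
qed

text \<open>Right translation by c commutes with the left translation by which G acts, and the
  relation c \<iota>'(\<theta> h) = \<iota>(h) c converts equivariance along \<iota>' into
  equivariance along \<iota>. Conjugate subgroups therefore induce the same representation.\<close>

lemma induced_conjugate: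
  assumes hom: "group_hom H G \<iota>" "group_hom H' G \<iota>'" "group_hom H H' \<theta>"
    and surj: "\<theta> ` carrier H = carrier H'" and c: "c \<in> carrier G"
    and conj: "\<And>h. h \<in> carrier H \<Longrightarrow> c \<otimes>\<^bsub>G\<^esub> \<iota>' (\<theta> h) = \<iota> h \<otimes>\<^bsub>G\<^esub> c"
    and R: "linear_rep H' R"
  shows "rep_iso G (induced G H' \<iota>' R) (induced G H \<iota> (pullback \<theta> R))"
proof -
  interpret i: group_hom H G \<iota> by fact
  interpret i': group_hom H' G \<iota>' by fact
  interpret t: group_hom H H' \<theta> by fact
  let ?f = "\<lambda>c u x. if x \<in> carrier G then u (x \<otimes>\<^bsub>G\<^esub> c) else 0"
  have f: "?f c u \<in> rspace (induced G H \<iota> (pullback \<theta> R))" if "u \<in> rspace (induced G H' \<iota>' R)" for u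
  proof (rule inducedI)
    fix x h assume x: "x \<in> carrier G" and h: "h \<in> carrier H"
    have "x \<otimes>\<^bsub>G\<^esub> \<iota> h \<otimes>\<^bsub>G\<^esub> c = (x \<otimes>\<^bsub>G\<^esub> c) \<otimes>\<^bsub>G\<^esub> \<iota>' (\<theta> h)"
      using x h c by (simp add: i.H.m_assoc conj)
    then show "?f c u (x \<otimes>\<^bsub>G\<^esub> \<iota> h) = ract (pullback \<theta> R) (inv\<^bsub>H\<^esub> h) (?f c u x)"
      using x h c inducedD(3)[OF that, of "x \<otimes>\<^bsub>G\<^esub> c" "\<theta> h"] by simp
  qed (use that c in \<open>auto simp: inducedD\<close>)
  have b: "?f (inv\<^bsub>G\<^esub> c) u \<in> rspace (induced G H' \<iota>' R)" if "u \<in> rspace (induced G H \<iota> (pullback \<theta> R))" for u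
  proof (rule inducedI)
    fix x h' assume x: "x \<in> carrier G" and "h' \<in> carrier H'"
    then obtain h where h: "h \<in> carrier H" "h' = \<theta> h"
      using surj by auto
    have "\<iota>' (\<theta> h) = inv\<^bsub>G\<^esub> c \<otimes>\<^bsub>G\<^esub> (\<iota> h \<otimes>\<^bsub>G\<^esub> c)"
      using h c conj[OF h(1)] i.H.inv_solve_left[of "\<iota>' (\<theta> h)" c "\<iota> h \<otimes>\<^bsub>G\<^esub> c"] by simp
    then have "\<iota>' (\<theta> h) \<otimes>\<^bsub>G\<^esub> inv\<^bsub>G\<^esub> c = inv\<^bsub>G\<^esub> c \<otimes>\<^bsub>G\<^esub> \<iota> h"
      using h c by (simp add: i.H.m_assoc)
    then have "x \<otimes>\<^bsub>G\<^esub> \<iota>' (\<theta> h) \<otimes>\<^bsub>G\<^esub> inv\<^bsub>G\<^esub> c = (x \<otimes>\<^bsub>G\<^esub> inv\<^bsub>G\<^esub> c) \<otimes>\<^bsub>G\<^esub> \<iota> h"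
      using x h c by (simp add: i.H.m_assoc)
    then show "?f (inv\<^bsub>G\<^esub> c) u (x \<otimes>\<^bsub>G\<^esub> \<iota>' h') = ract R (inv\<^bsub>H'\<^esub> h') (?f (inv\<^bsub>G\<^esub> c) u x)"
      using x h c inducedD(3)[OF that, of "x \<otimes>\<^bsub>G\<^esub> inv\<^bsub>G\<^esub> c" "h"] by simp
  qed (use that c inducedD(1)[OF that] in \<open>auto simp: inducedD(2)\<close>)
  show ?thesis
  proof (rule rep_isoI[where \<phi> = "?f c" and \<psi> = "?f (inv\<^bsub>G\<^esub> c)"])
    show "intertwiner G (induced G H' \<iota>' R) (induced G H \<iota> (pullback \<theta> R)) (?f c)"
      by (rule intertwinerI) (use c in \<open>auto intro!: clinear_onI f simp: fun_eq_iff induced_action i.H.m_assoc\<close>)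
  qed (use b c in \<open>auto simp: fun_eq_iff inducedD i.H.m_assoc\<close>)
qed

text \<open>An equivariant function is determined by its value v at the identity, being x \<mapsto>
  x^-1 v. The applications take for \<iota> an identity map and the map from S_a \<times> S_0 onto
  S_a.\<close>

lemma induced_surjective:
  assumes hom: "group_hom H G \<iota>" and surj: "\<iota> ` carrier H = carrier G" and R: "linear_rep G R"
  shows "rep_iso G R (induced G H \<iota> (pullback \<iota> R))"
proof -
  interpret G: group G by (rule group_hom.axioms(2)[OF hom])
  interpret H: group H by (rule group_hom.axioms(1)[OF hom])
  interpret hom: group_hom H G \<iota> by (rule hom)
  let ?f = "\<lambda>v x. if x \<in> carrier G then ract R (inv\<^bsub>G\<^esub> x) v else 0"
  have mult: "ract R (inv\<^bsub>G\<^esub> (x \<otimes>\<^bsub>G\<^esub> y)) v = ract R (inv\<^bsub>G\<^esub> y) (ract R (inv\<^bsub>G\<^esub> x) v)"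
    if "x \<in> carrier G" "y \<in> carrier G" "v \<in> rspace R" for x y v
    using that by (simp add: G.inv_mult_group linear_rep_mult[OF R])
  have eq: "u y = ract R (inv\<^bsub>G\<^esub> y) (u \<one>\<^bsub>G\<^esub>)" if "u \<in> rspace (induced G H \<iota> (pullback \<iota> R))" "y \<in> carrier G" for u y
  proof -
    obtain h where "h \<in> carrier H" "y = \<iota> h" using surj \<open>y \<in> carrier G\<close> by auto
    then show ?thesis
      using inducedD(3)[OF that(1), of "\<one>\<^bsub>G\<^esub>" h] by simp
  qed
  have f: "?f v \<in> rspace (induced G H \<iota> (pullback \<iota> R))" if "v \<in> rspace R" for v
    using that by (auto intro!: inducedI simp: mult linear_rep_closed[OF R])
  show ?thesis
  proof (rule rep_isoI[where \<phi> = ?f and \<psi> = "\<lambda>u. u \<one>\<^bsub>G\<^esub>"])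
    show "intertwiner G R (induced G H \<iota> (pullback \<iota> R)) ?f"
    proof (rule intertwinerI)
      show "clinear_on (rspace R) ?f"
        by (auto intro!: clinear_onI simp: fun_eq_iff clinear_on_add[OF linear_rep_linear[OF R]]
            clinear_on_scale[OF linear_rep_linear[OF R]])
      fix g v assume "g \<in> carrier G" "v \<in> rspace R"
      then show "?f (ract R g v) = ract (induced G H \<iota> (pullback \<iota> R)) g (?f v)"
        using mult[of "inv\<^bsub>G\<^esub> g" _ v] by (auto simp: fun_eq_iff induced_action)
    qed (rule f)
    show "?f (u \<one>\<^bsub>G\<^esub>) = u" if u: "u \<in> rspace (induced G H \<iota> (pullback \<iota> R))" for u
      by (rule induced_eqI[OF f u]) (use inducedD(1)[OF u] eq[OF u, symmetric] in auto)
  qed (auto simp: linear_rep_one[OF R] dest: inducedD(1))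
qed

text \<open>The generator x \<otimes> w in the group algebra model of the induced representation:
  for injective \<iota> it is the function supported on the coset of x with value w at x. Writing it
  as a sum over H avoids coset representatives.\<close>

definition bracket ::
    "('g, 'a) monoid_scheme \<Rightarrow> ('h, 'b) monoid_scheme \<Rightarrow> ('h \<Rightarrow> 'g) \<Rightarrow> ('h, 'v::complex_vector) rep
      \<Rightarrow> 'g \<Rightarrow> 'v \<Rightarrow> 'g \<Rightarrow> 'v"
  where "bracket G H \<iota> R x w = (\<lambda>y. \<Sum>h\<in>carrier H. if y = x \<otimes>\<^bsub>G\<^esub> \<iota> h then ract R (inv\<^bsub>H\<^esub> h) w else 0)"

lemma bracket_linear:
  assumes "group H" "linear_rep H R"
  shows "clinear_on (rspace R) (bracket G H \<iota> R x)"
proof -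
  have "clinear_on (rspace R) (\<lambda>w. bracket G H \<iota> R x w y)" for y
    unfolding bracket_def
  proof (rule clinear_on_sum_fun)
    fix h assume "h \<in> carrier H"
    then show "clinear_on (rspace R) (\<lambda>w. if y = x \<otimes>\<^bsub>G\<^esub> \<iota> h then ract R (inv\<^bsub>H\<^esub> h) w else 0)"
      using linear_rep_linear[OF assms(2) group.inv_closed[OF assms(1)]]
      by (cases "y = x \<otimes>\<^bsub>G\<^esub> \<iota> h") (simp_all add: clinear_on_def)
  qed
  then show ?thesis
    by (simp add: clinear_on_def fun_eq_iff)
qed

lemma bracket_in:
  assumes hom: "group_hom H G \<iota>" and R: "linear_rep H R" and x: "x \<in> carrier G" and w: "w \<in> rspace R"
  shows "bracket G H \<iota> R x w \<in> rspace (induced G H \<iota> R)"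
proof (rule inducedI)
  interpret G: group G by (rule group_hom.axioms(2)[OF hom])
  interpret H: group H by (rule group_hom.axioms(1)[OF hom])
  interpret hom: group_hom H G \<iota> by (rule hom)
  note sub = linear_rep_subspace[OF R]
  show "bracket G H \<iota> R x w y \<in> rspace R" for y
    unfolding bracket_def
    by (intro complex_vector.subspace_sum[OF sub])
      (use w in \<open>auto intro: linear_rep_closed[OF R] complex_vector.subspace_0[OF sub]\<close>)
  show "bracket G H \<iota> R x w y = 0" if "y \<notin> carrier G" for y
    unfolding bracket_def by (intro sum.neutral) (use that x in auto)
  fix y k assume y: "y \<in> carrier G" and k: "k \<in> carrier H"
  have "bracket G H \<iota> R x w (y \<otimes>\<^bsub>G\<^esub> \<iota> k) =
      (\<Sum>h\<in>carrier H. if y \<otimes>\<^bsub>G\<^esub> \<iota> k = x \<otimes>\<^bsub>G\<^esub> \<iota> (h \<otimes>\<^bsub>H\<^esub> k) then ract R (inv\<^bsub>H\<^esub> (h \<otimes>\<^bsub>H\<^esub> k)) w else 0)"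
    unfolding bracket_def
    by (rule sum.reindex_bij_witness[where j = "\<lambda>h. h \<otimes>\<^bsub>H\<^esub> inv\<^bsub>H\<^esub> k" and i = "\<lambda>h. h \<otimes>\<^bsub>H\<^esub> k"])
      (use k in \<open>auto simp: H.m_assoc\<close>)
  also have "\<dots> = (\<Sum>h\<in>carrier H. ract R (inv\<^bsub>H\<^esub> k) (if y = x \<otimes>\<^bsub>G\<^esub> \<iota> h then ract R (inv\<^bsub>H\<^esub> h) w else 0))"
  proof (rule sum.cong[OF refl])
    fix h assume h: "h \<in> carrier H"
    have "y \<otimes>\<^bsub>G\<^esub> \<iota> k = x \<otimes>\<^bsub>G\<^esub> \<iota> (h \<otimes>\<^bsub>H\<^esub> k) \<longleftrightarrow> y = x \<otimes>\<^bsub>G\<^esub> \<iota> h"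
      using x y h k by (simp add: G.m_assoc[symmetric] G.right_cancel)
    then show "(if y \<otimes>\<^bsub>G\<^esub> \<iota> k = x \<otimes>\<^bsub>G\<^esub> \<iota> (h \<otimes>\<^bsub>H\<^esub> k) then ract R (inv\<^bsub>H\<^esub> (h \<otimes>\<^bsub>H\<^esub> k)) w else 0) =
        ract R (inv\<^bsub>H\<^esub> k) (if y = x \<otimes>\<^bsub>G\<^esub> \<iota> h then ract R (inv\<^bsub>H\<^esub> h) w else 0)"
      using h k w by (simp add: H.inv_mult_group linear_rep_mult[OF R]
          clinear_on_0[OF linear_rep_linear[OF R] sub])
  qed
  also have "\<dots> = ract R (inv\<^bsub>H\<^esub> k) (bracket G H \<iota> R x w y)"
    unfolding bracket_def
    by (rule clinear_on_sum[OF linear_rep_linear[OF R] sub, symmetric])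
      (use k w in \<open>auto intro: linear_rep_closed[OF R] complex_vector.subspace_0[OF sub]\<close>)
  finally show "bracket G H \<iota> R x w (y \<otimes>\<^bsub>G\<^esub> \<iota> k) = ract R (inv\<^bsub>H\<^esub> k) (bracket G H \<iota> R x w y)" .
qed

text \<open>At a point y each h selects exactly one x, namely y \<iota>(h)^-1, and equivariance
  turns its contribution into u(y). Every h counts once, whence the factor |H|; dividing by it
  expands u in brackets.\<close>

lemma sum_bracket:
  assumes hom: "group_hom H G \<iota>" and R: "linear_rep H R" and fin: "finite (carrier G)"
    and u: "u \<in> rspace (induced G H \<iota> R)"
  shows "(\<Sum>x\<in>carrier G. bracket G H \<iota> R x (u x)) = of_nat (card (carrier H)) *\<^sub>C u"
proof
  interpret G: group G by (rule group_hom.axioms(2)[OF hom])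
  interpret H: group H by (rule group_hom.axioms(1)[OF hom])
  interpret hom: group_hom H G \<iota> by (rule hom)
  fix y
  show "(\<Sum>x\<in>carrier G. bracket G H \<iota> R x (u x)) y = (of_nat (card (carrier H)) *\<^sub>C u) y"
  proof (cases "y \<in> carrier G")
    case True
    have "(\<Sum>x\<in>carrier G. bracket G H \<iota> R x (u x)) y =
        (\<Sum>h\<in>carrier H. \<Sum>x\<in>carrier G. if y = x \<otimes>\<^bsub>G\<^esub> \<iota> h then ract R (inv\<^bsub>H\<^esub> h) (u x) else 0)"
      unfolding sum_fun_apply bracket_def by (rule sum.swap)
    also have "\<dots> = (\<Sum>h\<in>carrier H. u y)"
    proof (rule sum.cong[OF refl])
      fix h assume h: "h \<in> carrier H"
      have "(\<Sum>x\<in>carrier G. if y = x \<otimes>\<^bsub>G\<^esub> \<iota> h then ract R (inv\<^bsub>H\<^esub> h) (u x) else 0) =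
          (\<Sum>x\<in>carrier G. if x = y \<otimes>\<^bsub>G\<^esub> inv\<^bsub>G\<^esub> (\<iota> h) then ract R (inv\<^bsub>H\<^esub> h) (u x) else 0)"
        using h True by (intro sum.cong refl if_cong) (auto simp: G.m_assoc)
      also have "\<dots> = ract R (inv\<^bsub>H\<^esub> h) (u (y \<otimes>\<^bsub>G\<^esub> inv\<^bsub>G\<^esub> (\<iota> h)))"
        using h True by (subst sum.delta[OF fin]) auto
      also have "\<dots> = u (y \<otimes>\<^bsub>G\<^esub> inv\<^bsub>G\<^esub> (\<iota> h) \<otimes>\<^bsub>G\<^esub> \<iota> h)"
        using h True by (subst inducedD(3)[OF u]) auto
      also have "\<dots> = u y"
        using h True by (simp add: G.m_assoc)
      finally show "(\<Sum>x\<in>carrier G. if y = x \<otimes>\<^bsub>G\<^esub> \<iota> h then ract R (inv\<^bsub>H\<^esub> h) (u x) else 0) = u y" .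
    qed
    also have "\<dots> = of_nat (card (carrier H)) *\<^sub>C u y"
      using complex_vector.sum_constant_scale[of "u y" "carrier H"] by simp
    finally show ?thesis by simp
  next
    case False
    have "bracket G H \<iota> R x (u x) y = 0" if "x \<in> carrier G" for x
      by (rule inducedD(2)[OF bracket_in[OF hom R that] False]) (use inducedD(1)[OF u that] in auto)
    then show ?thesis
      using False inducedD(2)[OF u] by (simp add: sum_fun_apply)
  qed
qed

section \<open>External tensor products of induced representations\<close>

lemma pure_tensor_sum:
  assumes "csubspace V" "csubspace W" "\<And>i. i \<in> I \<Longrightarrow> f i \<in> V" "\<And>j. j \<in> J \<Longrightarrow> g j \<in> W"
  shows "pure_tensor V W (\<Sum>i\<in>I. f i) (\<Sum>j\<in>J. g j) = (\<Sum>i\<in>I. \<Sum>j\<in>J. pure_tensor V W (f i) (g j))"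
proof -
  have "pure_tensor V W (\<Sum>i\<in>I. f i) (\<Sum>j\<in>J. g j) = (\<Sum>i\<in>I. pure_tensor V W (f i) (\<Sum>j\<in>J. g j))"
    by (rule clinear_on_sum[OF pure_tensor_linear(2)])
      (use assms in \<open>auto intro: complex_vector.subspace_sum\<close>)
  also have "\<dots> = (\<Sum>i\<in>I. \<Sum>j\<in>J. pure_tensor V W (f i) (g j))"
    by (intro sum.cong refl clinear_on_sum[OF pure_tensor_linear(1)]) (use assms in auto)
  finally show ?thesis .
qed

lemma pure_tensor_0:
  assumes "csubspace V" "csubspace W"
  shows "w \<in> W \<Longrightarrow> pure_tensor V W 0 w = 0" "v \<in> V \<Longrightarrow> pure_tensor V W v 0 = 0"
  using clinear_on_0[OF pure_tensor_linear(2) assms(1)] clinear_on_0[OF pure_tensor_linear(1) assms(2)]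
  by auto

lemma group_hom_map_prod:
  assumes "group_hom H G \<iota>" "group_hom H' G' \<iota>'"
  shows "group_hom (H \<times>\<times> H') (G \<times>\<times> G') (map_prod \<iota> \<iota>')"
  using group_hom.axioms(1,2)[OF assms(1)] group_hom.axioms(1,2)[OF assms(2)]
  unfolding group_hom_def group_hom_axioms_def
  by (auto intro!: DirProd_group homI simp: group_hom.hom_mult[OF assms(1)] group_hom.hom_mult[OF assms(2)]
      group_hom.hom_closed[OF assms(1)] group_hom.hom_closed[OF assms(2)])

text \<open>A tensor u \<otimes> u' goes to the function (x, y) \<mapsto> u(x) \<otimes> u'(y). The
  inverse needs neither dimensions nor coset representatives: a function on G \<times> G' is the
  normalised sum of its brackets, and the bracket of a pure tensor is the image of a tensor of two
  brackets.\<close>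

lemma box_induced:
  assumes hom: "group_hom H G \<iota>" "group_hom H' G' \<iota>'"
    and R: "linear_rep H R" "linear_rep H' R'"
    and fin: "finite (carrier G)" "finite (carrier G')" "finite (carrier H)" "finite (carrier H')"
  shows "rep_iso (G \<times>\<times> G') (induced G H \<iota> R \<boxtimes> induced G' H' \<iota>' R')
    (induced (G \<times>\<times> G') (H \<times>\<times> H') (map_prod \<iota> \<iota>') (R \<boxtimes> R'))"
proof -
  interpret hom: group_hom H G \<iota> by (rule hom(1))
  interpret hom': group_hom H' G' \<iota>' by (rule hom(2))
  let ?V = "rspace R" and ?V' = "rspace R'"
  let ?I = "rspace (induced G H \<iota> R)" and ?I' = "rspace (induced G' H' \<iota>' R')"
  let ?J = "induced (G \<times>\<times> G') (H \<times>\<times> H') (map_prod \<iota> \<iota>') (R \<boxtimes> R')"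
  note grp = hom.H.is_group hom'.H.is_group hom.G.is_group hom'.G.is_group
  note lin = linear_rep_induced[OF hom(1) R(1)] linear_rep_induced[OF hom(2) R(2)]
  note box = linear_rep_box[OF R(1) grp(3) R(2) grp(4)]
  note hom2 = group_hom_map_prod[OF hom]
  note linJ = linear_rep_induced[OF hom2 box]
  note sub = linear_rep_subspace[OF R(1)] linear_rep_subspace[OF R(2)]
    linear_rep_subspace[OF lin(1)] linear_rep_subspace[OF lin(2)] linear_rep_subspace[OF linJ]
  define \<phi> where "\<phi> t p = (if p \<in> carrier (G \<times>\<times> G')
    then tensor_map ?V ?V' (\<lambda>u. u (fst p)) (\<lambda>u. u (snd p)) t else 0)" for t p
  define br where "br p = tensor_map ?I ?I' (bracket G H \<iota> R (fst p)) (bracket G' H' \<iota>' R' (snd p))" for p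
  \<comment> \<open>By \<open>sum_bracket\<close> for the product group, the brackets of a function
    add up to |H \<times> H'| times that function.\<close>
  define N where "N = (of_nat (card (carrier (H \<times>\<times> H'))) :: complex)"
  have N0: "N \<noteq> 0"
    using fin(3,4) hom.G.one_closed hom'.G.one_closed by (auto simp: N_def card_gt_0_iff)
  have ev: "clinear_on ?I (\<lambda>u. u x)" "(\<lambda>u. u x) ` ?I \<subseteq> ?V" if "x \<in> carrier G" for x
    using that by (auto intro!: clinear_onI dest: inducedD(1))
  have ev': "clinear_on ?I' (\<lambda>u. u x)" "(\<lambda>u. u x) ` ?I' \<subseteq> ?V'" if "x \<in> carrier G'" for x
    using that by (auto intro!: clinear_onI dest: inducedD(1))
  have brl: "clinear_on ?V (bracket G H \<iota> R x)" "bracket G H \<iota> R x ` ?V \<subseteq> ?I" if "x \<in> carrier G" for x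
    using that bracket_linear[OF grp(3) R(1)] bracket_in[OF hom(1) R(1)] by auto
  have brl': "clinear_on ?V' (bracket G' H' \<iota>' R' x)" "bracket G' H' \<iota>' R' x ` ?V' \<subseteq> ?I'" if "x \<in> carrier G'" for x
    using that bracket_linear[OF grp(4) R(2)] bracket_in[OF hom(2) R(2)] by auto
  have \<phi>_lin: "clinear_on U \<phi>" for U
    unfolding \<phi>_def by (auto intro!: clinear_onI simp: fun_eq_iff clinear_on_add[OF tensor_map_linear[of UNIV]]
      clinear_on_scale[OF tensor_map_linear[of UNIV]])
  have br_lin: "clinear_on U (br p)" for U p
    unfolding br_def by (rule tensor_map_linear)
  have \<phi>_pure: "\<phi> (pure_tensor ?I ?I' u u') (x, y) = pure_tensor ?V ?V' (u x) (u' y)"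
    if "u \<in> ?I" "u' \<in> ?I'" "x \<in> carrier G" "y \<in> carrier G'" for u u' x y
    using that by (simp add: \<phi>_def tensor_map_pure ev ev')
  have \<phi>_pure_in: "\<phi> (pure_tensor ?I ?I' u u') \<in> rspace ?J" if u: "u \<in> ?I" "u' \<in> ?I'" for u u'
  proof (rule inducedI)
    fix p assume "p \<in> carrier (G \<times>\<times> G')"
    then show "\<phi> (pure_tensor ?I ?I' u u') p \<in> rspace (R \<boxtimes> R')"
      using u by (auto simp: \<phi>_pure intro!: pure_tensor_in inducedD(1)[of u] inducedD(1)[of u'])
  next
    fix p h assume p: "p \<in> carrier (G \<times>\<times> G')" and h: "h \<in> carrier (H \<times>\<times> H')"
    then show "\<phi> (pure_tensor ?I ?I' u u') (p \<otimes>\<^bsub>G \<times>\<times> G'\<^esub> map_prod \<iota> \<iota>' h) =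
        ract (R \<boxtimes> R') (inv\<^bsub>H \<times>\<times> H'\<^esub> h) (\<phi> (pure_tensor ?I ?I' u u') p)"
      using u by (auto simp: \<phi>_pure inv_DirProd[OF grp(3,4)] inducedD(3)
          box_action_pure[OF R(1) grp(3) hom.G.inv_closed R(2) grp(4) hom'.G.inv_closed]
          inducedD(1)[OF u(1)] inducedD(1)[OF u(2)])
  qed (simp add: \<phi>_def)
  have \<phi>_in: "\<phi> t \<in> rspace ?J" if "t \<in> tensor_space ?I ?I'" for t
    by (rule tensor_space_image[OF \<phi>_lin sub(5) \<phi>_pure_in that])
  have \<phi>_inter: "intertwiner (G \<times>\<times> G') (induced G H \<iota> R \<boxtimes> induced G' H' \<iota>' R') ?J \<phi>"
  proof (rule intertwinerI)
    fix g t assume g: "g \<in> carrier (G \<times>\<times> G')" and t: "t \<in> rspace (induced G H \<iota> R \<boxtimes> induced G' H' \<iota>' R')"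
    obtain a b where g_eq: "g = (a, b)" and ab: "a \<in> carrier G" "b \<in> carrier G'"
      using g by auto
    show "\<phi> (ract (induced G H \<iota> R \<boxtimes> induced G' H' \<iota>' R') g t) = ract ?J g (\<phi> t)"
    proof (rule tensor_space_eq[OF _ _ _ t[unfolded rspace_box]])
      show "clinear_on (tensor_space ?I ?I') (\<lambda>t. \<phi> (ract (induced G H \<iota> R \<boxtimes> induced G' H' \<iota>' R') g t))"
        by (rule clinear_on_compose[where g = \<phi> and W = UNIV]) (auto intro: \<phi>_lin box_action_linear)
      show "clinear_on (tensor_space ?I ?I') (\<lambda>t. ract ?J g (\<phi> t))"
        by (rule clinear_on_compose[OF \<phi>_lin linear_rep_linear[OF linJ g]]) (use \<phi>_in in auto)
      fix u u' assume u: "u \<in> ?I" "u' \<in> ?I'"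
      have gu: "ract (induced G H \<iota> R) a u \<in> ?I" "ract (induced G' H' \<iota>' R') b u' \<in> ?I'"
        using u ab by (auto intro: linear_rep_closed[OF lin(1)] linear_rep_closed[OF lin(2)])
      show "\<phi> (ract (induced G H \<iota> R \<boxtimes> induced G' H' \<iota>' R') g (pure_tensor ?I ?I' u u')) =
          ract ?J g (\<phi> (pure_tensor ?I ?I' u u'))"
      proof (rule induced_eqI)
        show "\<phi> (ract (induced G H \<iota> R \<boxtimes> induced G' H' \<iota>' R') g (pure_tensor ?I ?I' u u')) \<in> rspace ?J"
          using u gu ab by (simp add: g_eq box_action_pure[OF lin(1) grp(1) _ lin(2) grp(2)] \<phi>_pure_in)
        show "ract ?J g (\<phi> (pure_tensor ?I ?I' u u')) \<in> rspace ?J"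
          using linear_rep_closed[OF linJ g \<phi>_pure_in[OF u]] .
        fix p assume "p \<in> carrier (G \<times>\<times> G')"
        then show "\<phi> (ract (induced G H \<iota> R \<boxtimes> induced G' H' \<iota>' R') g (pure_tensor ?I ?I' u u')) p =
            ract ?J g (\<phi> (pure_tensor ?I ?I' u u')) p"
          using u gu ab by (auto simp: g_eq box_action_pure[OF lin(1) grp(1) _ lin(2) grp(2)]
              \<phi>_pure induced_action inv_DirProd[OF grp(1,2)])
      qed
    qed
  qed (use \<phi>_in in \<open>auto intro: \<phi>_lin\<close>)
  define \<psi> where "\<psi> f = (1 / N) *\<^sub>C (\<Sum>p\<in>carrier (G \<times>\<times> G'). br p (f p))" for f
  have br_in: "br p s \<in> tensor_space ?I ?I'" if "s \<in> tensor_space ?V ?V'" "p \<in> carrier (G \<times>\<times> G')" for p s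
    unfolding br_def using that brl(2)[of "fst p"] brl'(2)[of "snd p"]
    by (intro tensor_map_in[of ?V _ _ ?V'] brl brl') auto
  \<comment> \<open>Brackets are multiplicative: for a pure tensor the sum over H \<times> H' that
    defines its bracket is the double sum obtained from the two factors.\<close>
  have \<phi>_br: "\<phi> (br p s) = bracket (G \<times>\<times> G') (H \<times>\<times> H') (map_prod \<iota> \<iota>') (R \<boxtimes> R') p s"
    if s: "s \<in> tensor_space ?V ?V'" and p: "p \<in> carrier (G \<times>\<times> G')" for p s
  proof (rule tensor_space_eq[OF _ _ _ s])
    show "clinear_on (tensor_space ?V ?V') (\<lambda>s. \<phi> (br p s))"
      by (rule clinear_on_compose[where g = \<phi> and W = UNIV]) (auto intro: \<phi>_lin br_lin)
    show "clinear_on (tensor_space ?V ?V') (bracket (G \<times>\<times> G') (H \<times>\<times> H') (map_prod \<iota> \<iota>') (R \<boxtimes> R') p)"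
      using bracket_linear[OF DirProd_group[OF grp(3,4)] box] by simp
    fix v w assume vw: "v \<in> ?V" "w \<in> ?V'"
    obtain x y where p_eq: "p = (x, y)" and xy: "x \<in> carrier G" "y \<in> carrier G'"
      using p by auto
    have b_in: "bracket G H \<iota> R x v \<in> ?I" "bracket G' H' \<iota>' R' y w \<in> ?I'"
      using vw xy bracket_in[OF hom(1) R(1)] bracket_in[OF hom(2) R(2)] by auto
    have 1: "br p (pure_tensor ?V ?V' v w) = pure_tensor ?I ?I' (bracket G H \<iota> R x v) (bracket G' H' \<iota>' R' y w)"
      unfolding br_def p_eq using vw xy by (simp add: tensor_map_pure brl brl')
    have pin: "pure_tensor ?V ?V' v w \<in> rspace (R \<boxtimes> R')"
      using vw by (simp add: pure_tensor_in)
    show "\<phi> (br p (pure_tensor ?V ?V' v w)) =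
        bracket (G \<times>\<times> G') (H \<times>\<times> H') (map_prod \<iota> \<iota>') (R \<boxtimes> R') p (pure_tensor ?V ?V' v w)"
    proof (rule induced_eqI)
      show "\<phi> (br p (pure_tensor ?V ?V' v w)) \<in> rspace ?J"
        unfolding 1 by (rule \<phi>_pure_in[OF b_in])
      show "bracket (G \<times>\<times> G') (H \<times>\<times> H') (map_prod \<iota> \<iota>') (R \<boxtimes> R') p (pure_tensor ?V ?V' v w) \<in> rspace ?J"
        by (rule bracket_in[OF hom2 box p pin])
      fix q assume "q \<in> carrier (G \<times>\<times> G')"
      then obtain x' y' where q: "q = (x', y')" and xy': "x' \<in> carrier G" "y' \<in> carrier G'"
        by auto
      have hv: "ract R (inv\<^bsub>H\<^esub> h) v \<in> ?V" if "h \<in> carrier H" for h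
        using that vw by (simp add: linear_rep_closed[OF R(1)])
      have kw: "ract R' (inv\<^bsub>H'\<^esub> k) w \<in> ?V'" if "k \<in> carrier H'" for k
        using that vw by (simp add: linear_rep_closed[OF R(2)])
      have "\<phi> (br p (pure_tensor ?V ?V' v w)) q =
          pure_tensor ?V ?V' (bracket G H \<iota> R x v x') (bracket G' H' \<iota>' R' y w y')"
        unfolding 1 q by (rule \<phi>_pure[OF b_in xy'])
      also have "\<dots> = (\<Sum>h\<in>carrier H. \<Sum>k\<in>carrier H'. pure_tensor ?V ?V'
          (if x' = x \<otimes>\<^bsub>G\<^esub> \<iota> h then ract R (inv\<^bsub>H\<^esub> h) v else 0)
          (if y' = y \<otimes>\<^bsub>G'\<^esub> \<iota>' k then ract R' (inv\<^bsub>H'\<^esub> k) w else 0))"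
        unfolding bracket_def
        by (rule pure_tensor_sum[OF sub(1,2)]) (use hv kw complex_vector.subspace_0[OF sub(1)]
            complex_vector.subspace_0[OF sub(2)] in auto)
      also have "\<dots> = (\<Sum>h\<in>carrier H. \<Sum>k\<in>carrier H'.
          if q = p \<otimes>\<^bsub>G \<times>\<times> G'\<^esub> map_prod \<iota> \<iota>' (h, k) then
            ract (R \<boxtimes> R') (inv\<^bsub>H \<times>\<times> H'\<^esub> (h, k)) (pure_tensor ?V ?V' v w) else 0)"
        by (intro sum.cong refl) (use hv kw vw complex_vector.subspace_0[OF sub(1)]
            complex_vector.subspace_0[OF sub(2)] in \<open>auto simp: q p_eq inv_DirProd[OF grp(3,4)]
            pure_tensor_0[OF sub(1,2)] box_action_pure[OF R(1) grp(3) hom.G.inv_closed R(2) grp(4) hom'.G.inv_closed]\<close>)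
      also have "\<dots> = bracket (G \<times>\<times> G') (H \<times>\<times> H') (map_prod \<iota> \<iota>') (R \<boxtimes> R') p (pure_tensor ?V ?V' v w) q"
        unfolding bracket_def by (auto simp: sum.cartesian_product intro!: sum.cong)
      finally show "\<phi> (br p (pure_tensor ?V ?V' v w)) q =
          bracket (G \<times>\<times> G') (H \<times>\<times> H') (map_prod \<iota> \<iota>') (R \<boxtimes> R') p (pure_tensor ?V ?V' v w) q" .
    qed
  qed
  have \<psi>_lin: "clinear_on U \<psi>" for U
    unfolding \<psi>_def
    by (auto intro!: clinear_onI simp: clinear_on_add[OF br_lin[of UNIV]] clinear_on_scale[OF br_lin[of UNIV]]
      sum.distrib scaleC_add_right complex_vector.scale_sum_right[symmetric] complex_vector.scale_left_commute)
  show ?thesis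
  proof (rule rep_isoI[OF \<phi>_inter])
    show "\<psi> f \<in> rspace (induced G H \<iota> R \<boxtimes> induced G' H' \<iota>' R')" if "f \<in> rspace ?J" for f
      unfolding \<psi>_def rspace_box
      by (intro complex_vector.subspace_scale complex_vector.subspace_sum subspace_tensor_space br_in)
        (use inducedD(1)[OF that] in auto)
    fix t assume t: "t \<in> rspace (induced G H \<iota> R \<boxtimes> induced G' H' \<iota>' R')"
    show "\<psi> (\<phi> t) = t"
    proof (rule tensor_space_eq[OF _ clinear_on_id _ t[unfolded rspace_box]])
      show "clinear_on (tensor_space ?I ?I') (\<lambda>t. \<psi> (\<phi> t))"
        by (rule clinear_on_compose[where g = \<psi> and W = UNIV]) (auto intro: \<phi>_lin \<psi>_lin)
      fix u u' assume u: "u \<in> ?I" "u' \<in> ?I'"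
      have "(\<Sum>p\<in>carrier (G \<times>\<times> G'). br p (\<phi> (pure_tensor ?I ?I' u u') p)) =
          (\<Sum>x\<in>carrier G. \<Sum>y\<in>carrier G'. pure_tensor ?I ?I' (bracket G H \<iota> R x (u x)) (bracket G' H' \<iota>' R' y (u' y)))"
        unfolding sum.cartesian_product
        by (rule sum.cong) (use u in \<open>auto simp: \<phi>_pure br_def tensor_map_pure brl brl' inducedD(1)[OF u(1)] inducedD(1)[OF u(2)]\<close>)
      also have "\<dots> = pure_tensor ?I ?I' (\<Sum>x\<in>carrier G. bracket G H \<iota> R x (u x)) (\<Sum>y\<in>carrier G'. bracket G' H' \<iota>' R' y (u' y))"
        by (rule pure_tensor_sum[OF sub(3,4), symmetric])
          (use u in \<open>auto intro!: bracket_in hom R dest: inducedD(1)\<close>)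
      also have "\<dots> = N *\<^sub>C pure_tensor ?I ?I' u u'"
        unfolding sum_bracket[OF hom(1) R(1) fin(1) u(1)] sum_bracket[OF hom(2) R(2) fin(2) u(2)]
        using u sub by (simp add: clinear_on_scale[OF pure_tensor_linear(1)] clinear_on_scale[OF pure_tensor_linear(2)]
            complex_vector.subspace_scale N_def card_cartesian_product scaleC_scaleC)
      finally show "\<psi> (\<phi> (pure_tensor ?I ?I' u u')) = pure_tensor ?I ?I' u u'"
        using N0 by (simp add: \<psi>_def scaleC_scaleC scaleC_one)
    qed
  next
    fix f assume f: "f \<in> rspace ?J"
    have "\<phi> (\<psi> f) = (1 / N) *\<^sub>C (\<Sum>p\<in>carrier (G \<times>\<times> G'). \<phi> (br p (f p)))"
      unfolding \<psi>_def
      by (simp only: clinear_on_scale[OF \<phi>_lin[of UNIV]] clinear_on_sum[OF \<phi>_lin[of UNIV]] complex_vector.subspace_UNIV UNIV_I)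
    also have "(\<Sum>p\<in>carrier (G \<times>\<times> G'). \<phi> (br p (f p))) =
        (\<Sum>p\<in>carrier (G \<times>\<times> G'). bracket (G \<times>\<times> G') (H \<times>\<times> H') (map_prod \<iota> \<iota>') (R \<boxtimes> R') p (f p))"
      by (intro sum.cong refl \<phi>_br) (use inducedD(1)[OF f] in auto)
    also have "\<dots> = N *\<^sub>C f"
      unfolding N_def by (rule sum_bracket[OF hom2 box _ f]) (simp add: fin)
    finally show "\<phi> (\<psi> f) = f"
      using N0 by (simp add: scaleC_scaleC scaleC_one)
  qed
qed

section \<open>Direct sums\<close>

text \<open>Biproduct data. In this form a decomposition is carried through induction, tensoring and
  \<open>char_rep\<close> simply by applying them to the embeddings and projections; the concrete
  function space \<open>direct_sum\<close> does not lend itself to that and is reached only at the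
  end, by \<open>decomposes_rep_iso\<close>.\<close>

definition decomposition ::
    "('g, 'a) monoid_scheme \<Rightarrow> ('g, 'v::complex_vector) rep \<Rightarrow> 'i set \<Rightarrow> ('i \<Rightarrow> ('g, 'w::complex_vector) rep)
      \<Rightarrow> ('i \<Rightarrow> 'w \<Rightarrow> 'v) \<Rightarrow> ('i \<Rightarrow> 'v \<Rightarrow> 'w) \<Rightarrow> bool"
  where "decomposition G E I R em pr \<longleftrightarrow>
    (\<forall>i\<in>I. intertwiner G (R i) E (em i) \<and> intertwiner G E (R i) (pr i)) \<and>
    (\<forall>i\<in>I. \<forall>j\<in>I. \<forall>v\<in>rspace (R j). pr i (em j v) = (if i = j then v else 0)) \<and>
    (\<forall>v\<in>rspace E. (\<Sum>i\<in>I. em i (pr i v)) = v)"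

definition decomposes ::
    "('g, 'a) monoid_scheme \<Rightarrow> ('g, 'v::complex_vector) rep \<Rightarrow> 'i set \<Rightarrow> ('i \<Rightarrow> ('g, 'w::complex_vector) rep) \<Rightarrow> bool"
  where "decomposes G E I R \<longleftrightarrow> (\<exists>em pr. decomposition G E I R em pr)"

lemma decompositionD:
  assumes "decomposition G E I R em pr"
  shows "i \<in> I \<Longrightarrow> intertwiner G (R i) E (em i)" "i \<in> I \<Longrightarrow> intertwiner G E (R i) (pr i)"
    and "i \<in> I \<Longrightarrow> j \<in> I \<Longrightarrow> w \<in> rspace (R j) \<Longrightarrow> pr i (em j w) = (if i = j then w else 0)"
    and "v \<in> rspace E \<Longrightarrow> (\<Sum>i\<in>I. em i (pr i v)) = v"
  using assms by (simp_all add: decomposition_def)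

lemma decomposesI:
  assumes "\<And>i. i \<in> I \<Longrightarrow> intertwiner G (R i) E (em i)" "\<And>i. i \<in> I \<Longrightarrow> intertwiner G E (R i) (pr i)"
    and "\<And>i j v. i \<in> I \<Longrightarrow> j \<in> I \<Longrightarrow> v \<in> rspace (R j) \<Longrightarrow> pr i (em j v) = (if i = j then v else 0)"
    and "\<And>v. v \<in> rspace E \<Longrightarrow> (\<Sum>i\<in>I. em i (pr i v)) = v"
  shows "decomposes G E I R"
  unfolding decomposes_def decomposition_def
  by (rule exI[of _ em], rule exI[of _ pr]) (simp add: assms)

lemma direct_sum_action:
  "ract (direct_sum I R) g u i = (if i \<in> I then ract (R i) g (u i) else 0)"
  by (simp add: direct_sum_def)

lemma direct_sum_iff:
  assumes "finite I"
  shows "u \<in> rspace (direct_sum I R) \<longleftrightarrow> (\<forall>i\<in>I. u i \<in> rspace (R i)) \<and> (\<forall>i. i \<notin> I \<longrightarrow> u i = 0)"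
proof -
  have "finite {i. u i \<noteq> 0}" if "\<forall>i. i \<notin> I \<longrightarrow> u i = 0"
    by (rule finite_subset[OF _ assms]) (use that in auto)
  then show ?thesis
    by (auto simp: direct_sum_def)
qed

lemma decomposes_rep_iso:
  assumes fin: "finite I" and E: "linear_rep G E" and dec: "decomposes G E I R"
  shows "rep_iso G E (direct_sum I R)"
proof -
  obtain em pr where d: "decomposition G E I R em pr"
    using dec by (auto simp: decomposes_def)
  note i = decompositionD(1)[OF d] and p = decompositionD(2)[OF d]
    and pi = decompositionD(3)[OF d] and ip = decompositionD(4)[OF d]
  note i' = intertwinerD[OF i] and p' = intertwinerD[OF p]
  note sub = linear_rep_subspace[OF E]
  show ?thesis
  proof (rule rep_isoI[where \<phi> = "\<lambda>v i. if i \<in> I then pr i v else 0" and \<psi> = "\<lambda>u. \<Sum>i\<in>I. em i (u i)"])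
    show "intertwiner G E (direct_sum I R) (\<lambda>v i. if i \<in> I then pr i v else 0)"
      by (rule intertwinerI) (auto intro!: clinear_onI simp: fun_eq_iff direct_sum_iff[OF fin] direct_sum_action
        p'(2,3) clinear_on_add[OF p'(1)] clinear_on_scale[OF p'(1)])
  next
    fix u assume "u \<in> rspace (direct_sum I R)"
    then have u: "\<And>i. i \<in> I \<Longrightarrow> u i \<in> rspace (R i)" "\<And>i. i \<notin> I \<Longrightarrow> u i = 0"
      by (auto simp: direct_sum_iff[OF fin])
    show "(\<Sum>i\<in>I. em i (u i)) \<in> rspace E"
      by (intro complex_vector.subspace_sum[OF sub]) (auto intro: i'(2) u)
    have "pr j (\<Sum>i\<in>I. em i (u i)) = u j" if "j \<in> I" for j
    proof -
      have "pr j (\<Sum>i\<in>I. em i (u i)) = (\<Sum>i\<in>I. pr j (em i (u i)))"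
        by (rule clinear_on_sum[OF p'(1)[OF that] sub]) (auto intro: i'(2) u)
      also have "\<dots> = (\<Sum>i\<in>I. if i = j then u i else 0)"
        by (intro sum.cong refl) (use that u pi in auto)
      finally show ?thesis using that fin by simp
    qed
    then show "(\<lambda>i'. if i' \<in> I then pr i' (\<Sum>i\<in>I. em i (u i)) else 0) = u"
      using u by auto
  next
    fix v assume "v \<in> rspace E"
    then show "(\<Sum>i\<in>I. em i (if i \<in> I then pr i v else 0)) = v"
      using ip[of v] by simp
  qed
qed

text \<open>The coordinate injections and projections of the direct sum, transported along the
  isomorphism.\<close>

lemma rep_iso_decomposes:
  fixes R :: "'i \<Rightarrow> ('g, 'w::complex_vector) rep"
  assumes fin: "finite I" and E: "linear_rep G E" and R: "\<And>i. i \<in> I \<Longrightarrow> linear_rep G (R i)"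
    and iso: "rep_iso G E (direct_sum I R)"
  shows "decomposes G E I R"
proof -
  obtain \<phi> \<psi> where \<phi>: "intertwiner G E (direct_sum I R) \<phi>" and \<psi>: "intertwiner G (direct_sum I R) E \<psi>"
    and inv: "\<And>v. v \<in> rspace E \<Longrightarrow> \<psi> (\<phi> v) = v" "\<And>w. w \<in> rspace (direct_sum I R) \<Longrightarrow> \<phi> (\<psi> w) = w"
    using rep_isoE[OF iso E] by metis
  note \<phi>' = intertwinerD[OF \<phi>] and \<psi>' = intertwinerD[OF \<psi>]
  define s where "s i v = (\<lambda>j. if j = i then v else 0)" for i :: 'i and v :: 'w
  have s_in: "s i v \<in> rspace (direct_sum I R)" if "i \<in> I" "v \<in> rspace (R i)" for i v
    using that linear_rep_subspace[OF R]
    by (auto simp: direct_sum_iff[OF fin] s_def complex_vector.subspace_0)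
  have \<phi>_in: "\<phi> v i \<in> rspace (R i)" "j \<notin> I \<Longrightarrow> \<phi> v j = 0" if "v \<in> rspace E" "i \<in> I" for v i j
    using \<phi>'(2)[OF that(1)] that(2) by (auto simp: direct_sum_iff[OF fin])
  show ?thesis
  proof (rule decomposesI[where em = "\<lambda>i v. \<psi> (s i v)" and pr = "\<lambda>i v. \<phi> v i"])
    fix i assume i: "i \<in> I"
    have "ract (R j) g 0 = 0" if "j \<in> I" "g \<in> carrier G" for j g
      using clinear_on_0[OF linear_rep_linear[OF R] linear_rep_subspace[OF R]] that by blast
    then have "intertwiner G (R i) (direct_sum I R) (s i)"
      by (intro intertwinerI s_in i) (auto intro!: clinear_onI simp: s_def fun_eq_iff direct_sum_action i)
    then show "intertwiner G (R i) E (\<lambda>v. \<psi> (s i v))"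
      by (rule intertwiner_compose[OF _ \<psi>])
    show "intertwiner G E (R i) (\<lambda>v. \<phi> v i)"
      by (rule intertwinerI) (use i in \<open>auto intro!: clinear_onI \<phi>_in simp: \<phi>'(3) direct_sum_action
        clinear_on_add[OF \<phi>'(1)] clinear_on_scale[OF \<phi>'(1)]\<close>)
  next
    fix i j v assume "i \<in> I" "j \<in> I" "v \<in> rspace (R j)"
    then show "\<phi> (\<psi> (s j v)) i = (if i = j then v else 0)"
      by (simp add: inv(2)[OF s_in]) (simp add: s_def)
  next
    fix v assume v: "v \<in> rspace E"
    have sum: "(\<Sum>i\<in>I. s i (\<phi> v i)) = \<phi> v"
    proof
      fix j show "(\<Sum>i\<in>I. s i (\<phi> v i)) j = \<phi> v j"
        using \<phi>'(2)[OF v] fin by (auto simp: sum_fun_apply s_def direct_sum_iff[OF fin])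
    qed
    have "(\<Sum>i\<in>I. \<psi> (s i (\<phi> v i))) = \<psi> (\<Sum>i\<in>I. s i (\<phi> v i))"
    proof (cases "I = {}")
      case False
      then have "csubspace (rspace (direct_sum I R))"
        by (auto intro!: complex_vector.subspaceI simp: direct_sum_iff[OF fin] linear_rep_subspace[OF R]
          complex_vector.subspace_0 complex_vector.subspace_add complex_vector.subspace_scale)
      then show ?thesis
        by (intro clinear_on_sum[OF \<psi>'(1), symmetric]) (use v in \<open>auto intro: s_in \<phi>_in\<close>)
    next
      case True
      then have "\<phi> v = 0" using sum by simp
      then show ?thesis using inv(1)[OF v] True clinear_on_scale[OF \<psi>'(1), of "\<phi> v" 0] \<phi>'(2)[OF v] by simp
    qed
    then show "(\<Sum>i\<in>I. \<psi> (s i (\<phi> v i))) = v"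
      using sum inv(1)[OF v] by simp
  qed
qed

lemma decomposes_self: "decomposes G E {i} (\<lambda>_. E)"
  by (rule decomposesI[where em = "\<lambda>_ v. v" and pr = "\<lambda>_ v. v"]) (auto simp: intertwiner_id)

lemma decomposes_iso:
  assumes "linear_rep G E" "rep_iso G E E'" "decomposes G E' I R"
  shows "decomposes G E I R"
proof -
  obtain \<phi> \<psi> where \<phi>: "intertwiner G E E' \<phi>" and \<psi>: "intertwiner G E' E \<psi>"
    and inv: "\<And>v. v \<in> rspace E \<Longrightarrow> \<psi> (\<phi> v) = v" "\<And>w. w \<in> rspace E' \<Longrightarrow> \<phi> (\<psi> w) = w"
    using rep_isoE[OF assms(2,1)] by metis
  obtain em pr where d: "decomposition G E' I R em pr"
    using assms(3) by (auto simp: decomposes_def)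
  note i = decompositionD(1)[OF d] and p = decompositionD(2)[OF d]
    and pi = decompositionD(3)[OF d] and ip = decompositionD(4)[OF d]
  note D = intertwinerD[OF \<phi>] intertwinerD[OF \<psi>]
  have sub': "csubspace (rspace E')"
  proof -
    have im: "rspace E' = \<phi> ` rspace E"
      using inv(2) D(2,5) by force
    note sub = linear_rep_subspace[OF assms(1)]
    show ?thesis
      unfolding im
    proof (rule complex_vector.subspaceI)
      show "0 \<in> \<phi> ` rspace E"
        using clinear_on_0[OF D(1) sub] complex_vector.subspace_0[OF sub] by force
      fix x y assume "x \<in> \<phi> ` rspace E" "y \<in> \<phi> ` rspace E"
      then show "x + y \<in> \<phi> ` rspace E"
        by (auto simp: clinear_on_add[OF D(1), symmetric] complex_vector.subspace_add[OF sub])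
    next
      fix x c assume "x \<in> \<phi> ` rspace E"
      then show "c *\<^sub>C x \<in> \<phi> ` rspace E"
        by (auto simp: clinear_on_scale[OF D(1), symmetric] complex_vector.subspace_scale[OF sub])
    qed
  qed
  show ?thesis
  proof (rule decomposesI[where em = "\<lambda>i v. \<psi> (em i v)" and pr = "\<lambda>i v. pr i (\<phi> v)"])
    show "(\<Sum>i\<in>I. \<psi> (em i (pr i (\<phi> v)))) = v" if v: "v \<in> rspace E" for v
    proof -
      have "(\<Sum>i\<in>I. \<psi> (em i (pr i (\<phi> v)))) = \<psi> (\<Sum>i\<in>I. em i (pr i (\<phi> v)))"
        by (rule clinear_on_sum[OF D(4) sub', symmetric])
          (use v D(2) in \<open>auto intro!: intertwinerD(2)[OF i] intertwinerD(2)[OF p]\<close>)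
      then show ?thesis using ip[OF D(2)[OF v]] inv(1)[OF v] by simp
    qed
  qed (use i p pi inv in \<open>auto intro: intertwiner_compose \<phi> \<psi> simp: intertwinerD(2)[OF i]\<close>)
qed

lemma decomposes_reindex:
  assumes "bij_betw f J I" "decomposes G E I R"
  shows "decomposes G E J (\<lambda>j. R (f j))"
proof -
  obtain em pr where d: "decomposition G E I R em pr"
    using assms(2) by (auto simp: decomposes_def)
  note i = decompositionD(1)[OF d] and p = decompositionD(2)[OF d]
    and pi = decompositionD(3)[OF d] and ip = decompositionD(4)[OF d]
  have f: "f j \<in> I" if "j \<in> J" for j using assms(1) that by (auto simp: bij_betw_def)
  have inj: "f i = f j \<longleftrightarrow> i = j" if "i \<in> J" "j \<in> J" for i j
    using assms(1) that by (auto simp: bij_betw_def inj_on_def)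
  show ?thesis
  proof (rule decomposesI[where em = "\<lambda>j. em (f j)" and pr = "\<lambda>j. pr (f j)"])
    show "(\<Sum>j\<in>J. em (f j) (pr (f j) v)) = v" if "v \<in> rspace E" for v
      using sum.reindex_bij_betw[OF assms(1), of "\<lambda>i. em i (pr i v)"] ip[OF that] by simp
  qed (use i p pi f inj in auto)
qed

lemma decomposes_induced:
  assumes hom: "group_hom H G \<iota>" and E: "linear_rep H E" and R: "\<And>i. i \<in> I \<Longrightarrow> linear_rep H (R i)"
    and dec: "decomposes H E I R"
  shows "decomposes G (induced G H \<iota> E) I (\<lambda>i. induced G H \<iota> (R i))"
proof -
  obtain em pr where d: "decomposition H E I R em pr"
    using dec by (auto simp: decomposes_def)
  note i = decompositionD(1)[OF d] and p = decompositionD(2)[OF d]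
    and pi = decompositionD(3)[OF d] and ip = decompositionD(4)[OF d]
  have 0: "0 \<in> rspace E" "\<And>i. i \<in> I \<Longrightarrow> 0 \<in> rspace (R i)"
    using linear_rep_subspace[OF E] linear_rep_subspace[OF R] by (auto simp: complex_vector.subspace_0)
  have in_E: "u x \<in> rspace E" if "u \<in> rspace (induced G H \<iota> E)" for u x
    using that 0 inducedD(1,2)[OF that] by (cases "x \<in> carrier G") auto
  have in_R: "u x \<in> rspace (R i)" if "u \<in> rspace (induced G H \<iota> (R i))" "i \<in> I" for u x i
    using that 0 inducedD(1,2)[OF that(1)] by (cases "x \<in> carrier G") auto
  show ?thesis
  proof (rule decomposesI[where em = "\<lambda>i u x. em i (u x)" and pr = "\<lambda>i u x. pr i (u x)"])
    show "(\<lambda>x. pr i (em j (u x))) = (if i = j then u else 0)"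
      if "i \<in> I" "j \<in> I" "u \<in> rspace (induced G H \<iota> (R j))" for i j u
      using that by (auto simp: fun_eq_iff pi in_R)
    show "(\<Sum>i\<in>I. (\<lambda>x. em i (pr i (u x)))) = u" if "u \<in> rspace (induced G H \<iota> E)" for u
      using that by (auto simp: fun_eq_iff sum_fun_apply ip in_E)
  qed (auto intro!: intertwiner_induced[OF hom] i p E R)
qed

lemma decomposes_box:
  assumes grp: "group G" "group H"
    and E: "linear_rep G E" "\<And>i. i \<in> I \<Longrightarrow> linear_rep G (R i)" "decomposes G E I R"
    and F: "linear_rep H F" "\<And>j. j \<in> J \<Longrightarrow> linear_rep H (S j)" "decomposes H F J S"
  shows "decomposes (G \<times>\<times> H) (E \<boxtimes> F) (I \<times> J) (\<lambda>(i, j). R i \<boxtimes> S j)"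
proof -
  obtain em pr where d: "decomposition G E I R em pr"
    using E(3) by (auto simp: decomposes_def)
  note i = decompositionD(1)[OF d] and p = decompositionD(2)[OF d]
    and pi = decompositionD(3)[OF d] and ip = decompositionD(4)[OF d]
  obtain em' pr' where d': "decomposition H F J S em' pr'"
    using F(3) by (auto simp: decomposes_def)
  note i' = decompositionD(1)[OF d'] and p' = decompositionD(2)[OF d']
    and pi' = decompositionD(3)[OF d'] and ip' = decompositionD(4)[OF d']
  note D = intertwinerD(1,2)[OF i] intertwinerD(1,2)[OF p]
  note D' = intertwinerD(1,2)[OF i'] intertwinerD(1,2)[OF p']
  have im: "em k ` rspace (R k) \<subseteq> rspace E" "pr k ` rspace E \<subseteq> rspace (R k)" if "k \<in> I" for k
    using D that by auto
  have im': "em' k ` rspace (S k) \<subseteq> rspace F" "pr' k ` rspace F \<subseteq> rspace (S k)" if "k \<in> J" for k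
    using D' that by auto
  have subE: "csubspace (rspace E)" and subF: "csubspace (rspace F)"
    using linear_rep_subspace E(1) F(1) by blast+
  let ?em = "\<lambda>(k, l). tensor_map (rspace E) (rspace F) (em k) (em' l)"
  let ?pr = "\<lambda>(k, l). tensor_map (rspace (R k)) (rspace (S l)) (pr k) (pr' l)"
  show ?thesis
  proof (rule decomposesI[where em = ?em and pr = ?pr])
    fix q assume "q \<in> I \<times> J"
    then obtain k l where q: "q = (k, l)" "k \<in> I" "l \<in> J" by auto
    show "intertwiner (G \<times>\<times> H) (case q of (i, j) \<Rightarrow> R i \<boxtimes> S j) (E \<boxtimes> F) (?em q)"
      using q by (simp add: intertwiner_box[OF E(2,1) grp(1) F(2,1) grp(2) i i'])
    show "intertwiner (G \<times>\<times> H) (E \<boxtimes> F) (case q of (i, j) \<Rightarrow> R i \<boxtimes> S j) (?pr q)"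
      using q by (simp add: intertwiner_box[OF E(1,2) grp(1) F(1,2) grp(2) p p'])
  next
    fix q q' t assume qq: "q \<in> I \<times> J" "q' \<in> I \<times> J" and t: "t \<in> rspace (case q' of (i, j) \<Rightarrow> R i \<boxtimes> S j)"
    obtain k l m n where q: "q = (k, l)" "k \<in> I" "l \<in> J" "q' = (m, n)" "m \<in> I" "n \<in> J"
      using qq by auto
    note subs = linear_rep_subspace[OF E(2)[OF q(2)]] linear_rep_subspace[OF F(2)[OF q(3)]]
    have t': "t \<in> tensor_space (rspace (R m)) (rspace (S n))"
      using t q by simp
    show "?pr q (?em q' t) = (if q = q' then t else 0)"
    proof (rule tensor_space_eq[OF _ _ _ t'])
      show "clinear_on (tensor_space (rspace (R m)) (rspace (S n))) (\<lambda>t. ?pr q (?em q' t))"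
        by (rule clinear_on_compose[where g = "?pr q" and W = UNIV]) (auto intro: tensor_map_linear simp: q)
      show "clinear_on (tensor_space (rspace (R m)) (rspace (S n))) (\<lambda>t. if q = q' then t else 0)"
        by (simp add: clinear_on_def)
      fix v w assume vw: "v \<in> rspace (R m)" "w \<in> rspace (S n)"
      have "?pr q (?em q' (pure_tensor (rspace (R m)) (rspace (S n)) v w)) =
          pure_tensor (rspace (R k)) (rspace (S l)) (pr k (em m v)) (pr' l (em' n w))"
        using vw by (simp add: q tensor_map_pure D D' im im')
      then show "?pr q (?em q' (pure_tensor (rspace (R m)) (rspace (S n)) v w)) =
          (if q = q' then pure_tensor (rspace (R m)) (rspace (S n)) v w else 0)"
        using vw q subs pure_tensor_0[OF subs] by (auto simp: pi pi' complex_vector.subspace_0)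
    qed
  next
    fix t assume t: "t \<in> rspace (E \<boxtimes> F)"
    show "(\<Sum>q\<in>I \<times> J. ?em q (?pr q t)) = t"
    proof (rule tensor_space_eq[OF _ clinear_on_id _ t[unfolded rspace_box]])
      show "clinear_on (tensor_space (rspace E) (rspace F)) (\<lambda>t. \<Sum>q\<in>I \<times> J. ?em q (?pr q t))"
      proof (rule clinear_on_sum_fun)
        fix q show "clinear_on (tensor_space (rspace E) (rspace F)) (\<lambda>t. ?em q (?pr q t))"
          by (cases q, rule clinear_on_compose[where g = "?em q" and W = UNIV]) (auto intro: tensor_map_linear)
      qed
      fix v w assume vw: "v \<in> rspace E" "w \<in> rspace F"
      have "(\<Sum>q\<in>I \<times> J. ?em q (?pr q (pure_tensor (rspace E) (rspace F) v w))) =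
          (\<Sum>k\<in>I. \<Sum>l\<in>J. pure_tensor (rspace E) (rspace F) (em k (pr k v)) (em' l (pr' l w)))"
        unfolding sum.cartesian_product
        by (rule sum.cong) (use vw in \<open>auto simp: tensor_map_pure D D' im im'\<close>)
      also have "\<dots> = pure_tensor (rspace E) (rspace F) v w"
        using pure_tensor_sum[OF subE subF, of I "\<lambda>k. em k (pr k v)" J "\<lambda>l. em' l (pr' l w)"] vw
        by (simp add: D D' ip ip')
      finally show "(\<Sum>q\<in>I \<times> J. ?em q (?pr q (pure_tensor (rspace E) (rspace F) v w))) = pure_tensor (rspace E) (rspace F) v w" .
    qed
  qed
qed

section \<open>Sums of two representations\<close>

lemma linear_rep_oplus:
  assumes "linear_rep G A" "linear_rep G B"
  shows "linear_rep G (oplus A B)"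
  using assms unfolding linear_rep_def
  by (auto simp: oplus_def clinear_on_def scaleC_prod_def complex_vector.subspace_def zero_prod_def image_subset_iff)

lemma rep_iso_oplus:
  assumes "rep_iso G A A'" "rep_iso G B B'" "linear_rep G A" "linear_rep G B"
  shows "rep_iso G (oplus A B) (oplus A' B')"
proof -
  obtain \<phi> \<phi>' where \<phi>: "intertwiner G A A' \<phi>" "intertwiner G A' A \<phi>'"
    "\<And>v. v \<in> rspace A \<Longrightarrow> \<phi>' (\<phi> v) = v" "\<And>w. w \<in> rspace A' \<Longrightarrow> \<phi> (\<phi>' w) = w"
    using rep_isoE[OF assms(1,3)] by metis
  obtain \<psi> \<psi>' where \<psi>: "intertwiner G B B' \<psi>" "intertwiner G B' B \<psi>'"
    "\<And>v. v \<in> rspace B \<Longrightarrow> \<psi>' (\<psi> v) = v" "\<And>w. w \<in> rspace B' \<Longrightarrow> \<psi> (\<psi>' w) = w"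
    using rep_isoE[OF assms(2,4)] by metis
  note D = intertwinerD[OF \<phi>(1)] intertwinerD[OF \<phi>(2)] intertwinerD[OF \<psi>(1)] intertwinerD[OF \<psi>(2)]
  show ?thesis
  proof (rule rep_isoI[where \<phi> = "map_prod \<phi> \<psi>" and \<psi> = "map_prod \<phi>' \<psi>'"])
    show "intertwiner G (oplus A B) (oplus A' B') (map_prod \<phi> \<psi>)"
      using D by (auto simp: oplus_def intertwiner_def clinear_on_def scaleC_prod_def)
  qed (use \<phi> \<psi> D in \<open>auto simp: oplus_def\<close>)
qed

lemma rep_iso_oplus_direct_sum:
  "rep_iso G (oplus A B) (direct_sum UNIV (\<lambda>b. if b then A else B))"
proof (rule rep_isoI[where \<phi> = "\<lambda>(v, w) b. if b then v else w" and \<psi> = "\<lambda>u. (u True, u False)"])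
  show "intertwiner G (oplus A B) (direct_sum UNIV (\<lambda>b. if b then A else B)) (\<lambda>(v, w) b. if b then v else w)"
    by (rule intertwinerI) (auto intro!: clinear_onI simp: oplus_def direct_sum_iff direct_sum_action fun_eq_iff scaleC_prod_def)
qed (auto simp: oplus_def direct_sum_iff fun_eq_iff split: if_splits)

section \<open>Complete reducibility and multiplicity-free representations\<close>

definition simple_rep :: "('g, 'a) monoid_scheme \<Rightarrow> ('g, 'v::complex_vector) rep \<Rightarrow> bool"
  where "simple_rep G R \<longleftrightarrow> linear_rep G R \<and> rspace R \<noteq> {0} \<and>
    (\<forall>U. invariant_subspace G R U \<longrightarrow> U = {0} \<or> U = rspace R)"

global_interpretation complex_vector_pair: vector_space_pair
  "scaleC :: complex \<Rightarrow> 'v \<Rightarrow> 'v::complex_vector" "scaleC :: complex \<Rightarrow> 'w \<Rightarrow> 'w::complex_vector"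
  by unfold_locales

section \<open>Invariant subspaces and restriction to them\<close>

lemma invariant_subspaceD:
  assumes "invariant_subspace G R U"
  shows "csubspace U" "U \<subseteq> rspace R" "g \<in> carrier G \<Longrightarrow> v \<in> U \<Longrightarrow> ract R g v \<in> U"
  using assms by (auto simp: invariant_subspace_def)

lemma restrict_space: "rspace (R\<lparr>rspace := U\<rparr>) = U"
  by simp

lemma linear_rep_restrict:
  assumes R: "linear_rep G R" and U: "invariant_subspace G R U"
  shows "linear_rep G (R\<lparr>rspace := U\<rparr>)"
  using invariant_subspaceD[OF U] clinear_on_subset[OF linear_rep_linear[OF R], of _ U]
  unfolding linear_rep_def
  by (auto simp: linear_rep_one[OF R] linear_rep_mult[OF R] subset_iff)

lemma intertwiner_restrict:
  assumes "invariant_subspace G R U"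
  shows "intertwiner G R S \<phi> \<Longrightarrow> intertwiner G (R\<lparr>rspace := U\<rparr>) S \<phi>"
    and "intertwiner G S (R\<lparr>rspace := U\<rparr>) \<psi> \<Longrightarrow> intertwiner G S R \<psi>"
  using invariant_subspaceD(2)[OF assms]
  by (auto simp: intertwiner_def clinear_on_def subset_iff)

lemma invariant_subspace_kernel:
  assumes R: "linear_rep G R" and S: "\<And>i. i \<in> I \<Longrightarrow> linear_rep G (S i)"
    and \<phi>: "\<And>i. i \<in> I \<Longrightarrow> intertwiner G R (S i) (\<phi> i)"
  shows "invariant_subspace G R {v \<in> rspace R. \<forall>i\<in>I. \<phi> i v = 0}"
proof -
  note D = intertwinerD[OF \<phi>]
  note sub = linear_rep_subspace[OF R]
  have "ract (S i) g 0 = 0" if "i \<in> I" "g \<in> carrier G" for i g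
    using that clinear_on_0[OF linear_rep_linear[OF S] linear_rep_subspace[OF S]] by blast
  then have "\<forall>g\<in>carrier G. ract R g ` {v \<in> rspace R. \<forall>i\<in>I. \<phi> i v = 0} \<subseteq> {v \<in> rspace R. \<forall>i\<in>I. \<phi> i v = 0}"
    by (auto simp: linear_rep_closed[OF R] D(3))
  moreover have "csubspace {v \<in> rspace R. \<forall>i\<in>I. \<phi> i v = 0}"
    by (rule complex_vector.subspaceI)
      (auto simp: sub complex_vector.subspace_0 complex_vector.subspace_add complex_vector.subspace_scale
        clinear_on_0[OF D(1) sub] clinear_on_add[OF D(1)] clinear_on_scale[OF D(1)])
  ultimately show ?thesis
    by (auto simp: invariant_subspace_def)
qed

lemma invariant_subspace_image:
  assumes R: "linear_rep G R" and \<phi>: "intertwiner G R S \<phi>" and U: "invariant_subspace G R U"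
  shows "invariant_subspace G S (\<phi> ` U)"
proof -
  note D = intertwinerD[OF \<phi>]
  note sub = invariant_subspaceD(1)[OF U]
  have U': "v \<in> rspace R" if "v \<in> U" for v
    using that invariant_subspaceD(2)[OF U] by auto
  have "csubspace (\<phi> ` U)"
  proof (rule complex_vector.subspaceI)
    show "0 \<in> \<phi> ` U"
      using clinear_on_0[OF D(1) linear_rep_subspace[OF R]] complex_vector.subspace_0[OF sub] by force
    show "x + y \<in> \<phi> ` U" if "x \<in> \<phi> ` U" "y \<in> \<phi> ` U" for x y
      using that by (auto simp: clinear_on_add[OF D(1), symmetric] U' complex_vector.subspace_add[OF sub])
    show "c *\<^sub>C x \<in> \<phi> ` U" if "x \<in> \<phi> ` U" for c x
      using that by (auto simp: clinear_on_scale[OF D(1), symmetric] U' complex_vector.subspace_scale[OF sub])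
  qed
  moreover have "\<forall>g\<in>carrier G. ract S g ` \<phi> ` U \<subseteq> \<phi> ` U"
    by (auto simp: D(3)[symmetric] U' intro!: imageI invariant_subspaceD(3)[OF U])
  ultimately show ?thesis
    by (auto simp: invariant_subspace_def D(2) U')
qed

lemma invariant_subspace_self: "linear_rep G R \<Longrightarrow> invariant_subspace G R (rspace R)"
  by (auto simp: invariant_subspace_def linear_rep_subspace intro: linear_rep_closed)

text \<open>A linear projection p onto U, averaged over its conjugates g p g^-1, commutes with G and
  still fixes U pointwise, because each conjugate does. An invariant complement is then the kernel
  of the averaged projection.\<close>

lemma maschke:
  assumes G: "group G" "finite (carrier G)" and R: "linear_rep G R" and U: "invariant_subspace G R U"
  obtains P where "intertwiner G R (R\<lparr>rspace := U\<rparr>) P" "\<And>u. u \<in> U \<Longrightarrow> P u = u"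
proof -
  interpret group G by fact
  note UD = invariant_subspaceD[OF U]
  note sub = linear_rep_subspace[OF R]
  \<comment> \<open>The projection is a left inverse of the inclusion of U, defined on the whole
    vector space type.\<close>
  obtain p where p: "range p \<subseteq> U" "Vector_Spaces.linear scaleC scaleC p" "\<And>v. v \<in> U \<Longrightarrow> p v = v"
    using complex_vector_pair.linear_exists_left_inverse_on[of "\<lambda>v. v" U] UD(1)
    unfolding csubspace_def by (auto simp: complex_vector.linear_ident)
  have pU: "p v \<in> U" for v using p(1) by auto
  have plin: "clinear_on V p" for V
    using p(2) by (auto simp: clinear_on_def linear_iff_module_hom module_hom.add module_hom.scale)
  define N where "N = (of_nat (card (carrier G)) :: complex)"
  have N0: "N \<noteq> 0" using G(2) one_closed by (auto simp: N_def card_gt_0_iff)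
  define P where "P v = (1 / N) *\<^sub>C (\<Sum>g\<in>carrier G. ract R g (p (ract R (inv\<^bsub>G\<^esub> g) v)))" for v
  have term_in: "ract R g (p v) \<in> U" if "g \<in> carrier G" for g v
    using that pU UD(3) by auto
  have P_in: "P v \<in> U" for v
    unfolding P_def by (intro complex_vector.subspace_scale complex_vector.subspace_sum UD(1) term_in) auto
  show ?thesis
  proof (rule that)
    show "P u = u" if u: "u \<in> U" for u
    proof -
      have "(\<Sum>g\<in>carrier G. ract R g (p (ract R (inv\<^bsub>G\<^esub> g) u))) = (\<Sum>g\<in>carrier G. u)"
        by (rule sum.cong) (use u UD in \<open>auto simp: p(3) linear_rep_inv[OF R G(1)] subset_iff\<close>)
      then show ?thesis
        using N0 complex_vector.sum_constant_scale[of u "carrier G"]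
        by (simp add: P_def scaleC_scaleC scaleC_one N_def)
    qed
    show "intertwiner G R (R\<lparr>rspace := U\<rparr>) P"
    proof (rule intertwinerI)
      have "clinear_on (rspace R) (\<lambda>v. ract R g (p (ract R (inv\<^bsub>G\<^esub> g) v)))" if "g \<in> carrier G" for g
        by (rule clinear_on_compose[OF linear_rep_linear[OF R, of "inv\<^bsub>G\<^esub> g"], where W = UNIV])
          (auto simp: that intro!: clinear_on_compose[OF plin linear_rep_linear[OF R that]] pU
             subsetD[OF UD(2)])
      then show "clinear_on (rspace R) P"
        unfolding P_def by (intro clinear_on_scale_fun clinear_on_sum_fun)
      fix h v assume h: "h \<in> carrier G" and v: "v \<in> rspace R"
      have "(\<Sum>g\<in>carrier G. ract R g (p (ract R (inv\<^bsub>G\<^esub> g) (ract R h v)))) =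
          (\<Sum>g\<in>carrier G. ract R h (ract R g (p (ract R (inv\<^bsub>G\<^esub> g) v))))"
      proof (rule sum.reindex_bij_witness[where i = "\<lambda>g. h \<otimes>\<^bsub>G\<^esub> g" and j = "\<lambda>g. inv\<^bsub>G\<^esub> h \<otimes>\<^bsub>G\<^esub> g"])
        fix g assume g: "g \<in> carrier G"
        have "ract R (inv\<^bsub>G\<^esub> (inv\<^bsub>G\<^esub> h \<otimes>\<^bsub>G\<^esub> g)) v = ract R (inv\<^bsub>G\<^esub> g) (ract R h v)"
          using g h v by (simp add: inv_mult_group linear_rep_mult[OF R])
        moreover have "ract R h (ract R (inv\<^bsub>G\<^esub> h \<otimes>\<^bsub>G\<^esub> g) w) = ract R g w" if "w \<in> U" for w
          using g h that UD(2) by (simp add: linear_rep_mult[OF R, symmetric] m_assoc[symmetric] subset_iff)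
        ultimately show "ract R h (ract R (inv\<^bsub>G\<^esub> h \<otimes>\<^bsub>G\<^esub> g) (p (ract R (inv\<^bsub>G\<^esub> (inv\<^bsub>G\<^esub> h \<otimes>\<^bsub>G\<^esub> g)) v))) =
            ract R g (p (ract R (inv\<^bsub>G\<^esub> g) (ract R h v)))"
          by (simp add: pU)
      qed (use h in \<open>auto simp: m_assoc[symmetric]\<close>)
      also have "\<dots> = ract R h (\<Sum>g\<in>carrier G. ract R g (p (ract R (inv\<^bsub>G\<^esub> g) v)))"
        by (rule clinear_on_sum[OF linear_rep_linear[OF R h] sub, symmetric]) (use term_in UD(2) in auto)
      finally show "P (ract R h v) = ract (R\<lparr>rspace := U\<rparr>) h (P v)"
        unfolding P_def using complex_vector.subspace_sum[OF UD(1), of "carrier G" "\<lambda>g. ract R g (p (ract R (inv\<^bsub>G\<^esub> g) v))"]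
        by (simp add: clinear_on_scale[OF linear_rep_linear[OF R h]] term_in subsetD[OF UD(2)])
    qed (auto simp: P_in)
  qed
qed

text \<open>One half of Schur's lemma: the kernel is an invariant subspace, and \<open>nz\<close>
  keeps it from being the whole space.\<close>

lemma simple_rep_inj:
  assumes S: "simple_rep G S" and T: "linear_rep G T" and \<phi>: "intertwiner G S T \<phi>"
    and nz: "v \<in> rspace S" "\<phi> v \<noteq> 0"
  shows "inj_on \<phi> (rspace S)"
proof -
  have lin: "linear_rep G S" using S by (simp add: simple_rep_def)
  note sub = linear_rep_subspace[OF lin]
  have "{v \<in> rspace S. \<phi> v = 0} \<noteq> rspace S" using nz by auto
  moreover have "invariant_subspace G S {v \<in> rspace S. \<phi> v = 0}"
    using invariant_subspace_kernel[OF lin, of "{()}" "\<lambda>_. T" "\<lambda>_. \<phi>"] T \<phi> by simp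
  ultimately have ker: "{v \<in> rspace S. \<phi> v = 0} = {0}"
    using S by (auto simp: simple_rep_def)
  show ?thesis
  proof (rule inj_onI)
    fix x y assume xy: "x \<in> rspace S" "y \<in> rspace S" "\<phi> x = \<phi> y"
    then have "\<phi> (x - y) = 0"
      by (simp add: clinear_on_diff[OF intertwinerD(1)[OF \<phi>] sub])
    then have "x - y \<in> {v \<in> rspace S. \<phi> v = 0}"
      using xy complex_vector.subspace_diff[OF sub] by simp
    then show "x = y" using ker by simp
  qed
qed

text \<open>The other half of Schur's lemma, for the image of an invariant subspace U, so that it
  also applies to complements and to joint kernels.\<close>

lemma simple_rep_image:
  assumes T: "simple_rep G T" and R: "linear_rep G R" and \<phi>: "intertwiner G R T \<phi>"
    and nz: "v \<in> U" "\<phi> v \<noteq> 0" and U: "invariant_subspace G R U"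
  shows "\<phi> ` U = rspace T"
  using invariant_subspace_image[OF R \<phi> U] T nz unfolding simple_rep_def by blast

lemma simple_rep_iso:
  assumes "simple_rep G S" "simple_rep G T" "intertwiner G S T \<phi>" "v \<in> rspace S" "\<phi> v \<noteq> 0"
  shows "rep_iso G S T"
proof -
  have lin: "linear_rep G S" "linear_rep G T" using assms by (simp_all add: simple_rep_def)
  have "bij_betw \<phi> (rspace S) (rspace T)"
    using simple_rep_inj[OF assms(1) lin(2) assms(3-5)]
      simple_rep_image[OF assms(2) lin(1) assms(3-5) invariant_subspace_self[OF lin(1)]]
    by (simp add: bij_betw_def)
  then show ?thesis
    using intertwinerD[OF assms(3)] by (auto simp: rep_iso_def)
qed

text \<open>Let P be Maschke's projection onto the kernel K of \<psi>. The kernel U of P is a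
  complement of K, so \<psi> is injective on U; it is onto by simplicity, because \<psi>(v - P v) =
  \<psi>(v).\<close>

lemma simple_quotient_splits:
  assumes G: "group G" "finite (carrier G)" and E: "linear_rep G E" and S: "simple_rep G S"
    and \<psi>: "intertwiner G E S \<psi>" and nz: "v \<in> rspace E" "\<psi> v \<noteq> 0"
  obtains U U' where "invariant_subspace G E U" "invariant_subspace G E U'" "U \<inter> U' = {0}"
    "{u + u' | u u'. u \<in> U \<and> u' \<in> U'} = rspace E" "rep_iso G S (E\<lparr>rspace := U\<rparr>)"
proof -
  have linS: "linear_rep G S" using S by (simp add: simple_rep_def)
  define K where "K = {v \<in> rspace E. \<psi> v = 0}"
  have K: "invariant_subspace G E K"
    using invariant_subspace_kernel[OF E, of "{()}" "\<lambda>_. S" "\<lambda>_. \<psi>"] linS \<psi> by (simp add: K_def)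
  obtain P where P: "intertwiner G E (E\<lparr>rspace := K\<rparr>) P" "\<And>u. u \<in> K \<Longrightarrow> P u = u"
    using maschke[OF G E K] by metis
  define U where "U = {v \<in> rspace E. P v = 0}"
  have U: "invariant_subspace G E U"
    using invariant_subspace_kernel[OF E, of "{()}" "\<lambda>_. E\<lparr>rspace := K\<rparr>" "\<lambda>_. P"] P(1) linear_rep_restrict[OF E K]
    by (simp add: U_def)
  note sub = linear_rep_subspace[OF E]
  note PD = intertwinerD[OF P(1)] and \<psi>D = intertwinerD[OF \<psi>]
  have PK: "P v \<in> K" "P v \<in> rspace E" if "v \<in> rspace E" for v
    using PD(2)[OF that] by (auto simp: K_def)
  have diff: "v - P v \<in> U" if "v \<in> rspace E" for v
    using that PK[OF that] P(2)[OF PK(1)[OF that]]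
    by (simp add: U_def complex_vector.subspace_diff[OF sub] clinear_on_diff[OF PD(1) sub])
  have inter: "U \<inter> K = {0}"
    using complex_vector.subspace_0[OF invariant_subspaceD(1)[OF U]]
      complex_vector.subspace_0[OF invariant_subspaceD(1)[OF K]] P(2) by (auto simp: U_def)
  have sum: "{u + u' | u u'. u \<in> U \<and> u' \<in> K} = rspace E"
  proof (intro equalityI subsetI)
    show "x \<in> {u + u' | u u'. u \<in> U \<and> u' \<in> K}" if "x \<in> rspace E" for x
      using diff[OF that] PK(1)[OF that] by (intro CollectI exI[of _ "x - P x"] exI[of _ "P x"]) simp
  qed (auto simp: U_def K_def complex_vector.subspace_add[OF sub])
  have \<psi>U: "\<psi> (v - P v) = \<psi> v" if "v \<in> rspace E" for v
    using that PK[OF that] by (simp add: clinear_on_diff[OF \<psi>D(1) sub] K_def)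
  have "inj_on \<psi> U"
  proof (rule inj_onI)
    fix x y assume xy: "x \<in> U" "y \<in> U" "\<psi> x = \<psi> y"
    then have "x - y \<in> U \<inter> K"
      using complex_vector.subspace_diff[OF invariant_subspaceD(1)[OF U]] invariant_subspaceD(2)[OF U]
      by (auto simp: K_def clinear_on_diff[OF \<psi>D(1) sub] complex_vector.subspace_diff[OF sub] subset_iff)
    then show "x = y" using inter by simp
  qed
  moreover have "\<psi> ` U = rspace S"
    by (rule simple_rep_image[OF S E \<psi> diff[OF nz(1)] _ U]) (simp add: \<psi>U nz)
  ultimately have "rep_iso G (E\<lparr>rspace := U\<rparr>) S"
    using intertwinerD[OF intertwiner_restrict(1)[OF U \<psi>]] by (auto simp: rep_iso_def bij_betw_def)
  then have "rep_iso G S (E\<lparr>rspace := U\<rparr>)"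
    by (rule rep_iso_sym[OF _ linear_rep_restrict[OF E U]])
  then show ?thesis
    using that[OF U K inter sum] by blast
qed

text \<open>Maschke's projection onto U, followed by the inverse isomorphism, extends that inverse
  to all of E.\<close>

lemma simple_sub_retract:
  assumes G: "group G" "finite (carrier G)" and E: "linear_rep G E" and S: "linear_rep G S"
    and U: "invariant_subspace G E U" and iso: "rep_iso G S (E\<lparr>rspace := U\<rparr>)"
  obtains \<phi> \<psi> where "intertwiner G S (E\<lparr>rspace := U\<rparr>) \<phi>" "intertwiner G E S \<psi>" "\<And>v. v \<in> rspace S \<Longrightarrow> \<psi> (\<phi> v) = v"
    "\<And>u. u \<in> U \<Longrightarrow> \<phi> (\<psi> u) = u"
proof -
  obtain \<phi> \<theta> where \<phi>: "intertwiner G S (E\<lparr>rspace := U\<rparr>) \<phi>" "intertwiner G (E\<lparr>rspace := U\<rparr>) S \<theta>"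
    "\<And>v. v \<in> rspace S \<Longrightarrow> \<theta> (\<phi> v) = v" "\<And>w. w \<in> U \<Longrightarrow> \<phi> (\<theta> w) = w"
    using rep_isoE[OF iso S] by (metis restrict_space)
  obtain P where P: "intertwiner G E (E\<lparr>rspace := U\<rparr>) P" "\<And>u. u \<in> U \<Longrightarrow> P u = u"
    using maschke[OF G E U] by metis
  show ?thesis
  proof (rule that[OF \<phi>(1) intertwiner_compose[OF P(1) \<phi>(2)]])
    show "\<theta> (P (\<phi> v)) = v" if "v \<in> rspace S" for v
      using \<phi>(3)[OF that] P(2) intertwinerD(2)[OF \<phi>(1) that] by simp
    show "\<phi> (\<theta> (P u)) = u" if "u \<in> U" for u
      using \<phi>(4)[OF that] P(2)[OF that] by simp
  qed
qed

text \<open>By complete reducibility, occurring as a summand is the same as occurring as a quotient.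
  This translates the definitions of \<open>bar\<close> and its variants into statements about
  intertwiners out of E.\<close>

lemma summand_iff:
  assumes G: "group G" "finite (carrier G)" and E: "linear_rep G E" and S: "simple_rep G S"
  shows "summand G S E \<longleftrightarrow> (\<exists>\<psi>. intertwiner G E S \<psi> \<and> (\<exists>v\<in>rspace E. \<psi> v \<noteq> 0))"
proof
  assume "summand G S E"
  then obtain U where U: "invariant_subspace G E U" and iso: "rep_iso G S (E\<lparr>rspace := U\<rparr>)"
    by (auto simp: summand_def)
  have linS: "linear_rep G S" using S by (simp add: simple_rep_def)
  obtain \<phi> \<psi> where \<phi>: "intertwiner G S (E\<lparr>rspace := U\<rparr>) \<phi>" and \<psi>: "intertwiner G E S \<psi>" "\<And>v. v \<in> rspace S \<Longrightarrow> \<psi> (\<phi> v) = v"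
    using simple_sub_retract[OF G E linS U iso] by metis
  obtain v where "v \<in> rspace S" "v \<noteq> 0"
    using S complex_vector.subspace_0[OF linear_rep_subspace[OF linS]] by (auto simp: simple_rep_def)
  then show "\<exists>\<psi>. intertwiner G E S \<psi> \<and> (\<exists>v\<in>rspace E. \<psi> v \<noteq> 0)"
    using \<psi> intertwinerD(2)[OF \<phi>] invariant_subspaceD(2)[OF U]
    by (intro exI[of _ \<psi>] conjI bexI[of _ "\<phi> v"]) auto
next
  assume "\<exists>\<psi>. intertwiner G E S \<psi> \<and> (\<exists>v\<in>rspace E. \<psi> v \<noteq> 0)"
  then obtain \<psi> v where \<psi>: "intertwiner G E S \<psi>" "v \<in> rspace E" "\<psi> v \<noteq> 0" by auto
  show "summand G S E"
    by (rule simple_quotient_splits[OF G E S \<psi>]) (unfold summand_def, intro exI conjI)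
qed

text \<open>One nonzero map \<open>\<psi> i\<close> is chosen from E to each \<open>S i\<close> that
  occurs. Together they form the isomorphism: \<open>mf\<close> makes the joint map injective and
  \<open>noniso\<close> makes it onto.\<close>

theorem multiplicity_free_decomposition:
  assumes G: "group G" "finite (carrier G)" and E: "linear_rep G E" and fin: "finite P"
    and S: "\<And>i. i \<in> P \<Longrightarrow> simple_rep G (S i)"
    and noniso: "\<And>i j. i \<in> P \<Longrightarrow> j \<in> P \<Longrightarrow> rep_iso G (S i) (S j) \<Longrightarrow> i = j"
    and ex: "\<And>U. invariant_subspace G E U \<Longrightarrow> U \<noteq> {0} \<Longrightarrow>
      \<exists>i\<in>P. \<exists>\<phi>. intertwiner G (S i) (E\<lparr>rspace := U\<rparr>) \<phi> \<and> (\<exists>v\<in>rspace (S i). \<phi> v \<noteq> 0)"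
    and mf: "\<And>i \<phi> \<psi> v. i \<in> P \<Longrightarrow> intertwiner G E (S i) \<phi> \<Longrightarrow> intertwiner G E (S i) \<psi> \<Longrightarrow>
      v \<in> rspace E \<Longrightarrow> \<phi> v \<noteq> 0 \<Longrightarrow> \<exists>c. \<forall>v\<in>rspace E. \<psi> v = c *\<^sub>C \<phi> v"
  shows "rep_iso G E (direct_sum {i \<in> P. summand G (S i) E} S)"
proof -
  define J where "J = {i \<in> P. summand G (S i) E}"
  have finJ: "finite J" using fin by (simp add: J_def)
  have JP: "i \<in> P" if "i \<in> J" for i using that by (simp add: J_def)
  have linS: "linear_rep G (S i)" if "i \<in> P" for i using S[OF that] by (simp add: simple_rep_def)
  note sub = linear_rep_subspace[OF E]
  have "\<forall>i\<in>J. \<exists>\<psi>. intertwiner G E (S i) \<psi> \<and> (\<exists>v\<in>rspace E. \<psi> v \<noteq> 0)"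
    using summand_iff[OF G E S] by (auto simp: J_def)
  then obtain \<psi> where \<psi>: "\<And>i. i \<in> J \<Longrightarrow> intertwiner G E (S i) (\<psi> i)" "\<And>i. i \<in> J \<Longrightarrow> \<exists>v\<in>rspace E. \<psi> i v \<noteq> 0"
    by metis
  note \<psi>D = intertwinerD[OF \<psi>(1)]
  define K where "K I = {v \<in> rspace E. \<forall>i\<in>I. \<psi> i v = 0}" for I
  have K: "invariant_subspace G E (K I)" if "I \<subseteq> J" for I
    unfolding K_def by (rule invariant_subspace_kernel[OF E, of _ S]) (use that \<psi> linS JP in auto)
  \<comment> \<open>A constituent \<open>S i\<close> of the joint kernel splits off E by a
    retraction \<chi>, so i belongs to J. By \<open>mf\<close> the retraction is a multiple of
    \<open>\<psi> i\<close>, which vanishes on the joint kernel, while \<chi> does not.\<close>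
  have KJ: "K J = {0}"
  proof (rule ccontr)
    assume "K J \<noteq> {0}"
    then obtain i \<phi> v where i: "i \<in> P" and \<phi>: "intertwiner G (S i) (E\<lparr>rspace := K J\<rparr>) \<phi>"
      and v: "v \<in> rspace (S i)" "\<phi> v \<noteq> 0"
      using ex[OF K] by blast
    have \<phi>E: "intertwiner G (S i) E \<phi>"
      using intertwiner_restrict(2)[OF K \<phi>] by simp
    define U where "U = \<phi> ` rspace (S i)"
    have U: "invariant_subspace G E U"
      unfolding U_def by (rule invariant_subspace_image[OF linS[OF i] \<phi>E invariant_subspace_self[OF linS[OF i]]])
    have "rep_iso G (S i) (E\<lparr>rspace := U\<rparr>)"
      using simple_rep_inj[OF S[OF i] E \<phi>E v] intertwinerD[OF \<phi>E]
      by (auto simp: rep_iso_def bij_betw_def U_def)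
    from simple_sub_retract[OF G E linS[OF i] U this]
    obtain \<phi>' \<chi> where \<phi>': "intertwiner G (S i) (E\<lparr>rspace := U\<rparr>) \<phi>'" and \<chi>: "intertwiner G E (S i) \<chi>"
        "\<And>v. v \<in> rspace (S i) \<Longrightarrow> \<chi> (\<phi>' v) = v" "\<And>u. u \<in> U \<Longrightarrow> \<phi>' (\<chi> u) = u"
      by metis
    have "\<phi> v \<in> U" "\<phi> v \<in> rspace E" using v intertwinerD(2)[OF \<phi>E] by (auto simp: U_def)
    moreover have "\<phi>' 0 = 0"
      by (rule clinear_on_0[OF intertwinerD(1)[OF \<phi>'] linear_rep_subspace[OF linS[OF i]]])
    ultimately have \<chi>v: "\<chi> (\<phi> v) \<noteq> 0"
      using \<chi>(3)[of "\<phi> v"] v(2) by auto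
    then have iJ: "i \<in> J"
      using i \<chi>(1) \<open>\<phi> v \<in> rspace E\<close> by (auto simp: J_def summand_iff[OF G E S[OF i]])
    obtain w where "w \<in> rspace E" "\<psi> i w \<noteq> 0" using \<psi>(2)[OF iJ] by auto
    then obtain c where "\<forall>v\<in>rspace E. \<chi> v = c *\<^sub>C \<psi> i v"
      using mf[OF i \<psi>(1)[OF iJ] \<chi>(1)] by blast
    moreover have "\<psi> i (\<phi> v) = 0"
      using intertwinerD(2)[OF \<phi> v(1)] iJ by (simp add: K_def)
    ultimately show False
      using \<chi>v \<open>\<phi> v \<in> rspace E\<close> by simp
  qed
  \<comment> \<open>If \<open>\<psi> i\<close> vanished on the joint kernel of the other maps, that
    kernel would lie in \<open>K J\<close> and be zero. A copy of \<open>S i\<close> inside E would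
    then be seen by some \<open>\<psi> j\<close> with j \<noteq> i, and \<open>S i\<close> would be
    isomorphic to \<open>S j\<close>.\<close>
  have surj: "\<psi> i ` K (J - {i}) = rspace (S i)" if i: "i \<in> J" for i
  proof -
    have "\<exists>v\<in>K (J - {i}). \<psi> i v \<noteq> 0"
    proof (rule ccontr)
      assume neg: "\<not> (\<exists>v\<in>K (J - {i}). \<psi> i v \<noteq> 0)"
      then have Ki: "K (J - {i}) \<subseteq> {0}"
        using KJ by (auto simp: K_def)
      obtain w where w: "w \<in> rspace E" "\<psi> i w \<noteq> 0" using \<psi>(2)[OF i] by auto
      from simple_quotient_splits[OF G E S[OF JP[OF i]] \<psi>(1)[OF i] w]
      obtain U where U: "invariant_subspace G E U" and iso: "rep_iso G (S i) (E\<lparr>rspace := U\<rparr>)"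
        by metis
      obtain \<phi> \<chi> where \<phi>: "intertwiner G (S i) (E\<lparr>rspace := U\<rparr>) \<phi>" and \<chi>: "\<And>v. v \<in> rspace (S i) \<Longrightarrow> \<chi> (\<phi> v) = v"
        using simple_sub_retract[OF G E linS[OF JP[OF i]] U iso] by metis
      have \<phi>E: "intertwiner G (S i) E \<phi>" using intertwiner_restrict(2)[OF U \<phi>] by simp
      obtain v where v: "v \<in> rspace (S i)" "v \<noteq> 0"
        using S[OF JP[OF i]] complex_vector.subspace_0[OF linear_rep_subspace[OF linS[OF JP[OF i]]]]
        by (auto simp: simple_rep_def)
      have "\<phi> v \<noteq> 0"
      proof
        assume "\<phi> v = 0"
        moreover have "\<phi> 0 = 0"
          by (rule clinear_on_0[OF intertwinerD(1)[OF \<phi>] linear_rep_subspace[OF linS[OF JP[OF i]]]])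
        ultimately show False
          using \<chi>[OF v(1)] \<chi>[of 0] v complex_vector.subspace_0[OF linear_rep_subspace[OF linS[OF JP[OF i]]]] by simp
      qed
      then have "\<phi> v \<notin> K (J - {i})" using Ki by auto
      then obtain j where j: "j \<in> J" "j \<noteq> i" "\<psi> j (\<phi> v) \<noteq> 0"
        using intertwinerD(2)[OF \<phi>E v(1)] by (auto simp: K_def)
      have "rep_iso G (S i) (S j)"
        by (rule simple_rep_iso[OF S S intertwiner_compose[OF \<phi>E \<psi>(1)] v(1)]) (use i j JP in auto)
      then show False using noniso[OF JP[OF i] JP[OF j(1)]] j by auto
    qed
    then obtain v where "v \<in> K (J - {i})" "\<psi> i v \<noteq> 0" by auto
    then show ?thesis
      by (rule simple_rep_image[OF S[OF JP[OF i]] E \<psi>(1)[OF i]]) (use K in auto)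
  qed
  define \<Psi> where "\<Psi> v = (\<lambda>i. if i \<in> J then \<psi> i v else 0)" for v
  have \<Psi>: "intertwiner G E (direct_sum J S) \<Psi>"
    by (rule intertwinerI) (auto intro!: clinear_onI simp: \<Psi>_def fun_eq_iff direct_sum_iff[OF finJ] direct_sum_action
      \<psi>D(2,3) clinear_on_add[OF \<psi>D(1)] clinear_on_scale[OF \<psi>D(1)])
  have "inj_on \<Psi> (rspace E)"
  proof (rule inj_onI)
    fix x y assume xy: "x \<in> rspace E" "y \<in> rspace E" "\<Psi> x = \<Psi> y"
    have "\<psi> i x = \<psi> i y" if "i \<in> J" for i
      using fun_cong[OF xy(3), of i] that by (simp add: \<Psi>_def)
    then have "x - y \<in> K J"
      using xy by (auto simp: K_def complex_vector.subspace_diff[OF sub] clinear_on_diff[OF \<psi>D(1) sub])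
    then show "x = y" using KJ by simp
  qed
  moreover have "\<Psi> ` rspace E = rspace (direct_sum J S)"
  proof (intro equalityI subsetI)
    show "w \<in> rspace (direct_sum J S)" if "w \<in> \<Psi> ` rspace E" for w
      using that intertwinerD(2)[OF \<Psi>] by auto
    fix w assume w: "w \<in> rspace (direct_sum J S)"
    have "\<forall>i\<in>J. \<exists>v. v \<in> K (J - {i}) \<and> \<psi> i v = w i"
    proof
      fix i assume i: "i \<in> J"
      then have "w i \<in> \<psi> i ` K (J - {i})"
        using w by (simp add: surj direct_sum_iff[OF finJ])
      then show "\<exists>v. v \<in> K (J - {i}) \<and> \<psi> i v = w i" by auto
    qed
    then obtain v where v: "\<And>i. i \<in> J \<Longrightarrow> v i \<in> K (J - {i})" "\<And>i. i \<in> J \<Longrightarrow> \<psi> i (v i) = w i"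
      by metis
    have vE: "v i \<in> rspace E" if "i \<in> J" for i using v(1)[OF that] by (simp add: K_def)
    have "\<psi> j (\<Sum>i\<in>J. v i) = w j" if j: "j \<in> J" for j
    proof -
      have "\<psi> j (\<Sum>i\<in>J. v i) = (\<Sum>i\<in>J. \<psi> j (v i))"
        by (rule clinear_on_sum[OF \<psi>D(1)[OF j] sub]) (use vE in auto)
      also have "\<dots> = (\<Sum>i\<in>J. if i = j then w j else 0)"
        by (rule sum.cong) (use v j in \<open>auto simp: K_def\<close>)
      finally show ?thesis using finJ j by simp
    qed
    then have "\<Psi> (\<Sum>i\<in>J. v i) = w"
      using w by (auto simp: \<Psi>_def fun_eq_iff direct_sum_iff[OF finJ])
    moreover have "(\<Sum>i\<in>J. v i) \<in> rspace E"
      by (rule complex_vector.subspace_sum[OF sub]) (rule vE)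
    ultimately show "w \<in> \<Psi> ` rspace E" by blast
  qed
  ultimately show ?thesis
    using intertwinerD[OF \<Psi>] unfolding J_def[symmetric] rep_iso_def bij_betw_def by blast
qed

text \<open>The injective half of Frobenius reciprocity: a map out of the induced representation is
  determined by its composite with w \<mapsto> bracket of w at the identity, which is an intertwiner
  over H. Proportionality over H therefore lifts to G.\<close>

lemma frobenius_proportional:
  assumes hom: "group_hom H G \<iota>" and fin: "finite (carrier G)" "finite (carrier H)"
    and R: "linear_rep H R" and S: "linear_rep G S"
    and mf: "\<And>f f' v. intertwiner H R (pullback \<iota> S) f \<Longrightarrow> intertwiner H R (pullback \<iota> S) f' \<Longrightarrow>
      v \<in> rspace R \<Longrightarrow> f v \<noteq> 0 \<Longrightarrow> \<exists>c. \<forall>v\<in>rspace R. f' v = c *\<^sub>C f v"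
    and \<phi>: "intertwiner G (induced G H \<iota> R) S \<phi>" and \<psi>: "intertwiner G (induced G H \<iota> R) S \<psi>"
    and nz: "u0 \<in> rspace (induced G H \<iota> R)" "\<phi> u0 \<noteq> 0"
  shows "\<exists>c. \<forall>u\<in>rspace (induced G H \<iota> R). \<psi> u = c *\<^sub>C \<phi> u"
proof -
  interpret G: group G by (rule group_hom.axioms(2)[OF hom])
  interpret H: group H by (rule group_hom.axioms(1)[OF hom])
  interpret hom: group_hom H G \<iota> by (rule hom)
  let ?E = "induced G H \<iota> R"
  define b where "b = bracket G H \<iota> R \<one>\<^bsub>G\<^esub>"
  note E = linear_rep_induced[OF hom R]
  define N where "N = (of_nat (card (carrier H)) :: complex)"
  have N0: "N \<noteq> 0" using fin(2) H.one_closed by (auto simp: N_def card_gt_0_iff)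
  have b_in: "b w \<in> rspace ?E" if "w \<in> rspace R" for w
    unfolding b_def using bracket_in[OF hom R _ that] by simp
  have b_tr: "bracket G H \<iota> R x w = ract ?E x (b w)" if "w \<in> rspace R" "x \<in> carrier G" for x w
  proof (rule induced_eqI[OF bracket_in[OF hom R that(2,1)] linear_rep_closed[OF E that(2) b_in[OF that(1)]]])
    fix y assume "y \<in> carrier G"
    then show "bracket G H \<iota> R x w y = ract ?E x (b w) y"
      using that by (auto simp: b_def bracket_def induced_action G.inv_solve_left' intro!: sum.cong)
  qed
  have b_int: "intertwiner H R (pullback \<iota> ?E) b"
  proof (rule intertwinerI)
    show "clinear_on (rspace R) b"
      unfolding b_def by (rule bracket_linear[OF H.is_group R])
    fix k w assume k: "k \<in> carrier H" and w: "w \<in> rspace R"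
    have kw: "ract R k w \<in> rspace R" using linear_rep_closed[OF R k w] .
    have "b (ract R k w) = bracket G H \<iota> R (\<iota> k) w"
    proof
      fix y
      show "b (ract R k w) y = bracket G H \<iota> R (\<iota> k) w y"
        unfolding b_def bracket_def
        by (rule sum.reindex_bij_witness[where i = "\<lambda>h. k \<otimes>\<^bsub>H\<^esub> h" and j = "\<lambda>h. inv\<^bsub>H\<^esub> k \<otimes>\<^bsub>H\<^esub> h"])
          (use k w in \<open>auto simp: H.m_assoc[symmetric] G.m_assoc[symmetric] H.inv_mult_group linear_rep_mult[OF R]\<close>)
    qed
    then show "b (ract R k w) = ract (pullback \<iota> ?E) k (b w)"
      using b_tr[OF w, of "\<iota> k"] k by simp
  qed (use b_in in auto)
  have comp: "intertwiner H R (pullback \<iota> S) (\<lambda>w. \<chi> (b w))" if "intertwiner G ?E S \<chi>" for \<chi>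
    by (rule intertwiner_compose[OF b_int]) (use that in \<open>auto simp: intertwiner_def\<close>)
  \<comment> \<open>The expansion of u in brackets, each of which is the translate by x of a bracket
    at the identity.\<close>
  have formula: "\<chi> u = (1 / N) *\<^sub>C (\<Sum>x\<in>carrier G. ract S x (\<chi> (b (u x))))"
    if \<chi>: "intertwiner G ?E S \<chi>" and u: "u \<in> rspace ?E" for \<chi> u
  proof -
    note D = intertwinerD[OF \<chi>]
    have "N *\<^sub>C \<chi> u = \<chi> (\<Sum>x\<in>carrier G. bracket G H \<iota> R x (u x))"
      unfolding sum_bracket[OF hom R fin(1) u] N_def using u by (simp add: clinear_on_scale[OF D(1)])
    also have "\<dots> = (\<Sum>x\<in>carrier G. \<chi> (bracket G H \<iota> R x (u x)))"
      by (rule clinear_on_sum[OF D(1) linear_rep_subspace[OF E]])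
        (use u in \<open>auto intro: bracket_in[OF hom R] dest: inducedD(1)\<close>)
    also have "\<dots> = (\<Sum>x\<in>carrier G. ract S x (\<chi> (b (u x))))"
      by (rule sum.cong) (use u in \<open>auto simp: b_tr inducedD(1)[OF u] D(3) b_in\<close>)
    finally show ?thesis
      using N0 by (metis (no_types, lifting) divide_self_if scaleC_one scaleC_scaleC times_divide_eq_left mult_1)
  qed
  have "\<exists>w\<in>rspace R. \<phi> (b w) \<noteq> 0"
  proof (rule ccontr)
    assume "\<not> (\<exists>w\<in>rspace R. \<phi> (b w) \<noteq> 0)"
    then have "\<phi> (b (u0 x)) = 0" if "x \<in> carrier G" for x
      using inducedD(1)[OF nz(1) that] by blast
    then have "\<phi> u0 = 0"
      using clinear_on_0[OF linear_rep_linear[OF S] linear_rep_subspace[OF S]]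
      by (simp add: formula[OF \<phi> nz(1)])
    then show False using nz(2) by simp
  qed
  then obtain c where c: "\<forall>w\<in>rspace R. \<psi> (b w) = c *\<^sub>C \<phi> (b w)"
    using mf[OF comp[OF \<phi>] comp[OF \<psi>]] by blast
  have "\<psi> u = c *\<^sub>C \<phi> u" if u: "u \<in> rspace ?E" for u
  proof -
    have "(\<Sum>x\<in>carrier G. ract S x (\<psi> (b (u x)))) = (\<Sum>x\<in>carrier G. c *\<^sub>C ract S x (\<phi> (b (u x))))"
      by (rule sum.cong) (use inducedD(1)[OF u] c in
        \<open>auto simp: clinear_on_scale[OF linear_rep_linear[OF S]] intertwinerD(2)[OF \<phi>] b_in\<close>)
    then show ?thesis
      by (simp add: formula[OF \<phi> u] formula[OF \<psi> u] complex_vector.scale_sum_right[symmetric] complex_vector.scale_left_commute)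
  qed
  then show ?thesis by blast
qed

section \<open>Conjugacy of permutations\<close>

text \<open>Only forward iterates are taken: for a permutation of a finite set the inverse is itself
  a power, so this is already the full cycle, as \<open>cycle_of_eq\<close> and
  \<open>cycle_of_inv\<close> confirm.\<close>

definition cycle_of :: "('a \<Rightarrow> 'a) \<Rightarrow> 'a \<Rightarrow> 'a set"
  where "cycle_of f x = range (\<lambda>n. (f ^^ n) x)"

lemma permutes_funpow: "f permutes A \<Longrightarrow> (f ^^ n) permutes A"
  by (induction n) (auto simp: permutes_compose permutes_id[unfolded id_def] id_def)

lemma cycle_of_period:
  assumes f: "f permutes A" and fin: "finite A" and x: "x \<in> A"
  shows "finite (cycle_of f x)" "card (cycle_of f x) > 0" "cycle_of f x \<subseteq> A"
    and "(f ^^ i) x = (f ^^ j) x \<longleftrightarrow> i mod card (cycle_of f x) = j mod card (cycle_of f x)"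
proof -
  have in_A: "(f ^^ n) x \<in> A" for n
    using permutes_in_image[OF permutes_funpow[OF f]] x by simp
  show sub: "cycle_of f x \<subseteq> A"
    using in_A by (auto simp: cycle_of_def)
  show fin': "finite (cycle_of f x)"
    using sub fin finite_subset by blast
  show pos: "card (cycle_of f x) > 0"
    using fin' by (auto simp: card_gt_0_iff cycle_of_def)
  have cancel: "(f ^^ (j - i)) x = x" if "(f ^^ i) x = (f ^^ j) x" "i \<le> j" for i j
  proof -
    have "(f ^^ i) ((f ^^ (j - i)) x) = (f ^^ i) x"
      using that by (simp flip: funpow_add[unfolded comp_def fun_eq_iff, rule_format])
    then show ?thesis
      using permutes_inj[OF permutes_funpow[OF f, of i]] by (simp add: inj_def)
  qed
  have "\<not> inj (\<lambda>n. (f ^^ n) x)"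
    using fin' finite_imageD[of "\<lambda>n. (f ^^ n) x" UNIV] by (auto simp: cycle_of_def)
  then obtain k l where "k < l" "(f ^^ k) x = (f ^^ l) x"
    unfolding inj_def by (metis nat_neq_iff)
  then have ex: "\<exists>p. p > 0 \<and> (f ^^ p) x = x"
    using cancel[of k l] by (intro exI[of _ "l - k"]) auto
  \<comment> \<open>The least period of x, which turns out to be the length of its cycle.\<close>
  define p where "p = (LEAST p. p > 0 \<and> (f ^^ p) x = x)"
  have p: "p > 0" "(f ^^ p) x = x"
    using LeastI_ex[OF ex] by (simp_all add: p_def)
  have least: "p \<le> q" if "q > 0" "(f ^^ q) x = x" for q
    unfolding p_def by (rule Least_le) (use that in auto)
  have mod: "(f ^^ n) x = (f ^^ (n mod p)) x" for n
    by (rule funpow_mod_eq[symmetric, OF p(2)])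
  have inj: "i = j" if "i < p" "j < p" "(f ^^ i) x = (f ^^ j) x" for i j
    using that
  proof (induction i j rule: linorder_wlog)
    case (le i j)
    show ?case
    proof (rule ccontr)
      assume "i \<noteq> j"
      then have "p \<le> j - i"
        using least[of "j - i"] cancel[of i j] le by simp
      then show False using le by simp
    qed
  qed simp
  have "cycle_of f x = (\<lambda>n. (f ^^ n) x) ` {..<p}"
    using mod p(1) by (auto simp: cycle_of_def) (metis imageI lessThan_iff mod_less_divisor)
  then have card: "card (cycle_of f x) = p"
    using inj by (simp add: card_image inj_on_def)
  show "(f ^^ i) x = (f ^^ j) x \<longleftrightarrow> i mod card (cycle_of f x) = j mod card (cycle_of f x)"
    unfolding card using mod[of i] mod[of j] inj[of "i mod p" "j mod p"] p(1) by auto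
qed

lemma cycle_of_self: "x \<in> cycle_of f x"
  unfolding cycle_of_def by (rule range_eqI[of _ _ 0]) simp

lemma cycle_of_eq:
  assumes f: "f permutes A" and fin: "finite A" and x: "x \<in> A" and y: "y \<in> cycle_of f x"
  shows "cycle_of f y = cycle_of f x"
proof -
  obtain k where k: "y = (f ^^ k) x" using y by (auto simp: cycle_of_def)
  let ?m = "card (cycle_of f x)"
  note per = cycle_of_period[OF f fin x]
  \<comment> \<open>On a cycle of length ?m, another ?m - 1 steps undo one step, so k (?m - 1) steps
    lead from y back to x.\<close>
  have "(f ^^ n) x = (f ^^ (n + k * (?m - 1))) y" for n
  proof -
    have "n + k * (?m - 1) + k = n + k * ?m"
      using per(2) by (cases ?m) auto
    then have "(f ^^ (n + k * (?m - 1))) y = (f ^^ (n + k * ?m)) x"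
      unfolding k by (metis funpow_add comp_apply)
    also have "\<dots> = (f ^^ n) x"
      by (subst per(4)) simp
    finally show ?thesis by simp
  qed
  then have "cycle_of f x \<subseteq> cycle_of f y"
    unfolding cycle_of_def by blast
  moreover have "cycle_of f y \<subseteq> cycle_of f x"
  proof
    fix z assume "z \<in> cycle_of f y"
    then obtain n where "z = (f ^^ n) ((f ^^ k) x)" by (auto simp: cycle_of_def k)
    then have "z = (f ^^ (n + k)) x" by (simp add: funpow_add)
    then show "z \<in> cycle_of f x" by (auto simp: cycle_of_def)
  qed
  ultimately show ?thesis by simp
qed

definition cycles :: "'a set \<Rightarrow> ('a \<Rightarrow> 'a) \<Rightarrow> 'a set set"
  where "cycles A f = cycle_of f ` A"

lemma cyclesD:
  assumes f: "f permutes A" and fin: "finite A" and C: "C \<in> cycles A f" "y \<in> C"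
  shows "y \<in> A" "cycle_of f y = C"
proof -
  obtain x where x: "x \<in> A" "C = cycle_of f x" using C(1) by (auto simp: cycles_def)
  show "y \<in> A" using cycle_of_period(3)[OF f fin x(1)] C(2) x(2) by auto
  show "cycle_of f y = C" using cycle_of_eq[OF f fin x(1)] C(2) x(2) by simp
qed

text \<open>Each cycle of f is laid over its partner cycle of g step by step, starting from the base
  points. The base points are free, and choosing them well later controls where marked points
  go.\<close>

lemma conjugating_permutation:
  assumes f: "f permutes A" and g: "g permutes A" and fin: "finite A"
    and bij: "bij_betw \<beta> (cycles A f) (cycles A g)"
    and card: "\<And>C. C \<in> cycles A f \<Longrightarrow> card (\<beta> C) = card C"
    and x: "\<And>C. C \<in> cycles A f \<Longrightarrow> x C \<in> C" and y: "\<And>C. C \<in> cycles A g \<Longrightarrow> y C \<in> C"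
  obtains h where "h permutes A" "h \<circ> f = g \<circ> h"
    "\<And>C k. C \<in> cycles A f \<Longrightarrow> h ((f ^^ k) (x C)) = (g ^^ k) (y (\<beta> C))"
proof -
  have xA: "x C \<in> A" "cycle_of f (x C) = C" if "C \<in> cycles A f" for C
    using cyclesD[OF f fin that x[OF that]] by auto
  have yA: "y C \<in> A" "cycle_of g (y C) = C" if "C \<in> cycles A g" for C
    using cyclesD[OF g fin that y[OF that]] by auto
  have \<beta>: "\<beta> C \<in> cycles A g" if "C \<in> cycles A f" for C
    using that bij by (auto simp: bij_betw_def)
  \<comment> \<open>The exponent is determined only modulo the length of the cycle of f; as the
    partner cycle of g has the same length, the image does not depend on the exponent that is
    picked.\<close>
  define h where "h a = (if a \<in> A then
      (g ^^ (SOME k. (f ^^ k) (x (cycle_of f a)) = a)) (y (\<beta> (cycle_of f a))) else a)" for a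
  have cyc: "cycle_of f ((f ^^ k) (x C)) = C" "(f ^^ k) (x C) \<in> A" if "C \<in> cycles A f" for C k
  proof -
    have "(f ^^ k) (x C) \<in> cycle_of f (x C)" by (auto simp: cycle_of_def)
    then show "cycle_of f ((f ^^ k) (x C)) = C" "(f ^^ k) (x C) \<in> A"
      using cycle_of_eq[OF f fin xA(1)[OF that]] cycle_of_period(3)[OF f fin xA(1)[OF that]] xA(2)[OF that] by auto
  qed
  have hk: "h ((f ^^ k) (x C)) = (g ^^ k) (y (\<beta> C))" if C: "C \<in> cycles A f" for C k
  proof -
    define l where "l = (SOME l. (f ^^ l) (x C) = (f ^^ k) (x C))"
    have "(f ^^ l) (x C) = (f ^^ k) (x C)"
      unfolding l_def by (rule someI_ex) auto
    then have "l mod card C = k mod card C"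
      using cycle_of_period(4)[OF f fin xA(1)[OF C]] xA(2)[OF C] by simp
    then have "(g ^^ l) (y (\<beta> C)) = (g ^^ k) (y (\<beta> C))"
      using cycle_of_period(4)[OF g fin yA(1)[OF \<beta>[OF C]]] yA(2)[OF \<beta>[OF C]] card[OF C] by simp
    then show ?thesis
      using cyc[OF C, of k] by (simp add: h_def l_def)
  qed
  have rep: "\<exists>C\<in>cycles A f. \<exists>k. a = (f ^^ k) (x C)" if "a \<in> A" for a
  proof -
    have C: "cycle_of f a \<in> cycles A f" using that by (auto simp: cycles_def)
    have "a \<in> cycle_of f (x (cycle_of f a))"
      using cycle_of_self[of a f] xA(2)[OF C] by simp
    then show ?thesis using C by (auto simp: cycle_of_def)
  qed
  have hA: "h a \<in> A" if a: "a \<in> A" for a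
  proof -
    obtain C k where C: "C \<in> cycles A f" "a = (f ^^ k) (x C)" using rep[OF a] by auto
    then show ?thesis
      using hk[OF C(1)] permutes_in_image[OF permutes_funpow[OF g]] yA(1)[OF \<beta>[OF C(1)]] by simp
  qed
  have "inj_on h A"
  proof (rule inj_onI)
    fix a b assume ab: "a \<in> A" "b \<in> A" "h a = h b"
    obtain C k where C: "C \<in> cycles A f" "a = (f ^^ k) (x C)" using rep[OF ab(1)] by auto
    obtain C' l where C': "C' \<in> cycles A f" "b = (f ^^ l) (x C')" using rep[OF ab(2)] by auto
    have eq: "(g ^^ k) (y (\<beta> C)) = (g ^^ l) (y (\<beta> C'))"
      using ab(3) hk C C' by simp
    have "cycle_of g ((g ^^ k) (y (\<beta> C))) = \<beta> C" if "C \<in> cycles A f" for C k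
      by (rule cycle_of_eq[OF g fin yA(1)[OF \<beta>[OF that]], unfolded yA(2)[OF \<beta>[OF that]]])
        (use yA(2)[OF \<beta>[OF that]] in \<open>auto simp: cycle_of_def\<close>)
    from this[OF C(1)] this[OF C'(1)]
    have "\<beta> C = \<beta> C'" using eq by metis
    then have "C = C'" using bij C C' by (auto simp: bij_betw_def inj_on_def)
    moreover from this have "k mod card C = l mod card C"
      using eq cycle_of_period(4)[OF g fin yA(1)[OF \<beta>[OF C(1)]]] yA(2)[OF \<beta>[OF C(1)]] card[OF C(1)] by simp
    ultimately show "a = b"
      using C C' cycle_of_period(4)[OF f fin xA(1)[OF C(1)]] xA(2)[OF C(1)] by simp
  qed
  then have "bij_betw h A A"
    using hA fin by (simp add: bij_betw_def endo_inj_surj image_subset_iff)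
  then have h: "h permutes A"
    by (rule bij_imp_permutes) (simp add: h_def)
  have "h (f a) = g (h a)" for a
  proof (cases "a \<in> A")
    case True
    obtain C k where C: "C \<in> cycles A f" "a = (f ^^ k) (x C)" using rep[OF True] by auto
    show ?thesis using hk[OF C(1), of "Suc k"] hk[OF C(1), of k] C(2) by simp
  next
    case False
    then show ?thesis using permutes_not_in[OF f] permutes_not_in[OF g] permutes_not_in[OF h] by simp
  qed
  then show ?thesis
    using that[OF h _ hk] by (simp add: fun_eq_iff)
qed

lemma cycle_of_inv:
  assumes f: "f permutes A" and fin: "finite A" and x: "x \<in> A"
  shows "cycle_of (inv' f) x = cycle_of f x"
proof -
  have *: "cycle_of (inv' f) x \<subseteq> cycle_of f x" if f: "f permutes A" for f
  proof
    fix y assume "y \<in> cycle_of (inv' f) x"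
    then obtain k where k: "y = (inv' f ^^ k) x" by (auto simp: cycle_of_def)
    have fk: "(f ^^ k) ((inv' f ^^ k) x) = x" for x
      by (induction k arbitrary: x) (simp_all add: funpow_swap1 permutes_inverses(1)[OF f])
    have yA: "y \<in> A"
      using permutes_in_image[OF permutes_funpow[OF permutes_inv[OF f]]] x by (simp add: k)
    have "x \<in> cycle_of f y"
      unfolding cycle_of_def by (rule range_eqI[of _ _ k]) (simp add: k fk)
    then show "y \<in> cycle_of f x"
      using cycle_of_eq[OF f fin yA] cycle_of_self by auto
  qed
  show ?thesis
    using *[OF f] *[OF permutes_inv[OF f]] permutes_inv_inv[OF f] by auto
qed

text \<open>On each cycle the conjugating permutation is a reflection; it can be chosen to exchange
  \<^term>\<open>a\<close> and \<^term>\<open>b\<close> if they lie on the same cycle, and to fix both of them otherwise.\<close>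

lemma conjugate_inverse_marked:
  fixes f :: "'a \<Rightarrow> 'a"
  assumes f: "f permutes A" and fin: "finite A" and ab: "a \<in> A" "b \<in> A"
  obtains h where "h permutes A" "h \<circ> f = inv' f \<circ> h" "h ` {a, b} = {a, b}"
proof -
  \<comment> \<open>The base points fix the reflection. If a and b share a cycle, it starts at a for
    f and at b for the inverse, so h sends the k-th iterate of a to the k-th backward iterate of b;
    hence a goes to b and b goes to a. A cycle with only one marked point has it as base point on
    both sides.\<close>
  define x where "x C = (if a \<in> C then a else if b \<in> C then b else SOME c. c \<in> C)" for C
  define y where "y C = (if b \<in> C then b else if a \<in> C then a else SOME c. c \<in> C)" for C
  have cyc: "cycles A (inv' f) = cycles A f"
    unfolding cycles_def by (rule image_cong) (auto simp: cycle_of_inv[OF f fin])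
  have ne: "\<exists>c. c \<in> C" if "C \<in> cycles A f" for C
    using that by (auto simp: cycles_def intro: cycle_of_self)
  have xO: "x C \<in> C" "y C \<in> C" if "C \<in> cycles A f" for C
    using someI_ex[OF ne[OF that]] by (auto simp: x_def y_def)
  obtain h where h: "h permutes A" "h \<circ> f = inv' f \<circ> h"
    and hk: "\<And>C k. C \<in> cycles A f \<Longrightarrow> h ((f ^^ k) (x C)) = (inv' f ^^ k) (y C)"
    by (rule conjugating_permutation[OF f permutes_inv[OF f] fin, of id x y]) (auto simp: cyc xO)
  have ca: "cycle_of f a \<in> cycles A f" "cycle_of f b \<in> cycles A f"
    using ab by (auto simp: cycles_def)
  have "h ` {a, b} = {a, b}"
  proof (cases "b \<in> cycle_of f a")
    case True
    then have 1: "x (cycle_of f a) = a" "y (cycle_of f a) = b"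
      by (simp_all add: x_def y_def cycle_of_self)
    obtain k where k: "b = (f ^^ k) a" using True by (auto simp: cycle_of_def)
    have "(inv' f ^^ k) ((f ^^ k) z) = z" for z
      by (induction k arbitrary: z) (simp_all add: funpow_swap1 permutes_inverses(2)[OF f])
    then have "h b = a"
      using hk[OF ca(1), of k] 1 k by simp
    moreover have "h a = b"
      using hk[OF ca(1), of 0] 1 by simp
    ultimately show ?thesis by auto
  next
    case False
    then have "a \<notin> cycle_of f b"
      using cycle_of_eq[OF f fin ab(2)] cycle_of_self by metis
    then have "x (cycle_of f b) = b" "y (cycle_of f b) = b" "x (cycle_of f a) = a" "y (cycle_of f a) = a"
      using False by (simp_all add: x_def y_def cycle_of_self)
    then have "h a = a" "h b = b"
      using hk[OF ca(1), of 0] hk[OF ca(2), of 0] by simp_all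
    then show ?thesis by simp
  qed
  then show ?thesis using that h by blast
qed

text \<open>Listed in decreasing order, so that a cycle type is a partition in the sense of
  \<open>is_partition\<close> and conjugacy classes are labelled by members of the set that indexes
  the Specht modules.\<close>

definition cycle_type :: "'a set \<Rightarrow> ('a \<Rightarrow> 'a) \<Rightarrow> nat list"
  where "cycle_type A f = rev (sorted_list_of_multiset (image_mset card (mset_set (cycles A f))))"

lemma finite_cycles: "finite A \<Longrightarrow> finite (cycles A f)"
  by (simp add: cycles_def)

lemma is_partition_cycle_type:
  assumes f: "f permutes A" and fin: "finite A"
  shows "is_partition (card A) (cycle_type A f)"
  unfolding is_partition_def
proof (intro conjI)
  show "sorted_wrt (\<ge>) (cycle_type A f)"
    by (simp add: cycle_type_def sorted_wrt_rev)
  show "0 \<notin> set (cycle_type A f)"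
    using cycle_of_period(2)[OF f fin] finite_cycles[OF fin] by (force simp: cycle_type_def cycles_def)
  have "sum_list (cycle_type A f) = sum_mset (image_mset card (mset_set (cycles A f)))"
    unfolding cycle_type_def by (metis mset_rev mset_sorted_list_of_multiset sum_mset_sum_list)
  also have "\<dots> = (\<Sum>C\<in>cycles A f. card C)"
    by (simp add: sum_unfold_sum_mset)
  also have "\<dots> = card (\<Union> (cycles A f))"
  proof (rule card_Union_disjoint[symmetric])
    show "pairwise disjnt (cycles A f)"
    proof (rule pairwiseI)
      fix C C' assume C: "C \<in> cycles A f" "C' \<in> cycles A f" "C \<noteq> C'"
      then show "disjnt C C'"
        using cyclesD(2)[OF f fin C(1)] cyclesD(2)[OF f fin C(2)] unfolding disjnt_iff by metis
    qed
  qed (use cycle_of_period(1)[OF f fin] in \<open>auto simp: cycles_def\<close>)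
  also have "\<Union> (cycles A f) = A"
    using cycle_of_period(3)[OF f fin] cycle_of_self by (fastforce simp: cycles_def)
  finally show "sum_list (cycle_type A f) = card A" .
qed

text \<open>The fibres of f and g over each value have equal size, so a bijection can be chosen
  fibre by fibre.\<close>

lemma image_mset_eq_imp_bij:
  assumes fin: "finite A" "finite B" and eq: "image_mset f (mset_set A) = image_mset g (mset_set B)"
  obtains \<beta> where "bij_betw \<beta> A B" "\<And>a. a \<in> A \<Longrightarrow> g (\<beta> a) = f a"
proof -
  have "card {a \<in> A. f a = c} = card {b \<in> B. g b = c}" for c
    using arg_cong[OF eq, of "\<lambda>M. count M c"] fin
    by (simp add: count_image_mset' Int_def vimage_def count_mset_set' conj_commute eq_commute[of c])
  then have "\<exists>\<beta>. bij_betw \<beta> {a \<in> A. f a = c} {b \<in> B. g b = c}" for c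
    using fin by (intro finite_same_card_bij) auto
  then obtain \<beta> where \<beta>: "\<And>c. bij_betw (\<beta> c) {a \<in> A. f a = c} {b \<in> B. g b = c}"
    by metis
  show ?thesis
  proof (rule that)
    have 1: "\<beta> (f a) a \<in> B \<and> g (\<beta> (f a) a) = f a" if "a \<in> A" for a
      using \<beta>[of "f a"] that by (auto simp: bij_betw_def)
    then show "g (\<beta> (f a) a) = f a" if "a \<in> A" for a using that by simp
    show "bij_betw (\<lambda>a. \<beta> (f a) a) A B"
      unfolding bij_betw_def
    proof (intro conjI inj_onI equalityI subsetI)
      fix a a' assume a: "a \<in> A" "a' \<in> A" "\<beta> (f a) a = \<beta> (f a') a'"
      then have "f a = f a'" using 1 by metis
      then show "a = a'" using a \<beta>[of "f a"] by (auto simp: bij_betw_def inj_on_def)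
    next
      fix b assume b: "b \<in> B"
      then have "b \<in> \<beta> (g b) ` {a \<in> A. f a = g b}"
        using \<beta>[of "g b"] by (auto simp: bij_betw_def)
      then obtain a where "a \<in> A" "f a = g b" "b = \<beta> (g b) a" by auto
      then show "b \<in> (\<lambda>a. \<beta> (f a) a) ` A" by (intro image_eqI[of _ _ a]) simp_all
    qed (use 1 in auto)
  qed
qed

lemma cycle_type_conjugate:
  assumes f: "f permutes A" and g: "g permutes A" and fin: "finite A"
    and eq: "cycle_type A f = cycle_type A g"
  obtains h where "h permutes A" "h \<circ> f = g \<circ> h"
proof -
  have "image_mset card (mset_set (cycles A f)) = image_mset card (mset_set (cycles A g))"
    using eq by (metis cycle_type_def mset_sorted_list_of_multiset rev_rev_ident)
  then obtain \<beta> where \<beta>: "bij_betw \<beta> (cycles A f) (cycles A g)" "\<And>C. C \<in> cycles A f \<Longrightarrow> card (\<beta> C) = card C"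
    using image_mset_eq_imp_bij[OF finite_cycles[OF fin] finite_cycles[OF fin]] by metis
  have ne: "(SOME c. c \<in> C) \<in> C" if "C \<in> cycles A f \<or> C \<in> cycles A g" for C
    by (rule someI_ex) (use that in \<open>auto simp: cycles_def intro: cycle_of_self\<close>)
  show ?thesis
    by (rule conjugating_permutation[OF f g fin \<beta>, of "\<lambda>C. SOME c. c \<in> C" "\<lambda>C. SOME c. c \<in> C"])
      (use ne that in auto)
qed

section \<open>Specht modules\<close>

definition perm_action :: "('a \<Rightarrow> 'a) \<Rightarrow> ((nat \<Rightarrow> 'a set) \<Rightarrow> complex) \<Rightarrow> (nat \<Rightarrow> 'a set) \<Rightarrow> complex"
  where "perm_action \<sigma> u = (\<lambda>T. u (\<lambda>i. inv' \<sigma> ` T i))"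

definition tabloids :: "nat list \<Rightarrow> (nat \<Rightarrow> nat set) set"
  where "tabloids p = tabloid p ` tableaux p"

text \<open>The permutation module on tabloids, usually written M^p, which contains
  \<open>specht p\<close>.\<close>

definition tabloid_functions :: "nat list \<Rightarrow> ((nat \<Rightarrow> nat set) \<Rightarrow> complex) set"
  where "tabloid_functions p = {u. \<forall>T. T \<notin> tabloids p \<longrightarrow> u T = 0}"

definition tabloid_row :: "(nat \<Rightarrow> nat set) \<Rightarrow> nat \<Rightarrow> nat"
  where "tabloid_row T x = (THE i. x \<in> T i)"

text \<open>The statistic n(p), the sum of i p_i with rows counted from 0. It is a numerical
  substitute for the dominance order, which it reverses: a partition that dominates another has at
  most its weight. Since numbers are totally ordered, one of two given partitions may always be
  taken as the heavier.\<close>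

definition row_weight :: "nat list \<Rightarrow> nat"
  where "row_weight p = (\<Sum>(i, j)\<in>young_diagram p. i)"

lemma specht_action [simp]: "ract (specht p) = perm_action"
  by (simp add: specht_def perm_action_def fun_eq_iff)

section \<open>Tableaux and their tabloids\<close>

lemma young_diagram_Sigma: "young_diagram p = Sigma {..<length p} (\<lambda>i. {..<p ! i})"
  by (auto simp: young_diagram_def)

lemma finite_young_diagram: "finite (young_diagram p)"
  by (simp add: young_diagram_Sigma)

lemma card_young_diagram: "card (young_diagram p) = sum_list p"
  by (simp add: young_diagram_Sigma sum_list_sum_nth atLeast0LessThan)

lemma tableaux_nonempty: "tableaux p \<noteq> {}"
  using finite_same_card_bij[OF finite_young_diagram[of p], of "{1..sum_list p}"]
  by (auto simp: tableaux_def card_young_diagram)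

lemma tableau_compose:
  assumes "t \<in> tableaux p" "\<sigma> permutes {1..sum_list p}"
  shows "\<sigma> \<circ> t \<in> tableaux p"
  using assms bij_betw_trans[OF _ permutes_imp_bij] by (auto simp: tableaux_def)

lemma tabloid_compose: "tabloid p (\<sigma> \<circ> t) = (\<lambda>i. \<sigma> ` tabloid p t i)"
  by (auto simp: tabloid_def fun_eq_iff image_iff)

text \<open>A tableau is a function on all pairs whose values outside the diagram are arbitrary, so
  agreement can be asserted on the diagram only; \<open>tabloid_cong\<close> and
  \<open>polytabloid_cong\<close> absorb the difference.\<close>

lemma tableaux_transitive:
  assumes t: "t \<in> tableaux p" and t': "t' \<in> tableaux p"
  obtains \<sigma> where "\<sigma> permutes {1..sum_list p}" "\<And>x. x \<in> young_diagram p \<Longrightarrow> t' x = (\<sigma> \<circ> t) x"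
proof -
  have b: "bij_betw t (young_diagram p) {1..sum_list p}" "bij_betw t' (young_diagram p) {1..sum_list p}"
    using t t' by (auto simp: tableaux_def)
  define \<tau> where "\<tau> = t' \<circ> the_inv_into (young_diagram p) t"
  have \<tau>: "bij_betw \<tau> {1..sum_list p} {1..sum_list p}"
    unfolding \<tau>_def using bij_betw_trans[OF bij_betw_the_inv_into[OF b(1)] b(2)] .
  define \<sigma> where "\<sigma> x = (if x \<in> {1..sum_list p} then \<tau> x else x)" for x
  have "bij_betw \<sigma> {1..sum_list p} {1..sum_list p}"
    using \<tau> by (subst bij_betw_cong[of _ _ \<tau>]) (auto simp: \<sigma>_def)
  then have "\<sigma> permutes {1..sum_list p}"
    by (rule bij_imp_permutes) (auto simp: \<sigma>_def)
  moreover have "t' x = (\<sigma> \<circ> t) x" if "x \<in> young_diagram p" for x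
    using that b(1) the_inv_into_f_f[of t "young_diagram p" x] bij_betwE[OF b(1)]
    by (auto simp: \<sigma>_def \<tau>_def bij_betw_def)
  ultimately show ?thesis using that by blast
qed

lemma tabloid_cong: "(\<And>x. x \<in> young_diagram p \<Longrightarrow> t x = t' x) \<Longrightarrow> tabloid p t = tabloid p t'"
  by (auto simp: tabloid_def fun_eq_iff) metis+

lemma polytabloid_cong:
  assumes "\<And>x. x \<in> young_diagram p \<Longrightarrow> t x = t' x"
  shows "polytabloid p t = polytabloid p t'"
proof -
  have "column_stabilizer p t = column_stabilizer p t'"
    using assms by (force simp: column_stabilizer_def)
  moreover have "tabloid p (\<pi> \<circ> t) = tabloid p (\<pi> \<circ> t')" for \<pi>
    by (rule tabloid_cong) (simp add: assms)
  ultimately show ?thesis by (simp add: polytabloid_def fun_eq_iff)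
qed

lemma tabloids_orbit:
  assumes "t \<in> tableaux p"
  shows "tabloids p = (\<lambda>\<sigma>. tabloid p (\<sigma> \<circ> t)) ` {\<sigma>. \<sigma> permutes {1..sum_list p}}"
proof (intro equalityI subsetI)
  fix T assume "T \<in> tabloids p"
  then obtain t' where t': "t' \<in> tableaux p" "T = tabloid p t'" by (auto simp: tabloids_def)
  obtain \<sigma> where "\<sigma> permutes {1..sum_list p}" "\<And>x. x \<in> young_diagram p \<Longrightarrow> t' x = (\<sigma> \<circ> t) x"
    using tableaux_transitive[OF assms t'(1)] by metis
  then show "T \<in> (\<lambda>\<sigma>. tabloid p (\<sigma> \<circ> t)) ` {\<sigma>. \<sigma> permutes {1..sum_list p}}"
    using tabloid_cong[of p t' "\<sigma> \<circ> t"] t' by auto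
qed (auto simp: tabloids_def tableau_compose[OF assms])

lemma finite_tabloids: "finite (tabloids p)"
proof -
  obtain t where "t \<in> tableaux p" using tableaux_nonempty by auto
  then show ?thesis
    by (simp add: tabloids_orbit finite_permutations)
qed

lemma tabloids_image:
  assumes "T \<in> tabloids p" "\<sigma> permutes {1..sum_list p}"
  shows "(\<lambda>i. \<sigma> ` T i) \<in> tabloids p"
  using assms tableau_compose[OF _ assms(2)] by (auto simp: tabloids_def tabloid_compose[symmetric])

lemma tabloids_image_iff:
  assumes "\<sigma> permutes {1..sum_list p}"
  shows "(\<lambda>i. \<sigma> ` T i) \<in> tabloids p \<longleftrightarrow> T \<in> tabloids p"
proof
  assume "(\<lambda>i. \<sigma> ` T i) \<in> tabloids p"
  from tabloids_image[OF this permutes_inv[OF assms]] show "T \<in> tabloids p"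
    by (simp add: image_comp permutes_inv_o[OF assms])
qed (rule tabloids_image[OF _ assms])

section \<open>Rows and columns of the entries of a tableau\<close>

definition entry_row :: "nat list \<Rightarrow> (nat \<times> nat \<Rightarrow> nat) \<Rightarrow> nat \<Rightarrow> nat"
  where "entry_row p t x = fst (the_inv_into (young_diagram p) t x)"

definition entry_col :: "nat list \<Rightarrow> (nat \<times> nat \<Rightarrow> nat) \<Rightarrow> nat \<Rightarrow> nat"
  where "entry_col p t x = snd (the_inv_into (young_diagram p) t x)"

lemma entry:
  assumes "t \<in> tableaux p"
  shows "(i, j) \<in> young_diagram p \<Longrightarrow> entry_row p t (t (i, j)) = i"
    and "(i, j) \<in> young_diagram p \<Longrightarrow> entry_col p t (t (i, j)) = j"
    and "(i, j) \<in> young_diagram p \<Longrightarrow> t (i, j) \<in> {1..sum_list p}"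
    and "x \<in> {1..sum_list p} \<Longrightarrow> (entry_row p t x, entry_col p t x) \<in> young_diagram p"
    and "x \<in> {1..sum_list p} \<Longrightarrow> t (entry_row p t x, entry_col p t x) = x"
proof -
  have b: "bij_betw t (young_diagram p) {1..sum_list p}" using assms by (simp add: tableaux_def)
  then have inj: "inj_on t (young_diagram p)" and im: "t ` young_diagram p = {1..sum_list p}"
    by (auto simp: bij_betw_def)
  show "(i, j) \<in> young_diagram p \<Longrightarrow> entry_row p t (t (i, j)) = i"
    "(i, j) \<in> young_diagram p \<Longrightarrow> entry_col p t (t (i, j)) = j"
    by (simp_all add: entry_row_def entry_col_def the_inv_into_f_f[OF inj])
  show "(i, j) \<in> young_diagram p \<Longrightarrow> t (i, j) \<in> {1..sum_list p}"
    using im by blast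
  show "x \<in> {1..sum_list p} \<Longrightarrow> (entry_row p t x, entry_col p t x) \<in> young_diagram p"
    using the_inv_into_into[OF inj, of x "young_diagram p"] im by (simp add: entry_row_def entry_col_def)
  show "x \<in> {1..sum_list p} \<Longrightarrow> t (entry_row p t x, entry_col p t x) = x"
    using f_the_inv_into_f[OF inj, of x] im by (simp add: entry_row_def entry_col_def)
qed

lemma entry_eq:
  assumes "t \<in> tableaux p" "x \<in> {1..sum_list p}" "y \<in> {1..sum_list p}"
    and "entry_row p t x = entry_row p t y" "entry_col p t x = entry_col p t y"
  shows "x = y"
  using entry(5)[OF assms(1,2)] entry(5)[OF assms(1,3)] assms(4,5) by metis

lemma tabloid_entry:
  assumes "t \<in> tableaux p"
  shows "tabloid p t i = {x \<in> {1..sum_list p}. entry_row p t x = i}"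
proof (intro equalityI subsetI)
  fix x assume "x \<in> {x \<in> {1..sum_list p}. entry_row p t x = i}"
  then show "x \<in> tabloid p t i"
    using entry(4,5)[OF assms, of x] by (auto simp: tabloid_def intro!: exI[of _ "entry_col p t x"])
next
  fix x assume "x \<in> tabloid p t i"
  then obtain j where "(i, j) \<in> young_diagram p" "x = t (i, j)" by (auto simp: tabloid_def)
  then show "x \<in> {x \<in> {1..sum_list p}. entry_row p t x = i}"
    using entry(1,3)[OF assms] by simp
qed

lemma tabloid_row:
  assumes "t \<in> tableaux p" "x \<in> {1..sum_list p}"
  shows "tabloid_row (tabloid p t) x = entry_row p t x"
  unfolding tabloid_row_def tabloid_entry[OF assms(1)] using assms(2) by (intro the_equality) auto

lemma tabloid_rows:
  assumes "T \<in> tabloids p"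
  shows "T i = {x \<in> {1..sum_list p}. tabloid_row T x = i}"
proof -
  obtain t where t: "t \<in> tableaux p" "T = tabloid p t" using assms by (auto simp: tabloids_def)
  show ?thesis
    unfolding t(2) using tabloid_entry[OF t(1)] tabloid_row[OF t(1)] by auto
qed

lemma tabloid_row_card:
  assumes "T \<in> tabloids p"
  shows "card (T i) = (if i < length p then p ! i else 0)"
proof -
  obtain t where t: "t \<in> tableaux p" "T = tabloid p t" using assms by (auto simp: tabloids_def)
  have "T i = t ` ({i} \<times> {j. (i, j) \<in> young_diagram p})"
    by (auto simp: t(2) tabloid_def)
  also have "card \<dots> = card ({i} \<times> {j. (i, j) \<in> young_diagram p})"
    by (rule card_image) (use t(1) in \<open>auto simp: tableaux_def bij_betw_def inj_on_def\<close>)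
  also have "\<dots> = card {j. (i, j) \<in> young_diagram p}"
    by (simp add: card_cartesian_product)
  also have "{j. (i, j) \<in> young_diagram p} = (if i < length p then {..<p ! i} else {})"
    by (auto simp: young_diagram_def)
  finally show ?thesis by auto
qed

lemma sum_entry_row:
  assumes "t \<in> tableaux p"
  shows "(\<Sum>x\<in>{1..sum_list p}. entry_row p t x) = row_weight p"
proof -
  have "bij_betw t (young_diagram p) {1..sum_list p}" using assms by (simp add: tableaux_def)
  from sum.reindex_bij_betw[OF this, of "entry_row p t"]
  have "(\<Sum>x\<in>{1..sum_list p}. entry_row p t x) = (\<Sum>c\<in>young_diagram p. entry_row p t (t c))" by simp
  also have "\<dots> = row_weight p"
    unfolding row_weight_def by (rule sum.cong) (auto simp: entry(1)[OF assms])
  finally show ?thesis .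
qed

lemma sum_tabloid_row:
  assumes "T \<in> tabloids p"
  shows "(\<Sum>x\<in>{1..sum_list p}. tabloid_row T x) = row_weight p"
proof -
  obtain t where t: "t \<in> tableaux p" "T = tabloid p t" using assms by (auto simp: tabloids_def)
  then show ?thesis using sum_entry_row[OF t(1)] tabloid_row[OF t(1)] by simp
qed

text \<open>Induction by removing the maximum, which is at least |A| - 1. The set A will consist of
  the rows of a tabloid met by one column of a tableau, and the initial segment is the configuration
  of least weight.\<close>

lemma sum_ge_initial_segment:
  fixes A :: "nat set"
  assumes "finite A"
  shows "\<Sum>A \<ge> \<Sum>{..<card A}" and "\<Sum>A = \<Sum>{..<card A} \<Longrightarrow> A = {..<card A}"
proof -
  have *: "\<Sum>A \<ge> \<Sum>{..<card A} \<and> (\<Sum>A = \<Sum>{..<card A} \<longrightarrow> A = {..<card A})"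
    using assms
  proof (induction "card A" arbitrary: A)
    case (Suc n)
    define M where "M = Max A"
    have ne: "A \<noteq> {}" using Suc.hyps(2) by auto
    have M: "M \<in> A" "\<And>x. x \<in> A \<Longrightarrow> x \<le> M"
      using ne Suc.prems by (auto simp: M_def)
    have "A \<subseteq> {..M}" using M by auto
    then have Mn: "n \<le> M"
      using card_mono[of "{..M}" A] Suc.hyps(2) by simp
    define B where "B = A - {M}"
    have B: "card B = n" "finite B" and A: "A = insert M B" "M \<notin> B"
      using Suc.hyps(2) Suc.prems M by (auto simp: B_def)
    have "\<Sum>B \<ge> \<Sum>{..<n} \<and> (\<Sum>B = \<Sum>{..<n} \<longrightarrow> B = {..<n})"
      using Suc.hyps(1)[of B] B by simp
    moreover have "\<Sum>A = M + \<Sum>B" using A B by simp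
    moreover have S: "\<Sum>{..<Suc n} = n + \<Sum>{..<n}" by (simp add: lessThan_Suc)
    ultimately have "\<Sum>A \<ge> \<Sum>{..<Suc n}" "\<Sum>A = \<Sum>{..<Suc n} \<Longrightarrow> M = n \<and> B = {..<n}"
      using Mn by linarith+
    then show ?case
      unfolding Suc.hyps(2)[symmetric] using A(1) lessThan_Suc[of n] by metis
  qed simp
  show "\<Sum>A \<ge> \<Sum>{..<card A}" "\<Sum>A = \<Sum>{..<card A} \<Longrightarrow> A = {..<card A}"
    using * by auto
qed

text \<open>The hypothesis of James' basic combinatorial lemma. When it fails, there is a
  transposition in the column stabilizer of t that fixes T.\<close>

definition transversal :: "nat list \<Rightarrow> (nat \<times> nat \<Rightarrow> nat) \<Rightarrow> (nat \<Rightarrow> nat set) \<Rightarrow> bool"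
  where "transversal p t T \<longleftrightarrow> (\<forall>x\<in>{1..sum_list p}. \<forall>y\<in>{1..sum_list p}.
    x \<noteq> y \<longrightarrow> entry_col p t x = entry_col p t y \<longrightarrow> tabloid_row T x \<noteq> tabloid_row T y)"

lemma column_stabilizer_iff:
  assumes t: "t \<in> tableaux p"
  shows "\<pi> \<in> column_stabilizer p t \<longleftrightarrow> \<pi> permutes {1..sum_list p} \<and>
    (\<forall>x\<in>{1..sum_list p}. entry_col p t (\<pi> x) = entry_col p t x)"
proof (cases "\<pi> permutes {1..sum_list p}")
  case \<pi>: True
  have "(\<forall>(i, j)\<in>young_diagram p. \<exists>i'. (i', j) \<in> young_diagram p \<and> \<pi> (t (i, j)) = t (i', j)) \<longleftrightarrow>
    (\<forall>x\<in>{1..sum_list p}. entry_col p t (\<pi> x) = entry_col p t x)"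
  proof (intro iffI ballI)
    fix x assume l: "\<forall>(i, j)\<in>young_diagram p. \<exists>i'. (i', j) \<in> young_diagram p \<and> \<pi> (t (i, j)) = t (i', j)"
      and x: "x \<in> {1..sum_list p}"
    obtain i' where "(i', entry_col p t x) \<in> young_diagram p" "\<pi> x = t (i', entry_col p t x)"
      using bspec[OF l entry(4)[OF t x]] entry(5)[OF t x] by auto
    then show "entry_col p t (\<pi> x) = entry_col p t x"
      using entry(2)[OF t] by simp
  next
    fix c assume r: "\<forall>x\<in>{1..sum_list p}. entry_col p t (\<pi> x) = entry_col p t x" and "c \<in> young_diagram p"
    then obtain i j where c: "c = (i, j)" "(i, j) \<in> young_diagram p" by (cases c) auto
    have x: "t (i, j) \<in> {1..sum_list p}" "\<pi> (t (i, j)) \<in> {1..sum_list p}"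
      using entry(3)[OF t c(2)] permutes_in_image[OF \<pi>] by auto
    then show "case c of (i, j) \<Rightarrow> \<exists>i'. (i', j) \<in> young_diagram p \<and> \<pi> (t (i, j)) = t (i', j)"
      using r entry(2)[OF t c(2)] entry(4,5)[OF t x(2)] c(1) by auto
  qed
  then show ?thesis using \<pi> by (simp add: column_stabilizer_def)
qed (simp add: column_stabilizer_def)

lemma column_stabilizer_group:
  assumes t: "t \<in> tableaux p"
  shows "id \<in> column_stabilizer p t"
    and "\<pi> \<in> column_stabilizer p t \<Longrightarrow> \<rho> \<in> column_stabilizer p t \<Longrightarrow> \<pi> \<circ> \<rho> \<in> column_stabilizer p t"
    and "\<pi> \<in> column_stabilizer p t \<Longrightarrow> inv' \<pi> \<in> column_stabilizer p t"
    and "finite (column_stabilizer p t)"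
proof -
  show "id \<in> column_stabilizer p t"
    by (simp add: column_stabilizer_iff[OF t] permutes_id)
  show "\<pi> \<in> column_stabilizer p t \<Longrightarrow> \<rho> \<in> column_stabilizer p t \<Longrightarrow> \<pi> \<circ> \<rho> \<in> column_stabilizer p t"
    by (auto simp: column_stabilizer_iff[OF t] permutes_compose permutes_in_image simp del: atLeastAtMost_iff)
  show "inv' \<pi> \<in> column_stabilizer p t" if "\<pi> \<in> column_stabilizer p t"
  proof -
    have \<pi>: "\<pi> permutes {1..sum_list p}" "\<And>x. x \<in> {1..sum_list p} \<Longrightarrow> entry_col p t (\<pi> x) = entry_col p t x"
      using that by (auto simp: column_stabilizer_iff[OF t])
    have "entry_col p t (inv' \<pi> x) = entry_col p t x" if "x \<in> {1..sum_list p}" for x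
      using \<pi>(2)[of "inv' \<pi> x"] permutes_inverses(1)[OF \<pi>(1)] permutes_in_image[OF permutes_inv[OF \<pi>(1)], of x] that
      by simp
    then show ?thesis
      using permutes_inv[OF \<pi>(1)] by (simp add: column_stabilizer_iff[OF t])
  qed
  show "finite (column_stabilizer p t)"
    by (rule finite_subset[OF _ finite_permutations[of "{1..sum_list p}"]]) (auto simp: column_stabilizer_def)
qed

lemma sum_column_partition:
  fixes f :: "nat \<Rightarrow> 'b::comm_monoid_add"
  shows "(\<Sum>x\<in>{1..m}. f x) = (\<Sum>j\<in>c ` {1..m}. \<Sum>x\<in>{x \<in> {1..m}. c x = j}. f x)"
  by (rule sum.image_gen) simp

text \<open>Transversality gives the entries of each column of t distinct row indices in T. Per
  column their sum is therefore at least 0 + 1 + 2 + ..., the value realised by t itself, and adding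
  up makes q at least as heavy as p. The hypothesis \<open>le\<close> forces equality in every
  column, so each column of t meets an initial segment of the rows of T, and T arises from t by a
  column permutation.\<close>

lemma transversal_row_weight:
  assumes p: "is_partition m p" and q: "is_partition m q"
    and t: "t \<in> tableaux p" and T: "T \<in> tabloids q" and tr: "transversal p t T"
    and le: "row_weight q \<le> row_weight p"
  shows "q = p \<and> (\<exists>\<pi>\<in>column_stabilizer p t. T = tabloid p (\<pi> \<circ> t))"
proof -
  have m: "sum_list p = m" "sum_list q = m" using p q by (auto simp: is_partition_def)
  note e = entry[OF t, unfolded m]
  let ?c = "entry_col p t" and ?r = "entry_row p t" and ?R = "tabloid_row T"
  define X where "X j = {x \<in> {1..m}. ?c x = j}" for j
  have finX: "finite (X j)" for j by (simp add: X_def)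
  have injR: "inj_on ?R (X j)" for j
    using tr unfolding transversal_def m X_def inj_on_def by blast
  have injr: "inj_on ?r (X j)" for j
    using entry_eq[OF t, unfolded m] by (auto simp: inj_on_def X_def)
  \<comment> \<open>As p is weakly decreasing, a column of its diagram occupies an initial segment
    of rows.\<close>
  have im_r: "?r ` X j = {..<card (X j)}" for j
  proof -
    have eq: "?r ` X j = {i. (i, j) \<in> young_diagram p}"
    proof (intro equalityI subsetI)
      fix i assume "i \<in> {i. (i, j) \<in> young_diagram p}"
      then show "i \<in> ?r ` X j"
        using e(1,2,3)[of i j] by (intro image_eqI[of _ _ "t (i, j)"]) (auto simp: X_def)
    qed (use e(4) in \<open>auto simp: X_def\<close>)
    have down: "i' \<in> {i. (i, j) \<in> young_diagram p}" if "i \<in> {i. (i, j) \<in> young_diagram p}" "i' < i" for i i'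
    proof -
      have "p ! i \<le> p ! i'"
        using p that by (auto simp: is_partition_def young_diagram_def sorted_wrt_iff_nth_less)
      then show ?thesis using that by (auto simp: young_diagram_def)
    qed
    have fin: "finite {i. (i, j) \<in> young_diagram p}"
      using finX[of j] eq by (metis finite_imageI)
    have "{i. (i, j) \<in> young_diagram p} = {..<card {i. (i, j) \<in> young_diagram p}}"
    proof (cases "{i. (i, j) \<in> young_diagram p} = {}")
      case False
      let ?A = "{i. (i, j) \<in> young_diagram p}"
      have "?A = {..Max ?A}"
        using down[OF Max_in[OF fin False]] Max_ge[OF fin] Max_in[OF fin False]
        by (auto simp: le_less)
      then show ?thesis by (metis card_atMost lessThan_Suc_atMost)
    qed simp
    then show ?thesis
      using eq card_image[OF injr[of j]] by simp
  qed
  have ge: "(\<Sum>x\<in>X j. ?R x) \<ge> (\<Sum>x\<in>X j. ?r x)" for j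
  proof -
    have "(\<Sum>x\<in>X j. ?r x) = \<Sum>(?r ` X j)" using sum.reindex[OF injr[of j], of id] by simp
    also have "\<dots> = \<Sum>{..<card (?R ` X j)}" using im_r card_image[OF injR] by simp
    also have "\<dots> \<le> \<Sum>(?R ` X j)" by (rule sum_ge_initial_segment(1)) (simp add: finX)
    also have "\<dots> = (\<Sum>x\<in>X j. ?R x)" using sum.reindex[OF injR[of j], of id] by simp
    finally show ?thesis .
  qed
  have sums: "(\<Sum>j\<in>?c ` {1..m}. \<Sum>x\<in>X j. ?R x) \<le> (\<Sum>j\<in>?c ` {1..m}. \<Sum>x\<in>X j. ?r x)"
    using le sum_tabloid_row[OF T] sum_entry_row[OF t] sum_column_partition[of ?R m ?c] sum_column_partition[of ?r m ?c]
    by (simp add: m X_def)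
  have eqj: "(\<Sum>x\<in>X j. ?R x) = (\<Sum>x\<in>X j. ?r x)" if j: "j \<in> ?c ` {1..m}" for j
  proof (rule ccontr)
    assume "(\<Sum>x\<in>X j. ?R x) \<noteq> (\<Sum>x\<in>X j. ?r x)"
    then have "(\<Sum>x\<in>X j. ?r x) < (\<Sum>x\<in>X j. ?R x)" using ge[of j] by simp
    then have "(\<Sum>j\<in>?c ` {1..m}. \<Sum>x\<in>X j. ?r x) < (\<Sum>j\<in>?c ` {1..m}. \<Sum>x\<in>X j. ?R x)"
      using j ge by (intro sum_strict_mono_ex1) (simp, blast, blast)
    then show False using sums by simp
  qed
  have in_D: "(?R x, ?c x) \<in> young_diagram p" if x: "x \<in> {1..m}" for x
  proof -
    have xX: "x \<in> X (?c x)" using x by (simp add: X_def)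
    have "\<Sum>(?R ` X (?c x)) = (\<Sum>x\<in>X (?c x). ?R x)" using sum.reindex[OF injR[of "?c x"], of id] by simp
    also have "\<dots> = (\<Sum>x\<in>X (?c x). ?r x)" using eqj x by simp
    also have "\<dots> = \<Sum>(?r ` X (?c x))" using sum.reindex[OF injr[of "?c x"], of id] by simp
    also have "\<dots> = \<Sum>{..<card (?R ` X (?c x))}" using im_r card_image[OF injR] by simp
    finally have "?R ` X (?c x) = {..<card (?R ` X (?c x))}"
      by (intro sum_ge_initial_segment(2)) (simp add: finX)
    then have "?R x \<in> ?r ` X (?c x)"
      using xX im_r card_image[OF injR] by (metis imageI)
    then obtain x' where x': "x' \<in> X (?c x)" "?R x = ?r x'" by auto
    then show ?thesis using e(4)[of x'] by (simp add: X_def)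
  qed
  \<comment> \<open>Moves the entry x inside its column of t to the row that x has in T. The inverse
    of \<rho> is the column permutation that produces T.\<close>
  define \<rho> where "\<rho> x = (if x \<in> {1..m} then t (?R x, ?c x) else x)" for x
  have \<rho>_in: "\<rho> x \<in> {1..m}" if "x \<in> {1..m}" for x
    using that e(3)[OF in_D[OF that]] by (simp add: \<rho>_def)
  have \<rho>_r: "?r (\<rho> x) = ?R x" and \<rho>_c: "?c (\<rho> x) = ?c x" if "x \<in> {1..m}" for x
    using that e(1,2)[OF in_D[OF that]] by (simp_all add: \<rho>_def)
  have "inj_on \<rho> {1..m}"
  proof (rule inj_onI)
    fix x y assume xy: "x \<in> {1..m}" "y \<in> {1..m}" "\<rho> x = \<rho> y"
    then have "?R x = ?R y" "?c x = ?c y" using \<rho>_r \<rho>_c by metis+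
    then show "x = y" using tr xy unfolding transversal_def m by blast
  qed
  then have "bij_betw \<rho> {1..m} {1..m}"
    using \<rho>_in by (simp add: bij_betw_def endo_inj_surj image_subset_iff)
  then have \<rho>: "\<rho> permutes {1..m}"
    by (rule bij_imp_permutes) (auto simp: \<rho>_def)
  then have \<rho>C: "\<rho> \<in> column_stabilizer p t"
    using \<rho>_c by (simp add: column_stabilizer_iff[OF t] m)
  have TT: "T = tabloid p (inv' \<rho> \<circ> t)"
  proof
    fix i
    have "x \<in> T i \<longleftrightarrow> x \<in> inv' \<rho> ` tabloid p t i" for x
    proof -
      have "x \<in> inv' \<rho> ` tabloid p t i \<longleftrightarrow> \<rho> x \<in> tabloid p t i"
        using permutes_inverses[OF \<rho>] by (metis imageE imageI)
      also have "\<dots> \<longleftrightarrow> \<rho> x \<in> {1..m} \<and> ?r (\<rho> x) = i"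
        by (simp add: tabloid_entry[OF t] m)
      also have "\<dots> \<longleftrightarrow> x \<in> {1..m} \<and> ?R x = i"
        using permutes_in_image[OF \<rho>, of x] \<rho>_r[of x] by metis
      also have "\<dots> \<longleftrightarrow> x \<in> T i"
        by (subst tabloid_rows[OF T, of i]) (simp add: m)
      finally show ?thesis by simp
    qed
    then show "T i = tabloid p (inv' \<rho> \<circ> t) i"
      by (auto simp: tabloid_compose)
  qed
  have \<pi>C: "inv' \<rho> \<in> column_stabilizer p t"
    by (rule column_stabilizer_group(3)[OF t \<rho>C])
  have Tp: "T \<in> tabloids p"
    using TT tableau_compose[OF t, of "inv' \<rho>"] permutes_inv[OF \<rho>] by (simp add: tabloids_def m)
  \<comment> \<open>T is now a tabloid of shape p as well as of shape q, and the sizes of the rows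
    determine the shape.\<close>
  have cards: "(if i < length p then p ! i else 0) = (if i < length q then q ! i else 0)" for i
    using tabloid_row_card[OF Tp, of i] tabloid_row_card[OF T, of i] by simp
  have nz: "i < length p \<Longrightarrow> p ! i \<noteq> 0" "i < length q \<Longrightarrow> q ! i \<noteq> 0" for i
    using p q nth_mem[of i p] nth_mem[of i q] unfolding is_partition_def by metis+
  have len: "length p = length q"
    using cards[of "length p"] cards[of "length q"] nz(1)[of "length q"] nz(2)[of "length p"]
    by (cases "length p" "length q" rule: linorder_cases) auto
  have "q = p"
    by (rule nth_equalityI) (use len cards in \<open>auto split: if_splits dest: spec\<close>, metis len)
  then show ?thesis using TT \<pi>C by blast
qed

text \<open>This symmetric bilinear form is the coefficient in
  \<open>column_symmetrizer_specht\<close>. Its companion \<open>hermitian_form\<close> supplies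
  positive definiteness, which a bilinear form over the complex numbers cannot have. Against a
  polytabloid, whose values are real, the two coincide.\<close>

definition tabloid_form :: "nat list \<Rightarrow> ((nat \<Rightarrow> nat set) \<Rightarrow> complex) \<Rightarrow> ((nat \<Rightarrow> nat set) \<Rightarrow> complex) \<Rightarrow> complex"
  where "tabloid_form p u v = (\<Sum>T\<in>tabloids p. u T * v T)"

definition hermitian_form :: "nat list \<Rightarrow> ((nat \<Rightarrow> nat set) \<Rightarrow> complex) \<Rightarrow> ((nat \<Rightarrow> nat set) \<Rightarrow> complex) \<Rightarrow> complex"
  where "hermitian_form p u v = (\<Sum>T\<in>tabloids p. u T * cnj (v T))"

text \<open>James' signed column sum \<kappa>_t. It is defined in an arbitrary representation so
  that an intertwiner can be said to commute with it.\<close>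

definition column_symmetrizer ::
    "nat list \<Rightarrow> (nat \<times> nat \<Rightarrow> nat) \<Rightarrow> (nat \<Rightarrow> nat, 'v::complex_vector) rep \<Rightarrow> 'v \<Rightarrow> 'v"
  where "column_symmetrizer p t R v = (\<Sum>\<pi>\<in>column_stabilizer p t. of_int (sign \<pi>) *\<^sub>C ract R \<pi> v)"

section \<open>The action of permutations and the two invariant forms\<close>

lemma perm_action_comp:
  assumes "\<sigma> permutes A" "\<tau> permutes A"
  shows "perm_action (\<sigma> \<circ> \<tau>) u = perm_action \<sigma> (perm_action \<tau> u)"
proof -
  have "inv' (\<sigma> \<circ> \<tau>) = inv' \<tau> \<circ> inv' \<sigma>"
    by (rule o_inv_distrib) (use assms permutes_bij in auto)
  then show ?thesis
    by (simp add: perm_action_def image_comp comp_def[of "inv' \<tau>"] image_image)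
qed

lemma perm_action_id: "perm_action id u = u"
  by (simp add: perm_action_def inv_id[unfolded id_def] id_def)

lemma perm_action_inv:
  assumes "\<sigma> permutes A"
  shows "perm_action (inv' \<sigma>) (perm_action \<sigma> u) = u" "perm_action \<sigma> (perm_action (inv' \<sigma>) u) = u"
  using assms by (simp_all add: perm_action_comp[of _ A, symmetric] permutes_inv permutes_inv_o perm_action_id)

lemma perm_action_linear: "clinear_on U (perm_action \<sigma>)"
  by (auto intro!: clinear_onI simp: perm_action_def fun_eq_iff)

lemma perm_action_form:
  assumes "\<sigma> permutes {1..sum_list p}"
  shows "tabloid_form p (perm_action \<sigma> u) (perm_action \<sigma> v) = tabloid_form p u v"
    and "hermitian_form p (perm_action \<sigma> u) (perm_action \<sigma> v) = hermitian_form p u v"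
proof -
  have "bij_betw (\<lambda>T i. inv' \<sigma> ` T i) (tabloids p) (tabloids p)"
    by (rule bij_betwI[where g = "\<lambda>T i. \<sigma> ` T i"])
      (auto intro: tabloids_image[OF _ assms] tabloids_image[OF _ permutes_inv[OF assms]]
        simp: image_comp permutes_inv_o[OF assms])
  from sum.reindex_bij_betw[OF this, of "\<lambda>T. u T * v T"] sum.reindex_bij_betw[OF this, of "\<lambda>T. u T * cnj (v T)"]
  show "tabloid_form p (perm_action \<sigma> u) (perm_action \<sigma> v) = tabloid_form p u v"
    "hermitian_form p (perm_action \<sigma> u) (perm_action \<sigma> v) = hermitian_form p u v"
    by (simp_all add: tabloid_form_def hermitian_form_def perm_action_def)
qed

lemma perm_action_form_adjoint:
  assumes "\<sigma> permutes {1..sum_list p}"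
  shows "tabloid_form p (perm_action \<sigma> u) v = tabloid_form p u (perm_action (inv' \<sigma>) v)"
    and "hermitian_form p (perm_action \<sigma> u) v = hermitian_form p u (perm_action (inv' \<sigma>) v)"
  using perm_action_form[OF assms, of u "perm_action (inv' \<sigma>) v"] by (simp_all add: perm_action_inv[OF assms])

lemma form_linear:
  "clinear_on U (\<lambda>u. tabloid_form p u v)" "clinear_on U (\<lambda>u. hermitian_form p u v)"
  "clinear_on U (tabloid_form p u)"
  "hermitian_form p v (x + y) = hermitian_form p v x + hermitian_form p v y"
  "hermitian_form p v (c *\<^sub>C x) = cnj c * hermitian_form p v x"
  by (auto intro!: clinear_onI simp: tabloid_form_def hermitian_form_def algebra_simps sum.distrib sum_distrib_left)

lemma form_commute: "tabloid_form p u v = tabloid_form p v u"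
  "hermitian_form p u v = cnj (hermitian_form p v u)"
  by (simp_all add: tabloid_form_def hermitian_form_def mult.commute)

lemma hermitian_form_self:
  "hermitian_form p u u = of_real (\<Sum>T\<in>tabloids p. (cmod (u T))\<^sup>2)"
  unfolding hermitian_form_def of_real_sum complex_norm_square ..

lemma hermitian_form_self_eq_0:
  assumes "u \<in> tabloid_functions p"
  shows "hermitian_form p u u = 0 \<longleftrightarrow> u = 0"
proof
  assume "hermitian_form p u u = 0"
  then have "(\<Sum>T\<in>tabloids p. (cmod (u T))\<^sup>2) = 0"
    unfolding hermitian_form_self by (simp only: of_real_eq_0_iff)
  then have "\<forall>T\<in>tabloids p. u T = 0"
    by (subst (asm) sum_nonneg_eq_0_iff) (auto simp: finite_tabloids)
  then show "u = 0"
    using assms by (auto simp: tabloid_functions_def fun_eq_iff)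
qed (simp add: hermitian_form_def)

lemma subspace_tabloid_functions: "csubspace (tabloid_functions p)"
  by (rule complex_vector.subspaceI) (auto simp: tabloid_functions_def)

text \<open>Conjugation by \<sigma> carries the column stabilizer of t to that of \<sigma> \<circ> t
  and preserves signs.\<close>

lemma polytabloid_action:
  assumes t: "t \<in> tableaux p" and \<sigma>: "\<sigma> permutes {1..sum_list p}"
  shows "perm_action \<sigma> (polytabloid p t) = polytabloid p (\<sigma> \<circ> t)"
proof
  fix T
  have st: "\<sigma> \<circ> t \<in> tableaux p" by (rule tableau_compose[OF t \<sigma>])
  have conj: "bij_betw (\<lambda>\<pi>. \<sigma> \<circ> \<pi> \<circ> inv' \<sigma>) (column_stabilizer p t) (column_stabilizer p (\<sigma> \<circ> t))"
  proof -
    have *: "\<sigma> \<circ> \<pi> \<circ> inv' \<sigma> \<in> column_stabilizer p (\<sigma> \<circ> t)"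
      if "\<pi> \<in> column_stabilizer p t" "\<sigma> permutes {1..sum_list p}" for \<pi> \<sigma> t
    proof -
      have \<pi>: "\<pi> permutes {1..sum_list p}" using that by (simp add: column_stabilizer_def)
      have "inv' \<sigma> (\<sigma> x) = x" for x using permutes_inverses(2)[OF that(2)] .
      then show ?thesis
        using that \<pi> by (force simp: column_stabilizer_def intro!: permutes_compose permutes_inv)
    qed
    have **: "inv' \<sigma> \<circ> \<rho> \<circ> \<sigma> \<in> column_stabilizer p t" if "\<rho> \<in> column_stabilizer p (\<sigma> \<circ> t)" for \<rho>
      using *[OF that permutes_inv[OF \<sigma>]] by (simp add: permutes_inv_inv[OF \<sigma>] comp_assoc[symmetric] permutes_inv_o[OF \<sigma>])
    show ?thesis
      by (rule bij_betwI[where g = "\<lambda>\<rho>. inv' \<sigma> \<circ> \<rho> \<circ> \<sigma>"])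
        (use * ** \<sigma> in \<open>auto simp: fun_eq_iff permutes_inverses[OF \<sigma>]\<close>)
  qed
  have "polytabloid p (\<sigma> \<circ> t) T = (\<Sum>\<pi>\<in>column_stabilizer p t.
      if T = tabloid p (\<sigma> \<circ> \<pi> \<circ> inv' \<sigma> \<circ> (\<sigma> \<circ> t)) then of_int (sign (\<sigma> \<circ> \<pi> \<circ> inv' \<sigma>)) else 0)"
    unfolding polytabloid_def by (rule sum.reindex_bij_betw[OF conj, symmetric])
  also have "\<dots> = (\<Sum>\<pi>\<in>column_stabilizer p t. if (\<lambda>i. inv' \<sigma> ` T i) = tabloid p (\<pi> \<circ> t) then of_int (sign \<pi>) else 0)"
  proof (rule sum.cong[OF refl])
    fix \<pi> assume "\<pi> \<in> column_stabilizer p t"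
    then have \<pi>: "\<pi> permutes {1..sum_list p}" by (simp add: column_stabilizer_def)
    have perm: "permutation \<sigma>" "permutation \<pi>" "permutation (inv' \<sigma>)"
      using \<sigma> \<pi> permutes_inv[OF \<sigma>] by (auto simp: permutation_permutes)
    have "sign (\<sigma> \<circ> \<pi> \<circ> inv' \<sigma>) = sign \<pi>"
      using perm by (simp add: sign_compose sign_inverse permutation_compose)
    moreover have "\<sigma> \<circ> \<pi> \<circ> inv' \<sigma> \<circ> (\<sigma> \<circ> t) = \<sigma> \<circ> (\<pi> \<circ> t)"
      by (simp add: fun_eq_iff permutes_inverses[OF \<sigma>])
    moreover have "T = tabloid p (\<sigma> \<circ> (\<pi> \<circ> t)) \<longleftrightarrow> (\<lambda>i. inv' \<sigma> ` T i) = tabloid p (\<pi> \<circ> t)"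
    proof
      assume "T = tabloid p (\<sigma> \<circ> (\<pi> \<circ> t))"
      then show "(\<lambda>i. inv' \<sigma> ` T i) = tabloid p (\<pi> \<circ> t)"
        by (simp add: tabloid_compose[of p \<sigma>] image_comp permutes_inv_o[OF \<sigma>])
    next
      assume "(\<lambda>i. inv' \<sigma> ` T i) = tabloid p (\<pi> \<circ> t)"
      then have "\<sigma> ` tabloid p (\<pi> \<circ> t) i = T i" for i
      proof -
        have "tabloid p (\<pi> \<circ> t) i = inv' \<sigma> ` T i"
          by (rule fun_cong[OF \<open>(\<lambda>i. inv' \<sigma> ` T i) = tabloid p (\<pi> \<circ> t)\<close>, symmetric])
        then show ?thesis by (simp add: image_comp permutes_inv_o[OF \<sigma>])
      qed
      then show "T = tabloid p (\<sigma> \<circ> (\<pi> \<circ> t))"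
        by (simp add: tabloid_compose[of p \<sigma>])
    qed
    ultimately show "(if T = tabloid p (\<sigma> \<circ> \<pi> \<circ> inv' \<sigma> \<circ> (\<sigma> \<circ> t)) then of_int (sign (\<sigma> \<circ> \<pi> \<circ> inv' \<sigma>)) else 0) =
        (if (\<lambda>i. inv' \<sigma> ` T i) = tabloid p (\<pi> \<circ> t) then complex_of_int (sign \<pi>) else 0)"
      by simp
  qed
  finally show "perm_action \<sigma> (polytabloid p t) T = polytabloid p (\<sigma> \<circ> t) T"
    by (simp add: perm_action_def polytabloid_def)
qed

lemma polytabloid_in:
  assumes t: "t \<in> tableaux p"
  shows "polytabloid p t \<in> tabloid_functions p"
proof -
  have "polytabloid p t T = 0" if "T \<notin> tabloids p" for T
    unfolding polytabloid_def
  proof (rule sum.neutral, rule ballI)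
    fix \<pi> assume "\<pi> \<in> column_stabilizer p t"
    then have "tabloid p (\<pi> \<circ> t) \<in> tabloids p"
      using tableau_compose[OF t] by (auto simp: tabloids_def column_stabilizer_def)
    then show "(if T = tabloid p (\<pi> \<circ> t) then of_int (sign \<pi>) else 0) = (0::complex)"
      using that by auto
  qed
  then show ?thesis by (simp add: tabloid_functions_def)
qed

lemma polytabloid_real: "cnj (polytabloid p t T) = polytabloid p t T"
  unfolding polytabloid_def by (simp add: if_distrib[of cnj] cong: if_cong)

lemma hermitian_form_polytabloid: "hermitian_form p u (polytabloid p t) = tabloid_form p u (polytabloid p t)"
  by (simp add: hermitian_form_def tabloid_form_def polytabloid_real)

lemma tabloid_transversal:
  assumes t: "t \<in> tableaux p" and \<pi>: "\<pi> \<in> column_stabilizer p t"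
  shows "x \<in> {1..sum_list p} \<Longrightarrow> tabloid_row (tabloid p (\<pi> \<circ> t)) x = entry_row p t (inv' \<pi> x)"
    and "transversal p t (tabloid p (\<pi> \<circ> t))"
proof -
  have perm: "\<pi> permutes {1..sum_list p}" using \<pi> by (simp add: column_stabilizer_def)
  note ip = permutes_inv[OF perm]
  have inC: "inv' \<pi> x \<in> {1..sum_list p}" if "x \<in> {1..sum_list p}" for x
    using permutes_in_image[OF ip] that by blast
  show row: "tabloid_row (tabloid p (\<pi> \<circ> t)) x = entry_row p t (inv' \<pi> x)" if x: "x \<in> {1..sum_list p}" for x
    unfolding tabloid_row_def
  proof (rule the_equality)
    have mem: "x \<in> tabloid p (\<pi> \<circ> t) i \<longleftrightarrow> entry_row p t (inv' \<pi> x) = i" for i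
    proof -
      have "x \<in> tabloid p (\<pi> \<circ> t) i \<longleftrightarrow> inv' \<pi> x \<in> tabloid p t i"
        unfolding tabloid_compose using permutes_inverses[OF perm] by (metis imageE imageI)
      then show ?thesis using inC[OF x] by (simp add: tabloid_entry[OF t])
    qed
    show "x \<in> tabloid p (\<pi> \<circ> t) (entry_row p t (inv' \<pi> x))" by (simp add: mem)
    show "i = entry_row p t (inv' \<pi> x)" if "x \<in> tabloid p (\<pi> \<circ> t) i" for i using that by (simp add: mem)
  qed
  have col: "entry_col p t (inv' \<pi> x) = entry_col p t x" if "x \<in> {1..sum_list p}" for x
    using column_stabilizer_group(3)[OF t \<pi>] that by (auto simp: column_stabilizer_iff[OF t])
  show "transversal p t (tabloid p (\<pi> \<circ> t))"
    unfolding transversal_def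
  proof (intro ballI impI notI)
    fix x y assume xy: "x \<in> {1..sum_list p}" "y \<in> {1..sum_list p}" "x \<noteq> y"
      "entry_col p t x = entry_col p t y" "tabloid_row (tabloid p (\<pi> \<circ> t)) x = tabloid_row (tabloid p (\<pi> \<circ> t)) y"
    have "inv' \<pi> x = inv' \<pi> y"
      by (rule entry_eq[OF t inC[OF xy(1)] inC[OF xy(2)]]) (use xy row col in auto)
    then show False
      using xy(3) permutes_inj[OF ip] by (auto simp: inj_def)
  qed
qed

text \<open>The tabloid remembers the row of each entry, and a column permutation preserves the
  column; row and column together determine the cell. As a consequence no two terms of a polytabloid
  collapse, and its coefficients are single signs.\<close>

lemma tabloid_column_inj:
  assumes t: "t \<in> tableaux p" and \<pi>: "\<pi> \<in> column_stabilizer p t" and \<rho>: "\<rho> \<in> column_stabilizer p t"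
    and eq: "tabloid p (\<pi> \<circ> t) = tabloid p (\<rho> \<circ> t)"
  shows "\<pi> = \<rho>"
proof -
  have perm: "\<pi> permutes {1..sum_list p}" "\<rho> permutes {1..sum_list p}"
    using \<pi> \<rho> by (simp_all add: column_stabilizer_def)
  have "inv' \<pi> x = inv' \<rho> x" for x
  proof (cases "x \<in> {1..sum_list p}")
    case True
    have col: "entry_col p t (inv' \<pi> x) = entry_col p t x" if "\<pi> \<in> column_stabilizer p t" for \<pi>
      using column_stabilizer_group(3)[OF t that] True by (auto simp: column_stabilizer_iff[OF t])
    have inC: "inv' \<pi> x \<in> {1..sum_list p}" "inv' \<rho> x \<in> {1..sum_list p}"
      using permutes_in_image[OF permutes_inv[OF perm(1)]] permutes_in_image[OF permutes_inv[OF perm(2)]] True by blast+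
    show ?thesis
    proof (rule entry_eq[OF t inC])
      show "entry_row p t (inv' \<pi> x) = entry_row p t (inv' \<rho> x)"
        using tabloid_transversal(1)[OF t \<pi> True] tabloid_transversal(1)[OF t \<rho> True] eq by metis
      show "entry_col p t (inv' \<pi> x) = entry_col p t (inv' \<rho> x)"
        using col[OF \<pi>] col[OF \<rho>] by simp
    qed
  next
    case False
    then show ?thesis
      using permutes_not_in[OF permutes_inv[OF perm(1)]] permutes_not_in[OF permutes_inv[OF perm(2)]] by metis
  qed
  then have "inv' \<pi> = inv' \<rho>" by auto
  then show ?thesis using permutes_inv_inv[OF perm(1)] permutes_inv_inv[OF perm(2)] by metis
qed

lemma polytabloid_column:
  assumes t: "t \<in> tableaux p" and \<pi>: "\<pi> \<in> column_stabilizer p t"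
  shows "polytabloid p t (tabloid p (\<pi> \<circ> t)) = of_int (sign \<pi>)"
proof -
  have "polytabloid p t (tabloid p (\<pi> \<circ> t)) = (\<Sum>\<rho>\<in>column_stabilizer p t. if \<rho> = \<pi> then of_int (sign \<pi>) else 0)"
    unfolding polytabloid_def by (rule sum.cong) (use tabloid_column_inj[OF t \<pi>] in auto)
  then show ?thesis using \<pi> column_stabilizer_group(4)[OF t] by simp
qed

lemma polytabloid_self: "t \<in> tableaux p \<Longrightarrow> polytabloid p t (tabloid p t) = 1"
  using polytabloid_column[OF _ column_stabilizer_group(1)] by simp

lemma polytabloid_not_transversal:
  assumes "t \<in> tableaux p" "\<not> transversal p t T"
  shows "polytabloid p t T = 0"
  unfolding polytabloid_def by (rule sum.neutral) (use tabloid_transversal(2)[OF assms(1)] assms(2) in auto)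

text \<open>James' identity \<kappa>_t u = (u, e_t) e_t, compared coefficient by coefficient at T. A
  transversal T forces q = p and is the tabloid of a column permutation of t, so reindexing the sum
  yields the form. For any other T a column transposition fixing T makes the coefficient its own
  negative.\<close>

lemma column_symmetrizer_specht:
  assumes p: "is_partition m p" and q: "is_partition m q" and t: "t \<in> tableaux p"
    and u: "u \<in> tabloid_functions q" and le: "row_weight q \<le> row_weight p"
  shows "column_symmetrizer p t (specht q) u =
    (if q = p then tabloid_form p u (polytabloid p t) *\<^sub>C polytabloid p t else 0)"
proof
  have m: "sum_list p = m" "sum_list q = m" using p q by (auto simp: is_partition_def)
  let ?C = "column_stabilizer p t"
  note grp = column_stabilizer_group[OF t]
  have perm: "\<pi> permutes {1..m}" if "\<pi> \<in> ?C" for \<pi> using that by (simp add: column_stabilizer_def m)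
  have permn: "permutation \<pi>" if "\<pi> \<in> ?C" for \<pi> using perm[OF that] by (auto simp: permutation_permutes)
  have form: "tabloid_form p u (polytabloid p t) = (\<Sum>\<pi>\<in>?C. of_int (sign \<pi>) * u (tabloid p (\<pi> \<circ> t)))" if "q = p"
  proof -
    have "tabloid_form p u (polytabloid p t) =
        (\<Sum>T\<in>tabloids p. \<Sum>\<pi>\<in>?C. if T = tabloid p (\<pi> \<circ> t) then of_int (sign \<pi>) * u T else 0)"
      unfolding tabloid_form_def polytabloid_def by (auto intro!: sum.cong simp: sum_distrib_left)
    also have "\<dots> = (\<Sum>\<pi>\<in>?C. \<Sum>T\<in>tabloids p. if T = tabloid p (\<pi> \<circ> t) then of_int (sign \<pi>) * u T else 0)"
      by (rule sum.swap)
    also have "\<dots> = (\<Sum>\<pi>\<in>?C. of_int (sign \<pi>) * u (tabloid p (\<pi> \<circ> t)))"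
    proof (rule sum.cong[OF refl])
      fix \<pi> assume "\<pi> \<in> ?C"
      then have "tabloid p (\<pi> \<circ> t) \<in> tabloids p"
        using tableau_compose[OF t] perm by (auto simp: tabloids_def m)
      then show "(\<Sum>T\<in>tabloids p. if T = tabloid p (\<pi> \<circ> t) then of_int (sign \<pi>) * u T else 0) =
          of_int (sign \<pi>) * u (tabloid p (\<pi> \<circ> t))"
        by (simp add: finite_tabloids)
    qed
    finally show ?thesis .
  qed
  fix T
  have K: "column_symmetrizer p t (specht q) u T = (\<Sum>\<pi>\<in>?C. of_int (sign \<pi>) * u (\<lambda>i. inv' \<pi> ` T i))"
    by (simp add: column_symmetrizer_def sum_fun_apply perm_action_def)
  show "column_symmetrizer p t (specht q) u T =
      (if q = p then tabloid_form p u (polytabloid p t) *\<^sub>C polytabloid p t else 0) T"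
  proof (cases "T \<in> tabloids q")
    case False
    have "u (\<lambda>i. inv' \<pi> ` T i) = 0" if "\<pi> \<in> ?C" for \<pi>
      using u False tabloids_image_iff[of "inv' \<pi>" q T] permutes_inv[OF perm[OF that]]
      by (simp add: tabloid_functions_def m)
    then show ?thesis
      using False polytabloid_in[OF t] by (auto simp: K tabloid_functions_def)
  next
    case T: True
    show ?thesis
    proof (cases "transversal p t T")
      case True
      from transversal_row_weight[OF p q t T True le]
      obtain \<pi>0 where qp: "q = p" and \<pi>0: "\<pi>0 \<in> ?C" "T = tabloid p (\<pi>0 \<circ> t)" by auto
      \<comment> \<open>Substituting \<pi>0 \<pi>^-1 for \<pi> turns the translate of T at which u
        is evaluated into the tabloid of \<pi> \<circ> t.\<close>
      have bij: "bij_betw (\<lambda>\<pi>. \<pi>0 \<circ> inv' \<pi>) ?C ?C"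
      proof (rule bij_betwI[where g = "\<lambda>\<pi>. inv' \<pi> \<circ> \<pi>0"])
        note b0 = permutes_bij[OF perm[OF \<pi>0(1)]] and o0 = permutes_inv_o[OF perm[OF \<pi>0(1)]]
        show "inv' (\<pi>0 \<circ> inv' \<pi>) \<circ> \<pi>0 = \<pi>" if "\<pi> \<in> ?C" for \<pi>
          using o_inv_distrib[OF b0 permutes_bij[OF permutes_inv[OF perm[OF that]]]] permutes_inv_inv[OF perm[OF that]]
          by (simp add: comp_assoc o0)
        show "\<pi>0 \<circ> inv' (inv' \<pi> \<circ> \<pi>0) = \<pi>" if "\<pi> \<in> ?C" for \<pi>
          using o_inv_distrib[OF permutes_bij[OF permutes_inv[OF perm[OF that]]] b0] permutes_inv_inv[OF perm[OF that]]
          by (simp add: comp_assoc[symmetric] o0)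
      qed (use grp(2,3) \<pi>0 in auto)
      have "(\<Sum>\<pi>\<in>?C. of_int (sign \<pi>) * u (\<lambda>i. inv' \<pi> ` T i)) =
          (\<Sum>\<pi>\<in>?C. of_int (sign (\<pi>0 \<circ> inv' \<pi>)) * u (\<lambda>i. inv' (\<pi>0 \<circ> inv' \<pi>) ` T i))"
        by (rule sum.reindex_bij_betw[OF bij, symmetric])
      also have "\<dots> = (\<Sum>\<pi>\<in>?C. of_int (sign \<pi>0) * (of_int (sign \<pi>) * u (tabloid p (\<pi> \<circ> t))))"
      proof (rule sum.cong[OF refl])
        fix \<pi> assume \<pi>: "\<pi> \<in> ?C"
        have "sign (\<pi>0 \<circ> inv' \<pi>) = sign \<pi>0 * sign \<pi>"
          using permn[OF \<pi>] permn[OF \<pi>0(1)] permn[OF grp(3)[OF \<pi>]] by (simp add: sign_compose sign_inverse)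
        moreover have "inv' (\<pi>0 \<circ> inv' \<pi>) = \<pi> \<circ> inv' \<pi>0"
          using o_inv_distrib[OF permutes_bij[OF perm[OF \<pi>0(1)]] permutes_bij[OF permutes_inv[OF perm[OF \<pi>]]]]
            permutes_inv_inv[OF perm[OF \<pi>]] by simp
        moreover have "(\<lambda>i. (\<pi> \<circ> inv' \<pi>0) ` T i) = tabloid p (\<pi> \<circ> t)"
          unfolding \<pi>0(2) tabloid_compose using permutes_inverses(2)[OF perm[OF \<pi>0(1)]]
          by (simp add: image_comp fun_eq_iff comp_def)
        ultimately show "of_int (sign (\<pi>0 \<circ> inv' \<pi>)) * u (\<lambda>i. inv' (\<pi>0 \<circ> inv' \<pi>) ` T i) =
            of_int (sign \<pi>0) * (of_int (sign \<pi>) * u (tabloid p (\<pi> \<circ> t)))"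
          by simp
      qed
      also have "\<dots> = of_int (sign \<pi>0) * tabloid_form p u (polytabloid p t)"
        by (simp add: form[OF qp] sum_distrib_left)
      finally show ?thesis
        using polytabloid_column[OF t \<pi>0(1)] K unfolding qp \<pi>0(2) by simp
    next
      case False
      then obtain x y where xy: "x \<in> {1..m}" "y \<in> {1..m}" "x \<noteq> y"
        "entry_col p t x = entry_col p t y" "tabloid_row T x = tabloid_row T y"
        by (auto simp: transversal_def m)
      \<comment> \<open>The entries x and y share a column of t and a row of T, so their
        transposition is an odd column permutation that fixes T. Replacing \<pi> by \<tau> \<circ>
        \<pi> negates the sum.\<close>
      define \<tau> where "\<tau> = transpose x y"
      have \<tau>p: "\<tau> permutes {1..m}" unfolding \<tau>_def using xy by (intro permutes_swap_id)
      have \<tau>C: "\<tau> \<in> ?C"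
        using \<tau>p xy by (auto simp: column_stabilizer_iff[OF t] m \<tau>_def transpose_def)
      have \<tau>\<tau>: "\<tau> \<circ> \<tau> = id" "inv' \<tau> = \<tau>"
        by (simp_all add: \<tau>_def)
      have \<tau>T: "\<tau> ` T i = T i" for i
      proof -
        have "x \<in> T i \<longleftrightarrow> y \<in> T i"
          by (subst (1 2) tabloid_rows[OF T]) (use xy m in auto)
        then show ?thesis by (auto simp: \<tau>_def transpose_def image_iff)
      qed
      have sgn: "sign \<tau> = -1" using xy(3) by (simp add: \<tau>_def sign_swap_id)
      have bij: "bij_betw (\<lambda>\<pi>. \<tau> \<circ> \<pi>) ?C ?C"
        by (rule bij_betwI[where g = "\<lambda>\<pi>. \<tau> \<circ> \<pi>"]) (use grp(2)[OF \<tau>C] \<tau>\<tau> in \<open>auto simp: comp_assoc[symmetric]\<close>)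
      have "(\<Sum>\<pi>\<in>?C. of_int (sign \<pi>) * u (\<lambda>i. inv' \<pi> ` T i)) =
          (\<Sum>\<pi>\<in>?C. of_int (sign (\<tau> \<circ> \<pi>)) * u (\<lambda>i. inv' (\<tau> \<circ> \<pi>) ` T i))"
        by (rule sum.reindex_bij_betw[OF bij, symmetric])
      also have "\<dots> = (\<Sum>\<pi>\<in>?C. - (of_int (sign \<pi>) * u (\<lambda>i. inv' \<pi> ` T i)))"
      proof (rule sum.cong[OF refl])
        fix \<pi> assume \<pi>: "\<pi> \<in> ?C"
        have "sign (\<tau> \<circ> \<pi>) = - sign \<pi>"
          using permn[OF \<pi>] permn[OF \<tau>C] sgn by (simp add: sign_compose)
        moreover have "inv' (\<tau> \<circ> \<pi>) = inv' \<pi> \<circ> \<tau>"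
          using perm[OF \<pi>] \<tau>p \<tau>\<tau> by (simp add: o_inv_distrib permutes_bij)
        ultimately show "of_int (sign (\<tau> \<circ> \<pi>)) * u (\<lambda>i. inv' (\<tau> \<circ> \<pi>) ` T i) =
            - (of_int (sign \<pi>) * u (\<lambda>i. inv' \<pi> ` T i))"
          using \<tau>T by (simp only: image_comp[symmetric]) simp
      qed
      finally have "(\<Sum>\<pi>\<in>?C. of_int (sign \<pi>) * u (\<lambda>i. inv' \<pi> ` T i)) = 0"
        by (simp add: sum_negf)
      then show ?thesis
        using polytabloid_not_transversal[OF t False] by (simp add: K)
    qed
  qed
qed

section \<open>Irreducibility and distinctness of the Specht modules\<close>

lemma sym_group_simps [simp]: "carrier (sym_group m) = {\<sigma>. \<sigma> permutes {1..m}}"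
  "\<sigma> \<otimes>\<^bsub>sym_group m\<^esub> \<tau> = \<sigma> \<circ> \<tau>" "\<one>\<^bsub>sym_group m\<^esub> = id"
  by (simp_all add: sym_group_def)

lemma perm_action_0: "perm_action \<sigma> 0 = 0"
  by (simp add: perm_action_def fun_eq_iff)

lemma finite_sym_group: "finite (carrier (sym_group m))"
  by (simp add: finite_permutations)

lemma sum_list_partition: "is_partition m p \<Longrightarrow> sum_list p = m"
  by (simp add: is_partition_def)

lemma specht_space: "rspace (specht p) = cspan (polytabloid p ` tableaux p)"
  by (simp add: specht_def)

lemma specht_subset: "rspace (specht p) \<subseteq> tabloid_functions p"
  unfolding specht_space
  by (rule complex_vector.span_minimal[OF _ subspace_tabloid_functions]) (auto intro: polytabloid_in)

lemma polytabloid_in_specht: "t \<in> tableaux p \<Longrightarrow> polytabloid p t \<in> rspace (specht p)"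
  by (simp add: specht_space complex_vector.span_base)

lemma linear_rep_specht:
  assumes p: "is_partition m p"
  shows "linear_rep (sym_group m) (specht p)"
proof -
  note m = sum_list_partition[OF p]
  have "perm_action \<sigma> u \<in> rspace (specht p)" if "\<sigma> permutes {1..m}" "u \<in> rspace (specht p)" for \<sigma> u
    unfolding specht_space
    by (rule clinear_on_span_image[OF perm_action_linear complex_vector.subspace_span _ that(2)[unfolded specht_space]])
      (use that m in \<open>auto simp: polytabloid_action intro!: complex_vector.span_base tableau_compose\<close>)
  then show ?thesis
    unfolding linear_rep_def
    by (auto simp: perm_action_linear perm_action_id perm_action_comp specht_space complex_vector.subspace_span)
qed

lemma column_symmetrizer_intertwiner:
  assumes p: "sum_list p = m" and R: "linear_rep (sym_group m) R" and \<phi>: "intertwiner (sym_group m) R S \<phi>"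
    and v: "v \<in> rspace R"
  shows "\<phi> (column_symmetrizer p t R v) = column_symmetrizer p t S (\<phi> v)"
proof -
  note D = intertwinerD[OF \<phi>]
  have g: "\<pi> \<in> carrier (sym_group m)" if "\<pi> \<in> column_stabilizer p t" for \<pi>
    using that p by (simp add: column_stabilizer_def)
  note sub = linear_rep_subspace[OF R]
  have in_R: "ract R \<pi> v \<in> rspace R" if "\<pi> \<in> column_stabilizer p t" for \<pi>
    using linear_rep_closed[OF R g[OF that] v] .
  have "\<phi> (column_symmetrizer p t R v) = (\<Sum>\<pi>\<in>column_stabilizer p t. \<phi> (of_int (sign \<pi>) *\<^sub>C ract R \<pi> v))"
    unfolding column_symmetrizer_def
    by (rule clinear_on_sum[OF D(1) sub]) (use in_R sub in \<open>auto intro: complex_vector.subspace_scale\<close>)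
  also have "\<dots> = column_symmetrizer p t S (\<phi> v)"
    unfolding column_symmetrizer_def
    by (rule sum.cong) (use in_R g v in \<open>auto simp: clinear_on_scale[OF D(1)] D(3)\<close>)
  finally show ?thesis .
qed

lemma polytabloid_norm:
  assumes "t \<in> tableaux p"
  shows "tabloid_form p (polytabloid p t) (polytabloid p t) \<noteq> 0"
proof -
  have "polytabloid p t \<noteq> 0"
    using polytabloid_self[OF assms] by auto
  then show ?thesis
    using hermitian_form_self_eq_0[OF polytabloid_in[OF assms]] by (simp add: hermitian_form_polytabloid)
qed

lemma column_symmetrizer_self:
  assumes p: "is_partition m p" and t: "t \<in> tableaux p" and u: "u \<in> rspace (specht p)"
  shows "column_symmetrizer p t (specht p) u = tabloid_form p u (polytabloid p t) *\<^sub>C polytabloid p t"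
  using column_symmetrizer_specht[OF p p t] u specht_subset by auto

text \<open>The polytabloids span the module and the two forms agree against them, so u is
  Hermitian-orthogonal to every vector of the module, itself included.\<close>

lemma specht_nondegenerate:
  assumes u: "u \<in> rspace (specht p)" and z: "\<And>t. t \<in> tableaux p \<Longrightarrow> tabloid_form p u (polytabloid p t) = 0"
  shows "u = 0"
proof -
  have "rspace (specht p) \<subseteq> {v. hermitian_form p u v = 0}"
    unfolding specht_space
  proof (rule complex_vector.span_minimal)
    show "csubspace {v. hermitian_form p u v = 0}"
      by (rule complex_vector.subspaceI) (auto simp: form_linear(4,5) hermitian_form_def[of _ _ 0])
  qed (use z in \<open>auto simp: hermitian_form_polytabloid\<close>)
  then show ?thesis
    using u hermitian_form_self_eq_0[of u p] specht_subset by blast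
qed

lemma specht_generated:
  assumes p: "is_partition m p" and U: "invariant_subspace (sym_group m) (specht p) U"
    and t: "t \<in> tableaux p" and e: "polytabloid p t \<in> U"
  shows "U = rspace (specht p)"
proof (rule antisym)
  show "U \<subseteq> rspace (specht p)" by (rule invariant_subspaceD(2)[OF U])
  show "rspace (specht p) \<subseteq> U"
    unfolding specht_space
  proof (rule complex_vector.span_minimal[OF _ invariant_subspaceD(1)[OF U]], rule image_subsetI)
    fix s assume "s \<in> tableaux p"
    then obtain \<sigma> where \<sigma>: "\<sigma> permutes {1..sum_list p}" "\<And>x. x \<in> young_diagram p \<Longrightarrow> s x = (\<sigma> \<circ> t) x"
      using tableaux_transitive[OF t] by metis
    have "polytabloid p s = perm_action \<sigma> (polytabloid p t)"
      using polytabloid_cong[of p s "\<sigma> \<circ> t"] \<sigma> polytabloid_action[OF t \<sigma>(1)] by simp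
    then show "polytabloid p s \<in> U"
      using invariant_subspaceD(3)[OF U, of \<sigma> "polytabloid p t"] e \<sigma>(1) sum_list_partition[OF p] by simp
  qed
qed

text \<open>James' submodule argument. Since \<kappa>_t u is a multiple of e_t, either U contains a
  polytabloid, and with it the orbit that spans the module, or U pairs to zero with all polytabloids
  and vanishes by definiteness.\<close>

lemma simple_specht:
  assumes p: "is_partition m p"
  shows "simple_rep (sym_group m) (specht p)"
  unfolding simple_rep_def
proof (intro conjI allI impI)
  show "linear_rep (sym_group m) (specht p)" by (rule linear_rep_specht[OF p])
  obtain t where t: "t \<in> tableaux p" using tableaux_nonempty by auto
  show "rspace (specht p) \<noteq> {0}"
    using polytabloid_in_specht[OF t] polytabloid_self[OF t] by force
  fix U assume U: "invariant_subspace (sym_group m) (specht p) U"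
  note UD = invariant_subspaceD[OF U]
  show "U = {0} \<or> U = rspace (specht p)"
  proof (rule disjCI)
    assume ne: "U \<noteq> rspace (specht p)"
    have "u = 0" if u: "u \<in> U" for u
    proof (rule specht_nondegenerate)
      show uS: "u \<in> rspace (specht p)" using u UD(2) by auto
      fix t assume t: "t \<in> tableaux p"
      have K: "column_symmetrizer p t (specht p) u \<in> U"
        unfolding column_symmetrizer_def
        by (intro complex_vector.subspace_sum[OF UD(1)] complex_vector.subspace_scale[OF UD(1)] UD(3) u)
          (use sum_list_partition[OF p] in \<open>auto simp: column_stabilizer_def\<close>)
      show "tabloid_form p u (polytabloid p t) = 0"
      proof (rule ccontr)
        assume nz: "tabloid_form p u (polytabloid p t) \<noteq> 0"
        have "(1 / tabloid_form p u (polytabloid p t)) *\<^sub>C column_symmetrizer p t (specht p) u \<in> U"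
          using complex_vector.subspace_scale[OF UD(1) K] .
        then have "polytabloid p t \<in> U"
          using nz by (simp add: column_symmetrizer_self[OF p t uS] scaleC_scaleC scaleC_one)
        then show False using specht_generated[OF p U t] ne by simp
      qed
    qed
    then show "U = {0}" using complex_vector.subspace_0[OF UD(1)] by auto
  qed
qed

text \<open>Let p be the heavier of two different partitions. The symmetrizer \<kappa>_t of a
  p-tableau annihilates \<open>specht q\<close> but multiplies its own polytabloid by a nonzero
  norm, so no isomorphism commutes with it. Comparability of weights covers both orders.\<close>

lemma specht_iso_imp_eq:
  assumes p: "is_partition m p" and q: "is_partition m q"
    and iso: "rep_iso (sym_group m) (specht p) (specht q)"
  shows "p = q"
proof -
  have *: "p = q" if p: "is_partition m p" and q: "is_partition m q" and le: "row_weight q \<le> row_weight p"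
    and iso: "rep_iso (sym_group m) (specht p) (specht q)" for p q
  proof (rule ccontr)
    assume ne: "p \<noteq> q"
    obtain \<phi> \<psi> where \<phi>: "intertwiner (sym_group m) (specht p) (specht q) \<phi>"
      "\<And>v. v \<in> rspace (specht p) \<Longrightarrow> \<psi> (\<phi> v) = v"
      using rep_isoE[OF iso linear_rep_specht[OF p]] by metis
    obtain t where t: "t \<in> tableaux p" using tableaux_nonempty by auto
    let ?e = "polytabloid p t"
    note e = polytabloid_in_specht[OF t]
    have "\<phi> ?e \<in> tabloid_functions q"
      using intertwinerD(2)[OF \<phi>(1) e] specht_subset by blast
    then have "\<phi> (column_symmetrizer p t (specht p) ?e) = 0"
      using column_symmetrizer_intertwiner[OF sum_list_partition[OF p] linear_rep_specht[OF p] \<phi>(1) e]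
        column_symmetrizer_specht[OF p q t _ le] ne by simp
    then have "tabloid_form p ?e ?e *\<^sub>C \<phi> ?e = 0"
      by (simp add: column_symmetrizer_self[OF p t e] clinear_on_scale[OF intertwinerD(1)[OF \<phi>(1)] e])
    then have "\<phi> ?e = \<phi> 0"
      using polytabloid_norm[OF t] clinear_on_0[OF intertwinerD(1)[OF \<phi>(1)] linear_rep_subspace[OF linear_rep_specht[OF p]]]
      by simp
    then have "?e = 0"
      using \<phi>(2)[OF e] \<phi>(2)[OF complex_vector.subspace_0[OF linear_rep_subspace[OF linear_rep_specht[OF p]]]] by simp
    then show False using polytabloid_self[OF t] by simp
  qed
  show ?thesis
    using *[OF p q _ iso] *[OF q p _ rep_iso_sym[OF iso linear_rep_specht[OF p]]] by (metis nat_le_linear)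
qed

text \<open>Every representation of the symmetric group contains a Specht module: the class functions
  \<^term>\<open>specht_class\<close> (essentially the characters) are linearly independent and as many as there
  are cycle types, so they span the indicator function of the identity.\<close>

definition specht_coeff :: "nat list \<Rightarrow> (nat \<times> nat \<Rightarrow> nat) \<Rightarrow> (nat \<Rightarrow> nat) \<Rightarrow> complex"
  where "specht_coeff p t \<sigma> = tabloid_form p (polytabloid p t) (perm_action \<sigma> (polytabloid p t))"

text \<open>Made from one matrix coefficient by summing over all conjugations; the conjugation
  invariance so obtained stands in for that of a trace.\<close>

definition specht_class :: "nat list \<Rightarrow> (nat \<times> nat \<Rightarrow> nat) \<Rightarrow> (nat \<Rightarrow> nat) \<Rightarrow> complex"
  where "specht_class p t \<sigma> = (\<Sum>g | g permutes {1..sum_list p}. specht_coeff p t (inv' g \<circ> \<sigma> \<circ> g))"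

text \<open>The rank-one map u \<mapsto> (u, e_t) w, summed over its conjugates by the group. In
  this way any vector w of any R yields an intertwiner from the Specht module to R.\<close>

definition specht_hom :: "nat list \<Rightarrow> (nat \<times> nat \<Rightarrow> nat) \<Rightarrow> (nat \<Rightarrow> nat, 'v::complex_vector) rep \<Rightarrow> 'v
    \<Rightarrow> ((nat \<Rightarrow> nat set) \<Rightarrow> complex) \<Rightarrow> 'v"
  where "specht_hom p t R w u =
    (\<Sum>\<sigma> | \<sigma> permutes {1..sum_list p}. tabloid_form p u (perm_action \<sigma> (polytabloid p t)) *\<^sub>C ract R \<sigma> w)"

lemma specht_hom_intertwiner:
  assumes p: "is_partition m p" and R: "linear_rep (sym_group m) R" and w: "w \<in> rspace R"
  shows "intertwiner (sym_group m) (specht p) R (specht_hom p t R w)"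
proof (rule intertwinerI)
  note m = sum_list_partition[OF p]
  note sub = linear_rep_subspace[OF R]
  have R\<sigma>: "ract R \<sigma> w \<in> rspace R" if "\<sigma> permutes {1..m}" for \<sigma>
    using linear_rep_closed[OF R _ w] that by simp
  show "clinear_on (rspace (specht p)) (specht_hom p t R w)"
    unfolding specht_hom_def
    by (rule clinear_onI) (simp_all add: clinear_on_add[OF form_linear(1)[of UNIV]] clinear_on_scale[OF form_linear(1)[of UNIV]]
      scaleC_add_left sum.distrib complex_vector.scale_sum_right scaleC_scaleC)
  show "specht_hom p t R w u \<in> rspace R" for u
    unfolding specht_hom_def m
    by (intro complex_vector.subspace_sum[OF sub] complex_vector.subspace_scale[OF sub] R\<sigma>) auto
  fix g u assume "g \<in> carrier (sym_group m)"
  then have g: "g permutes {1..m}" by simp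
  have "specht_hom p t R w (perm_action g u) = (\<Sum>\<sigma> | \<sigma> permutes {1..m}.
      tabloid_form p (perm_action g u) (perm_action (g \<circ> \<sigma>) (polytabloid p t)) *\<^sub>C ract R (g \<circ> \<sigma>) w)"
    unfolding specht_hom_def m
    by (rule sum.reindex_bij_witness[where i = "\<lambda>\<sigma>. g \<circ> \<sigma>" and j = "\<lambda>\<sigma>. inv' g \<circ> \<sigma>"])
      (use g in \<open>auto simp: comp_assoc[symmetric] permutes_inv_o permutes_compose permutes_inv\<close>)
  also have "\<dots> = (\<Sum>\<sigma> | \<sigma> permutes {1..m}. ract R g (tabloid_form p u (perm_action \<sigma> (polytabloid p t)) *\<^sub>C ract R \<sigma> w))"
  proof (rule sum.cong[OF refl])
    fix \<sigma> assume "\<sigma> \<in> {\<sigma>. \<sigma> permutes {1..m}}"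
    then have \<sigma>: "\<sigma> permutes {1..m}" by simp
    have "ract R (g \<circ> \<sigma>) w = ract R g (ract R \<sigma> w)"
      using linear_rep_mult[OF R, of g \<sigma> w] g \<sigma> w by simp
    then show "tabloid_form p (perm_action g u) (perm_action (g \<circ> \<sigma>) (polytabloid p t)) *\<^sub>C ract R (g \<circ> \<sigma>) w =
        ract R g (tabloid_form p u (perm_action \<sigma> (polytabloid p t)) *\<^sub>C ract R \<sigma> w)"
      using clinear_on_scale[OF linear_rep_linear[OF R, of g] R\<sigma>[OF \<sigma>]] g
      by (simp add: perm_action_comp[OF g \<sigma>] perm_action_form(1) m)
  qed
  also have "\<dots> = ract R g (specht_hom p t R w u)"
    unfolding specht_hom_def m
    by (rule clinear_on_sum[OF linear_rep_linear[OF R] sub, symmetric])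
      (use g in \<open>auto intro!: complex_vector.subspace_scale[OF sub] R\<sigma>\<close>)
  finally show "specht_hom p t R w (ract (specht p) g u) = ract R g (specht_hom p t R w u)" by simp
qed

text \<open>The group algebra element with coefficients \<open>specht_class p t\<close> acts on R
  through the maps \<open>specht_hom\<close>. If it does not annihilate R, then
  \<open>specht p\<close> maps nontrivially to R.\<close>

lemma specht_class_sum:
  assumes p: "is_partition m p" and R: "linear_rep (sym_group m) R" and v: "v \<in> rspace R"
  shows "(\<Sum>\<sigma> | \<sigma> permutes {1..m}. specht_class p t \<sigma> *\<^sub>C ract R \<sigma> v) =
    (\<Sum>g | g permutes {1..m}. ract R g (specht_hom p t R (ract R (inv' g) v) (polytabloid p t)))"
proof -
  note m = sum_list_partition[OF p]
  note sub = linear_rep_subspace[OF R]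
  have R\<sigma>: "ract R \<sigma> w \<in> rspace R" if "\<sigma> permutes {1..m}" "w \<in> rspace R" for \<sigma> w
    using linear_rep_closed[OF R _ that(2)] that(1) by simp
  have "(\<Sum>\<sigma> | \<sigma> permutes {1..m}. specht_class p t \<sigma> *\<^sub>C ract R \<sigma> v) =
      (\<Sum>g | g permutes {1..m}. \<Sum>\<sigma> | \<sigma> permutes {1..m}. specht_coeff p t (inv' g \<circ> \<sigma> \<circ> g) *\<^sub>C ract R \<sigma> v)"
    unfolding specht_class_def m complex_vector.scale_sum_left by (rule sum.swap)
  also have "\<dots> = (\<Sum>g | g permutes {1..m}. ract R g (specht_hom p t R (ract R (inv' g) v) (polytabloid p t)))"
  proof (rule sum.cong[OF refl])
    fix g assume "g \<in> {g. g permutes {1..m}}"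
    then have g: "g permutes {1..m}" by simp
    note gi = permutes_inv[OF g]
    have "(\<Sum>\<sigma> | \<sigma> permutes {1..m}. specht_coeff p t (inv' g \<circ> \<sigma> \<circ> g) *\<^sub>C ract R \<sigma> v) =
        (\<Sum>\<tau> | \<tau> permutes {1..m}. specht_coeff p t \<tau> *\<^sub>C ract R (g \<circ> \<tau> \<circ> inv' g) v)"
    proof (rule sum.reindex_bij_witness[where i = "\<lambda>\<tau>. g \<circ> \<tau> \<circ> inv' g" and j = "\<lambda>\<sigma>. inv' g \<circ> \<sigma> \<circ> g"])
      fix \<sigma> :: "nat \<Rightarrow> nat"
      show "g \<circ> (inv' g \<circ> \<sigma> \<circ> g) \<circ> inv' g = \<sigma>" "inv' g \<circ> (g \<circ> \<sigma> \<circ> inv' g) \<circ> g = \<sigma>"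
        by (simp_all add: fun_eq_iff permutes_inverses[OF g])
      then show "specht_coeff p t (inv' g \<circ> \<sigma> \<circ> g) *\<^sub>C ract R (g \<circ> (inv' g \<circ> \<sigma> \<circ> g) \<circ> inv' g) v =
          specht_coeff p t (inv' g \<circ> \<sigma> \<circ> g) *\<^sub>C ract R \<sigma> v"
        by simp
    qed (use g gi in \<open>auto intro!: permutes_compose\<close>)
    also have "\<dots> = (\<Sum>\<tau> | \<tau> permutes {1..m}. ract R g (specht_coeff p t \<tau> *\<^sub>C ract R \<tau> (ract R (inv' g) v)))"
    proof (rule sum.cong[OF refl])
      fix \<tau> assume "\<tau> \<in> {\<tau>. \<tau> permutes {1..m}}"
      then have \<tau>: "\<tau> permutes {1..m}" by simp
      have "ract R (g \<circ> \<tau> \<circ> inv' g) v = ract R g (ract R \<tau> (ract R (inv' g) v))"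
        using linear_rep_mult[OF R, of "g \<circ> \<tau>" "inv' g" v] linear_rep_mult[OF R, of g \<tau> "ract R (inv' g) v"]
          g \<tau> gi v R\<sigma>[OF gi v] permutes_compose[OF \<tau> g] by simp
      then show "specht_coeff p t \<tau> *\<^sub>C ract R (g \<circ> \<tau> \<circ> inv' g) v =
          ract R g (specht_coeff p t \<tau> *\<^sub>C ract R \<tau> (ract R (inv' g) v))"
        using clinear_on_scale[OF linear_rep_linear[OF R, of g] R\<sigma>[OF \<tau> R\<sigma>[OF gi v]]] g by simp
    qed
    also have "\<dots> = ract R g (specht_hom p t R (ract R (inv' g) v) (polytabloid p t))"
      unfolding specht_hom_def m specht_coeff_def
      by (rule clinear_on_sum[OF linear_rep_linear[OF R] sub, symmetric])
        (use g in \<open>auto intro!: complex_vector.subspace_scale[OF sub] R\<sigma> gi v\<close>)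
    finally show "(\<Sum>\<sigma> | \<sigma> permutes {1..m}. specht_coeff p t (inv' g \<circ> \<sigma> \<circ> g) *\<^sub>C ract R \<sigma> v) =
        ract R g (specht_hom p t R (ract R (inv' g) v) (polytabloid p t))" .
  qed
  finally show ?thesis .
qed

lemma specht_hom_zero:
  assumes p: "is_partition m p" and q: "is_partition m q" and ne: "p \<noteq> q"
    and u: "u \<in> rspace (specht p)" and w: "w \<in> rspace (specht q)"
  shows "specht_hom p t (specht q) w u = 0"
  using specht_iso_imp_eq[OF p q] simple_rep_iso[OF simple_specht[OF p] simple_specht[OF q]
      specht_hom_intertwiner[OF p linear_rep_specht[OF q] w] u] ne by blast

lemma specht_coeff_inv:
  assumes "\<sigma> permutes {1..sum_list p}"
  shows "specht_coeff p t (inv' \<sigma>) = specht_coeff p t \<sigma>"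
  unfolding specht_coeff_def
  using perm_action_form_adjoint(1)[OF assms, of "polytabloid p t" "polytabloid p t"] form_commute(1) by metis

lemma specht_coeff_real: "cnj (specht_coeff p t \<sigma>) = specht_coeff p t \<sigma>"
  by (simp add: specht_coeff_def tabloid_form_def perm_action_def polytabloid_real)

lemma specht_coeff_square_sum:
  assumes t: "t \<in> tableaux p"
  shows "(\<Sum>\<sigma> | \<sigma> permutes {1..sum_list p}. (specht_coeff p t \<sigma>)\<^sup>2) \<noteq> 0"
proof -
  let ?G = "{\<sigma>. \<sigma> permutes {1..sum_list p}}"
  have sq: "(specht_coeff p t \<sigma>)\<^sup>2 = of_real ((cmod (specht_coeff p t \<sigma>))\<^sup>2)" for \<sigma>
    by (metis complex_norm_square power2_eq_square specht_coeff_real)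
  have "specht_coeff p t id \<noteq> 0"
    by (simp add: specht_coeff_def perm_action_id polytabloid_norm[OF t])
  then have "0 < (\<Sum>\<sigma>\<in>?G. (cmod (specht_coeff p t \<sigma>))\<^sup>2)"
    by (intro sum_pos2[of _ id]) (auto simp: finite_permutations permutes_id)
  then show ?thesis
    unfolding sq of_real_sum[symmetric] of_real_eq_0_iff by simp
qed

text \<open>The product of this vector with e_t is computed explicitly: times (e_t, e_t)^2 it equals
  c^2, where c is the sum of the squared coefficients. It is nonzero because the coefficients are
  real and the one at the identity is the norm of e_t.\<close>

lemma specht_class_nonzero:
  assumes p: "is_partition m p" and t: "t \<in> tableaux p"
  shows "(\<Sum>\<sigma> | \<sigma> permutes {1..m}. specht_class p t \<sigma> *\<^sub>C perm_action \<sigma> (polytabloid p t)) \<noteq> 0"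
proof -
  note m = sum_list_partition[OF p]
  let ?e = "polytabloid p t" and ?G = "{\<sigma>. \<sigma> permutes {1..m}}" and ?b = "tabloid_form p"
  note lin = linear_rep_specht[OF p] and e = polytabloid_in_specht[OF t]
  define N where "N = ?b ?e ?e"
  have N0: "N \<noteq> 0" unfolding N_def by (rule polytabloid_norm[OF t])
  define Y where "Y w = specht_hom p t (specht p) w ?e" for w
  have Y_sum: "Y w = (\<Sum>\<sigma>\<in>?G. specht_coeff p t \<sigma> *\<^sub>C perm_action \<sigma> w)" for w
    by (simp add: Y_def specht_hom_def specht_coeff_def m)
  have b_sum: "?b (\<Sum>i\<in>I. f i) v = (\<Sum>i\<in>I. ?b (f i) v)" for f :: "(nat \<Rightarrow> nat) \<Rightarrow> _" and I v
    by (rule clinear_on_sum[OF form_linear(1)[of UNIV]]) (auto simp: complex_vector.subspace_UNIV)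
  have b_scale: "?b (c *\<^sub>C u) v = c * ?b u v" for c u v
    using clinear_on_scale[OF form_linear(1)[of UNIV p v], of u c] by simp
  \<comment> \<open>The symmetrizer multiplies e_t by N, and \<open>specht_hom\<close> commutes with
    it, so Y w lies on the line of e_t.\<close>
  have Y: "N *\<^sub>C Y w = ?b (Y w) ?e *\<^sub>C ?e" if w: "w \<in> rspace (specht p)" for w
  proof -
    note \<phi> = specht_hom_intertwiner[OF p lin w, of t]
    have "specht_hom p t (specht p) w (column_symmetrizer p t (specht p) ?e) =
        column_symmetrizer p t (specht p) (Y w)"
      unfolding Y_def by (rule column_symmetrizer_intertwiner[OF m lin \<phi> e])
    then show ?thesis
      using column_symmetrizer_self[OF p t e] column_symmetrizer_self[OF p t intertwinerD(2)[OF \<phi> e]]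
        clinear_on_scale[OF intertwinerD(1)[OF \<phi>] e]
      by (simp add: N_def Y_def)
  qed
  \<comment> \<open>Y is self-adjoint because the coefficients at a permutation and at its inverse
    agree.\<close>
  have adj: "?b (Y w) ?e = ?b w (Y ?e)" for w
  proof -
    have "?b (Y w) ?e = (\<Sum>\<sigma>\<in>?G. specht_coeff p t \<sigma> * ?b (perm_action \<sigma> w) ?e)"
      by (simp add: Y_sum b_sum b_scale)
    also have "\<dots> = (\<Sum>\<sigma>\<in>?G. specht_coeff p t \<sigma> * ?b w (perm_action (inv' \<sigma>) ?e))"
      by (rule sum.cong) (auto simp: perm_action_form_adjoint m)
    also have "\<dots> = (\<Sum>\<sigma>\<in>?G. specht_coeff p t \<sigma> * ?b w (perm_action \<sigma> ?e))"
      by (rule sum.reindex_bij_witness[where i = "inv'" and j = "inv'"])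
        (auto simp: permutes_inv permutes_inv_inv specht_coeff_inv m)
    also have "\<dots> = ?b w (Y ?e)"
      unfolding Y_sum form_commute(1)[of p w] b_sum b_scale ..
    finally show ?thesis .
  qed
  define c where "c = (\<Sum>\<sigma>\<in>?G. (specht_coeff p t \<sigma>)\<^sup>2)"
  have c0: "c \<noteq> 0" unfolding c_def using specht_coeff_square_sum[OF t] by (simp add: m)
  have bYe: "?b (Y ?e) ?e = c"
  proof -
    have "?b (Y ?e) ?e = (\<Sum>\<sigma>\<in>?G. specht_coeff p t \<sigma> * ?b (perm_action \<sigma> ?e) ?e)"
      by (simp add: Y_sum b_sum b_scale)
    then show ?thesis
      by (simp add: c_def specht_coeff_def power2_eq_square form_commute(1)[of p "perm_action _ _"])
  qed
  have bYw: "N * ?b (Y w) ?e = c * ?b w ?e" if w: "w \<in> rspace (specht p)" for w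
  proof -
    have "N * ?b (Y w) ?e = ?b (N *\<^sub>C Y ?e) w"
      by (simp add: adj b_scale form_commute(1)[of p w])
    then show ?thesis
      by (simp add: Y[OF e] bYe b_scale form_commute(1)[of p w])
  qed
  let ?Z = "(\<Sum>\<sigma>\<in>?G. specht_class p t \<sigma> *\<^sub>C perm_action \<sigma> ?e)"
  have Z: "?Z = (\<Sum>g\<in>?G. perm_action g (Y (perm_action (inv' g) ?e)))"
    using specht_class_sum[OF p lin e, of t] by (simp add: Y_def)
  have "N * N * ?b ?Z ?e = (\<Sum>g\<in>?G. N * (N * ?b (perm_action g (Y (perm_action (inv' g) ?e))) ?e))"
    unfolding Z b_sum sum_distrib_left mult.assoc ..
  also have "\<dots> = (\<Sum>g\<in>?G. c * (specht_coeff p t g)\<^sup>2)"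
  proof (rule sum.cong[OF refl])
    fix g assume "g \<in> ?G"
    then have g: "g permutes {1..m}" by simp
    let ?w = "perm_action (inv' g) ?e"
    have w: "?w \<in> rspace (specht p)"
      using linear_rep_closed[OF lin _ e, of "inv' g"] permutes_inv[OF g] by simp
    have f: "?b ?w ?e = specht_coeff p t g" "?b ?e ?w = specht_coeff p t g"
      using specht_coeff_inv[of g p t] g m form_commute(1)[of p ?w ?e] by (simp_all add: specht_coeff_def)
    have "N * ?b (perm_action g (Y ?w)) ?e = ?b (N *\<^sub>C Y ?w) ?w"
      using g by (simp add: perm_action_form_adjoint m b_scale)
    also have "\<dots> = ?b (Y ?w) ?e * specht_coeff p t g"
      by (simp add: Y[OF w] b_scale f)
    finally have "N * (N * ?b (perm_action g (Y ?w)) ?e) = (N * ?b (Y ?w) ?e) * specht_coeff p t g"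
      by simp
    then show "N * (N * ?b (perm_action g (Y ?w)) ?e) = c * (specht_coeff p t g)\<^sup>2"
      by (simp add: bYw[OF w] f power2_eq_square)
  qed
  also have "\<dots> = c * c"
    by (simp add: c_def sum_distrib_left)
  finally have "?b ?Z ?e \<noteq> 0"
    using c0 by auto
  then show ?thesis
    using clinear_on_0[OF form_linear(1)[of UNIV] complex_vector.subspace_UNIV] by auto
qed

lemma specht_class_conjugate:
  assumes p: "is_partition m p" and h: "h permutes {1..m}"
  shows "specht_class p t (h \<circ> \<sigma> \<circ> inv' h) = specht_class p t \<sigma>"
  unfolding specht_class_def sum_list_partition[OF p]
proof (rule sum.reindex_bij_witness[where i = "\<lambda>g. h \<circ> g" and j = "\<lambda>g. inv' h \<circ> g"])
  fix g assume "g \<in> {g. g permutes {1..m}}"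
  then have g: "g permutes {1..m}" by simp
  have "inv' (inv' h \<circ> g) = inv' g \<circ> h"
    using o_inv_distrib[OF permutes_bij[OF permutes_inv[OF h]] permutes_bij[OF g]] permutes_inv_inv[OF h] by simp
  then show "specht_coeff p t (inv' (inv' h \<circ> g) \<circ> \<sigma> \<circ> (inv' h \<circ> g)) = specht_coeff p t (inv' g \<circ> (h \<circ> \<sigma> \<circ> inv' h) \<circ> g)"
    by (simp add: comp_assoc)
qed (use h in \<open>auto simp: comp_assoc[symmetric] permutes_inv_o permutes_compose permutes_inv\<close>)

lemma finite_partitions: "finite {p. is_partition m p}"
proof (rule finite_subset)
  show "finite {xs. set xs \<subseteq> {..m} \<and> length xs \<le> m}"
    by (rule finite_lists_length_le) simp
  show "{p. is_partition m p} \<subseteq> {xs. set xs \<subseteq> {..m} \<and> length xs \<le> m}"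
  proof
    fix p assume "p \<in> {p. is_partition m p}"
    then have p: "0 \<notin> set p" "sum_list p = m" by (auto simp: is_partition_def)
    have "length p \<le> sum_list p"
      using p(1) by (induction p) auto
    moreover have "set p \<subseteq> {..m}"
      using member_le_sum_list[of _ p] p(2) by auto
    ultimately show "p \<in> {xs. set xs \<subseteq> {..m} \<and> length xs \<le> m}" using p(2) by simp
  qed
qed

text \<open>Once the indicator of the identity is a combination of the class functions
  \<open>z p\<close>, letting it act as a group algebra element writes v as a combination of the
  vectors obtained from v by the elements with coefficients \<open>z p\<close>. One of these vectors
  is nonzero, and \<open>specht_class_sum\<close> extracts from it an intertwiner that does not
  vanish.\<close>

theorem specht_exhaustive:
  assumes R: "linear_rep (sym_group m) R" and v: "v \<in> rspace R" "v \<noteq> 0"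
  shows "\<exists>p. is_partition m p \<and> (\<exists>\<phi>. intertwiner (sym_group m) (specht p) R \<phi> \<and> (\<exists>u\<in>rspace (specht p). \<phi> u \<noteq> 0))"
proof -
  define P where "P = {p. is_partition m p}"
  have finP: "finite P" unfolding P_def by (rule finite_partitions)
  define tb where "tb p = (SOME t. t \<in> tableaux p)" for p
  have tb: "tb p \<in> tableaux p" for p
    unfolding tb_def some_in_eq by (rule tableaux_nonempty)
  define z where "z p = specht_class p (tb p)" for p
  let ?G = "{\<sigma>. \<sigma> permutes {1..m}}"
  define ct where "ct \<sigma> = cycle_type {1..m} \<sigma>" for \<sigma>
  have ct: "ct \<sigma> \<in> P" if "\<sigma> \<in> ?G" for \<sigma>
    using is_partition_cycle_type[of \<sigma> "{1..m}"] that by (simp add: P_def ct_def)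
  \<comment> \<open>The class function \<open>z p\<close>, read as a function of the cycle type;
    lists that are not cycle types receive the value 0.\<close>
  define y where "y p k = (if k \<in> ct ` ?G then z p (SOME \<sigma>. \<sigma> \<in> ?G \<and> ct \<sigma> = k) else 0)" for p k
  have yz: "y p (ct \<sigma>) = z p \<sigma>" if \<sigma>: "\<sigma> \<in> ?G" and p: "p \<in> P" for p \<sigma>
  proof -
    define \<tau> where "\<tau> = (SOME \<tau>. \<tau> \<in> ?G \<and> ct \<tau> = ct \<sigma>)"
    have \<tau>: "\<tau> \<in> ?G" "ct \<tau> = ct \<sigma>"
      using someI_ex[of "\<lambda>\<tau>. \<tau> \<in> ?G \<and> ct \<tau> = ct \<sigma>"] \<sigma> unfolding \<tau>_def by auto
    obtain h where h: "h permutes {1..m}" "h \<circ> \<sigma> = \<tau> \<circ> h"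
      by (rule cycle_type_conjugate[of \<sigma> "{1..m}" \<tau>]) (use \<sigma> \<tau> in \<open>auto simp: ct_def\<close>)
    have "\<tau> = h \<circ> \<sigma> \<circ> inv' h"
      using h by (simp add: comp_assoc permutes_inv_o)
    then have "z p \<tau> = z p \<sigma>"
      using specht_class_conjugate[OF _ h(1)] p by (simp add: z_def P_def)
    moreover have "y p (ct \<sigma>) = z p \<tau>"
      unfolding y_def \<tau>_def using \<sigma> by (simp only: imageI if_True)
    ultimately show ?thesis by simp
  qed
  \<comment> \<open>On a polytabloid of shape q the element with coefficients \<open>z p\<close>
    gives 0 for p \<noteq> q, by Schur's lemma, and a nonzero vector for p = q.\<close>
  have indep: "c q = 0" if c: "\<forall>\<sigma>\<in>?G. (\<Sum>p\<in>P. c p * z p \<sigma>) = 0" and q: "q \<in> P" for c q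
  proof -
    let ?e = "polytabloid q (tb q)"
    have q': "is_partition m q" using q by (simp add: P_def)
    note e = polytabloid_in_specht[OF tb]
    define Z where "Z p = (\<Sum>\<sigma>\<in>?G. z p \<sigma> *\<^sub>C perm_action \<sigma> ?e)" for p
    have Z0: "Z p = 0" if "p \<in> P" "p \<noteq> q" for p
    proof -
      have p': "is_partition m p" using that by (simp add: P_def)
      have "specht_hom p (tb p) (specht q) (perm_action (inv' g) ?e) (polytabloid p (tb p)) = 0" if "g \<in> ?G" for g
        by (rule specht_hom_zero[OF p' q' \<open>p \<noteq> q\<close> e])
          (use linear_rep_closed[OF linear_rep_specht[OF q'] _ e] permutes_inv that in auto)
      then show ?thesis
        using specht_class_sum[OF p' linear_rep_specht[OF q'] e, of "tb p"]
        by (simp add: Z_def z_def perm_action_0)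
    qed
    have "(\<Sum>p\<in>P. c p *\<^sub>C Z p) = (\<Sum>\<sigma>\<in>?G. (\<Sum>p\<in>P. c p * z p \<sigma>) *\<^sub>C perm_action \<sigma> ?e)"
      unfolding Z_def complex_vector.scale_sum_right complex_vector.scale_sum_left scaleC_scaleC by (rule sum.swap)
    also have "\<dots> = 0" using c by simp
    finally have "(\<Sum>p\<in>P. c p *\<^sub>C Z p) = 0" .
    moreover have "(\<Sum>p\<in>P. c p *\<^sub>C Z p) = (\<Sum>p\<in>P. if p = q then c q *\<^sub>C Z q else 0)"
      by (rule sum.cong) (auto simp: Z0)
    ultimately have "c q *\<^sub>C Z q = 0" using finP q by simp
    then show "c q = 0"
      using specht_class_nonzero[OF q' tb] by (simp add: Z_def z_def)
  qed
  define \<delta> where "\<delta> k = (\<lambda>k'. if k' = k then 1 else 0 :: complex)" for k :: "nat list"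
  have expand: "f = (\<Sum>k\<in>P. f k *\<^sub>C \<delta> k)" if "\<And>k. k \<notin> P \<Longrightarrow> f k = 0" for f
    using that finP by (auto simp: fun_eq_iff sum_fun_apply \<delta>_def if_distrib[of "(*) _"] cong: if_cong)
  have spanT: "f \<in> cspan (\<delta> ` P)" if "\<And>k. k \<notin> P \<Longrightarrow> f k = 0" for f
    by (subst expand[OF that]) (blast intro: complex_vector.span_sum complex_vector.span_scale complex_vector.span_base)+
  have y0: "y p k = 0" if "k \<notin> P" for p k
    using that ct by (auto simp: y_def)
  have y_indep: "c p = 0" if s: "(\<Sum>p\<in>P. c p *\<^sub>C y p) = 0" and p: "p \<in> P" for c p
  proof (rule indep[OF _ p], rule ballI)
    fix \<sigma> assume \<sigma>: "\<sigma> \<in> ?G"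
    have "(\<Sum>p\<in>P. c p * z p \<sigma>) = (\<Sum>p\<in>P. c p *\<^sub>C y p) (ct \<sigma>)"
      by (simp add: sum_fun_apply yz[OF \<sigma>])
    then show "(\<Sum>p\<in>P. c p * z p \<sigma>) = 0" using s by simp
  qed
  have y_inj: "inj_on y P"
  proof (rule inj_onI, rule ccontr)
    fix p q assume pq: "p \<in> P" "q \<in> P" "y p = y q" "p \<noteq> q"
    have "(\<Sum>r\<in>P. (if r = p then 1 else if r = q then -1 else 0) *\<^sub>C y r) =
        (\<Sum>r\<in>P. (if r = p then y p else 0) - (if r = q then y q else 0))"
      by (rule sum.cong) (use pq in \<open>auto simp: scaleC_one complex_vector.scale_minus_left\<close>)
    also have "\<dots> = 0"
      using pq finP by (simp add: sum_subtractf)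
    finally show False
      using y_indep[of "\<lambda>r. if r = p then 1 else if r = q then -1 else 0" p] pq by simp
  qed
  have ind: "\<not> complex_vector.dependent (y ` P)"
  proof
    assume "complex_vector.dependent (y ` P)"
    then obtain u where u: "(\<Sum>x\<in>y ` P. u x *\<^sub>C x) = 0" "\<exists>x\<in>y ` P. u x \<noteq> 0"
      using complex_vector.dependent_finite[of "y ` P"] finP by auto
    then have "(\<Sum>p\<in>P. u (y p) *\<^sub>C y p) = 0"
      by (simp add: sum.reindex[OF y_inj])
    then show False using y_indep[of "\<lambda>p. u (y p)"] u(2) by auto
  qed
  \<comment> \<open>The functions supported on P have dimension at most |P|, and the
    \<open>y p\<close> are |P| independent ones among them; adjoining a further independent function
    would exceed the dimension.\<close>
  have span: "\<delta> k \<in> cspan (y ` P)" if k: "k \<in> P" for k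
  proof (rule ccontr)
    assume no: "\<delta> k \<notin> cspan (y ` P)"
    have ins: "\<not> complex_vector.dependent (insert (\<delta> k) (y ` P))"
      by (rule complex_vector.independent_insertI[OF no ind])
    have "insert (\<delta> k) (y ` P) \<subseteq> cspan (\<delta> ` P)"
      using k y0 spanT by (auto intro: complex_vector.span_base)
    then have "card (insert (\<delta> k) (y ` P)) \<le> card (\<delta> ` P)"
      using complex_vector.independent_span_bound[OF _ ins, of "\<delta> ` P"] finP by simp
    moreover have "\<delta> k \<notin> y ` P" using no complex_vector.span_base by blast
    ultimately have "Suc (card P) \<le> card (\<delta> ` P)"
      using finP by (simp add: card_image[OF y_inj])
    then show False using card_image_le[OF finP, of \<delta>] by simp
  qed
  have idG: "id \<in> ?G" by (simp add: permutes_id)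
  have "\<delta> (ct id) \<in> cspan (y ` P)" by (rule span[OF ct[OF idG]])
  then obtain u where "\<delta> (ct id) = (\<Sum>x\<in>y ` P. u x *\<^sub>C x)"
    using complex_vector.span_finite[of "y ` P"] finP by auto
  then have c: "\<delta> (ct id) = (\<Sum>p\<in>P. u (y p) *\<^sub>C y p)"
    by (simp add: sum.reindex[OF y_inj])
  have id: "(\<Sum>p\<in>P. u (y p) * z p \<sigma>) = (if \<sigma> = id then 1 else 0)" if \<sigma>: "\<sigma> \<in> ?G" for \<sigma>
  proof -
    have "(\<Sum>p\<in>P. u (y p) * z p \<sigma>) = \<delta> (ct id) (ct \<sigma>)"
      unfolding c by (simp add: sum_fun_apply yz[OF \<sigma>])
    \<comment> \<open>The identity is alone in its conjugacy class, so \<delta> at its cycle type is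
      the indicator of the identity among permutations.\<close>
    moreover have "\<sigma> = id" if eq: "ct \<sigma> = ct id"
    proof -
      obtain h where h: "h permutes {1..m}" "h \<circ> id = \<sigma> \<circ> h"
        by (rule cycle_type_conjugate[of id "{1..m}" \<sigma>]) (use \<sigma> eq in \<open>auto simp: ct_def permutes_id\<close>)
      then have "\<sigma> \<circ> h \<circ> inv' h = h \<circ> inv' h" by simp
      then show ?thesis by (simp add: comp_assoc permutes_inv_o[OF h(1)])
    qed
    ultimately show ?thesis by (auto simp: \<delta>_def)
  qed
  have "v = (\<Sum>\<sigma>\<in>?G. (\<Sum>p\<in>P. u (y p) * z p \<sigma>) *\<^sub>C ract R \<sigma> v)"
  proof -
    have "(\<Sum>\<sigma>\<in>?G. (\<Sum>p\<in>P. u (y p) * z p \<sigma>) *\<^sub>C ract R \<sigma> v) = (\<Sum>\<sigma>\<in>?G. if \<sigma> = id then ract R id v else 0)"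
      by (rule sum.cong) (auto simp: id scaleC_one)
    then show ?thesis
      using linear_rep_one[OF R v(1)] finite_permutations[of "{1..m}"] idG by simp
  qed
  also have "\<dots> = (\<Sum>p\<in>P. u (y p) *\<^sub>C (\<Sum>\<sigma>\<in>?G. z p \<sigma> *\<^sub>C ract R \<sigma> v))"
    unfolding complex_vector.scale_sum_right complex_vector.scale_sum_left scaleC_scaleC by (rule sum.swap)
  finally obtain p where p: "p \<in> P" "(\<Sum>\<sigma>\<in>?G. z p \<sigma> *\<^sub>C ract R \<sigma> v) \<noteq> 0"
    using v(2) by (metis (no_types, lifting) complex_vector.scale_zero_right sum.neutral)
  have p': "is_partition m p" using p(1) by (simp add: P_def)
  have "(\<Sum>g\<in>?G. ract R g (specht_hom p (tb p) R (ract R (inv' g) v) (polytabloid p (tb p)))) \<noteq> 0"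
    using p(2) specht_class_sum[OF p' R v(1), of "tb p"] by (simp add: z_def)
  then obtain g where g: "g \<in> ?G" "ract R g (specht_hom p (tb p) R (ract R (inv' g) v) (polytabloid p (tb p))) \<noteq> 0"
    by (metis (no_types, lifting) sum.neutral)
  then have "specht_hom p (tb p) R (ract R (inv' g) v) (polytabloid p (tb p)) \<noteq> 0"
    using clinear_on_0[OF linear_rep_linear[OF R, of g] linear_rep_subspace[OF R]] by auto
  moreover have "ract R (inv' g) v \<in> rspace R"
    using linear_rep_closed[OF R _ v(1), of "inv' g"] permutes_inv[of g "{1..m}"] g(1) by simp
  ultimately show ?thesis
    using specht_hom_intertwiner[OF p' R] p' polytabloid_in_specht[OF tb] by blast
qed

section \<open>Pieri's rule\<close>

lemma sym_embed_apply: "sym_embed a (\<sigma>, \<sigma>') i = (if i \<le> a then \<sigma> i else \<sigma>' (i - a) + a)"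
  by (simp add: sym_embed_def)

lemma permutes_interval:
  assumes "\<sigma> permutes {1..n::nat}"
  shows "i \<le> n \<Longrightarrow> \<sigma> i \<le> n" "i > 0 \<Longrightarrow> \<sigma> i > 0" "i > n \<Longrightarrow> \<sigma> i = i" "\<sigma> 0 = 0"
proof -
  show z: "\<sigma> 0 = 0" by (rule permutes_not_in[OF assms]) simp
  show out: "\<sigma> i = i" if "i > n" for i by (rule permutes_not_in[OF assms]) (use that in simp)
  have mem: "\<sigma> i \<in> {1..n} \<longleftrightarrow> i \<in> {1..n}" for i by (rule permutes_in_image[OF assms])
  show "\<sigma> i \<le> n" if "i \<le> n"
    using z mem[of i] that by (cases "i = 0") auto
  show "\<sigma> i > 0" if "i > 0"
    using out mem[of i] that by (cases "i \<le> n") auto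
qed

lemma sym_embed_comp:
  assumes "\<tau> permutes {1..a}" "\<tau>' permutes {1..b}"
  shows "sym_embed a (\<sigma> \<circ> \<tau>, \<sigma>' \<circ> \<tau>') = sym_embed a (\<sigma>, \<sigma>') \<circ> sym_embed a (\<tau>, \<tau>')"
proof
  fix i
  show "sym_embed a (\<sigma> \<circ> \<tau>, \<sigma>' \<circ> \<tau>') i = (sym_embed a (\<sigma>, \<sigma>') \<circ> sym_embed a (\<tau>, \<tau>')) i"
    using permutes_interval(1)[OF assms(1), of i] permutes_interval(2)[OF assms(2), of "i - a"]
    by (auto simp: sym_embed_apply)
qed

lemma sym_embed_id: "sym_embed a (id, id) = id"
  by (auto simp: sym_embed_apply fun_eq_iff)

lemma sym_embed_permutes:
  assumes "\<sigma> permutes {1..a}" "\<sigma>' permutes {1..b}"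
  shows "sym_embed a (\<sigma>, \<sigma>') permutes {1..a + b}"
  unfolding permutes_def bij_iff[symmetric]
proof (intro conjI allI impI)
  have 1: "sym_embed a (inv' \<sigma>, inv' \<sigma>') \<circ> sym_embed a (\<sigma>, \<sigma>') = id"
    "sym_embed a (\<sigma>, \<sigma>') \<circ> sym_embed a (inv' \<sigma>, inv' \<sigma>') = id"
    using sym_embed_comp[OF assms, of "inv' \<sigma>" "inv' \<sigma>'"]
      sym_embed_comp[OF permutes_inv[OF assms(1)] permutes_inv[OF assms(2)], of \<sigma> \<sigma>']
    by (simp_all add: permutes_inv_o[OF assms(1)] permutes_inv_o[OF assms(2)] sym_embed_id)
  then show "bij (sym_embed a (\<sigma>, \<sigma>'))"
    by (rule o_bij)
  fix i assume "i \<notin> {1..a + b}"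
  then show "sym_embed a (\<sigma>, \<sigma>') i = i"
    using permutes_interval[OF assms(1)] permutes_interval(3)[OF assms(2), of "i - a"]
    by (cases "i = 0") (auto simp: sym_embed_apply)
qed

lemma group_hom_sym_embed: "group_hom (sym_group a \<times>\<times> sym_group b) (sym_group (a + b)) (sym_embed a)"
  unfolding group_hom_def group_hom_axioms_def
  by (auto intro!: homI DirProd_group sym_group_is_group sym_embed_permutes simp: sym_embed_comp simp del: One_nat_def)

text \<open>Both components are read off from h on the two blocks. Through this, a conjugating
  permutation that preserves the marked points is recognised as an element of the subgroup.\<close>

lemma sym_embed_stabilizer:
  assumes h: "h permutes {1..a + b}" and im: "h ` {a + 1..a + b} = {a + 1..a + b}"
  obtains \<sigma> \<sigma>' where "\<sigma> permutes {1..a}" "\<sigma>' permutes {1..b}" "h = sym_embed a (\<sigma>, \<sigma>')"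
proof -
  have inj: "inj h" by (rule permutes_inj[OF h])
  have high: "h i \<in> {a + 1..a + b} \<longleftrightarrow> i \<in> {a + 1..a + b}" for i
    using im inj by (metis imageE imageI injD)
  have all: "h i \<in> {1..a + b} \<longleftrightarrow> i \<in> {1..a + b}" for i
    by (rule permutes_in_image[OF h])
  have low: "h i \<in> {1..a} \<longleftrightarrow> i \<in> {1..a}" for i
    using high[of i] all[of i] by auto
  define \<sigma> where "\<sigma> i = (if i \<in> {1..a} then h i else i)" for i
  define \<sigma>' where "\<sigma>' i = (if i \<in> {1..b} then h (i + a) - a else i)" for i
  have "inj_on \<sigma> {1..a}"
    by (rule inj_onI, rule injD[OF inj]) (simp add: \<sigma>_def)
  moreover have "\<sigma> ` {1..a} \<subseteq> {1..a}"
    by (simp add: image_subset_iff \<sigma>_def low del: atLeastAtMost_iff One_nat_def)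
  ultimately have "bij_betw \<sigma> {1..a} {1..a}"
    by (simp add: bij_betw_def endo_inj_surj)
  then have \<sigma>: "\<sigma> permutes {1..a}"
    by (rule bij_imp_permutes) (auto simp: \<sigma>_def)
  have hb: "h (i + a) \<in> {a + 1..a + b}" if "i \<in> {1..b}" for i
    using high[of "i + a"] that by auto
  have "inj_on \<sigma>' {1..b}"
  proof (rule inj_onI)
    fix i j assume ij: "i \<in> {1..b}" "j \<in> {1..b}" "\<sigma>' i = \<sigma>' j"
    then have "h (i + a) = h (j + a)"
      using hb[OF ij(1)] hb[OF ij(2)] by (auto simp: \<sigma>'_def)
    then show "i = j" using injD[OF inj] by (metis add_right_cancel)
  qed
  moreover have "\<sigma>' ` {1..b} \<subseteq> {1..b}"
    using hb by (fastforce simp: \<sigma>'_def)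
  ultimately have "bij_betw \<sigma>' {1..b} {1..b}"
    by (simp add: bij_betw_def endo_inj_surj)
  then have \<sigma>': "\<sigma>' permutes {1..b}"
    by (rule bij_imp_permutes) (auto simp: \<sigma>'_def)
  have "h i = sym_embed a (\<sigma>, \<sigma>') i" for i
  proof (cases "i \<in> {1..a + b}")
    case True
    then show ?thesis
      using hb[of "i - a"] by (auto simp: sym_embed_apply \<sigma>_def \<sigma>'_def)
  next
    case False
    then show ?thesis
      using permutes_not_in[OF h False] by (auto simp: sym_embed_apply \<sigma>_def \<sigma>'_def)
  qed
  then show ?thesis using that[OF \<sigma> \<sigma>'] by auto
qed

text \<open>The representation R \<boxtimes> \<chi> realised on the space of R itself, so that forms
  and polytabloids apply without a detour through the tensor space.\<close>

definition twist :: "('h \<Rightarrow> complex) \<Rightarrow> ('g, 'v::complex_vector) rep \<Rightarrow> ('g \<times> 'h, 'v) rep"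
  where "twist \<chi> R = \<lparr>rspace = rspace R, ract = (\<lambda>(g, h) v. \<chi> h *\<^sub>C ract R g v)\<rparr>"

text \<open>The isomorphism is v \<mapsto> v \<otimes> 1; it is onto because v \<otimes> c = (c v)
  \<otimes> 1.\<close>

lemma rep_iso_box_character:
  assumes R: "linear_rep G R" "group G" and X: "linear_rep H X" "group H"
    and \<chi>: "rspace X = UNIV" "\<And>h z. ract X h z = \<chi> h * (z::complex)"
  shows "rep_iso (G \<times>\<times> H) (twist \<chi> R) (R \<boxtimes> X)"
proof -
  let ?p = "pure_tensor (rspace R) (UNIV :: complex set)"
  note sub = linear_rep_subspace[OF R(1)]
  have scale: "?p v c = ?p (c *\<^sub>C v) 1" if "v \<in> rspace R" for v c
    using clinear_on_scale[OF pure_tensor_linear(1)[OF that, of "UNIV :: complex set"], of 1 c]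
      clinear_on_scale[OF pure_tensor_linear(2)[of "1 :: complex" UNIV "rspace R"], of v c] that by simp
  have lin: "clinear_on (rspace R) (\<lambda>v. ?p v 1)"
    by (rule pure_tensor_linear(2)) simp
  have inj: "inj_on (\<lambda>v. ?p v 1) (rspace R)"
  proof (rule inj_onI, rule ccontr)
    fix v w assume vw: "v \<in> rspace R" "w \<in> rspace R" "?p v 1 = ?p w 1" "v \<noteq> w"
    \<comment> \<open>A linear functional l with l (v - w) = 1 gives the bilinear form c l(u), which
      separates v \<otimes> 1 from w \<otimes> 1.\<close>
    have "\<not> complex_vector.dependent {v - w}"
      using vw(4) by simp
    then obtain l where l: "Vector_Spaces.linear scaleC scaleC l" "l (v - w) = (1::complex)"
      using complex_vector_pair.linear_independent_extend[of "{v - w}" "\<lambda>_. 1::complex"]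
      by (auto simp: complex_vector.dependent_def)
    define \<beta> where "\<beta> u c = c * l u" for u and c :: complex
    have "bilinear_form_on (rspace R) UNIV \<beta>"
      using l(1) by (auto simp: bilinear_form_on_def clinear_on_def \<beta>_def algebra_simps linear_iff_module_hom
          module_hom.add module_hom.scale)
    then have "l v = l w"
      using fun_cong[OF vw(3), of \<beta>] by (simp add: pure_tensor_apply \<beta>_def)
    then show False
      using l by (simp add: linear_iff_module_hom module_hom.diff)
  qed
  have surj: "(\<lambda>v. ?p v 1) ` rspace R = rspace (R \<boxtimes> X)"
  proof
    show "(\<lambda>v. ?p v 1) ` rspace R \<subseteq> rspace (R \<boxtimes> X)"
      by (auto simp: \<chi>(1) intro: pure_tensor_in)
    have "csubspace ((\<lambda>v. ?p v 1) ` rspace R)"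
    proof (rule complex_vector.subspaceI)
      show "0 \<in> (\<lambda>v. ?p v 1) ` rspace R"
        using clinear_on_0[OF lin sub] complex_vector.subspace_0[OF sub] by force
      show "x + y \<in> (\<lambda>v. ?p v 1) ` rspace R" if "x \<in> (\<lambda>v. ?p v 1) ` rspace R" "y \<in> (\<lambda>v. ?p v 1) ` rspace R" for x y
        using that by (auto simp: clinear_on_add[OF lin, symmetric] complex_vector.subspace_add[OF sub])
      show "c *\<^sub>C x \<in> (\<lambda>v. ?p v 1) ` rspace R" if "x \<in> (\<lambda>v. ?p v 1) ` rspace R" for c x
        using that by (auto simp: clinear_on_scale[OF lin, symmetric] complex_vector.subspace_scale[OF sub])
    qed
    moreover have "?p v c \<in> (\<lambda>v. ?p v 1) ` rspace R" if "v \<in> rspace R" for v c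
      unfolding scale[OF that, of c] using complex_vector.subspace_scale[OF sub that, of c] by (rule imageI)
    ultimately show "rspace (R \<boxtimes> X) \<subseteq> (\<lambda>v. ?p v 1) ` rspace R"
      unfolding rspace_box \<chi>(1) tensor_space_def by (intro complex_vector.span_minimal) auto
  qed
  have eqv: "?p (\<chi> h *\<^sub>C ract R g v) 1 = ract (R \<boxtimes> X) (g, h) (?p v 1)"
    if "g \<in> carrier G" "h \<in> carrier H" "v \<in> rspace R" for g h v
    using box_action_pure[OF R that(1) X that(2) that(3), of 1] scale[OF linear_rep_closed[OF R(1) that(1,3)], of "\<chi> h"]
    by (simp add: \<chi>)
  show ?thesis
    unfolding rep_iso_def bij_betw_def
    by (rule exI[of _ "\<lambda>v. ?p v 1"]) (use inj surj lin eqv in \<open>auto simp: twist_def\<close>)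
qed

text \<open>In the second argument (e_t, e_t) e_t is rewritten as \<kappa>_t e_t; invariance of the
  Hermitian form moves every column permutation to the first argument, where \<kappa>_t u = (u, e_t)
  e_t. Column permutations enter as pairs (\<pi>, id), on which the character is 1.\<close>

lemma intertwiner_twist_norm:
  assumes p: "is_partition m p" and q: "is_partition (m + k) q" and t: "t \<in> tableaux p" and \<chi>: "\<chi> id = 1"
    and f: "intertwiner (sym_group m \<times>\<times> sym_group k) (twist \<chi> (specht p)) (pullback (sym_embed m) (specht q)) f"
    and g: "intertwiner (sym_group m \<times>\<times> sym_group k) (twist \<chi> (specht p)) (pullback (sym_embed m) (specht q)) g"
    and u: "u \<in> rspace (specht p)"
  shows "tabloid_form p (polytabloid p t) (polytabloid p t) * hermitian_form q (f u) (g (polytabloid p t)) =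
    tabloid_form p u (polytabloid p t) * hermitian_form q (f (polytabloid p t)) (g (polytabloid p t))"
proof -
  let ?e = "polytabloid p t" and ?C = "column_stabilizer p t"
  note m = sum_list_partition[OF p] and mk = sum_list_partition[OF q]
  note e = polytabloid_in_specht[OF t]
  have perm: "\<pi> permutes {1..m}" if "\<pi> \<in> ?C" for \<pi> using that by (simp add: column_stabilizer_def m)
  have lin: "clinear_on (rspace (specht p)) f" "clinear_on (rspace (specht p)) g"
    using intertwinerD(1)[OF f] intertwinerD(1)[OF g] by (simp_all add: twist_def)
  have eqv: "f (perm_action \<pi> v) = perm_action (sym_embed m (\<pi>, id)) (f v)"
    "g (perm_action \<pi> v) = perm_action (sym_embed m (\<pi>, id)) (g v)"
    if "\<pi> permutes {1..m}" "v \<in> rspace (specht p)" for \<pi> v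
    using intertwinerD(3)[OF f, of "(\<pi>, id)" v] intertwinerD(3)[OF g, of "(\<pi>, id)" v] that \<chi>
    by (simp_all add: twist_def permutes_id scaleC_one)
  have act: "perm_action \<pi> v \<in> rspace (specht p)" if "\<pi> permutes {1..m}" "v \<in> rspace (specht p)" for \<pi> v
    using linear_rep_closed[OF linear_rep_specht[OF p], of \<pi> v] that by simp
  note sub = linear_rep_subspace[OF linear_rep_specht[OF p]]
  have K: "h (tabloid_form p v ?e *\<^sub>C ?e) = (\<Sum>\<pi>\<in>?C. of_int (sign \<pi>) *\<^sub>C h (perm_action \<pi> v))"
    if h: "clinear_on (rspace (specht p)) h" and v: "v \<in> rspace (specht p)" for h :: "_ \<Rightarrow> 'z::complex_vector" and v
  proof -
    have "h (\<Sum>\<pi>\<in>?C. of_int (sign \<pi>) *\<^sub>C perm_action \<pi> v) = (\<Sum>\<pi>\<in>?C. h (of_int (sign \<pi>) *\<^sub>C perm_action \<pi> v))"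
      by (rule clinear_on_sum[OF h sub]) (auto intro!: complex_vector.subspace_scale[OF sub] act perm v)
    also have "\<dots> = (\<Sum>\<pi>\<in>?C. of_int (sign \<pi>) *\<^sub>C h (perm_action \<pi> v))"
      by (rule sum.cong) (auto intro!: clinear_on_scale[OF h] act perm v)
    finally show ?thesis
      using column_symmetrizer_self[OF p t v] by (simp add: column_symmetrizer_def)
  qed
  have h0: "hermitian_form q w 0 = 0" for w by (simp add: hermitian_form_def)
  have h_sum: "hermitian_form q w (\<Sum>i\<in>I. c i *\<^sub>C z i) = (\<Sum>i\<in>I. cnj (c i) * hermitian_form q w (z i))"
    for w and I :: "(nat \<Rightarrow> nat) set" and c z
    by (induction I rule: infinite_finite_induct) (simp_all only: sum.infinite sum.empty sum.insert h0 form_linear(4,5) not_False_eq_True)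
  have NR: "cnj (tabloid_form p ?e ?e) = tabloid_form p ?e ?e"
    by (simp add: tabloid_form_def polytabloid_real)
  have "tabloid_form p ?e ?e * hermitian_form q (f u) (g ?e) = hermitian_form q (f u) (g (tabloid_form p ?e ?e *\<^sub>C ?e))"
    by (simp add: clinear_on_scale[OF lin(2) e] form_linear(5) NR)
  also have "\<dots> = (\<Sum>\<pi>\<in>?C. of_int (sign \<pi>) * hermitian_form q (f u) (g (perm_action \<pi> ?e)))"
    unfolding K[OF lin(2) e] h_sum by simp
  also have "\<dots> = (\<Sum>\<pi>\<in>?C. of_int (sign \<pi>) * hermitian_form q (f (perm_action (inv' \<pi>) u)) (g ?e))"
  proof (rule sum.cong[OF refl])
    fix \<pi> assume "\<pi> \<in> ?C"
    then have \<pi>: "\<pi> permutes {1..m}" by (rule perm)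
    have emb: "sym_embed m (\<pi>, id) permutes {1..sum_list q}"
      unfolding mk by (rule sym_embed_permutes[OF \<pi> permutes_id])
    have "f u = perm_action (sym_embed m (\<pi>, id)) (f (perm_action (inv' \<pi>) u))"
      using eqv(1)[OF \<pi> act[OF permutes_inv[OF \<pi>] u]] by (simp add: perm_action_inv(2)[OF \<pi>])
    then have "hermitian_form q (f u) (g (perm_action \<pi> ?e)) = hermitian_form q (f (perm_action (inv' \<pi>) u)) (g ?e)"
      using eqv(2)[OF \<pi> e] perm_action_form(2)[OF emb] by simp
    then show "of_int (sign \<pi>) * hermitian_form q (f u) (g (perm_action \<pi> ?e)) =
        of_int (sign \<pi>) * hermitian_form q (f (perm_action (inv' \<pi>) u)) (g ?e)" by simp
  qed
  also have "\<dots> = (\<Sum>\<pi>\<in>?C. of_int (sign \<pi>) * hermitian_form q (f (perm_action \<pi> u)) (g ?e))"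
  proof (rule sum.reindex_bij_witness[where i = "inv'" and j = "inv'"])
    fix \<pi> assume "\<pi> \<in> ?C"
    then show "of_int (sign (inv' \<pi>)) * hermitian_form q (f (perm_action (inv' \<pi>) u)) (g ?e) =
        of_int (sign \<pi>) * hermitian_form q (f (perm_action (inv' \<pi>) u)) (g ?e)"
      using sign_inverse[of \<pi>] perm[of \<pi>] permutation_permutes[of \<pi>] by (metis finite_atLeastAtMost)
  qed (auto simp: column_stabilizer_group(3)[OF t] permutes_inv_inv[OF perm])
  also have "\<dots> = hermitian_form q (f (tabloid_form p u ?e *\<^sub>C ?e)) (g ?e)"
    unfolding K[OF lin(1) u]
    using clinear_on_sum[OF form_linear(2)[of UNIV q "g ?e"] complex_vector.subspace_UNIV, of ?C "\<lambda>\<pi>. of_int (sign \<pi>) *\<^sub>C f (perm_action \<pi> u)"]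
      clinear_on_scale[OF form_linear(2)[of UNIV q "g ?e"]]
    by simp
  also have "\<dots> = tabloid_form p u ?e * hermitian_form q (f ?e) (g ?e)"
    using clinear_on_scale[OF lin(1) e] clinear_on_scale[OF form_linear(2)[of UNIV q "g ?e"]] by simp
  finally show ?thesis .
qed

text \<open>Gelfand's trick: since every permutation is conjugate to its inverse under the subgroup, the
  function \<open>g \<mapsto> \<Sum>\<^sub>h (g h x, h y)\<close> is symmetric in \<open>x\<close> and \<open>y\<close>; as the group algebra
  contains all operators \<open>v \<mapsto> (v, z) z'\<close>, this symmetry passes to these.\<close>

lemma gelfand_symmetry:
  assumes q: "is_partition (m + k) q" and k: "0 < k" "k \<le> 2"
    and x: "x \<in> rspace (specht q)" and y: "y \<in> rspace (specht q)" and z: "z \<in> rspace (specht q)"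
  shows "(\<Sum>h\<in>carrier (sym_group m \<times>\<times> sym_group k). hermitian_form q (perm_action (sym_embed m h) x) z *\<^sub>C perm_action (sym_embed m h) y) =
    (\<Sum>h\<in>carrier (sym_group m \<times>\<times> sym_group k). hermitian_form q (perm_action (sym_embed m h) y) z *\<^sub>C perm_action (sym_embed m h) x)"
proof -
  let ?H = "carrier (sym_group m \<times>\<times> sym_group k)" and ?b = "tabloid_form q"
  note mk = sum_list_partition[OF q]
  interpret hom: group_hom "sym_group m \<times>\<times> sym_group k" "sym_group (m + k)" "sym_embed m"
    by (rule group_hom_sym_embed)
  define E where "E h = perm_action (sym_embed m h)" for h
  have emb: "sym_embed m h permutes {1..sum_list q}" if "h \<in> ?H" for h
    using hom.hom_closed[OF that] by (simp add: mk)
  have Ein: "E h v \<in> rspace (specht q)" if "h \<in> ?H" "v \<in> rspace (specht q)" for h v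
    using linear_rep_closed[OF linear_rep_specht[OF q] hom.hom_closed[OF that(1)] that(2)] by (simp add: E_def)
  have Emult: "E (h \<otimes>\<^bsub>sym_group m \<times>\<times> sym_group k\<^esub> h') v = E h (E h' v)" if "h \<in> ?H" "h' \<in> ?H" for h h' v
    using hom.hom_mult[OF that] perm_action_comp[OF emb[OF that(1)] emb[OF that(2)]] by (simp add: E_def)
  have sym: "(\<Sum>h\<in>?H. ?b (perm_action g (E h x)) (E h y)) = (\<Sum>h\<in>?H. ?b (perm_action g (E h y)) (E h x))"
    if g: "g permutes {1..m + k}" for g
  proof -
    \<comment> \<open>For k \<le> 2 the second block consists of m + 1 and m + k, which coincide
      when k = 1. Preserving this set is the same as belonging to the subgroup.\<close>
    have "{m + 1, m + k} = {m + 1..m + k}"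
      using k by auto
    then obtain c where c: "c permutes {1..m + k}" "c \<circ> g = inv' g \<circ> c" "c ` {m + 1..m + k} = {m + 1..m + k}"
      using conjugate_inverse_marked[OF g, of "m + 1" "m + k"] k by auto
    obtain k0 where k0: "k0 \<in> ?H" "c = sym_embed m k0"
      by (rule sym_embed_stabilizer[OF c(1,3)]) auto
    have gq: "g permutes {1..sum_list q}" and cq: "c permutes {1..sum_list q}" using g c by (simp_all add: mk)
    have "(\<Sum>h\<in>?H. ?b (perm_action g (E h x)) (E h y)) = (\<Sum>h\<in>?H. ?b (E h x) (perm_action (inv' g) (E h y)))"
      using gq by (simp add: perm_action_form_adjoint)
    \<comment> \<open>The sum over the subgroup absorbs the factor c, after which c \<circ> g = g^-1
      \<circ> c turns the inverse of g back into g.\<close>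
    also have "\<dots> = (\<Sum>h\<in>?H. ?b (E (k0 \<otimes>\<^bsub>sym_group m \<times>\<times> sym_group k\<^esub> h) x)
        (perm_action (inv' g) (E (k0 \<otimes>\<^bsub>sym_group m \<times>\<times> sym_group k\<^esub> h) y)))"
      by (rule sum.reindex_bij_witness[where j = "\<lambda>h. inv\<^bsub>sym_group m \<times>\<times> sym_group k\<^esub> k0 \<otimes>\<^bsub>sym_group m \<times>\<times> sym_group k\<^esub> h"
            and i = "\<lambda>h. k0 \<otimes>\<^bsub>sym_group m \<times>\<times> sym_group k\<^esub> h"])
        (use k0(1) hom.G.is_group in \<open>auto simp del: carrier_DirProd simp: hom.G.m_assoc[symmetric]\<close>)
    also have "\<dots> = (\<Sum>h\<in>?H. ?b (E h x) (perm_action g (E h y)))"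
    proof (rule sum.cong[OF refl])
      fix h assume h: "h \<in> ?H"
      have "perm_action (inv' g) (E (k0 \<otimes>\<^bsub>sym_group m \<times>\<times> sym_group k\<^esub> h) y) = perm_action (inv' g \<circ> c) (E h y)"
        unfolding Emult[OF k0(1) h]
        by (simp add: E_def k0(2)[symmetric] perm_action_comp[OF permutes_inv[OF g] c(1)])
      also have "\<dots> = perm_action c (perm_action g (E h y))"
        by (simp add: c(2)[symmetric] perm_action_comp[OF c(1) g])
      finally show "?b (E (k0 \<otimes>\<^bsub>sym_group m \<times>\<times> sym_group k\<^esub> h) x) (perm_action (inv' g) (E (k0 \<otimes>\<^bsub>sym_group m \<times>\<times> sym_group k\<^esub> h) y)) =
          ?b (E h x) (perm_action g (E h y))"
        unfolding Emult[OF k0(1) h, of x] by (simp add: E_def k0(2)[symmetric] perm_action_form(1)[OF cq])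
    qed
    also have "\<dots> = (\<Sum>h\<in>?H. ?b (perm_action g (E h y)) (E h x))"
      by (simp add: form_commute(1))
    finally show ?thesis .
  qed
  obtain t where t: "t \<in> tableaux q" using tableaux_nonempty[of q] by auto
  let ?e = "polytabloid q t" and ?C = "column_stabilizer q t"
  have perm: "\<pi> permutes {1..m + k}" if "\<pi> \<in> ?C" for \<pi> using that by (simp add: column_stabilizer_def mk)
  have b_sum: "?b (\<Sum>i\<in>I. f i) v = (\<Sum>i\<in>I. ?b (f i) v)" for f :: "'i \<Rightarrow> _" and I v
    by (rule clinear_on_sum[OF form_linear(1)[of UNIV]]) (auto simp: complex_vector.subspace_UNIV)
  have b_scale: "?b (c *\<^sub>C u) v = c * ?b u v" for c u v
    using clinear_on_scale[OF form_linear(1)[of UNIV q v], of u c] by simp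
  \<comment> \<open>By James' identity the signed sum of the permutations \<sigma>2 \<circ> \<pi>
    \<circ> \<sigma>1^-1 acts as the rank-one operator v \<mapsto> (v, \<sigma>1 e) \<sigma>2 e, so
    the symmetry known for single group elements passes to these operators.\<close>
  have op: "(\<Sum>\<pi>\<in>?C. of_int (sign \<pi>) * (\<Sum>h\<in>?H. ?b (perm_action (\<sigma>2 \<circ> \<pi> \<circ> inv' \<sigma>1) (E h v)) (E h w))) =
      (\<Sum>h\<in>?H. ?b (E h v) (perm_action \<sigma>1 ?e) * ?b (E h w) (perm_action \<sigma>2 ?e))"
    if \<sigma>: "\<sigma>1 permutes {1..m + k}" "\<sigma>2 permutes {1..m + k}" and vw: "v \<in> rspace (specht q)" "w \<in> rspace (specht q)"
    for \<sigma>1 \<sigma>2 v w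
  proof -
    have "(\<Sum>\<pi>\<in>?C. of_int (sign \<pi>) * (\<Sum>h\<in>?H. ?b (perm_action (\<sigma>2 \<circ> \<pi> \<circ> inv' \<sigma>1) (E h v)) (E h w))) =
        (\<Sum>h\<in>?H. \<Sum>\<pi>\<in>?C. of_int (sign \<pi>) * ?b (perm_action (\<sigma>2 \<circ> \<pi> \<circ> inv' \<sigma>1) (E h v)) (E h w))"
      unfolding sum_distrib_left by (rule sum.swap)
    also have "\<dots> = (\<Sum>h\<in>?H. ?b (E h v) (perm_action \<sigma>1 ?e) * ?b (E h w) (perm_action \<sigma>2 ?e))"
    proof (rule sum.cong[OF refl])
      fix h assume h: "h \<in> ?H"
      let ?u = "perm_action (inv' \<sigma>1) (E h v)"
      have u: "?u \<in> rspace (specht q)"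
        using linear_rep_closed[OF linear_rep_specht[OF q] _ Ein[OF h vw(1)], of "inv' \<sigma>1"] permutes_inv[OF \<sigma>(1)] by simp
      have "(\<Sum>\<pi>\<in>?C. of_int (sign \<pi>) * ?b (perm_action (\<sigma>2 \<circ> \<pi> \<circ> inv' \<sigma>1) (E h v)) (E h w)) =
          (\<Sum>\<pi>\<in>?C. ?b (of_int (sign \<pi>) *\<^sub>C perm_action \<pi> ?u) (perm_action (inv' \<sigma>2) (E h w)))"
      proof (rule sum.cong[OF refl])
        fix \<pi> assume \<pi>: "\<pi> \<in> ?C"
        have "perm_action (\<sigma>2 \<circ> \<pi> \<circ> inv' \<sigma>1) (E h v) = perm_action \<sigma>2 (perm_action \<pi> ?u)"
          using perm_action_comp[OF permutes_compose[OF perm[OF \<pi>] \<sigma>(2)] permutes_inv[OF \<sigma>(1)]]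
            perm_action_comp[OF \<sigma>(2) perm[OF \<pi>]] by simp
        then show "of_int (sign \<pi>) * ?b (perm_action (\<sigma>2 \<circ> \<pi> \<circ> inv' \<sigma>1) (E h v)) (E h w) =
            ?b (of_int (sign \<pi>) *\<^sub>C perm_action \<pi> ?u) (perm_action (inv' \<sigma>2) (E h w))"
          using \<sigma>(2) by (simp add: b_scale perm_action_form_adjoint mk)
      qed
      also have "\<dots> = ?b (?b ?u ?e *\<^sub>C ?e) (perm_action (inv' \<sigma>2) (E h w))"
        using column_symmetrizer_self[OF q t u] by (simp add: column_symmetrizer_def b_sum[symmetric])
      also have "\<dots> = ?b (E h v) (perm_action \<sigma>1 ?e) * ?b (E h w) (perm_action \<sigma>2 ?e)"
        using perm_action_form_adjoint(1)[of "inv' \<sigma>1" q "E h v" ?e] perm_action_form_adjoint(1)[of \<sigma>2 q ?e "E h w"]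
          permutes_inv[OF \<sigma>(1)] permutes_inv_inv[OF \<sigma>(1)] \<sigma>(2)
        by (simp add: b_scale mk form_commute(1)[of q _ "E h w"])
      finally show "(\<Sum>\<pi>\<in>?C. of_int (sign \<pi>) * ?b (perm_action (\<sigma>2 \<circ> \<pi> \<circ> inv' \<sigma>1) (E h v)) (E h w)) =
          ?b (E h v) (perm_action \<sigma>1 ?e) * ?b (E h w) (perm_action \<sigma>2 ?e)" .
    qed
    finally show ?thesis .
  qed
  have sym_e: "(\<Sum>h\<in>?H. ?b (E h x) (perm_action \<sigma>1 ?e) * ?b (E h y) (perm_action \<sigma>2 ?e)) =
      (\<Sum>h\<in>?H. ?b (E h y) (perm_action \<sigma>1 ?e) * ?b (E h x) (perm_action \<sigma>2 ?e))"
    if \<sigma>: "\<sigma>1 permutes {1..m + k}" "\<sigma>2 permutes {1..m + k}" for \<sigma>1 \<sigma>2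
    unfolding op[OF \<sigma> x y, symmetric] op[OF \<sigma> y x, symmetric]
    by (intro sum.cong refl arg_cong2[of _ _ _ _ "(*)"] sym permutes_compose[OF permutes_inv[OF \<sigma>(1)]]
        permutes_compose[OF _ \<sigma>(2)] perm)
  have poly: "\<exists>\<sigma>. \<sigma> permutes {1..m + k} \<and> polytabloid q s = perm_action \<sigma> ?e" if s: "s \<in> tableaux q" for s
  proof -
    obtain \<sigma> where \<sigma>: "\<sigma> permutes {1..sum_list q}" "\<And>c. c \<in> young_diagram q \<Longrightarrow> s c = (\<sigma> \<circ> t) c"
      using tableaux_transitive[OF t s] by metis
    then show ?thesis
      using polytabloid_cong[of q s "\<sigma> \<circ> t"] polytabloid_action[OF t \<sigma>(1)] by (auto simp: mk)
  qed
  note sub = linear_rep_subspace[OF linear_rep_specht[OF q]]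
  \<comment> \<open>The difference of the two sides as a function of z. It is conjugate-linear, so
    its zeros form a subspace, and only polytabloids, the translates of one of them, have to be
    tested.\<close>
  define V where "V z = (\<Sum>h\<in>?H. hermitian_form q (E h x) z *\<^sub>C E h y) - (\<Sum>h\<in>?H. hermitian_form q (E h y) z *\<^sub>C E h x)" for z
  have V0: "V (polytabloid q s) = 0" if s: "s \<in> tableaux q" for s
  proof (rule specht_nondegenerate)
    show "V (polytabloid q s) \<in> rspace (specht q)"
      unfolding V_def by (intro complex_vector.subspace_diff[OF sub] complex_vector.subspace_sum[OF sub]
        complex_vector.subspace_scale[OF sub] Ein x y)
    fix s' assume s': "s' \<in> tableaux q"
    obtain \<sigma>1 \<sigma>2 where \<sigma>: "\<sigma>1 permutes {1..m + k}" "polytabloid q s = perm_action \<sigma>1 ?e"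
      "\<sigma>2 permutes {1..m + k}" "polytabloid q s' = perm_action \<sigma>2 ?e"
      using poly[OF s] poly[OF s'] by auto
    have b_diff: "?b (u - v) w = ?b u w - ?b v w" for u v w
      by (rule clinear_on_diff[OF form_linear(1)[of UNIV]]) (auto simp: complex_vector.subspace_UNIV)
    show "?b (V (polytabloid q s)) (polytabloid q s') = 0"
      unfolding V_def b_diff b_sum b_scale hermitian_form_polytabloid
      using sym_e[OF \<sigma>(1,3)] by (simp add: \<sigma>(2,4))
  qed
  have "rspace (specht q) \<subseteq> {z. V z = 0}"
    unfolding specht_space
  proof (rule complex_vector.span_minimal)
    have V_add: "V (z + z') = V z + V z'" for z z'
      unfolding V_def by (simp add: form_linear(4) scaleC_add_left sum.distrib)
    have V_scale: "V (c *\<^sub>C z) = cnj c *\<^sub>C V z" for c z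
      unfolding V_def by (simp add: form_linear(5) complex_vector.scale_sum_right complex_vector.scale_right_diff_distrib)
    have "V 0 = 0"
      using V_scale[of 0 0] by simp
    then show "csubspace {z. V z = 0}"
      by (intro complex_vector.subspaceI) (auto simp: V_add V_scale)
  qed (use V0 in auto)
  then show ?thesis
    using z by (auto simp: V_def E_def)
qed

text \<open>As in Gram-Schmidt, g' is g minus its component along f, so g'(e) is orthogonal to f(e).
  Gelfand symmetry for f(e) and g'(e), tested against f(e), has one side equal to zero; pairing the
  other side with g'(e) leaves a nonzero multiple of the product of the squared norms of f(e) and
  g'(e). Hence g'(e) = 0, and g' vanishes because e generates the module.\<close>

lemma specht_twist_proportional:
  assumes p: "is_partition m p" and q: "is_partition (m + k) q" and k: "0 < k" "k \<le> 2"
    and \<chi>: "\<chi> id = 1" "\<And>\<sigma>. \<chi> \<sigma> * \<chi> \<sigma> = (1::complex)"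
    and f: "intertwiner (sym_group m \<times>\<times> sym_group k) (twist \<chi> (specht p)) (pullback (sym_embed m) (specht q)) f"
    and g: "intertwiner (sym_group m \<times>\<times> sym_group k) (twist \<chi> (specht p)) (pullback (sym_embed m) (specht q)) g"
    and nz: "v \<in> rspace (specht p)" "f v \<noteq> 0"
  shows "\<exists>c. \<forall>v\<in>rspace (specht p). g v = c *\<^sub>C f v"
proof -
  let ?H = "carrier (sym_group m \<times>\<times> sym_group k)"
  note m = sum_list_partition[OF p] and mk = sum_list_partition[OF q]
  obtain t where t: "t \<in> tableaux p" using tableaux_nonempty[of p] by auto
  let ?e = "polytabloid p t"
  note e = polytabloid_in_specht[OF t]
  define N where "N = tabloid_form p ?e ?e"
  have N0: "N \<noteq> 0" unfolding N_def by (rule polytabloid_norm[OF t])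
  \<comment> \<open>All polytabloids are translates of e, so an intertwiner is determined by its
    value there.\<close>
  have zero: "f' u = 0" if f': "intertwiner (sym_group m \<times>\<times> sym_group k) (twist \<chi> (specht p)) (pullback (sym_embed m) (specht q)) f'"
    and 0: "f' ?e = 0" and u: "u \<in> rspace (specht p)" for f' u
  proof (rule clinear_on_span_eq[of "polytabloid p ` tableaux p" f' "\<lambda>_. 0"])
    show "clinear_on (cspan (polytabloid p ` tableaux p)) f'"
      using intertwinerD(1)[OF f'] by (simp add: twist_def specht_space)
    fix b assume "b \<in> polytabloid p ` tableaux p"
    then obtain s where s: "s \<in> tableaux p" "b = polytabloid p s" by auto
    obtain \<sigma> where \<sigma>: "\<sigma> permutes {1..sum_list p}" "\<And>x. x \<in> young_diagram p \<Longrightarrow> s x = (\<sigma> \<circ> t) x"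
      using tableaux_transitive[OF t s(1)] by metis
    have "b = perm_action \<sigma> ?e"
      using polytabloid_cong[of p s "\<sigma> \<circ> t"] polytabloid_action[OF t \<sigma>(1)] \<sigma>(2) s(2) by simp
    then show "f' b = 0"
      using intertwinerD(3)[OF f', of "(\<sigma>, id)" ?e] \<sigma>(1) e 0
      by (simp add: twist_def m \<chi> permutes_id scaleC_one perm_action_0)
  qed (use u in \<open>auto simp: specht_space clinear_on_def\<close>)
  have x0: "f ?e \<noteq> 0" using zero[OF f _ nz(1)] nz(2) by auto
  have fq: "f' ?e \<in> rspace (specht q)"
    if "intertwiner (sym_group m \<times>\<times> sym_group k) (twist \<chi> (specht p)) (pullback (sym_embed m) (specht q)) f'" for f'
    using intertwinerD(2)[OF that, of ?e] e by (simp add: twist_def)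
  have hx: "hermitian_form q (f ?e) (f ?e) \<noteq> 0"
    using hermitian_form_self_eq_0[of "f ?e" q] fq[OF f] specht_subset x0 by auto
  define c where "c = hermitian_form q (g ?e) (f ?e) / hermitian_form q (f ?e) (f ?e)"
  define g' where "g' u = g u - c *\<^sub>C f u" for u
  have g': "intertwiner (sym_group m \<times>\<times> sym_group k) (twist \<chi> (specht p)) (pullback (sym_embed m) (specht q)) g'"
  proof (rule intertwinerI)
    note D = intertwinerD[OF f] intertwinerD[OF g]
    note sub = linear_rep_subspace[OF linear_rep_specht[OF q]]
    show "clinear_on (rspace (twist \<chi> (specht p))) g'"
      by (rule clinear_onI) (simp_all add: g'_def clinear_on_add[OF D(1)] clinear_on_add[OF D(4)] clinear_on_scale[OF D(1)]
        clinear_on_scale[OF D(4)] scaleC_add_right complex_vector.scale_right_diff_distrib complex_vector.scale_left_commute)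
    show "g' v \<in> rspace (pullback (sym_embed m) (specht q))" if "v \<in> rspace (twist \<chi> (specht p))" for v
      using D(2)[OF that] D(5)[OF that] complex_vector.subspace_diff[OF sub] complex_vector.subspace_scale[OF sub]
      by (simp add: g'_def)
    show "g' (ract (twist \<chi> (specht p)) h v) = ract (pullback (sym_embed m) (specht q)) h (g' v)"
      if "h \<in> ?H" "v \<in> rspace (twist \<chi> (specht p))" for h v
      using D(3)[OF that] D(6)[OF that]
        clinear_on_diff[OF perm_action_linear[of UNIV] complex_vector.subspace_UNIV, of "g v" "c *\<^sub>C f v" "sym_embed m h"]
        clinear_on_scale[OF perm_action_linear[of UNIV], of "f v" "sym_embed m h" c]
      by (simp add: g'_def)
  qed
  have h_diff: "hermitian_form q (u - v) w = hermitian_form q u w - hermitian_form q v w" for u v w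
    by (rule clinear_on_diff[OF form_linear(2)[of UNIV]]) (auto simp: complex_vector.subspace_UNIV)
  have h_scale: "hermitian_form q (c *\<^sub>C u) v = c * hermitian_form q u v" for c u v
    using clinear_on_scale[OF form_linear(2)[of UNIV q v], of u c] by simp
  have h_sum: "hermitian_form q (\<Sum>i\<in>I. w i) v = (\<Sum>i\<in>I. hermitian_form q (w i) v)" for w :: "'i \<Rightarrow> _" and I v
    by (rule clinear_on_sum[OF form_linear(2)[of UNIV]]) (auto simp: complex_vector.subspace_UNIV)
  have orth: "hermitian_form q (g' ?e) (f ?e) = 0"
    using hx by (simp add: g'_def h_diff h_scale c_def)
  \<comment> \<open>Matrix coefficients of the subgroup at the images of e are those of
    \<open>specht p\<close> itself, up to the value of \<chi> and the norm N.\<close>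
  have trans: "N * hermitian_form q (perm_action (sym_embed m (\<sigma>, \<sigma>')) (f1 ?e)) (f2 ?e) =
      \<chi> \<sigma>' * specht_coeff p t \<sigma> * hermitian_form q (f1 ?e) (f2 ?e)"
    if \<sigma>: "\<sigma> permutes {1..m}" "\<sigma>' permutes {1..k}"
      and f1: "intertwiner (sym_group m \<times>\<times> sym_group k) (twist \<chi> (specht p)) (pullback (sym_embed m) (specht q)) f1"
      and f2: "intertwiner (sym_group m \<times>\<times> sym_group k) (twist \<chi> (specht p)) (pullback (sym_embed m) (specht q)) f2"
    for \<sigma> \<sigma>' f1 f2
  proof -
    have se: "perm_action \<sigma> ?e \<in> rspace (specht p)"
      using linear_rep_closed[OF linear_rep_specht[OF p] _ e, of \<sigma>] \<sigma>(1) by simp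
    have "perm_action (sym_embed m (\<sigma>, \<sigma>')) (f1 ?e) = f1 (\<chi> \<sigma>' *\<^sub>C perm_action \<sigma> ?e)"
      using intertwinerD(3)[OF f1, of "(\<sigma>, \<sigma>')" ?e] \<sigma> e by (simp add: twist_def)
    also have "\<dots> = \<chi> \<sigma>' *\<^sub>C f1 (perm_action \<sigma> ?e)"
      using clinear_on_scale[OF intertwinerD(1)[OF f1]] se by (simp add: twist_def)
    moreover have "tabloid_form p (perm_action \<sigma> ?e) ?e = specht_coeff p t \<sigma>"
      unfolding specht_coeff_def by (rule form_commute(1))
    ultimately show ?thesis
      using intertwiner_twist_norm[where f = f1 and g = f2, OF p q t \<chi>(1) f1 f2 se]
      by (simp add: h_scale N_def)
  qed
  have left: "(\<Sum>h\<in>?H. hermitian_form q (perm_action (sym_embed m h) (g' ?e)) (f ?e) *\<^sub>C perm_action (sym_embed m h) (f ?e)) = 0"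
  proof (rule sum.neutral, rule ballI)
    fix h assume "h \<in> ?H"
    then have "N * hermitian_form q (perm_action (sym_embed m h) (g' ?e)) (f ?e) = 0"
      using trans[OF _ _ g' f] orth by auto
    then show "hermitian_form q (perm_action (sym_embed m h) (g' ?e)) (f ?e) *\<^sub>C perm_action (sym_embed m h) (f ?e) = 0"
      using N0 by simp
  qed
  have "(\<Sum>h\<in>?H. hermitian_form q (perm_action (sym_embed m h) (f ?e)) (f ?e) *\<^sub>C perm_action (sym_embed m h) (g' ?e)) = 0"
    using gelfand_symmetry[OF q k fq[OF f] fq[OF g'] fq[OF f]] left by simp
  then have "hermitian_form q (\<Sum>h\<in>?H. hermitian_form q (perm_action (sym_embed m h) (f ?e)) (f ?e) *\<^sub>C perm_action (sym_embed m h) (g' ?e)) (g' ?e) = 0"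
    by (simp add: hermitian_form_def)
  then have "0 = N * N * (\<Sum>h\<in>?H. hermitian_form q (perm_action (sym_embed m h) (f ?e)) (f ?e) * hermitian_form q (perm_action (sym_embed m h) (g' ?e)) (g' ?e))"
    by (simp add: h_sum h_scale)
  also have "\<dots> = (\<Sum>h\<in>?H. (N * hermitian_form q (perm_action (sym_embed m h) (f ?e)) (f ?e)) *
      (N * hermitian_form q (perm_action (sym_embed m h) (g' ?e)) (g' ?e)))"
    by (simp add: sum_distrib_left mult_ac)
  \<comment> \<open>The character occurs squared in each product, and \<chi>(\<sigma>')^2 =
    1.\<close>
  also have "\<dots> = (\<Sum>h\<in>?H. (specht_coeff p t (fst h))\<^sup>2 * (hermitian_form q (f ?e) (f ?e) * hermitian_form q (g' ?e) (g' ?e)))"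
  proof (rule sum.cong[OF refl])
    fix h assume "h \<in> ?H"
    then obtain \<sigma> \<sigma>' where h: "h = (\<sigma>, \<sigma>')" "\<sigma> permutes {1..m}" "\<sigma>' permutes {1..k}" by auto
    have "(N * hermitian_form q (perm_action (sym_embed m h) (f ?e)) (f ?e)) *
      (N * hermitian_form q (perm_action (sym_embed m h) (g' ?e)) (g' ?e)) =
      (\<chi> \<sigma>' * \<chi> \<sigma>') * ((specht_coeff p t \<sigma>)\<^sup>2 * (hermitian_form q (f ?e) (f ?e) * hermitian_form q (g' ?e) (g' ?e)))"
      unfolding h(1) trans[OF h(2,3) f f] trans[OF h(2,3) g' g'] by (simp add: power2_eq_square mult_ac)
    then show "(N * hermitian_form q (perm_action (sym_embed m h) (f ?e)) (f ?e)) *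
      (N * hermitian_form q (perm_action (sym_embed m h) (g' ?e)) (g' ?e)) =
      (specht_coeff p t (fst h))\<^sup>2 * (hermitian_form q (f ?e) (f ?e) * hermitian_form q (g' ?e) (g' ?e))"
      by (simp add: \<chi>(2) h(1))
  qed
  also have "\<dots> = of_nat (card {\<sigma>'. \<sigma>' permutes {1..k}}) * (\<Sum>\<sigma> | \<sigma> permutes {1..m}. (specht_coeff p t \<sigma>)\<^sup>2) *
      (hermitian_form q (f ?e) (f ?e) * hermitian_form q (g' ?e) (g' ?e))"
  proof -
    define S where "S = {\<sigma>. \<sigma> permutes {1..m}}"
    define S' where "S' = {\<sigma>'. \<sigma>' permutes {1..k}}"
    define M where "M = hermitian_form q (f ?e) (f ?e) * hermitian_form q (g' ?e) (g' ?e)"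
    have "(\<Sum>h\<in>S \<times> S'. (specht_coeff p t (fst h))\<^sup>2 * M) = (\<Sum>\<sigma>\<in>S. \<Sum>\<sigma>'\<in>S'. (specht_coeff p t \<sigma>)\<^sup>2 * M)"
      unfolding sum.cartesian_product by (simp add: split_def)
    also have "\<dots> = of_nat (card S') * (\<Sum>\<sigma>\<in>S. (specht_coeff p t \<sigma>)\<^sup>2) * M"
      by (simp add: sum_distrib_left sum_distrib_right mult.assoc)
    finally show ?thesis
      by (simp only: S_def S'_def M_def carrier_DirProd sym_group_simps(1))
  qed
  finally have "hermitian_form q (g' ?e) (g' ?e) = 0"
    using hx specht_coeff_square_sum[OF t] card_permutations[of "{1..k}" k] by (simp add: m)
  then have "g' ?e = 0"
    using hermitian_form_self_eq_0[of "g' ?e" q] fq[OF g'] specht_subset by auto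
  then have "g u = c *\<^sub>C f u" if "u \<in> rspace (specht p)" for u
    using zero[OF g' _ that] by (simp add: g'_def)
  then show ?thesis by blast
qed

text \<open>Frobenius reciprocity lifts proportionality from the subgroup, and completeness of the
  Specht modules supplies the other half of the general criterion. A character with square 1 covers
  the trivial and the sign representation at once, and the index set has the form of the definitions
  of \<open>bar\<close>, \<open>bar_bar\<close> and \<open>tilde_bar\<close>.\<close>

theorem specht_induced_decomposition:
  assumes p: "is_partition m p" and k: "0 < k" "k \<le> 2"
    and X: "linear_rep (sym_group k) X" "rspace X = (UNIV :: complex set)" "\<And>\<sigma> z. ract X \<sigma> z = \<chi> \<sigma> * z"
    and \<chi>: "\<chi> id = 1" "\<And>\<sigma>. \<chi> \<sigma> * \<chi> \<sigma> = 1"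
  defines "E \<equiv> induced (sym_group (m + k)) (sym_group m \<times>\<times> sym_group k) (sym_embed m) (specht p \<boxtimes> X)"
  shows "rep_iso (sym_group (m + k)) E
    (direct_sum {q. is_partition (m + k) q \<and> summand (sym_group (m + k)) (specht q) E} specht)"
proof -
  note grp = sym_group_is_group
  note box = linear_rep_box[OF linear_rep_specht[OF p] grp X(1) grp]
  note E = linear_rep_induced[OF group_hom_sym_embed box, folded E_def]
  have iso: "rep_iso (sym_group m \<times>\<times> sym_group k) (twist \<chi> (specht p)) (specht p \<boxtimes> X)"
    by (rule rep_iso_box_character[OF linear_rep_specht[OF p] grp X(1) grp X(2,3)])
  then obtain \<alpha> where \<alpha>: "bij_betw \<alpha> (rspace (twist \<chi> (specht p))) (rspace (specht p \<boxtimes> X))"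
    "intertwiner (sym_group m \<times>\<times> sym_group k) (twist \<chi> (specht p)) (specht p \<boxtimes> X) \<alpha>"
    by (auto simp: rep_iso_def intertwiner_def bij_betw_def)
  have "rep_iso (sym_group (m + k)) E
      (direct_sum {q \<in> {q. is_partition (m + k) q}. summand (sym_group (m + k)) (specht q) E} specht)"
  proof (rule multiplicity_free_decomposition[OF grp finite_sym_group E finite_partitions])
    fix U assume U: "invariant_subspace (sym_group (m + k)) E U" "U \<noteq> {0}"
    then obtain v where "v \<in> rspace (E\<lparr>rspace := U\<rparr>)" "v \<noteq> 0"
      using complex_vector.subspace_0[OF invariant_subspaceD(1)[OF U(1)]] by auto
    from specht_exhaustive[OF linear_rep_restrict[OF E U(1)] this]
    show "\<exists>i\<in>{q. is_partition (m + k) q}. \<exists>\<phi>. intertwiner (sym_group (m + k)) (specht i) (E\<lparr>rspace := U\<rparr>) \<phi> \<and>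
        (\<exists>v\<in>rspace (specht i). \<phi> v \<noteq> 0)" by blast
  next
    fix q \<phi> \<psi> v
    assume q: "q \<in> {q. is_partition (m + k) q}" and \<phi>: "intertwiner (sym_group (m + k)) E (specht q) \<phi>"
      and \<psi>: "intertwiner (sym_group (m + k)) E (specht q) \<psi>" and v: "v \<in> rspace E" "\<phi> v \<noteq> 0"
    have q': "is_partition (m + k) q" using q by simp
    have fin: "finite (carrier (sym_group m \<times>\<times> sym_group k))"
      using finite_sym_group by simp
    \<comment> \<open>Proportionality was proved for the twisted Specht module; \<alpha> carries it
      over to the tensor product.\<close>
    have mf: "\<exists>c. \<forall>v\<in>rspace (specht p \<boxtimes> X). f' v = c *\<^sub>C f v"
      if f: "intertwiner (sym_group m \<times>\<times> sym_group k) (specht p \<boxtimes> X) (pullback (sym_embed m) (specht q)) f"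
        and f': "intertwiner (sym_group m \<times>\<times> sym_group k) (specht p \<boxtimes> X) (pullback (sym_embed m) (specht q)) f'"
        and v: "v \<in> rspace (specht p \<boxtimes> X)" "f v \<noteq> 0" for f f' v
    proof -
      obtain w where w: "w \<in> rspace (specht p)" "v = \<alpha> w"
        using \<alpha>(1) v(1) by (auto simp: bij_betw_def twist_def)
      obtain c where c: "\<forall>w\<in>rspace (specht p). f' (\<alpha> w) = c *\<^sub>C f (\<alpha> w)"
        using specht_twist_proportional[OF p q' k \<chi> intertwiner_compose[OF \<alpha>(2) f] intertwiner_compose[OF \<alpha>(2) f'] w(1)]
          v(2) w(2) by auto
      have "f' v = c *\<^sub>C f v" if v: "v \<in> rspace (specht p \<boxtimes> X)" for v
      proof -
        obtain w where "w \<in> rspace (specht p)" "v = \<alpha> w"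
          using v \<alpha>(1) unfolding bij_betw_def twist_def by auto
        then show ?thesis using c by simp
      qed
      then show "\<exists>c. \<forall>v\<in>rspace (specht p \<boxtimes> X). f' v = c *\<^sub>C f v" by blast
    qed
    show "\<exists>c. \<forall>v\<in>rspace E. \<psi> v = c *\<^sub>C \<phi> v"
      unfolding E_def
      by (rule frobenius_proportional[where S = "specht q" and \<phi> = \<phi> and \<psi> = \<psi> and ?u0.0 = v])
        (fact group_hom_sym_embed finite_sym_group fin box linear_rep_specht[OF q'] mf
          \<phi>[unfolded E_def] \<psi>[unfolded E_def] v(1)[unfolded E_def] v(2))+
  qed (auto intro: simple_specht specht_iso_imp_eq)
  then show ?thesis by simp
qed

section \<open>Representations of the hyperoctahedral groups\<close>

lemma hyperoct_simps [simp]: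
  "(f, \<sigma>) \<in> carrier (hyperoct m) \<longleftrightarrow> (\<forall>i. i \<notin> {1..m} \<longrightarrow> f i = 0) \<and> \<sigma> permutes {1..m}"
  "(f, \<sigma>) \<otimes>\<^bsub>hyperoct m\<^esub> (f', \<sigma>') = (\<lambda>i. f i + f' (inv' \<sigma> i), \<sigma> \<circ> \<sigma>')"
  "\<one>\<^bsub>hyperoct m\<^esub> = (\<lambda>i. 0, id)"
  by (simp_all add: hyperoct_def)

lemma hyperoct_carrierE:
  assumes "x \<in> carrier (hyperoct m)"
  obtains f \<sigma> where "x = (f, \<sigma>)" "\<And>i. i \<notin> {1..m} \<Longrightarrow> f i = 0" "\<sigma> permutes {1..m}"
  using assms by (cases x) auto

lemma hyperoct_carrierI: "(\<And>i. i \<notin> {1..m} \<Longrightarrow> f i = 0) \<Longrightarrow> \<sigma> permutes {1..m} \<Longrightarrow> (f, \<sigma>) \<in> carrier (hyperoct m)"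
  by simp

lemma group_hyperoct: "group (hyperoct m)"
proof (rule groupI)
  fix x y assume "x \<in> carrier (hyperoct m)" "y \<in> carrier (hyperoct m)"
  then obtain f \<sigma> f' \<sigma>' where x: "x = (f, \<sigma>)" "\<And>i. i \<notin> {1..m} \<Longrightarrow> f i = 0" "\<sigma> permutes {1..m}"
    and y: "y = (f', \<sigma>')" "\<And>i. i \<notin> {1..m} \<Longrightarrow> f' i = 0" "\<sigma>' permutes {1..m}"
    by (metis hyperoct_carrierE)
  have "f' (inv' \<sigma> i) = 0" if "i \<notin> {1..m}" for i
    using y(2)[OF that] permutes_not_in[OF permutes_inv[OF x(3)] that] by simp
  then show "x \<otimes>\<^bsub>hyperoct m\<^esub> y \<in> carrier (hyperoct m)"
    using x y by (auto intro: permutes_compose)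
next
  fix x y z assume "x \<in> carrier (hyperoct m)" "y \<in> carrier (hyperoct m)" "z \<in> carrier (hyperoct m)"
  then obtain f \<sigma> f' \<sigma>' g \<tau> where x: "x = (f, \<sigma>)" "\<sigma> permutes {1..m}"
    and y: "y = (f', \<sigma>')" "\<sigma>' permutes {1..m}" and z: "z = (g, \<tau>)"
    by (metis hyperoct_carrierE)
  have "inv' (\<sigma> \<circ> \<sigma>') i = inv' \<sigma>' (inv' \<sigma> i)" for i
    using o_inv_distrib[OF permutes_bij[OF x(2)] permutes_bij[OF y(2)]] by simp
  then show "x \<otimes>\<^bsub>hyperoct m\<^esub> y \<otimes>\<^bsub>hyperoct m\<^esub> z = x \<otimes>\<^bsub>hyperoct m\<^esub> (y \<otimes>\<^bsub>hyperoct m\<^esub> z)"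
    by (simp only: x y z hyperoct_simps(2) add.assoc comp_assoc)
next
  fix x assume "x \<in> carrier (hyperoct m)"
  then obtain f \<sigma> where x: "x = (f, \<sigma>)" "\<And>i. i \<notin> {1..m} \<Longrightarrow> f i = 0" "\<sigma> permutes {1..m}"
    by (metis hyperoct_carrierE)
  have "(\<lambda>i. f (\<sigma> i), inv' \<sigma>) \<in> carrier (hyperoct m)"
    using x permutes_not_in[OF x(3)] by (intro hyperoct_carrierI permutes_inv) auto
  moreover have "(\<lambda>i. f (\<sigma> i), inv' \<sigma>) \<otimes>\<^bsub>hyperoct m\<^esub> x = \<one>\<^bsub>hyperoct m\<^esub>"
    by (simp add: x(1) permutes_inv_inv[OF x(3)] permutes_inv_o[OF x(3)])
  ultimately show "\<exists>y\<in>carrier (hyperoct m). y \<otimes>\<^bsub>hyperoct m\<^esub> x = \<one>\<^bsub>hyperoct m\<^esub>" by blast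
next
  fix x assume "x \<in> carrier (hyperoct m)"
  show "\<one>\<^bsub>hyperoct m\<^esub> \<otimes>\<^bsub>hyperoct m\<^esub> x = x"
    by (cases x) (simp only: hyperoct_simps(2,3) inv_id id_apply add_0 id_o)
qed (simp add: permutes_id)

text \<open>Every element of F is its own negative, so inversion merely permutes the entries of
  f.\<close>

lemma hyperoct_inv:
  assumes "(f, \<sigma>) \<in> carrier (hyperoct m)"
  shows "inv\<^bsub>hyperoct m\<^esub> (f, \<sigma>) = (\<lambda>i. f (\<sigma> i), inv' \<sigma>)"
proof (rule group.inv_equality[OF group_hyperoct])
  have \<sigma>: "\<sigma> permutes {1..m}" and f: "\<And>i. i \<notin> {1..m} \<Longrightarrow> f i = 0"
    using assms by auto
  show "(\<lambda>i. f (\<sigma> i), inv' \<sigma>) \<otimes>\<^bsub>hyperoct m\<^esub> (f, \<sigma>) = \<one>\<^bsub>hyperoct m\<^esub>"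
    by (simp add: permutes_inv_inv[OF \<sigma>] permutes_inv_o[OF \<sigma>])
  show "(\<lambda>i. f (\<sigma> i), inv' \<sigma>) \<in> carrier (hyperoct m)"
    using f permutes_not_in[OF \<sigma>] by (intro hyperoct_carrierI permutes_inv[OF \<sigma>]) auto
qed (fact assms)

lemma finite_hyperoct: "finite (carrier (hyperoct m))"
proof -
  have "finite (UNIV :: bit set)"
    by (rule finite_subset[of _ "{0, 1}"]) (auto simp: bit_not_one_iff)
  then have fin: "finite {f :: nat \<Rightarrow> bit. \<forall>i. (i \<in> {1..m} \<longrightarrow> f i \<in> UNIV) \<and> (i \<notin> {1..m} \<longrightarrow> f i = 0)}"
    by (intro finite_set_of_finite_funs) auto
  have "carrier (hyperoct m) \<subseteq>
      {f. \<forall>i. (i \<in> {1..m} \<longrightarrow> f i \<in> UNIV) \<and> (i \<notin> {1..m} \<longrightarrow> f i = 0)} \<times> {\<sigma>. \<sigma> permutes {1..m}}"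
    by (auto simp del: atLeastAtMost_iff)
  then show ?thesis
    by (rule finite_subset[OF _ finite_cartesian_product[OF fin finite_permutations[OF finite_atLeastAtMost]]])
qed

lemma sym_embed_inv:
  assumes "\<sigma> permutes {1..a}" "\<sigma>' permutes {1..b}"
  shows "inv' (sym_embed a (\<sigma>, \<sigma>')) = sym_embed a (inv' \<sigma>, inv' \<sigma>')"
proof (rule inv_unique_comp)
  show "sym_embed a (\<sigma>, \<sigma>') \<circ> sym_embed a (inv' \<sigma>, inv' \<sigma>') = id"
    using sym_embed_comp[OF permutes_inv[OF assms(1)] permutes_inv[OF assms(2)], of \<sigma> \<sigma>']
    by (simp add: permutes_inv_o[OF assms(1)] permutes_inv_o[OF assms(2)] sym_embed_id)
  show "sym_embed a (inv' \<sigma>, inv' \<sigma>') \<circ> sym_embed a (\<sigma>, \<sigma>') = id"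
    using sym_embed_comp[OF assms, of "inv' \<sigma>" "inv' \<sigma>'"]
    by (simp add: permutes_inv_o[OF assms(1)] permutes_inv_o[OF assms(2)] sym_embed_id)
qed

lemma hyperoct_embed_apply:
  "hyperoct_embed a ((f, \<sigma>), (f', \<sigma>')) = (\<lambda>i. if i \<le> a then f i else f' (i - a), sym_embed a (\<sigma>, \<sigma>'))"
  by (simp add: hyperoct_embed_def)

lemma hyperoct_prodE:
  assumes "x \<in> carrier (hyperoct a \<times>\<times> hyperoct b)"
  obtains f \<sigma> f' \<sigma>' where "x = ((f, \<sigma>), (f', \<sigma>'))"
    "(f, \<sigma>) \<in> carrier (hyperoct a)" "(f', \<sigma>') \<in> carrier (hyperoct b)"
proof -
  obtain y z where x: "x = (y, z)" by (cases x)
  obtain f \<sigma> where y: "y = (f, \<sigma>)" by (cases y)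
  obtain f' \<sigma>' where z: "z = (f', \<sigma>')" by (cases z)
  show ?thesis
    by (rule that[of f \<sigma> f' \<sigma>']) (use assms in \<open>simp_all only: x y z carrier_DirProd mem_Sigma_iff\<close>)
qed

lemma group_hom_hyperoct_embed:
  "group_hom (hyperoct a \<times>\<times> hyperoct b) (hyperoct (a + b)) (hyperoct_embed a)"
  unfolding group_hom_def group_hom_axioms_def
proof (intro conjI DirProd_group group_hyperoct homI)
  fix x assume "x \<in> carrier (hyperoct a \<times>\<times> hyperoct b)"
  then obtain f \<sigma> f' \<sigma>' where "x = ((f, \<sigma>), (f', \<sigma>'))"
    "(f, \<sigma>) \<in> carrier (hyperoct a)" "(f', \<sigma>') \<in> carrier (hyperoct b)"
    by (rule hyperoct_prodE)
  then have x: "x = ((f, \<sigma>), (f', \<sigma>'))" "\<And>i. i \<notin> {1..a} \<Longrightarrow> f i = 0" "\<sigma> permutes {1..a}"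
    "\<And>i. i \<notin> {1..b} \<Longrightarrow> f' i = 0" "\<sigma>' permutes {1..b}"
    by simp_all
  show "hyperoct_embed a x \<in> carrier (hyperoct (a + b))"
    unfolding x(1) hyperoct_embed_apply
  proof (intro hyperoct_carrierI sym_embed_permutes x)
    fix i assume i: "i \<notin> {1..a + b}"
    show "(if i \<le> a then f i else f' (i - a)) = 0"
    proof (cases "i \<le> a")
      case False
      then have "i - a \<notin> {1..b}" using i by auto
      then show ?thesis using False x(4) by simp
    qed (use i x(2)[of i] in auto)
  qed
next
  fix x y assume "x \<in> carrier (hyperoct a \<times>\<times> hyperoct b)" "y \<in> carrier (hyperoct a \<times>\<times> hyperoct b)"
  then obtain f \<sigma> f' \<sigma>' g \<tau> g' \<tau>' where "x = ((f, \<sigma>), (f', \<sigma>'))"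
      "(f, \<sigma>) \<in> carrier (hyperoct a)" "(f', \<sigma>') \<in> carrier (hyperoct b)"
      "y = ((g, \<tau>), (g', \<tau>'))" "(g, \<tau>) \<in> carrier (hyperoct a)" "(g', \<tau>') \<in> carrier (hyperoct b)"
    by (elim hyperoct_prodE)
  then have x: "x = ((f, \<sigma>), (f', \<sigma>'))" "\<sigma> permutes {1..a}" "\<sigma>' permutes {1..b}"
    and y: "y = ((g, \<tau>), (g', \<tau>'))" "\<tau> permutes {1..a}" "\<tau>' permutes {1..b}"
    by simp_all
  have eq: "(if i \<le> a then f i + g (inv' \<sigma> i) else f' (i - a) + g' (inv' \<sigma>' (i - a))) =
      (if i \<le> a then f i else f' (i - a)) + (if sym_embed a (inv' \<sigma>, inv' \<sigma>') i \<le> a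
        then g (sym_embed a (inv' \<sigma>, inv' \<sigma>') i) else g' (sym_embed a (inv' \<sigma>, inv' \<sigma>') i - a))" for i
    using permutes_interval(1)[OF permutes_inv[OF x(2)], of i] permutes_interval(2)[OF permutes_inv[OF x(3)], of "i - a"]
    by (cases "i \<le> a") (simp_all add: sym_embed_apply)
  show "hyperoct_embed a (x \<otimes>\<^bsub>hyperoct a \<times>\<times> hyperoct b\<^esub> y) =
      hyperoct_embed a x \<otimes>\<^bsub>hyperoct (a + b)\<^esub> hyperoct_embed a y"
    by (simp only: x(1) y(1) mult_DirProd hyperoct_simps(2) hyperoct_embed_apply
        sym_embed_comp[OF y(2,3)] sym_embed_inv[OF x(2,3)] eq)
qed

definition multiplicative :: "(bit \<Rightarrow> complex) \<Rightarrow> bool"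
  where "multiplicative D \<longleftrightarrow> D 0 = 1 \<and> (\<forall>x y. D (x + y) = D x * D y)"

section \<open>The representations (D; E)\<close>

lemma multiplicative_triv_char: "multiplicative triv_char"
  by (simp add: multiplicative_def triv_char_def)

lemma multiplicative_sign_char: "multiplicative sign_char"
proof -
  have "sign_char (x + y) = sign_char x * sign_char y" for x y
    by (cases x; cases y) (simp_all add: sign_char_def)
  then show ?thesis by (simp add: multiplicative_def sign_char_def)
qed

lemma prod_permutes:
  fixes F :: "nat \<Rightarrow> complex"
  assumes "\<sigma> permutes {1..m}"
  shows "(\<Prod>i=1..m. F (\<sigma> i)) = (\<Prod>i=1..m. F i)"
  using prod.permute[OF assms, of F] by (simp add: comp_def)

lemma char_rep_simps [simp]: "rspace (char_rep m D E) = rspace E"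
  "ract (char_rep m D E) (f, \<sigma>) v = (\<Prod>i=1..m. D (f i)) *\<^sub>C ract E \<sigma> v"
  by (simp_all add: char_rep_def)

lemma linear_rep_char_rep:
  assumes D: "multiplicative D" and E: "linear_rep (sym_group m) E"
  shows "linear_rep (hyperoct m) (char_rep m D E)"
proof -
  have mem: "\<sigma> \<in> carrier (sym_group m)" if "(f, \<sigma>) \<in> carrier (hyperoct m)" for f \<sigma>
    using that by simp
  have mult: "ract (char_rep m D E) (x \<otimes>\<^bsub>hyperoct m\<^esub> y) v = ract (char_rep m D E) x (ract (char_rep m D E) y v)"
    if xy: "x \<in> carrier (hyperoct m)" "y \<in> carrier (hyperoct m)" and v: "v \<in> rspace E" for x y v
  proof -
    obtain f \<sigma> f' \<sigma>' where x: "x = (f, \<sigma>)" "\<sigma> permutes {1..m}" and y: "y = (f', \<sigma>')" "\<sigma>' permutes {1..m}"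
      using xy by (metis hyperoct_carrierE)
    have "(\<Prod>i=1..m. D (f i + f' (inv' \<sigma> i))) = (\<Prod>i=1..m. D (f i)) * (\<Prod>i=1..m. D (f' i))"
      using D prod_permutes[OF permutes_inv[OF x(2)], of "\<lambda>i. D (f' i)"] by (simp add: multiplicative_def prod.distrib)
    moreover have "ract E (\<sigma> \<circ> \<sigma>') v = ract E \<sigma> (ract E \<sigma>' v)"
      using linear_rep_mult[OF E, of \<sigma> \<sigma>' v] x y v by simp
    moreover have "ract E \<sigma>' v \<in> rspace E"
      using linear_rep_closed[OF E, of \<sigma>' v] y v by simp
    ultimately show ?thesis
      using clinear_on_scale[OF linear_rep_linear[OF E, of \<sigma>]] x y by (simp add: scaleC_scaleC)
  qed
  show ?thesis
    unfolding linear_rep_def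
  proof (intro conjI ballI)
    fix x assume "x \<in> carrier (hyperoct m)"
    then obtain f \<sigma> where x: "x = (f, \<sigma>)" "\<sigma> permutes {1..m}"
      by (metis hyperoct_carrierE)
    show "clinear_on (rspace (char_rep m D E)) (ract (char_rep m D E) x)"
      using clinear_on_scale_fun[OF linear_rep_linear[OF E, of \<sigma>], of "\<Prod>i=1..m. D (f i)"] x
      by (simp add: clinear_on_def)
    show "ract (char_rep m D E) x ` rspace (char_rep m D E) \<subseteq> rspace (char_rep m D E)"
      using linear_rep_closed[OF E, of \<sigma>] x complex_vector.subspace_scale[OF linear_rep_subspace[OF E]] by auto
  next
    fix v assume "v \<in> rspace (char_rep m D E)"
    then show "ract (char_rep m D E) \<one>\<^bsub>hyperoct m\<^esub> v = v"
      using linear_rep_one[OF E] D by (simp add: multiplicative_def scaleC_one)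
  qed (use linear_rep_subspace[OF E] mult in auto)
qed

lemma char_rep_decomposes:
  assumes E: "linear_rep (sym_group m) E" and R: "\<And>i. i \<in> I \<Longrightarrow> linear_rep (sym_group m) (R i)"
    and dec: "decomposes (sym_group m) E I R"
  shows "decomposes (hyperoct m) (char_rep m D E) I (\<lambda>i. char_rep m D (R i))"
proof -
  have tr: "intertwiner (hyperoct m) (char_rep m D A) (char_rep m D B) \<phi>"
    if \<phi>: "intertwiner (sym_group m) A B \<phi>" and A: "linear_rep (sym_group m) A"
    for A :: "(nat \<Rightarrow> nat, 'u::complex_vector) rep" and B :: "(nat \<Rightarrow> nat, 'w::complex_vector) rep" and \<phi>
  proof (rule intertwinerI)
    fix x v assume "x \<in> carrier (hyperoct m)" and v: "v \<in> rspace (char_rep m D A)"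
    then obtain f \<sigma> where x: "x = (f, \<sigma>)" "\<sigma> permutes {1..m}"
      by (metis hyperoct_carrierE)
    then show "\<phi> (ract (char_rep m D A) x v) = ract (char_rep m D B) x (\<phi> v)"
      using intertwinerD(3)[OF \<phi>, of \<sigma> v] v clinear_on_scale[OF intertwinerD(1)[OF \<phi>] linear_rep_closed[OF A]] by simp
  qed (use intertwinerD[OF \<phi>] in auto)
  obtain em pr where d: "decomposition (sym_group m) E I R em pr"
    using dec by (auto simp: decomposes_def)
  show ?thesis
    by (rule decomposesI[where em = em and pr = pr]) (use decompositionD[OF d] E R in \<open>auto intro: tr\<close>)
qed

lemma char_rep_box_action:
  assumes R: "linear_rep (sym_group a) R" and X: "linear_rep (sym_group c) X" and D: "multiplicative D"
    and g: "(f, \<sigma>) \<in> carrier (hyperoct a)" and h: "(f', \<sigma>') \<in> carrier (hyperoct c)"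
    and t: "t \<in> rspace (R \<boxtimes> X)"
  shows "ract (char_rep a D R \<boxtimes> char_rep c D X) ((f, \<sigma>), (f', \<sigma>')) t =
    ((\<Prod>i=1..a. D (f i)) * (\<Prod>i=1..c. D (f' i))) *\<^sub>C ract (R \<boxtimes> X) (\<sigma>, \<sigma>') t"
proof (rule tensor_space_eq[OF box_action_linear _ _ t[unfolded rspace_box]])
  show "clinear_on (tensor_space (rspace R) (rspace X))
      (\<lambda>t. ((\<Prod>i=1..a. D (f i)) * (\<Prod>i=1..c. D (f' i))) *\<^sub>C ract (R \<boxtimes> X) (\<sigma>, \<sigma>') t)"
    by (rule clinear_on_scale_fun[OF box_action_linear])
  fix v w assume vw: "v \<in> rspace R" "w \<in> rspace X"
  have \<sigma>: "\<sigma> \<in> carrier (sym_group a)" "\<sigma>' \<in> carrier (sym_group c)" using g h by auto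
  note R' = linear_rep_char_rep[OF D R] and X' = linear_rep_char_rep[OF D X]
  have in': "ract R \<sigma> v \<in> rspace R" "ract X \<sigma>' w \<in> rspace X"
    using linear_rep_closed[OF R \<sigma>(1) vw(1)] linear_rep_closed[OF X \<sigma>(2) vw(2)] .
  have "ract (char_rep a D R \<boxtimes> char_rep c D X) ((f, \<sigma>), (f', \<sigma>')) (pure_tensor (rspace R) (rspace X) v w) =
      pure_tensor (rspace R) (rspace X) ((\<Prod>i=1..a. D (f i)) *\<^sub>C ract R \<sigma> v) ((\<Prod>i=1..c. D (f' i)) *\<^sub>C ract X \<sigma>' w)"
    using box_action_pure[OF R' group_hyperoct g X' group_hyperoct h, of v w] vw by simp
  also have "\<dots> = ((\<Prod>i=1..a. D (f i)) * (\<Prod>i=1..c. D (f' i))) *\<^sub>C pure_tensor (rspace R) (rspace X) (ract R \<sigma> v) (ract X \<sigma>' w)"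
    using in' complex_vector.subspace_scale[OF linear_rep_subspace[OF X] in'(2)]
    by (simp add: clinear_on_scale[OF pure_tensor_linear(1)] clinear_on_scale[OF pure_tensor_linear(2)] scaleC_scaleC)
  finally show "ract (char_rep a D R \<boxtimes> char_rep c D X) ((f, \<sigma>), (f', \<sigma>')) (pure_tensor (rspace R) (rspace X) v w) =
      ((\<Prod>i=1..a. D (f i)) * (\<Prod>i=1..c. D (f' i))) *\<^sub>C ract (R \<boxtimes> X) (\<sigma>, \<sigma>') (pure_tensor (rspace R) (rspace X) v w)"
    by (simp add: box_action_pure[OF R sym_group_is_group \<sigma>(1) X sym_group_is_group \<sigma>(2) vw])
qed

lemma prod_split:
  fixes F :: "nat \<Rightarrow> complex"
  shows "(\<Prod>i=1..a + c. F i) = (\<Prod>i=1..a. F i) * (\<Prod>i=1..c. F (i + a))"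
  by (induction c) (simp_all add: add.commute)

text \<open>All of F^(a+c) lies in the image of B_a \<times> B_c, so an equivariant function on
  B_(a+c) is determined by its restriction to the symmetric group, and this restriction is
  equivariant there. Since both blocks carry the same character D, the scalar that describes the
  dependence on f is the full product of the D(f_i), independent of \<sigma>.\<close>

lemma char_rep_induced:
  assumes R: "linear_rep (sym_group a) R" and X: "linear_rep (sym_group c) X" and D: "multiplicative D"
  shows "rep_iso (hyperoct (a + c))
    (induced (hyperoct (a + c)) (hyperoct a \<times>\<times> hyperoct c) (hyperoct_embed a) (char_rep a D R \<boxtimes> char_rep c D X))
    (char_rep (a + c) D (induced (sym_group (a + c)) (sym_group a \<times>\<times> sym_group c) (sym_embed a) (R \<boxtimes> X)))"
    (is "rep_iso ?B ?I (char_rep _ D ?J)")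
proof -
  let ?H = "hyperoct a \<times>\<times> hyperoct c" and ?K = "sym_group a \<times>\<times> sym_group c"
  let ?S = "sym_group (a + c)"
  let ?P = "\<lambda>f. \<Prod>i=1..a + c. D (f i)"
  have D1: "D 0 = 1" using D by (simp add: multiplicative_def)
  interpret e: group_hom ?H ?B "hyperoct_embed a" by (rule group_hom_hyperoct_embed)
  note RX = linear_rep_box[OF R sym_group_is_group X sym_group_is_group]
  have sp: "rspace (char_rep a D R \<boxtimes> char_rep c D X) = rspace (R \<boxtimes> X)" by simp
  have fact: "u (f, \<sigma>) = ?P f *\<^sub>C u (\<lambda>i. 0, \<sigma>)" if u: "u \<in> rspace ?I" and x: "(f, \<sigma>) \<in> carrier ?B" for u f \<sigma>
  proof -
    have \<sigma>: "\<sigma> permutes {1..a + c}" and f: "\<And>i. i \<notin> {1..a + c} \<Longrightarrow> f i = 0" using x by auto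
    \<comment> \<open>Moving f to the right of \<sigma> replaces it by f \<circ> \<sigma>, which is
      then cut into its parts on the two blocks.\<close>
    define g1 where "g1 i = (if i \<in> {1..a} then f (\<sigma> i) else 0)" for i
    define g2 where "g2 i = (if i \<in> {1..c} then f (\<sigma> (i + a)) else 0)" for i
    have g: "(g1, id) \<in> carrier (hyperoct a)" "(g2, id) \<in> carrier (hyperoct c)"
      by (simp_all add: g1_def g2_def permutes_id)
    have "f (\<sigma> i) = 0" if "i \<notin> {1..a + c}" for i
      using f[OF that] permutes_not_in[OF \<sigma> that] by simp
    then have e: "hyperoct_embed a ((g1, id), (g2, id)) = (\<lambda>i. f (\<sigma> i), id)"
      by (auto simp: hyperoct_embed_apply sym_embed_id g1_def g2_def fun_eq_iff)
    have z: "(\<lambda>i. 0, \<sigma>) \<in> carrier ?B" using \<sigma> by simp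
    have "(f, \<sigma>) = (\<lambda>i. 0, \<sigma>) \<otimes>\<^bsub>?B\<^esub> hyperoct_embed a ((g1, id), (g2, id))"
      unfolding e by (simp only: hyperoct_simps(2) add_0 permutes_inverses(1)[OF \<sigma>] comp_id)
    then have "u (f, \<sigma>) = ract (char_rep a D R \<boxtimes> char_rep c D X) (inv\<^bsub>?H\<^esub> ((g1, id), (g2, id))) (u (\<lambda>i. 0, \<sigma>))"
      using inducedD(3)[OF u z, of "((g1, id), (g2, id))"] g by simp
    \<comment> \<open>Elements of the base group are involutions, so the inverse in the equivariance
      rule has no effect.\<close>
    also have "inv\<^bsub>?H\<^esub> ((g1, id), (g2, id)) = ((g1, id), (g2, id))"
      using g by (simp add: inv_DirProd[OF group_hyperoct group_hyperoct] hyperoct_inv inv_id)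
    also have "ract (char_rep a D R \<boxtimes> char_rep c D X) ((g1, id), (g2, id)) (u (\<lambda>i. 0, \<sigma>)) =
        ((\<Prod>i=1..a. D (g1 i)) * (\<Prod>i=1..c. D (g2 i))) *\<^sub>C ract (R \<boxtimes> X) (id, id) (u (\<lambda>i. 0, \<sigma>))"
      by (rule char_rep_box_action[OF R X D g]) (use inducedD(1)[OF u z] in simp)
    also have "ract (R \<boxtimes> X) (id, id) (u (\<lambda>i. 0, \<sigma>)) = u (\<lambda>i. 0, \<sigma>)"
      using linear_rep_one[OF RX] inducedD(1)[OF u z] by simp
    also have "(\<Prod>i=1..a. D (g1 i)) * (\<Prod>i=1..c. D (g2 i)) = (\<Prod>i=1..a + c. D (f (\<sigma> i)))"
      unfolding prod_split by (simp add: g1_def g2_def)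
    also have "\<dots> = ?P f"
      using prod_permutes[OF \<sigma>, of "\<lambda>i. D (f i)"] .
    finally show ?thesis .
  qed
  let ?\<phi> = "\<lambda>u \<sigma>. u (\<lambda>i. 0 :: bit, \<sigma>)"
  let ?\<psi> = "\<lambda>w x. if x \<in> carrier ?B then ?P (fst x) *\<^sub>C w (snd x) else 0"
  have \<phi>_in: "?\<phi> u \<in> rspace ?J" if u: "u \<in> rspace ?I" for u
  proof (rule inducedI)
    show "?\<phi> u \<sigma> \<in> rspace (R \<boxtimes> X)" if "\<sigma> \<in> carrier ?S" for \<sigma>
      using inducedD(1)[OF u, of "(\<lambda>i. 0, \<sigma>)"] that by simp
    show "?\<phi> u \<sigma> = 0" if "\<sigma> \<notin> carrier ?S" for \<sigma>
      using inducedD(2)[OF u, of "(\<lambda>i. 0, \<sigma>)"] that by simp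
    fix \<sigma> h assume \<sigma>: "\<sigma> \<in> carrier ?S" and "h \<in> carrier ?K"
    then obtain \<tau> \<tau>' where h: "h = (\<tau>, \<tau>')" "\<tau> permutes {1..a}" "\<tau>' permutes {1..c}" by auto
    let ?h = "((\<lambda>i. 0 :: bit, \<tau>), (\<lambda>i. 0 :: bit, \<tau>'))"
    have hH: "(\<lambda>i. 0, \<tau>) \<in> carrier (hyperoct a)" "(\<lambda>i. 0, \<tau>') \<in> carrier (hyperoct c)" using h by auto
    have ih: "(\<lambda>i. 0, inv' \<tau>) \<in> carrier (hyperoct a)" "(\<lambda>i. 0, inv' \<tau>') \<in> carrier (hyperoct c)"
      using permutes_inv[OF h(2)] permutes_inv[OF h(3)] by auto
    have z: "(\<lambda>i. 0, \<sigma>) \<in> carrier ?B" using \<sigma> by simp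
    have "(\<lambda>i. 0 :: bit, \<sigma> \<otimes>\<^bsub>?S\<^esub> sym_embed a h) = (\<lambda>i. 0, \<sigma>) \<otimes>\<^bsub>?B\<^esub> hyperoct_embed a ?h"
      by (simp add: h(1) hyperoct_embed_apply fun_eq_iff)
    then have "?\<phi> u (\<sigma> \<otimes>\<^bsub>?S\<^esub> sym_embed a h) =
        ract (char_rep a D R \<boxtimes> char_rep c D X) (inv\<^bsub>?H\<^esub> ?h) (?\<phi> u \<sigma>)"
      using inducedD(3)[OF u z, of ?h] hH by simp
    also have "inv\<^bsub>?H\<^esub> ?h = ((\<lambda>i. 0, inv' \<tau>), (\<lambda>i. 0, inv' \<tau>'))"
      using hH by (simp add: inv_DirProd[OF group_hyperoct group_hyperoct] hyperoct_inv)
    also have "ract (char_rep a D R \<boxtimes> char_rep c D X) \<dots> (?\<phi> u \<sigma>) = ract (R \<boxtimes> X) (inv' \<tau>, inv' \<tau>') (?\<phi> u \<sigma>)"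
      by (subst char_rep_box_action[OF R X D ih]) (use inducedD(1)[OF u z] D1 in \<open>auto simp: scaleC_one\<close>)
    also have "(inv' \<tau>, inv' \<tau>') = inv\<^bsub>?K\<^esub> h"
      using h by (simp add: inv_DirProd[OF sym_group_is_group sym_group_is_group] sym_group_inv_equality)
    finally show "?\<phi> u (\<sigma> \<otimes>\<^bsub>?S\<^esub> sym_embed a h) = ract (R \<boxtimes> X) (inv\<^bsub>?K\<^esub> h) (?\<phi> u \<sigma>)" .
  qed
  have \<psi>_in: "?\<psi> w \<in> rspace ?I" if w: "w \<in> rspace ?J" for w
  proof (rule inducedI)
    show "?\<psi> w x \<in> rspace (char_rep a D R \<boxtimes> char_rep c D X)" if "x \<in> carrier ?B" for x
      unfolding sp using inducedD(1)[OF w, of "snd x"] complex_vector.subspace_scale[OF linear_rep_subspace[OF RX]] that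
      by (cases x) auto
    fix x h assume x: "x \<in> carrier ?B" and h: "h \<in> carrier ?H"
    obtain f \<sigma> where x_eq: "x = (f, \<sigma>)" and \<sigma>: "\<sigma> permutes {1..a + c}"
      using x by (metis hyperoct_carrierE)
    obtain f1 \<tau> f2 \<tau>' where h_eq: "h = ((f1, \<tau>), (f2, \<tau>'))"
      and h1: "(f1, \<tau>) \<in> carrier (hyperoct a)" and h2: "(f2, \<tau>') \<in> carrier (hyperoct c)"
      using h by (cases h) auto
    have \<tau>: "\<tau> permutes {1..a}" "\<tau>' permutes {1..c}" using h1 h2 by auto
    let ?F = "\<lambda>i. if i \<le> a then f1 i else f2 (i - a)"
    have e: "hyperoct_embed a h = (?F, sym_embed a (\<tau>, \<tau>'))" by (simp add: h_eq hyperoct_embed_apply)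
    have "?P ?F = (\<Prod>i=1..a. D (f1 i)) * (\<Prod>i=1..c. D (f2 i))"
      unfolding prod_split by (intro arg_cong2[of _ _ _ _ "(*)"] prod.cong) auto
    moreover have "?P (\<lambda>i. f i + ?F (inv' \<sigma> i)) = ?P f * ?P ?F"
      using D prod_permutes[OF permutes_inv[OF \<sigma>], of "\<lambda>i. D (?F i)"] by (simp add: multiplicative_def prod.distrib)
    ultimately have "?P (\<lambda>i. f i + ?F (inv' \<sigma> i)) = ?P f * ((\<Prod>i=1..a. D (f1 i)) * (\<Prod>i=1..c. D (f2 i)))" by simp
    moreover have "x \<otimes>\<^bsub>?B\<^esub> hyperoct_embed a h \<in> carrier ?B"
      using x h by simp
    ultimately have l: "?\<psi> w (x \<otimes>\<^bsub>?B\<^esub> hyperoct_embed a h) =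
        (?P f * ((\<Prod>i=1..a. D (f1 i)) * (\<Prod>i=1..c. D (f2 i)))) *\<^sub>C w (\<sigma> \<circ> sym_embed a (\<tau>, \<tau>'))"
      by (simp only: e x_eq hyperoct_simps(2) fst_conv snd_conv if_True)
    have w\<sigma>: "w \<sigma> \<in> rspace (R \<boxtimes> X)" using inducedD(1)[OF w, of \<sigma>] \<sigma> by simp
    have wt: "w (\<sigma> \<circ> sym_embed a (\<tau>, \<tau>')) = ract (R \<boxtimes> X) (inv' \<tau>, inv' \<tau>') (w \<sigma>)"
      using inducedD(3)[OF w, of \<sigma> "(\<tau>, \<tau>')"] \<sigma> \<tau>
      by (simp add: inv_DirProd[OF sym_group_is_group sym_group_is_group] sym_group_inv_equality)
    have ih: "(\<lambda>i. f1 (\<tau> i), inv' \<tau>) \<in> carrier (hyperoct a)" "(\<lambda>i. f2 (\<tau>' i), inv' \<tau>') \<in> carrier (hyperoct c)"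
      using group.inv_closed[OF group_hyperoct h1] group.inv_closed[OF group_hyperoct h2]
      by (simp_all only: hyperoct_inv[OF h1] hyperoct_inv[OF h2])
    have "ract (char_rep a D R \<boxtimes> char_rep c D X) (inv\<^bsub>?H\<^esub> h) (?\<psi> w x) =
        ract (char_rep a D R \<boxtimes> char_rep c D X) ((\<lambda>i. f1 (\<tau> i), inv' \<tau>), (\<lambda>i. f2 (\<tau>' i), inv' \<tau>')) (?P f *\<^sub>C w \<sigma>)"
      using x h1 h2 by (simp only: h_eq inv_DirProd[OF group_hyperoct group_hyperoct h1 h2] hyperoct_inv[OF h1] hyperoct_inv[OF h2] x_eq fst_conv snd_conv if_True)
    also have "\<dots> = ((\<Prod>i=1..a. D (f1 (\<tau> i))) * (\<Prod>i=1..c. D (f2 (\<tau>' i)))) *\<^sub>C ract (R \<boxtimes> X) (inv' \<tau>, inv' \<tau>') (?P f *\<^sub>C w \<sigma>)"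
      by (rule char_rep_box_action[OF R X D ih]) (rule complex_vector.subspace_scale[OF linear_rep_subspace[OF RX] w\<sigma>])
    also have "ract (R \<boxtimes> X) (inv' \<tau>, inv' \<tau>') (?P f *\<^sub>C w \<sigma>) = ?P f *\<^sub>C ract (R \<boxtimes> X) (inv' \<tau>, inv' \<tau>') (w \<sigma>)"
      by (rule clinear_on_scale[OF box_action_linear[of UNIV]]) simp
    also have "(\<Prod>i=1..a. D (f1 (\<tau> i))) = (\<Prod>i=1..a. D (f1 i))" using prod_permutes[OF \<tau>(1), of "\<lambda>i. D (f1 i)"] .
    also have "(\<Prod>i=1..c. D (f2 (\<tau>' i))) = (\<Prod>i=1..c. D (f2 i))" using prod_permutes[OF \<tau>(2), of "\<lambda>i. D (f2 i)"] .
    finally show "?\<psi> w (x \<otimes>\<^bsub>?B\<^esub> hyperoct_embed a h) = ract (char_rep a D R \<boxtimes> char_rep c D X) (inv\<^bsub>?H\<^esub> h) (?\<psi> w x)"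
      unfolding l wt by (simp only: scaleC_scaleC mult_ac)
  qed simp
  show ?thesis
  proof (rule rep_isoI[where \<phi> = ?\<phi> and \<psi> = ?\<psi>])
    show "intertwiner ?B ?I (char_rep (a + c) D ?J) ?\<phi>"
    proof (rule intertwinerI)
      fix x u assume x: "x \<in> carrier ?B" and u: "u \<in> rspace ?I"
      obtain g \<tau> where x_eq: "x = (g, \<tau>)" and \<tau>: "\<tau> permutes {1..a + c}"
        using x by (metis hyperoct_carrierE)
      have gx: "(g, \<tau>) \<in> carrier ?B" using x x_eq by simp
      show "?\<phi> (ract ?I x u) = ract (char_rep (a + c) D ?J) x (?\<phi> u)"
      proof
        fix \<sigma>
        show "?\<phi> (ract ?I x u) \<sigma> = ract (char_rep (a + c) D ?J) x (?\<phi> u) \<sigma>"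
        proof (cases "\<sigma> permutes {1..a + c}")
          case \<sigma>: True
          have m: "(\<lambda>i. g (\<tau> i), inv' \<tau> \<circ> \<sigma>) \<in> carrier ?B"
            using group.inv_closed[OF group_hyperoct gx] hyperoct_inv[OF gx] \<sigma> by (auto intro: permutes_compose)
          have "?\<phi> (ract ?I x u) \<sigma> = u (\<lambda>i. g (\<tau> i), inv' \<tau> \<circ> \<sigma>)"
          proof -
            have "(\<lambda>i. 0 :: bit, \<sigma>) \<in> carrier ?B" using \<sigma> by simp
            then show ?thesis
              by (simp only: induced_action x_eq hyperoct_inv[OF gx] hyperoct_simps(2) add_0_right if_True)
          qed
          also have "\<dots> = ?P (\<lambda>i. g (\<tau> i)) *\<^sub>C u (\<lambda>i. 0, inv' \<tau> \<circ> \<sigma>)"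
            by (rule fact[OF u m])
          also have "?P (\<lambda>i. g (\<tau> i)) = ?P g" using prod_permutes[OF \<tau>, of "\<lambda>i. D (g i)"] .
          also have "?P g *\<^sub>C u (\<lambda>i. 0, inv' \<tau> \<circ> \<sigma>) = ract (char_rep (a + c) D ?J) x (?\<phi> u) \<sigma>"
          proof -
            have "\<tau> \<in> carrier ?S" "\<sigma> \<in> carrier ?S" using \<sigma> \<tau> by simp_all
            then show ?thesis
              by (simp only: x_eq char_rep_simps(2) scaleC_fun_apply induced_action sym_group_simps(2)
                  sym_group_inv_equality if_True)
          qed
          finally show ?thesis .
        qed (simp add: induced_action x_eq)
      qed
    qed (use \<phi>_in in \<open>auto intro!: clinear_onI simp: fun_eq_iff\<close>)
    show "?\<psi> (?\<phi> u) = u" if u: "u \<in> rspace ?I" for u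
    proof (rule induced_eqI[OF \<psi>_in[OF \<phi>_in[OF u]] u])
      fix x assume x: "x \<in> carrier ?B"
      then show "?\<psi> (?\<phi> u) x = u x"
        using fact[OF u, of "fst x" "snd x"] by (simp only: prod.collapse if_True)
    qed
    show "?\<phi> (?\<psi> w) = w" if w: "w \<in> rspace (char_rep (a + c) D ?J)" for w
      using w D1 inducedD(2)[of w ?S ?K "sym_embed a" "R \<boxtimes> X"] by (auto simp: fun_eq_iff scaleC_one)
  qed (use \<psi>_in in auto)
qed

section \<open>Regrouping four blocks of B_n\<close>

lemma group_hom_compose:
  assumes "group_hom H K f" "group_hom K G g"
  shows "group_hom H G (\<lambda>h. g (f h))"
  using group_hom.axioms(1)[OF assms(1)] group_hom.axioms(2)[OF assms(2)]
  by (auto intro!: homI simp: group_hom_def group_hom_axioms_def group_hom.hom_closed[OF assms(1)]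
      group_hom.hom_closed[OF assms(2)] group_hom.hom_mult[OF assms(1)] group_hom.hom_mult[OF assms(2)])

text \<open>Carries consecutive blocks of sizes a, c, b, d to the order a, b, c, d; the last block
  stays in place.\<close>

definition block_swap :: "nat \<Rightarrow> nat \<Rightarrow> nat \<Rightarrow> nat \<Rightarrow> nat"
  where "block_swap a b c i = (if i \<le> a then i else if i \<le> a + c then i + b else if i \<le> a + c + b then i - c else i)"

lemma block_swap_permutes: "block_swap a b c permutes {1..a + b + c + d}"
  unfolding permutes_def bij_iff[symmetric]
proof (intro conjI allI impI)
  show "block_swap a b c i = i" if "i \<notin> {1..a + b + c + d}" for i
    using that by (auto simp: block_swap_def)
  show "bij (block_swap a b c)"
    by (rule o_bij[where g = "block_swap a c b"]) (auto simp: block_swap_def fun_eq_iff)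
qed

text \<open>The two iterated embeddings differ by the block permutation w: their F-components
  satisfy F' = F \<circ> w, and their permutations satisfy w \<circ> s' = s \<circ> w, checked block
  by block.\<close>

lemma block_swap_conjugates:
  assumes g: "(f1, \<sigma>1) \<in> carrier (hyperoct a)" "(f2, \<sigma>2) \<in> carrier (hyperoct b)"
    "(f3, \<sigma>3) \<in> carrier (hyperoct c)" "(f4, \<sigma>4) \<in> carrier (hyperoct d)"
  defines "n \<equiv> a + b + (c + d)"
  shows "(\<lambda>i. 0, block_swap a b c) \<otimes>\<^bsub>hyperoct n\<^esub>
      hyperoct_embed (a + c) (hyperoct_embed a ((f1, \<sigma>1), (f3, \<sigma>3)), hyperoct_embed b ((f2, \<sigma>2), (f4, \<sigma>4))) =
    hyperoct_embed (a + b) (hyperoct_embed a ((f1, \<sigma>1), (f2, \<sigma>2)), hyperoct_embed c ((f3, \<sigma>3), (f4, \<sigma>4)))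
      \<otimes>\<^bsub>hyperoct n\<^esub> (\<lambda>i. 0, block_swap a b c)"
proof -
  let ?w = "block_swap a b c"
  have w: "?w permutes {1..a + b + c + d}" by (rule block_swap_permutes)
  have p: "\<sigma>1 permutes {1..a}" "\<sigma>2 permutes {1..b}" "\<sigma>3 permutes {1..c}" "\<sigma>4 permutes {1..d}"
    using g by auto
  define F where "F i = (if i \<le> a + b then if i \<le> a then f1 i else f2 (i - a)
      else if i - (a + b) \<le> c then f3 (i - (a + b)) else f4 (i - (a + b) - c))" for i
  define F' where "F' i = (if i \<le> a + c then if i \<le> a then f1 i else f3 (i - a)
      else if i - (a + c) \<le> b then f2 (i - (a + c)) else f4 (i - (a + c) - b))" for i
  define s where "s = sym_embed (a + b) (sym_embed a (\<sigma>1, \<sigma>2), sym_embed c (\<sigma>3, \<sigma>4))"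
  define s' where "s' = sym_embed (a + c) (sym_embed a (\<sigma>1, \<sigma>3), sym_embed b (\<sigma>2, \<sigma>4))"
  have E: "hyperoct_embed (a + b) (hyperoct_embed a ((f1, \<sigma>1), (f2, \<sigma>2)), hyperoct_embed c ((f3, \<sigma>3), (f4, \<sigma>4))) = (F, s)"
    "hyperoct_embed (a + c) (hyperoct_embed a ((f1, \<sigma>1), (f3, \<sigma>3)), hyperoct_embed b ((f2, \<sigma>2), (f4, \<sigma>4))) = (F', s')"
    by (simp_all add: hyperoct_embed_def F_def F'_def s_def s'_def fun_eq_iff)
  have FF: "F' j = F (?w j)" for j
    by (auto simp: F_def F'_def block_swap_def ac_simps)
  have "F' (inv' ?w i) = F i" for i
    by (simp add: FF permutes_inverses(1)[OF w])
  moreover have "?w (s' i) = s (?w i)" for i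
  proof -
    note i1 = permutes_interval(1)[OF p(1), of i]
    consider "i \<le> a" | "a < i" "i \<le> a + c" | "a + c < i" "i \<le> a + c + b" | "a + c + b < i" by linarith
    then show ?thesis
    proof cases
      case 1
      then show ?thesis using permutes_interval(1)[OF p(1), of i]
        by (simp add: s_def s'_def sym_embed_apply block_swap_def)
    next
      case 2
      then have "i - a \<le> c" "i - a > 0" by auto
      then show ?thesis using 2 permutes_interval(1,2)[OF p(3), of "i - a"]
        by (simp add: s_def s'_def sym_embed_apply block_swap_def)
    next
      case 3
      then have "i - (a + c) \<le> b" "i - (a + c) > 0" "i - c - a = i - (a + c)" "\<not> i - c \<le> a" "i - c \<le> a + b"
        by auto
      then show ?thesis using 3 permutes_interval(1,2)[OF p(2), of "i - (a + c)"]
        by (simp add: s_def s'_def sym_embed_apply block_swap_def)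
    next
      case 4
      define j where "j = i - (a + b + c)"
      have j: "i = a + b + c + j" "j > 0" using 4 by (simp_all add: j_def)
      have "s i = \<sigma>4 j + a + b + c" "s' i = \<sigma>4 j + a + b + c"
        using j(2) by (simp_all add: s_def s'_def sym_embed_apply j(1))
      then show ?thesis using j permutes_interval(2)[OF p(4) j(2)]
        by (simp add: block_swap_def)
    qed
  qed
  ultimately show ?thesis
    unfolding E by (simp only: hyperoct_simps(2) add_0 add_0_right prod.inject fun_eq_iff comp_apply simp_thms)
qed

text \<open>Once the inner inductions are pulled out of the tensor product, both sides are induced
  from a product of the same four groups. What remains is the exchange of the second and third
  factor, effected on the representation by \<open>rep_iso_box_swap\<close> and inside B_n by
  conjugation with \<open>block_swap\<close>.\<close>

lemma induced_box_swap:
  assumes R: "linear_rep (hyperoct a) R1" "linear_rep (hyperoct b) R2" "linear_rep (hyperoct c) R3" "linear_rep (hyperoct d) R4"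
    and n: "n = a + b + (c + d)"
  shows "rep_iso (hyperoct n)
    (induced (hyperoct n) (hyperoct (a + b) \<times>\<times> hyperoct (c + d)) (hyperoct_embed (a + b))
      (induced (hyperoct (a + b)) (hyperoct a \<times>\<times> hyperoct b) (hyperoct_embed a) (R1 \<boxtimes> R2) \<boxtimes>
       induced (hyperoct (c + d)) (hyperoct c \<times>\<times> hyperoct d) (hyperoct_embed c) (R3 \<boxtimes> R4)))
    (induced (hyperoct n) (hyperoct (a + c) \<times>\<times> hyperoct (b + d)) (hyperoct_embed (a + c))
      (induced (hyperoct (a + c)) (hyperoct a \<times>\<times> hyperoct c) (hyperoct_embed a) (R1 \<boxtimes> R3) \<boxtimes>
       induced (hyperoct (b + d)) (hyperoct b \<times>\<times> hyperoct d) (hyperoct_embed b) (R2 \<boxtimes> R4)))"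
    (is "rep_iso ?B ?L ?R")
proof -
  note grp = group_hyperoct and hom = group_hom_hyperoct_embed and fin = finite_hyperoct
  let ?H = "(hyperoct a \<times>\<times> hyperoct b) \<times>\<times> (hyperoct c \<times>\<times> hyperoct d)"
  let ?H' = "(hyperoct a \<times>\<times> hyperoct c) \<times>\<times> (hyperoct b \<times>\<times> hyperoct d)"
  let ?\<iota> = "\<lambda>h. hyperoct_embed (a + b) (map_prod (hyperoct_embed a) (hyperoct_embed c) h)"
  let ?\<iota>' = "\<lambda>h. hyperoct_embed (a + c) (map_prod (hyperoct_embed a) (hyperoct_embed b) h)"
  let ?\<theta> = "\<lambda>((x, y), (z, w)). ((x, z), (y, w))"
  have n': "n = a + c + (b + d)" using n by simp
  have homn: "group_hom (hyperoct (a + b) \<times>\<times> hyperoct (c + d)) ?B (hyperoct_embed (a + b))"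
    unfolding n by (rule hom)
  have homn': "group_hom (hyperoct (a + c) \<times>\<times> hyperoct (b + d)) ?B (hyperoct_embed (a + c))"
    unfolding n' by (rule hom)
  note box = linear_rep_box[OF R(1) grp R(2) grp] linear_rep_box[OF R(3) grp R(4) grp]
    linear_rep_box[OF R(1) grp R(3) grp] linear_rep_box[OF R(2) grp R(4) grp]
  have finp: "finite (carrier (hyperoct x \<times>\<times> hyperoct y))" for x y using fin by simp
  \<comment> \<open>Used for both orders of the blocks, hence stated for arbitrary sizes and with
    four independent vector space types.\<close>
  have inner: "rep_iso ?B
      (induced ?B (hyperoct (x + y) \<times>\<times> hyperoct (z + w)) (hyperoct_embed (x + y))
        (induced (hyperoct (x + y)) (hyperoct x \<times>\<times> hyperoct y) (hyperoct_embed x) (X \<boxtimes> Y) \<boxtimes>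
         induced (hyperoct (z + w)) (hyperoct z \<times>\<times> hyperoct w) (hyperoct_embed z) (Z \<boxtimes> W)))
      (induced ?B ((hyperoct x \<times>\<times> hyperoct y) \<times>\<times> (hyperoct z \<times>\<times> hyperoct w))
        (\<lambda>h. hyperoct_embed (x + y) (map_prod (hyperoct_embed x) (hyperoct_embed z) h)) ((X \<boxtimes> Y) \<boxtimes> (Z \<boxtimes> W)))"
    if X: "linear_rep (hyperoct x) X" "linear_rep (hyperoct y) Y" "linear_rep (hyperoct z) Z" "linear_rep (hyperoct w) W"
      and xy: "n = x + y + (z + w)"
    for x y z w and X :: "(signed_perm, 'x1::complex_vector) rep" and Y :: "(signed_perm, 'x2::complex_vector) rep"
      and Z :: "(signed_perm, 'x3::complex_vector) rep" and W :: "(signed_perm, 'x4::complex_vector) rep"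
  proof -
    note b = linear_rep_box[OF X(1) grp X(2) grp] linear_rep_box[OF X(3) grp X(4) grp]
    note bb = linear_rep_box[OF b(1) DirProd_group[OF grp grp] b(2) DirProd_group[OF grp grp]]
    have h: "group_hom (hyperoct (x + y) \<times>\<times> hyperoct (z + w)) ?B (hyperoct_embed (x + y))"
      using hom[of "x + y" "z + w"] xy by simp
    have "rep_iso (hyperoct (x + y) \<times>\<times> hyperoct (z + w))
        (induced (hyperoct (x + y)) (hyperoct x \<times>\<times> hyperoct y) (hyperoct_embed x) (X \<boxtimes> Y) \<boxtimes>
         induced (hyperoct (z + w)) (hyperoct z \<times>\<times> hyperoct w) (hyperoct_embed z) (Z \<boxtimes> W))
        (induced (hyperoct (x + y) \<times>\<times> hyperoct (z + w)) ((hyperoct x \<times>\<times> hyperoct y) \<times>\<times> (hyperoct z \<times>\<times> hyperoct w))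
          (map_prod (hyperoct_embed x) (hyperoct_embed z)) ((X \<boxtimes> Y) \<boxtimes> (Z \<boxtimes> W)))"
      by (rule box_induced[OF hom hom b fin fin finp finp])
    then have "rep_iso ?B
        (induced ?B (hyperoct (x + y) \<times>\<times> hyperoct (z + w)) (hyperoct_embed (x + y))
          (induced (hyperoct (x + y)) (hyperoct x \<times>\<times> hyperoct y) (hyperoct_embed x) (X \<boxtimes> Y) \<boxtimes>
           induced (hyperoct (z + w)) (hyperoct z \<times>\<times> hyperoct w) (hyperoct_embed z) (Z \<boxtimes> W)))
        (induced ?B (hyperoct (x + y) \<times>\<times> hyperoct (z + w)) (hyperoct_embed (x + y))
          (induced (hyperoct (x + y) \<times>\<times> hyperoct (z + w)) ((hyperoct x \<times>\<times> hyperoct y) \<times>\<times> (hyperoct z \<times>\<times> hyperoct w))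
            (map_prod (hyperoct_embed x) (hyperoct_embed z)) ((X \<boxtimes> Y) \<boxtimes> (Z \<boxtimes> W))))"
      by (intro rep_iso_induced[OF h] linear_rep_box linear_rep_induced[OF hom] linear_rep_induced[OF group_hom_map_prod[OF hom hom]] b bb grp DirProd_group)
    also have "rep_iso ?B \<dots> (induced ?B ((hyperoct x \<times>\<times> hyperoct y) \<times>\<times> (hyperoct z \<times>\<times> hyperoct w))
        (\<lambda>h. hyperoct_embed (x + y) (map_prod (hyperoct_embed x) (hyperoct_embed z) h)) ((X \<boxtimes> Y) \<boxtimes> (Z \<boxtimes> W)))"
      by (rule induced_transitive[OF group_hom_map_prod[OF hom hom] h bb])
    finally show ?thesis .
  qed
  have bb: "linear_rep ?H ((R1 \<boxtimes> R2) \<boxtimes> (R3 \<boxtimes> R4))" "linear_rep ?H' ((R1 \<boxtimes> R3) \<boxtimes> (R2 \<boxtimes> R4))"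
    by (intro linear_rep_box box DirProd_group grp)+
  have hom\<iota>: "group_hom ?H ?B ?\<iota>" "group_hom ?H' ?B ?\<iota>'"
    by (rule group_hom_compose[OF group_hom_map_prod[OF hom hom] homn],
        rule group_hom_compose[OF group_hom_map_prod[OF hom hom] homn'])
  have hom\<theta>: "group_hom ?H ?H' ?\<theta>"
    unfolding group_hom_def group_hom_axioms_def
    by (intro conjI DirProd_group grp homI) auto
  have "rep_iso ?B ?L (induced ?B ?H ?\<iota> ((R1 \<boxtimes> R2) \<boxtimes> (R3 \<boxtimes> R4)))"
    by (rule inner[OF R n])
  also have "rep_iso ?B \<dots> (induced ?B ?H ?\<iota> (pullback ?\<theta> ((R1 \<boxtimes> R3) \<boxtimes> (R2 \<boxtimes> R4))))"
    by (rule rep_iso_induced[OF hom\<iota>(1) bb(1) linear_rep_pullback[OF hom\<theta> bb(2)]])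
      (rule rep_iso_box_swap[OF R(1) grp R(2) grp R(3) grp R(4) grp])
  also have "rep_iso ?B \<dots> (induced ?B ?H' ?\<iota>' ((R1 \<boxtimes> R3) \<boxtimes> (R2 \<boxtimes> R4)))"
  proof (rule rep_iso_sym[OF induced_conjugate[OF hom\<iota>(1,2) hom\<theta> _ _ _ bb(2)] linear_rep_induced[OF hom\<iota>(2) bb(2)]])
    show "?\<theta> ` carrier ?H = carrier ?H'"
    proof (intro equalityI subsetI)
      fix x assume "x \<in> carrier ?H'"
      moreover obtain p q r s where "x = ((p, r), (q, s))"
        by (metis surj_pair)
      ultimately show "x \<in> ?\<theta> ` carrier ?H"
        by (intro image_eqI[of _ _ "((p, q), (r, s))"]) simp_all
    qed auto
    show "(\<lambda>i. 0, block_swap a b c) \<in> carrier ?B"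
      using block_swap_permutes[of a b c d] by (simp add: n add.assoc)
    fix h assume "h \<in> carrier ?H"
    moreover obtain f1 \<sigma>1 f2 \<sigma>2 f3 \<sigma>3 f4 \<sigma>4 where "h = (((f1, \<sigma>1), (f2, \<sigma>2)), ((f3, \<sigma>3), (f4, \<sigma>4)))"
      by (metis surj_pair)
    ultimately show "(\<lambda>i. 0, block_swap a b c) \<otimes>\<^bsub>?B\<^esub> ?\<iota>' (?\<theta> h) = ?\<iota> h \<otimes>\<^bsub>?B\<^esub> (\<lambda>i. 0, block_swap a b c)"
      using block_swap_conjugates[of f1 \<sigma>1 a f2 \<sigma>2 b f3 \<sigma>3 c f4 \<sigma>4 d]
      by (simp only: n map_prod_simp prod.case carrier_DirProd mem_Sigma_iff simp_thms)
  qed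
  also have "rep_iso ?B \<dots> ?R"
    by (rule rep_iso_sym[OF inner[OF R(1,3,2,4) n']])
      (intro linear_rep_induced[OF homn'] linear_rep_box linear_rep_induced[OF hom] box grp)
  finally show ?thesis .
qed

section \<open>Specht modules of dimension one\<close>

text \<open>Composition with \<pi> permutes the column stabilizer and multiplies every sign by that
  of \<pi>.\<close>

lemma polytabloid_column_action:
  assumes t: "t \<in> tableaux p" and \<pi>: "\<pi> \<in> column_stabilizer p t"
  shows "perm_action \<pi> (polytabloid p t) = of_int (sign \<pi>) *\<^sub>C polytabloid p t"
proof
  fix T
  let ?C = "column_stabilizer p t"
  note grp = column_stabilizer_group[OF t]
  have perm: "\<rho> permutes {1..sum_list p}" if "\<rho> \<in> ?C" for \<rho> using that by (simp add: column_stabilizer_def)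
  have permn: "permutation \<rho>" if "\<rho> \<in> ?C" for \<rho>
    using perm[OF that] permutation_permutes[of \<rho>] by (metis finite_atLeastAtMost)
  have bij: "bij_betw (\<lambda>\<rho>. inv' \<pi> \<circ> \<rho>) ?C ?C"
    by (rule bij_betwI[where g = "\<lambda>\<rho>. \<pi> \<circ> \<rho>"])
      (use grp(2)[OF grp(3)[OF \<pi>]] grp(2)[OF \<pi>] in \<open>auto simp: fun_eq_iff permutes_inverses[OF perm[OF \<pi>]]\<close>)
  have "perm_action \<pi> (polytabloid p t) T =
      (\<Sum>\<rho>\<in>?C. if (\<lambda>i. inv' \<pi> ` T i) = tabloid p (inv' \<pi> \<circ> \<rho> \<circ> t) then of_int (sign (inv' \<pi> \<circ> \<rho>)) else 0)"
    unfolding perm_action_def polytabloid_def by (rule sum.reindex_bij_betw[OF bij, symmetric])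
  also have "\<dots> = (\<Sum>\<rho>\<in>?C. of_int (sign \<pi>) * (if T = tabloid p (\<rho> \<circ> t) then of_int (sign \<rho>) else 0))"
  proof (rule sum.cong[OF refl])
    fix \<rho> assume \<rho>: "\<rho> \<in> ?C"
    have "sign (inv' \<pi> \<circ> \<rho>) = sign \<pi> * sign \<rho>"
      using sign_compose[OF permn[OF grp(3)[OF \<pi>]] permn[OF \<rho>]] sign_inverse[OF permn[OF \<pi>]] by simp
    moreover have "(\<lambda>i. inv' \<pi> ` T i) = tabloid p (inv' \<pi> \<circ> \<rho> \<circ> t) \<longleftrightarrow> T = tabloid p (\<rho> \<circ> t)"
      unfolding comp_assoc tabloid_compose[of p "inv' \<pi>"] fun_eq_iff
      using inj_image_eq_iff[OF permutes_inj[OF permutes_inv[OF perm[OF \<pi>]]]] by metis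
    ultimately show "(if (\<lambda>i. inv' \<pi> ` T i) = tabloid p (inv' \<pi> \<circ> \<rho> \<circ> t) then of_int (sign (inv' \<pi> \<circ> \<rho>)) else 0) =
        of_int (sign \<pi>) * (if T = tabloid p (\<rho> \<circ> t) then complex_of_int (sign \<rho>) else 0)"
      by simp
  qed
  also have "\<dots> = of_int (sign \<pi>) * polytabloid p t T"
    by (simp only: polytabloid_def sum_distrib_left)
  finally show "perm_action \<pi> (polytabloid p t) T = (of_int (sign \<pi>) *\<^sub>C polytabloid p t) T"
    by simp
qed

text \<open>All polytabloids are translates of one of them, so if every permutation scales that one,
  the module is the line through it.\<close>

lemma specht_character:
  assumes p: "is_partition k p" and t: "t \<in> tableaux p"
    and \<chi>: "\<And>\<sigma>. \<sigma> permutes {1..k} \<Longrightarrow> perm_action \<sigma> (polytabloid p t) = \<chi> \<sigma> *\<^sub>C polytabloid p t"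
    and X: "rspace X = (UNIV :: complex set)" "\<And>\<sigma> z. ract X \<sigma> z = \<chi> \<sigma> * z"
  shows "rep_iso (sym_group k) X (specht p)"
proof -
  let ?e = "polytabloid p t"
  have e0: "?e \<noteq> 0" using polytabloid_self[OF t] by auto
  have im: "(\<lambda>z. z *\<^sub>C ?e) ` UNIV = rspace (specht p)"
  proof
    show "(\<lambda>z. z *\<^sub>C ?e) ` UNIV \<subseteq> rspace (specht p)"
      using complex_vector.subspace_scale[OF linear_rep_subspace[OF linear_rep_specht[OF p]] polytabloid_in_specht[OF t]] by auto
    have "csubspace (range (\<lambda>z. z *\<^sub>C ?e))"
    proof (rule complex_vector.subspaceI)
      show "0 \<in> range (\<lambda>z. z *\<^sub>C ?e)" by (rule range_eqI[of _ _ 0]) simp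
      show "x + y \<in> range (\<lambda>z. z *\<^sub>C ?e)" if "x \<in> range (\<lambda>z. z *\<^sub>C ?e)" "y \<in> range (\<lambda>z. z *\<^sub>C ?e)" for x y
        using that by (auto simp: scaleC_add_left[symmetric])
      show "c *\<^sub>C x \<in> range (\<lambda>z. z *\<^sub>C ?e)" if "x \<in> range (\<lambda>z. z *\<^sub>C ?e)" for c x
        using that by (auto simp: scaleC_scaleC)
    qed
    then show "rspace (specht p) \<subseteq> (\<lambda>z. z *\<^sub>C ?e) ` UNIV"
      unfolding specht_space
    proof (rule complex_vector.span_minimal[rotated], intro image_subsetI)
      fix s assume "s \<in> tableaux p"
      then obtain \<sigma> where \<sigma>: "\<sigma> permutes {1..sum_list p}" "\<And>x. x \<in> young_diagram p \<Longrightarrow> s x = (\<sigma> \<circ> t) x"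
        using tableaux_transitive[OF t] by metis
      then have "polytabloid p s = \<chi> \<sigma> *\<^sub>C ?e"
        using polytabloid_cong[of p s "\<sigma> \<circ> t"] polytabloid_action[OF t \<sigma>(1)] \<chi>[of \<sigma>] sum_list_partition[OF p] by simp
      then show "polytabloid p s \<in> range (\<lambda>z. z *\<^sub>C ?e)" by blast
    qed
  qed
  have "inj_on (\<lambda>z. z *\<^sub>C ?e) UNIV"
    using e0 by (auto simp: inj_on_def)
  moreover have "clinear_on UNIV (\<lambda>z. z *\<^sub>C ?e)"
    by (rule clinear_onI) (simp_all add: scaleC_add_left scaleC_scaleC)
  moreover have "(\<chi> \<sigma> * z) *\<^sub>C ?e = perm_action \<sigma> (z *\<^sub>C ?e)" if "\<sigma> permutes {1..k}" for \<sigma> z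
    using clinear_on_scale[OF perm_action_linear[of UNIV \<sigma>], of ?e z] \<chi>[OF that] by (simp only: UNIV_I scaleC_scaleC mult.commute)
  ultimately show ?thesis
    unfolding rep_iso_def bij_betw_def using im X
    by (intro exI[of _ "\<lambda>z. z *\<^sub>C ?e"]) simp
qed

lemma linear_rep_character:
  assumes X: "rspace X = (UNIV :: complex set)" "\<And>\<sigma> z. ract X \<sigma> z = \<chi> \<sigma> * z"
    and \<chi>: "\<chi> id = 1" "\<And>\<sigma> \<tau>. \<sigma> permutes {1..k} \<Longrightarrow> \<tau> permutes {1..k} \<Longrightarrow> \<chi> (\<sigma> \<circ> \<tau>) = \<chi> \<sigma> * \<chi> \<tau>"
  shows "linear_rep (sym_group k) X"
  unfolding linear_rep_def
  by (auto simp: X \<chi> complex_vector.subspace_UNIV algebra_simps intro!: clinear_onI)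

lemma linear_rep_trivial: "linear_rep (sym_group k) trivial_rep"
  by (rule linear_rep_character[where \<chi> = "\<lambda>_. 1"]) (simp_all add: trivial_rep_def)

lemma linear_rep_sign: "linear_rep (sym_group k) sign_rep"
proof (rule linear_rep_character[where \<chi> = "\<lambda>\<sigma>. of_int (sign \<sigma>)"])
  fix \<sigma> \<tau> :: "nat \<Rightarrow> nat" assume "\<sigma> permutes {1..k}" "\<tau> permutes {1..k}"
  then have "permutation \<sigma>" "permutation \<tau>"
    using permutation_permutes[of \<sigma>] permutation_permutes[of \<tau>] by (metis finite_atLeastAtMost)+
  then show "complex_of_int (sign (\<sigma> \<circ> \<tau>)) = of_int (sign \<sigma>) * of_int (sign \<tau>)"
    by (simp add: sign_compose)
qed (simp_all add: sign_rep_def)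

lemma young_diagram_row: "young_diagram [k] = {0} \<times> {..<k}"
  by (auto simp: young_diagram_def)

text \<open>A single row has trivial column stabilizer and only one tabloid, so its polytabloid is
  fixed by every permutation.\<close>

lemma specht_row:
  assumes "0 < k"
  shows "rep_iso (sym_group k) trivial_rep (specht [k])"
proof -
  have p: "is_partition k [k]" using assms by (simp add: is_partition_def)
  obtain t where t: "t \<in> tableaux [k]" using tableaux_nonempty[of "[k]"] by auto
  have row: "entry_row [k] t x = 0" if "x \<in> {1..k}" for x
    using entry(4)[OF t, of x] that by (simp add: young_diagram_row)
  have C: "column_stabilizer [k] t = {id}"
  proof (intro equalityI subsetI)
    fix \<pi> assume "\<pi> \<in> column_stabilizer [k] t"
    then have \<pi>: "\<pi> permutes {1..k}" "\<And>x. x \<in> {1..k} \<Longrightarrow> entry_col [k] t (\<pi> x) = entry_col [k] t x"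
      by (auto simp: column_stabilizer_iff[OF t])
    have "\<pi> x = x" for x
    proof (cases "x \<in> {1..k}")
      case True
      then have "\<pi> x \<in> {1..k}" using permutes_in_image[OF \<pi>(1)] by blast
      then show ?thesis
        using entry_eq[OF t, of "\<pi> x" x] \<pi>(2)[OF True] row True by simp
    qed (rule permutes_not_in[OF \<pi>(1)])
    then show "\<pi> \<in> {id}" by auto
  qed (use column_stabilizer_group(1)[OF t] in auto)
  have tab: "tabloid [k] (\<sigma> \<circ> t) = tabloid [k] t" if \<sigma>: "\<sigma> permutes {1..k}" for \<sigma>
  proof -
    have "tabloid [k] t i = (if i = 0 then {1..k} else {})" for i
      using row by (auto simp: tabloid_entry[OF t])
    then show ?thesis
      using permutes_image[OF \<sigma>] by (auto simp: tabloid_compose fun_eq_iff)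
  qed
  have inv_tab: "(\<lambda>i. inv' \<sigma> ` T i) = tabloid [k] t \<longleftrightarrow> T = tabloid [k] t" if \<sigma>: "\<sigma> permutes {1..k}" for \<sigma> T
  proof -
    have "tabloid [k] t = (\<lambda>i. inv' \<sigma> ` tabloid [k] t i)"
      using tab[OF permutes_inv[OF \<sigma>]] by (simp add: tabloid_compose)
    then have "(\<lambda>i. inv' \<sigma> ` T i) = tabloid [k] t \<longleftrightarrow> (\<lambda>i. inv' \<sigma> ` T i) = (\<lambda>i. inv' \<sigma> ` tabloid [k] t i)" by simp
    also have "\<dots> \<longleftrightarrow> T = tabloid [k] t"
      using inj_image_eq_iff[OF permutes_inj[OF permutes_inv[OF \<sigma>]]] by (metis ext)
    finally show ?thesis .
  qed
  show ?thesis
  proof (rule specht_character[OF p t, where \<chi> = "\<lambda>_. 1"])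
    fix \<sigma> assume \<sigma>: "\<sigma> permutes {1..k}"
    have poly: "polytabloid [k] t T = (if T = tabloid [k] t then 1 else 0)" for T
      by (simp add: polytabloid_def C)
    show "perm_action \<sigma> (polytabloid [k] t) = 1 *\<^sub>C polytabloid [k] t"
      by (rule ext) (simp only: scaleC_one perm_action_def poly inv_tab[OF \<sigma>])
  qed (simp_all add: trivial_rep_def)
qed

lemma specht_empty: "rep_iso (sym_group 0) trivial_rep (specht [])"
proof -
  obtain t where t: "t \<in> tableaux []" using tableaux_nonempty[of "[]"] by auto
  show ?thesis
  proof (rule specht_character[OF _ t, where \<chi> = "\<lambda>_. 1"])
    fix \<sigma> :: "nat \<Rightarrow> nat" assume "\<sigma> permutes {1..0}"
    then have "\<sigma> = id" by (simp add: permutes_empty)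
    then show "perm_action \<sigma> (polytabloid [] t) = 1 *\<^sub>C polytabloid [] t"
      by (simp add: perm_action_id scaleC_one)
  qed (simp_all add: trivial_rep_def is_partition_def)
qed

text \<open>In a single column every permutation is a column permutation and acts on the polytabloid
  by its sign.\<close>

lemma specht_column: "rep_iso (sym_group 2) sign_rep (specht [1, 1])"
proof -
  obtain t where t: "t \<in> tableaux [1, 1]" using tableaux_nonempty[of "[1, 1]"] by auto
  show ?thesis
  proof (rule specht_character[OF _ t, where \<chi> = "\<lambda>\<sigma>. of_int (sign \<sigma>)"])
    fix \<sigma> :: "nat \<Rightarrow> nat" assume \<sigma>: "\<sigma> permutes {1..2}"
    have s2: "sum_list [1, 1] = (2::nat)" by simp
    have col: "entry_col [1, 1] t x = 0" if "x \<in> {1..2}" for x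
      using entry(4)[OF t, of x] that by (auto simp: young_diagram_def nth_Cons split: nat.splits)
    have "\<sigma> \<in> column_stabilizer [1, 1] t"
      unfolding column_stabilizer_iff[OF t] s2
    proof (intro conjI ballI \<sigma>)
      fix x assume x: "x \<in> {1..2::nat}"
      then have "\<sigma> x \<in> {1..2}" using permutes_in_image[OF \<sigma>] by blast
      then show "entry_col [1, 1] t (\<sigma> x) = entry_col [1, 1] t x"
        using col[OF x] col[of "\<sigma> x"] by simp
    qed
    then show "perm_action \<sigma> (polytabloid [1, 1] t) = of_int (sign \<sigma>) *\<^sub>C polytabloid [1, 1] t"
      by (rule polytabloid_column_action[OF t])
  qed (simp_all add: sign_rep_def is_partition_def)
qed

section \<open>Induction products\<close>

definition sym_product :: "nat \<Rightarrow> nat list \<Rightarrow> nat \<Rightarrow> (nat \<Rightarrow> nat, 'v::complex_vector) rep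
    \<Rightarrow> (nat \<Rightarrow> nat, (nat \<Rightarrow> nat) \<Rightarrow> ((((nat \<Rightarrow> nat set) \<Rightarrow> complex) \<Rightarrow> 'v \<Rightarrow> complex) \<Rightarrow> complex)) rep"
  where "sym_product a p c X =
    induced (sym_group (a + c)) (sym_group a \<times>\<times> sym_group c) (sym_embed a) (specht p \<boxtimes> X)"

lemma linear_rep_sym_product:
  assumes "is_partition a p" "linear_rep (sym_group c) X"
  shows "linear_rep (sym_group (a + c)) (sym_product a p c X)"
  unfolding sym_product_def
  by (intro linear_rep_induced group_hom_sym_embed linear_rep_box linear_rep_specht assms sym_group_is_group)

lemma sym_product_iso:
  assumes p: "is_partition a p" and X: "linear_rep (sym_group c) X" "linear_rep (sym_group c) Y"
    and iso: "rep_iso (sym_group c) X Y"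
  shows "rep_iso (sym_group (a + c)) (sym_product a p c X) (sym_product a p c Y)"
  unfolding sym_product_def
  by (intro rep_iso_induced group_hom_sym_embed linear_rep_box rep_iso_box linear_rep_specht[OF p] X
      sym_group_is_group iso rep_iso_refl)

text \<open>The factors of \<open>bispecht\<close> are Specht modules, whereas \<open>bar\<close>
  and its variants are defined with one-dimensional representations X; \<open>iso\<close> is the
  bridge between the two.\<close>

lemma sym_product_decomposes:
  assumes p: "is_partition a p" and al: "is_partition c al" and c: "0 < c" "c \<le> 2"
    and X: "linear_rep (sym_group c) X" "rspace X = (UNIV :: complex set)" "\<And>\<sigma> z. ract X \<sigma> z = \<chi> \<sigma> * z"
    and \<chi>: "\<chi> id = 1" "\<And>\<sigma>. \<chi> \<sigma> * \<chi> \<sigma> = 1"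
    and iso: "rep_iso (sym_group c) X (specht al)"
  shows "decomposes (sym_group (a + c)) (sym_product a p c (specht al))
    {q. is_partition (a + c) q \<and> summand (sym_group (a + c)) (specht q) (sym_product a p c X)} specht"
proof (rule rep_iso_decomposes)
  note lin = linear_rep_sym_product[OF p linear_rep_specht[OF al]]
  show "finite {q. is_partition (a + c) q \<and> summand (sym_group (a + c)) (specht q) (sym_product a p c X)}"
    by (rule finite_subset[OF _ finite_partitions[of "a + c"]]) auto
  show "linear_rep (sym_group (a + c)) (sym_product a p c (specht al))" by (rule lin)
  have "rep_iso (sym_group (a + c)) (sym_product a p c (specht al)) (sym_product a p c X)"
    by (rule sym_product_iso[OF p linear_rep_specht[OF al] X(1) rep_iso_sym[OF iso X(1)]])
  also have "rep_iso (sym_group (a + c)) \<dots>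
      (direct_sum {q. is_partition (a + c) q \<and> summand (sym_group (a + c)) (specht q) (sym_product a p c X)} specht)"
    unfolding sym_product_def by (rule specht_induced_decomposition[OF p c X \<chi>])
  finally show "rep_iso (sym_group (a + c)) (sym_product a p c (specht al))
      (direct_sum {q. is_partition (a + c) q \<and> summand (sym_group (a + c)) (specht q) (sym_product a p c X)} specht)" .
qed (auto intro: linear_rep_specht)

lemma sym_product_row:
  assumes p: "is_partition a p"
  shows "decomposes (sym_group (a + 2)) (sym_product a p 2 (specht [2])) (bar_bar p) specht"
    and "decomposes (sym_group (a + 1)) (sym_product a p 1 (specht [1])) (bar p) specht"
  using sym_product_decomposes[OF p, of 2 "[2]" trivial_rep "\<lambda>_. 1"] sym_product_decomposes[OF p, of 1 "[1]" trivial_rep "\<lambda>_. 1"]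
    specht_row[of 2] specht_row[of 1] linear_rep_trivial[of 2] linear_rep_trivial[of 1] sum_list_partition[OF p]
  by (simp_all add: bar_bar_def bar_def Let_def sym_product_def is_partition_def trivial_rep_def)

lemma sym_product_column:
  assumes p: "is_partition a p"
  shows "decomposes (sym_group (a + 2)) (sym_product a p 2 (specht [1, 1])) (tilde_bar p) specht"
  using sym_product_decomposes[OF p, of 2 "[1, 1]" sign_rep "\<lambda>\<sigma>. of_int (sign \<sigma>)"]
    specht_column linear_rep_sign[of 2] sum_list_partition[OF p]
  by (simp add: tilde_bar_def Let_def sym_product_def is_partition_def sign_rep_def sign_idempotent flip: of_int_mult)

text \<open>Treats the side on which a representation such as \<open>bispecht [2] []\<close>
  contributes no boxes: S_a \<times> S_0 is carried onto S_a, and inducing along this map returns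
  the Specht module unchanged.\<close>

lemma sym_product_empty:
  assumes p: "is_partition a p"
  shows "decomposes (sym_group (a + 0)) (sym_product a p 0 (specht [])) {p} specht"
proof -
  let ?H = "sym_group a \<times>\<times> sym_group 0"
  have al: "is_partition 0 []" by (simp add: is_partition_def)
  note lin = linear_rep_specht[OF p]
  have hom: "group_hom ?H (sym_group a) (sym_embed a)"
    using group_hom_sym_embed[of a 0] by simp
  have surj: "sym_embed a ` carrier ?H = carrier (sym_group a)"
  proof (intro equalityI subsetI)
    fix \<sigma> assume "\<sigma> \<in> carrier (sym_group a)"
    then have \<sigma>: "\<sigma> permutes {1..a}" by simp
    have "\<sigma> = sym_embed a (\<sigma>, id)"
      using permutes_not_in[OF \<sigma>] by (auto simp: sym_embed_apply fun_eq_iff)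
    then show "\<sigma> \<in> sym_embed a ` carrier ?H"
      using \<sigma> by (intro image_eqI[of _ _ "(\<sigma>, id)"]) (auto simp: permutes_id)
  qed (use group_hom.hom_closed[OF hom] in blast)
  have emb: "sym_embed a (\<sigma>, \<tau>) = \<sigma>" if "\<sigma> permutes {1..a}" "\<tau> permutes {1..0}" for \<sigma> \<tau>
    using permutes_not_in[OF that(1)] that(2) by (auto simp: sym_embed_apply fun_eq_iff permutes_empty)
  have tw: "rep_iso ?H (pullback (sym_embed a) (specht p)) (twist (\<lambda>_. 1) (specht p))"
    unfolding rep_iso_def
    by (rule exI[of _ "\<lambda>v. v"]) (auto simp: twist_def scaleC_one emb clinear_on_id bij_betw_def)
  have "rep_iso (sym_group a) (specht p) (induced (sym_group a) ?H (sym_embed a) (pullback (sym_embed a) (specht p)))"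
    by (rule induced_surjective[OF hom surj lin])
  also have "rep_iso (sym_group a) \<dots> (induced (sym_group a) ?H (sym_embed a) (specht p \<boxtimes> trivial_rep))"
  proof (rule rep_iso_induced[OF hom linear_rep_pullback[OF hom lin]])
    show "linear_rep ?H (specht p \<boxtimes> trivial_rep)"
      by (rule linear_rep_box[OF lin sym_group_is_group linear_rep_trivial sym_group_is_group])
    show "rep_iso ?H (pullback (sym_embed a) (specht p)) (specht p \<boxtimes> trivial_rep)"
      by (rule rep_iso_trans[OF tw rep_iso_box_character[OF lin sym_group_is_group linear_rep_trivial sym_group_is_group]])
        (simp_all add: trivial_rep_def)
  qed
  also have "\<dots> = sym_product a p 0 trivial_rep"
    by (simp add: sym_product_def)
  also have "rep_iso (sym_group a) \<dots> (sym_product a p 0 (specht []))"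
    using sym_product_iso[OF p linear_rep_trivial linear_rep_specht[OF al] specht_empty] by simp
  finally have iso: "rep_iso (sym_group a) (specht p) (sym_product a p 0 (specht []))" .
  have "decomposes (sym_group a) (sym_product a p 0 (specht [])) {p} (\<lambda>_. specht p)"
    using decomposes_iso[OF _ rep_iso_sym[OF iso lin] decomposes_self] linear_rep_sym_product[OF p linear_rep_specht[OF al]] by simp
  then show ?thesis
    by (simp add: decomposes_def decomposition_def)
qed

section \<open>Induction products of irreducible representations of hyperoctahedral groups\<close>

lemma linear_rep_bispecht:
  assumes "is_partition a p" "is_partition b q"
  shows "linear_rep (hyperoct (a + b)) (bispecht p q)"
  unfolding bispecht_def Let_def sum_list_partition[OF assms(1)] sum_list_partition[OF assms(2)]
  by (intro linear_rep_induced group_hom_hyperoct_embed linear_rep_box linear_rep_char_rep linear_rep_specht assms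
      multiplicative_triv_char multiplicative_sign_char group_hyperoct)

lemma decomposes_cong:
  assumes "\<And>i. i \<in> I \<Longrightarrow> R i = R' i"
  shows "decomposes G E I R \<longleftrightarrow> decomposes G E I R'"
  using assms by (simp add: decomposes_def decomposition_def)

text \<open>After the blocks are regrouped, the two parts with trivial character merge into one
  representation (1; E1) and the two with sign character into one (\<epsilon>; E2). They decompose
  independently, so the constituents are indexed by I \<times> J. The separate variables m, k and n
  allow n - 2 and 2 to be inserted as block sizes.\<close>

lemma bispecht_product:
  assumes p: "is_partition a p" "is_partition b q" "is_partition c al" "is_partition d be"
    and I: "decomposes (sym_group (a + c)) (sym_product a p c (specht al)) I specht" "\<And>i. i \<in> I \<Longrightarrow> is_partition (a + c) i"
    and J: "decomposes (sym_group (b + d)) (sym_product b q d (specht be)) J specht" "\<And>j. j \<in> J \<Longrightarrow> is_partition (b + d) j"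
    and mk: "m = a + b" "k = c + d" and nmk: "n = m + k"
  shows "decomposes (hyperoct n)
    (induced (hyperoct n) (hyperoct m \<times>\<times> hyperoct k) (hyperoct_embed m) (bispecht p q \<boxtimes> bispecht al be))
    (I \<times> J) (\<lambda>(i, j). bispecht i j)"
proof -
  have n: "n = a + b + (c + d)" using mk nmk by simp
  note m = sum_list_partition[OF p(1)] sum_list_partition[OF p(2)] sum_list_partition[OF p(3)] sum_list_partition[OF p(4)]
  note T = multiplicative_triv_char and S = multiplicative_sign_char
  note sp = linear_rep_specht[OF p(1)] linear_rep_specht[OF p(2)] linear_rep_specht[OF p(3)] linear_rep_specht[OF p(4)]
  note ch = linear_rep_char_rep[OF T sp(1)] linear_rep_char_rep[OF S sp(2)] linear_rep_char_rep[OF T sp(3)] linear_rep_char_rep[OF S sp(4)]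
  let ?E1 = "sym_product a p c (specht al)" and ?E2 = "sym_product b q d (specht be)"
  note E = linear_rep_sym_product[OF p(1) sp(3)] linear_rep_sym_product[OF p(2) sp(4)]
  note chE = linear_rep_char_rep[OF T E(1)] linear_rep_char_rep[OF S E(2)]
  have n': "n = a + c + (b + d)" using n by simp
  have hom: "group_hom (hyperoct (a + b) \<times>\<times> hyperoct (c + d)) (hyperoct n) (hyperoct_embed (a + b))"
    unfolding n by (rule group_hom_hyperoct_embed)
  have hom': "group_hom (hyperoct (a + c) \<times>\<times> hyperoct (b + d)) (hyperoct n) (hyperoct_embed (a + c))"
    unfolding n' by (rule group_hom_hyperoct_embed)
  let ?L = "induced (hyperoct n) (hyperoct (a + b) \<times>\<times> hyperoct (c + d)) (hyperoct_embed (a + b)) (bispecht p q \<boxtimes> bispecht al be)"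
  let ?M = "induced (hyperoct n) (hyperoct (a + c) \<times>\<times> hyperoct (b + d)) (hyperoct_embed (a + c))
      (char_rep (a + c) triv_char ?E1 \<boxtimes> char_rep (b + d) sign_char ?E2)"
  have "rep_iso (hyperoct n) ?L
      (induced (hyperoct n) (hyperoct (a + c) \<times>\<times> hyperoct (b + d)) (hyperoct_embed (a + c))
        (induced (hyperoct (a + c)) (hyperoct a \<times>\<times> hyperoct c) (hyperoct_embed a)
          (char_rep a triv_char (specht p) \<boxtimes> char_rep c triv_char (specht al)) \<boxtimes>
         induced (hyperoct (b + d)) (hyperoct b \<times>\<times> hyperoct d) (hyperoct_embed b)
          (char_rep b sign_char (specht q) \<boxtimes> char_rep d sign_char (specht be))))"
    unfolding bispecht_def Let_def m by (rule induced_box_swap[OF ch n])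
  also have "rep_iso (hyperoct n) \<dots> ?M"
    unfolding sym_product_def
    by (intro rep_iso_induced[OF hom'] linear_rep_box rep_iso_box linear_rep_induced[OF group_hom_hyperoct_embed]
        char_rep_induced T S sp ch chE[unfolded sym_product_def] group_hyperoct)
  finally have iso: "rep_iso (hyperoct n) ?L ?M" .
  have "decomposes (hyperoct (a + c)) (char_rep (a + c) triv_char ?E1) I (\<lambda>i. char_rep (a + c) triv_char (specht i))"
    by (rule char_rep_decomposes[OF E(1) linear_rep_specht[OF I(2)] I(1)])
  moreover have "decomposes (hyperoct (b + d)) (char_rep (b + d) sign_char ?E2) J (\<lambda>i. char_rep (b + d) sign_char (specht i))"
    by (rule char_rep_decomposes[OF E(2) linear_rep_specht[OF J(2)] J(1)])
  ultimately have "decomposes (hyperoct (a + c) \<times>\<times> hyperoct (b + d))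
      (char_rep (a + c) triv_char ?E1 \<boxtimes> char_rep (b + d) sign_char ?E2) (I \<times> J)
      (\<lambda>(i, j). char_rep (a + c) triv_char (specht i) \<boxtimes> char_rep (b + d) sign_char (specht j))"
    by (intro decomposes_box group_hyperoct chE linear_rep_char_rep T S linear_rep_specht I(2) J(2))
  then have "decomposes (hyperoct n) ?M (I \<times> J) (\<lambda>x. induced (hyperoct n) (hyperoct (a + c) \<times>\<times> hyperoct (b + d)) (hyperoct_embed (a + c))
      (case x of (i, j) \<Rightarrow> char_rep (a + c) triv_char (specht i) \<boxtimes> char_rep (b + d) sign_char (specht j)))"
  proof (rule decomposes_induced[OF hom' linear_rep_box[OF chE(1) group_hyperoct chE(2) group_hyperoct], rotated])
    fix x assume "x \<in> I \<times> J"
    then show "linear_rep (hyperoct (a + c) \<times>\<times> hyperoct (b + d))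
        (case x of (i, j) \<Rightarrow> char_rep (a + c) triv_char (specht i) \<boxtimes> char_rep (b + d) sign_char (specht j))"
      by (auto intro!: linear_rep_box linear_rep_char_rep T S linear_rep_specht I(2) J(2) group_hyperoct)
  qed
  \<comment> \<open>For partitions i of a + c and j of b + d the induced term is
    \<open>bispecht i j\<close> by definition.\<close>
  then have "decomposes (hyperoct n) ?M (I \<times> J) (\<lambda>(i, j). bispecht i j)"
  proof (subst (asm) decomposes_cong[where R' = "\<lambda>(i, j). bispecht i j"])
    fix x assume "x \<in> I \<times> J"
    then show "induced (hyperoct n) (hyperoct (a + c) \<times>\<times> hyperoct (b + d)) (hyperoct_embed (a + c))
      (case x of (i, j) \<Rightarrow> char_rep (a + c) triv_char (specht i) \<boxtimes> char_rep (b + d) sign_char (specht j)) =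
      (case x of (i, j) \<Rightarrow> bispecht i j)"
      using sum_list_partition[OF I(2)] sum_list_partition[OF J(2)] by (auto simp: bispecht_def Let_def n')
  qed
  moreover have "linear_rep (hyperoct n) ?L"
    by (intro linear_rep_induced[OF hom] linear_rep_box linear_rep_bispecht p group_hyperoct)
  ultimately show ?thesis
    unfolding mk using decomposes_iso[OF _ iso] by blast
qed

text \<open>S is regarded as induced from K to K along the identity, so that
  \<open>box_induced\<close> applies to both tensor factors; induction in stages finishes the
  argument. This is how W gives way to its induction to B_2.\<close>

lemma induced_box_induced:
  assumes K: "group K" and hom: "group_hom (K \<times>\<times> G) B \<kappa>" "group_hom H G \<iota>"
    and S: "linear_rep K S" and W: "linear_rep H W"
    and fin: "finite (carrier K)" "finite (carrier G)" "finite (carrier H)"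
  shows "rep_iso B (induced B (K \<times>\<times> G) \<kappa> (S \<boxtimes> induced G H \<iota> W))
    (induced B (K \<times>\<times> H) (\<lambda>h. \<kappa> (map_prod id \<iota> h)) (S \<boxtimes> W))"
proof -
  have H: "group H" and G: "group G"
    using group_hom.axioms(1,2)[OF hom(2)] .
  have idK: "group_hom K K id"
    using K by (auto simp: group_hom_def group_hom_axioms_def intro!: homI)
  have "pullback id S = S"
    by (cases S) (simp add: pullback_def)
  then have SS: "rep_iso K S (induced K K id S)"
    using induced_surjective[OF idK _ S] by simp
  note ind = linear_rep_induced[OF hom(2) W] linear_rep_induced[OF idK S]
  note SW = linear_rep_box[OF S K W H]
  note hp = group_hom_map_prod[OF idK hom(2)]
  have "rep_iso (K \<times>\<times> G) (S \<boxtimes> induced G H \<iota> W) (induced K K id S \<boxtimes> induced G H \<iota> W)"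
    by (rule rep_iso_box[OF S ind(2) K ind(1) ind(1) G SS rep_iso_refl])
  also have "rep_iso (K \<times>\<times> G) \<dots> (induced (K \<times>\<times> G) (K \<times>\<times> H) (map_prod id \<iota>) (S \<boxtimes> W))"
    by (rule box_induced[OF idK hom(2) S W fin(1,2,1,3)])
  finally have "rep_iso B (induced B (K \<times>\<times> G) \<kappa> (S \<boxtimes> induced G H \<iota> W))
      (induced B (K \<times>\<times> G) \<kappa> (induced (K \<times>\<times> G) (K \<times>\<times> H) (map_prod id \<iota>) (S \<boxtimes> W)))"
    by (rule rep_iso_induced[OF hom(1) linear_rep_box[OF S K ind(1) G] linear_rep_induced[OF hp SW]])
  also have "rep_iso B \<dots> (induced B (K \<times>\<times> H) (\<lambda>h. \<kappa> (map_prod id \<iota> h)) (S \<boxtimes> W))"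
    by (rule induced_transitive[OF hp hom(1) SW])
  finally show ?thesis .
qed

text \<open>The sum passes through \<open>decomposes\<close> as a direct sum over the two truth
  values, since it is there that tensoring and induction are known to preserve sums; S enters with a
  one-element index set.\<close>

lemma induced_box_oplus:
  fixes A C :: "('g, 'v::complex_vector) rep"
  assumes K: "group K" and G: "group G" and hom: "group_hom (K \<times>\<times> G) B \<kappa>"
    and S: "linear_rep K S" and E: "linear_rep G E" and AC: "linear_rep G A" "linear_rep G C"
    and iso: "rep_iso G E (oplus A C)"
  shows "rep_iso B (induced B (K \<times>\<times> G) \<kappa> (S \<boxtimes> E))
    (oplus (induced B (K \<times>\<times> G) \<kappa> (S \<boxtimes> A)) (induced B (K \<times>\<times> G) \<kappa> (S \<boxtimes> C)))"
proof -
  let ?F = "\<lambda>b. if b then A else C"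
  have F: "linear_rep G (?F b)" for b using AC by simp
  have "decomposes G E UNIV ?F"
    by (rule rep_iso_decomposes[OF _ E F rep_iso_trans[OF iso rep_iso_oplus_direct_sum]]) simp
  from decomposes_box[OF K G S _ decomposes_self[of K S "()"] E _ this]
  have "decomposes (K \<times>\<times> G) (S \<boxtimes> E) ({()} \<times> UNIV) (\<lambda>(i, b). S \<boxtimes> ?F b)"
    using S F by simp
  then have "decomposes B (induced B (K \<times>\<times> G) \<kappa> (S \<boxtimes> E)) ({()} \<times> UNIV)
      (\<lambda>x. induced B (K \<times>\<times> G) \<kappa> (case x of (i, b) \<Rightarrow> S \<boxtimes> ?F b))"
    by (rule decomposes_induced[OF hom linear_rep_box[OF S K E G], rotated])
      (auto intro!: linear_rep_box[OF S K _ G] AC)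
  then have "decomposes B (induced B (K \<times>\<times> G) \<kappa> (S \<boxtimes> E)) UNIV
      (\<lambda>b. induced B (K \<times>\<times> G) \<kappa> (case ((), b) of (i, b) \<Rightarrow> S \<boxtimes> ?F b))"
    by (rule decomposes_reindex[rotated]) (auto simp: bij_betw_def inj_on_def)
  then have "rep_iso B (induced B (K \<times>\<times> G) \<kappa> (S \<boxtimes> E))
      (direct_sum UNIV (\<lambda>b. induced B (K \<times>\<times> G) \<kappa> (case ((), b) of (i, b) \<Rightarrow> S \<boxtimes> ?F b)))"
    by (rule decomposes_rep_iso[rotated 2]) (auto intro!: linear_rep_induced[OF hom] linear_rep_box[OF S K E G])
  also have "(\<lambda>b. induced B (K \<times>\<times> G) \<kappa> (case ((), b) of (i, b) \<Rightarrow> S \<boxtimes> ?F b)) =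
      (\<lambda>b. if b then induced B (K \<times>\<times> G) \<kappa> (S \<boxtimes> A) else induced B (K \<times>\<times> G) \<kappa> (S \<boxtimes> C))"
    by (rule ext) simp
  also have "rep_iso B (direct_sum UNIV \<dots>)
      (oplus (induced B (K \<times>\<times> G) \<kappa> (S \<boxtimes> A)) (induced B (K \<times>\<times> G) \<kappa> (S \<boxtimes> C)))"
    by (rule rep_iso_sym[OF rep_iso_oplus_direct_sum])
      (intro linear_rep_oplus linear_rep_induced[OF hom] linear_rep_box[OF S K _ G] AC)
  finally show ?thesis .
qed

lemma finite_bars: "finite (bar p)" "finite (bar_bar p)" "finite (tilde_bar p)"
  by (rule finite_subset[OF _ finite_partitions[of "sum_list p + 1"]], auto simp: bar_def Let_def)
    (rule finite_subset[OF _ finite_partitions[of "sum_list p + 2"]], auto simp: bar_bar_def tilde_bar_def Let_def)+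

lemma is_partition_bars:
  assumes "is_partition a p"
  shows "q \<in> bar p \<Longrightarrow> is_partition (a + 1) q" "q \<in> bar_bar p \<Longrightarrow> is_partition (a + 2) q"
    "q \<in> tilde_bar p \<Longrightarrow> is_partition (a + 2) q"
  using sum_list_partition[OF assms] by (simp_all add: bar_def bar_bar_def tilde_bar_def Let_def)

theorem corollary7p8:
  fixes n a b :: nat and lam mu :: "nat list"
    and W :: "(signed_perm, 'w::complex_vector) rep"
  assumes "n \<ge> 4"
    and "is_partition a lam" and "is_partition b mu" and "a + b = n - 2"
    and "irreducible_rep H2 W"
  shows
    "(rep_iso (hyperoct 2) (induced (hyperoct 2) H2 id W)
          (oplus (bispecht [2] []) (bispecht [] [1, 1]))
        \<longrightarrow> rep_iso (hyperoct n)
            (induced (hyperoct n) (hyperoct (n - 2) \<times>\<times> H2) (hyperoct_embed (n - 2))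
              (bispecht lam mu \<boxtimes> W))
            (oplus (direct_sum (bar_bar lam) (\<lambda>t. bispecht t mu))
                   (direct_sum (tilde_bar mu) (\<lambda>r. bispecht lam r)))) \<and>
     (rep_iso (hyperoct 2) (induced (hyperoct 2) H2 id W)
          (oplus (bispecht [] [2]) (bispecht [1, 1] []))
        \<longrightarrow> rep_iso (hyperoct n)
            (induced (hyperoct n) (hyperoct (n - 2) \<times>\<times> H2) (hyperoct_embed (n - 2))
              (bispecht lam mu \<boxtimes> W))
            (oplus (direct_sum (bar_bar mu) (\<lambda>r. bispecht lam r))
                   (direct_sum (tilde_bar lam) (\<lambda>t. bispecht t mu)))) \<and>
     (rep_iso (hyperoct 2) (induced (hyperoct 2) H2 id W)
          (bispecht [1] [1])
        \<longrightarrow> rep_iso (hyperoct n)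
            (induced (hyperoct n) (hyperoct (n - 2) \<times>\<times> H2) (hyperoct_embed (n - 2))
              (bispecht lam mu \<boxtimes> W))
            (direct_sum (bar lam \<times> bar mu) (\<lambda>(t, r). bispecht t r)))"
proof -
  note p = assms(2) and q = assms(3)
  let ?B = "hyperoct n" and ?K = "hyperoct (n - 2)" and ?G = "hyperoct 2"
  let ?S = "bispecht lam mu" and ?I = "induced (hyperoct 2) H2 id W"
  \<comment> \<open>Subtraction is truncated; n \<ge> 4 excludes the case in which n - 2 + 2 differs
    from n.\<close>
  have m: "n - 2 = a + b" and n: "n = n - 2 + 2" using assms(1,4) by simp_all
  have W: "linear_rep H2 W" and H2: "group H2"
    using assms(5) representation_linear_rep by (auto simp: irreducible_rep_def representation_def)
  have sub: "carrier H2 \<subseteq> carrier ?G" by (auto simp: H2_def)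
  have hom2: "group_hom H2 ?G id"
    using H2 sub by (auto simp: group_hom_def group_hom_axioms_def group_hyperoct H2_def intro!: homI)
  have fin: "finite (carrier H2)" by (rule finite_subset[OF sub finite_hyperoct])
  have hom: "group_hom (?K \<times>\<times> ?G) ?B (hyperoct_embed (n - 2))"
    using group_hom_hyperoct_embed[of "n - 2" 2] n by simp
  have S: "linear_rep ?K ?S"
    unfolding m by (rule linear_rep_bispecht[OF p q])
  have I: "linear_rep ?G ?I" by (rule linear_rep_induced[OF hom2 W])
  let ?L = "induced ?B (?K \<times>\<times> H2) (hyperoct_embed (n - 2)) (?S \<boxtimes> W)"
  let ?X = "\<lambda>E. induced ?B (?K \<times>\<times> ?G) (hyperoct_embed (n - 2)) (?S \<boxtimes> E)"
  have X: "linear_rep ?B (?X E)" if "linear_rep ?G E"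
    for E :: "(signed_perm, 'e::complex_vector) rep"
    by (intro linear_rep_induced[OF hom] linear_rep_box S group_hyperoct that)
  \<comment> \<open>The three hypotheses describe the induction of W to B_2, so W is replaced by
    that representation at once for all cases.\<close>
  have L: "rep_iso ?B ?L (?X ?I)"
    using rep_iso_sym[OF induced_box_induced[OF group_hyperoct hom hom2 S W finite_hyperoct finite_hyperoct fin] X[OF I]]
    by (simp add: map_prod.id)
  have part: "is_partition 2 [2]" "is_partition 2 [1, 1]" "is_partition 1 [1]" "is_partition 0 []"
    by (simp_all add: is_partition_def)
  note prod = bispecht_product[OF p q, of _ _ _ _ _ _ "n - 2" 2 n, OF _ _ _ _ _ _ m _ n]
  have bisp: "linear_rep ?G (bispecht [2] [])" "linear_rep ?G (bispecht [] [2])"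
    "linear_rep ?G (bispecht [1, 1] [])" "linear_rep ?G (bispecht [] [1, 1])" "linear_rep ?G (bispecht [1] [1])"
    using linear_rep_bispecht[OF part(1) part(4)] linear_rep_bispecht[OF part(4) part(1)]
      linear_rep_bispecht[OF part(2) part(4)] linear_rep_bispecht[OF part(4) part(2)]
      linear_rep_bispecht[OF part(3) part(3)] by (simp_all add: numeral_2_eq_2)
  have single: "is_partition (a + 0) i" if "i \<in> {lam}" for i using that p by simp
  have single': "is_partition (b + 0) i" if "i \<in> {mu}" for i using that q by simp
  \<comment> \<open>When the sign part of the B_2-representation is empty, the second index set is
    the singleton of mu, and reindexing removes it.\<close>
  have left: "rep_iso ?B (?X E) (direct_sum J (\<lambda>t. bispecht t mu))"
    if "decomposes ?B (?X E) (J \<times> {mu}) (\<lambda>(i, j). bispecht i j)" "linear_rep ?G E" "finite J"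
    for E :: "(signed_perm, 'e::complex_vector) rep" and J
    using decomposes_rep_iso[OF that(3) X[OF that(2)] decomposes_reindex[OF _ that(1), of "\<lambda>t. (t, mu)" J]]
    by (auto simp: bij_betw_def inj_on_def)
  have right: "rep_iso ?B (?X E) (direct_sum J (\<lambda>r. bispecht lam r))"
    if "decomposes ?B (?X E) ({lam} \<times> J) (\<lambda>(i, j). bispecht i j)" "linear_rep ?G E" "finite J"
    for E :: "(signed_perm, 'e::complex_vector) rep" and J
    using decomposes_rep_iso[OF that(3) X[OF that(2)] decomposes_reindex[OF _ that(1), of "\<lambda>r. (lam, r)" J]]
    by (auto simp: bij_betw_def inj_on_def)
  have 1: "rep_iso ?B (?X (bispecht [2] [])) (direct_sum (bar_bar lam) (\<lambda>t. bispecht t mu))"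
    by (rule left[OF prod[OF part(1,4) sym_product_row(1)[OF p] is_partition_bars(2)[OF p]
          sym_product_empty[OF q] single'] bisp(1) finite_bars(2)]) simp_all
  have 2: "rep_iso ?B (?X (bispecht [] [1, 1])) (direct_sum (tilde_bar mu) (\<lambda>r. bispecht lam r))"
    by (rule right[OF prod[OF part(4,2) sym_product_empty[OF p] single sym_product_column[OF q]
          is_partition_bars(3)[OF q]] bisp(4) finite_bars(3)]) simp_all
  have 3: "rep_iso ?B (?X (bispecht [] [2])) (direct_sum (bar_bar mu) (\<lambda>r. bispecht lam r))"
    by (rule right[OF prod[OF part(4,1) sym_product_empty[OF p] single sym_product_row(1)[OF q]
          is_partition_bars(2)[OF q]] bisp(2) finite_bars(2)]) simp_all
  have 4: "rep_iso ?B (?X (bispecht [1, 1] [])) (direct_sum (tilde_bar lam) (\<lambda>t. bispecht t mu))"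
    by (rule left[OF prod[OF part(2,4) sym_product_column[OF p] is_partition_bars(3)[OF p]
          sym_product_empty[OF q] single'] bisp(3) finite_bars(3)]) simp_all
  have 5: "rep_iso ?B (?X (bispecht [1] [1])) (direct_sum (bar lam \<times> bar mu) (\<lambda>(t, r). bispecht t r))"
    by (rule decomposes_rep_iso[OF _ X[OF bisp(5)] prod[OF part(3,3) sym_product_row(2)[OF p] is_partition_bars(1)[OF p]
          sym_product_row(2)[OF q] is_partition_bars(1)[OF q]]]) (simp_all add: finite_bars)
  \<comment> \<open>The common part of the first two cases: A and C are the two constituents of the
    induction of W, and A' and C' are the decomposed products with them.\<close>
  have two: "rep_iso ?B ?L (oplus A' C')"
    if iso: "rep_iso ?G ?I (oplus A C)" and AC: "linear_rep ?G A" "linear_rep ?G C"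
      and A': "rep_iso ?B (?X A) A'" and C': "rep_iso ?B (?X C) C'"
    for A :: "(signed_perm, 'x::complex_vector) rep" and C :: "(signed_perm, 'x) rep"
      and A' :: "(signed_perm, 'y::complex_vector) rep" and C' :: "(signed_perm, 'z::complex_vector) rep"
  proof -
    note L
    also have "rep_iso ?B (?X ?I) (oplus (?X A) (?X C))"
      by (rule induced_box_oplus[OF group_hyperoct group_hyperoct hom S I AC iso])
    also have "rep_iso ?B \<dots> (oplus A' C')"
      by (rule rep_iso_oplus[OF A' C' X[OF AC(1)] X[OF AC(2)]])
    finally show ?thesis .
  qed
  have one: "rep_iso ?B ?L (direct_sum (bar lam \<times> bar mu) (\<lambda>(t, r). bispecht t r))"
    if iso: "rep_iso ?G ?I (bispecht [1] [1])"
  proof -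
    note L
    also have "rep_iso ?B (?X ?I) (?X (bispecht [1] [1]))"
      by (intro rep_iso_induced[OF hom] linear_rep_box rep_iso_box S I bisp(5) group_hyperoct rep_iso_refl iso)
    also note 5
    finally show ?thesis .
  qed
  show ?thesis
    using two[OF _ bisp(1,4) 1 2] two[OF _ bisp(2,3) 3 4] one by blast
qed

end
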